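(* Let $\mathcal{C}$ be the CAR algebra, let $0<p<\infty$, and let $b=(b_k)_{k\ge1}$ be a noncommutative martingale with respect to the filtration $(\mathcal{C}_k)_{k\ge1}$. Then $\pi_b\in S_p(L_2(\mathcal{C}))$ if and only if $b\in\boldsymbol{B}_p(\mathcal{C})$. Moreover, $$\|\pi_b\|_{S_p(L_2(\mathcal{C}))}\approx_p\|b\|_{\boldsymbol{B}_p(\mathcal{C})}.$$
   Context: Let $\sigma_0=\begin{pmatrix}1&0\\0&-1\end{pmatrix}$, $\sigma_1=\begin{pmatrix}0&1\\1&0\end{pmatrix}$, $\sigma_2=\begin{pmatrix}0&-i\\i&0\end{pmatrix}$, and for $n\ge1$ let $c_{2n-1}=\sigma_0\otimes\cdots\otimes\sigma_0\otimes\sigma_1\otimes1\otimes1\cdots$ and $c_{2n}=\sigma_0\otimes\cdots\otimes\sigma_0\otimes\sigma_2\otimes1\otimes1\cdots$ (with $\sigma_1,\sigma_2$ in the $n$-th position). These are selfadjoint unitaries with $c_jc_k+c_kc_j=2\delta_{jk}$. For a nonempty finite set $A=\{k_1<\dots<k_n\}\subset\mathbb{N}$ put $c_A=c_{k_1}\cdots c_{k_n}$ and $\max(A)=k_n$; put $c_\emptyset=1$ and $\max(\emptyset)=1$. On finite linear combinations let $\tau(\sum_A\alpha_Ac_A)=\alpha_\emptyset$, a positive faithful tracial state. The CAR algebra $\mathcal{C}$ is the von Neumann algebra of the GNS representation of $\tau$, equipped with $\tau$, and $L_p(\mathcal{C})$ is the associated noncommutative $L_p$-space, with $\|x\|_{L_p(\mathcal{C})}=\tau(|x|^p)^{1/p}$.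 For $n\ge1$, $\mathcal{C}_n$ is the von Neumann subalgebra generated by $\{c_A:\max(A)\le n\}$, and $\mathcal{E}_n$ is the trace-preserving conditional expectation of $\mathcal{C}$ onto $\mathcal{C}_n$. A martingale is a sequence $x=(x_n)_{n\ge1}\subset L_1(\mathcal{C})$ with $\mathcal{E}_n(x_{n+1})=x_n$ for every $n\ge1$; its martingale differences are $d_nx=x_n-x_{n-1}$ for $n\ge1$, with the convention $x_0=0$. An element $x\in L_q(\mathcal{C})$, $1\le q\le\infty$, is identified with the martingale $x_n=\mathcal{E}_n(x)$. The martingale paraproduct with symbol $b$ is $\pi_b(f)=\sum_{k=1}^\infty d_kb\cdot f_{k-1}$ for $f=(f_k)_{k\ge1}\in L_2(\mathcal{C})$. $S_p(\mathcal{H})$ denotes the Schatten $p$-class of operators on a Hilbert space $\mathcal{H}$. The martingale Besov space $\boldsymbol{B}_p(\mathcal{C})$ is the completion, with respect to $\|\cdot\|_{\boldsymbol{B}_p(\mathcal{C})}$, of the set of all $b\in\mathcal{S}(\mathcal{C})$ such that $$\|b\|_{\boldsymbol{B}_p(\mathcal{C})}=\Big(\sum_{k=1}^\infty2^k\|d_kb\|_{L_p(\mathcal{C})}^p\Big)^{1/p}<\infty,$$ where $\mathcal{S}(\mathcal{C})$ is the linear span of the positive elements of $\mathcal{C}$ whose support projection has finite trace (so $\mathcal{S}(\mathcal{C})=\mathcal{C}$, as $\tau$ is finite). $A\approx_pB$ means that $A\le C_pB$ and $B\le C_p'A$ with positive constants depending only on $p$.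
   Formalization: The bound of ‖b‖_B by a constant times ‖π_b‖_{S_p} is stated only for martingales with d_1b = 0: since f_0 = 0, π_b ignores d_1b, and b = 1 has π_b = 0 but ‖b‖_B = 2^{1/p}. The equivalence and the other bound hold for all b. *)

theory Defs
  imports "HOL-Analysis.Analysis" "HOL-Computational_Algebra.Polynomial"
begin

section \<open>The generators\<close>

definition pauli0 :: "complex^2^2" where
  "pauli0 = vector [vector [1, 0], vector [0, -1]]"

definition pauli1 :: "complex^2^2" where
  "pauli1 = vector [vector [0, 1], vector [1, 0]]"

definition pauli2 :: "complex^2^2" where
  "pauli2 = vector [vector [0, -\<i>], vector [\<i>, 0]]"

text \<open>
  \<open>a 1 \<otimes> \<dots> \<otimes> a N \<otimes> 1 \<otimes> 1 \<otimes> \<dots>\<close> is realised as an infinite matrix with rows and columns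
  indexed by sequences \<open>s :: nat \<Rightarrow> 2\<close> (positions \<open>1, 2, \<dots>\<close>).  Each row has finitely many nonzero
  entries, so the matrix acts on all functions of \<open>s\<close>; products of such tensors are compositions.
\<close>

type_synonym tensor_op = "((nat \<Rightarrow> 2) \<Rightarrow> complex) \<Rightarrow> ((nat \<Rightarrow> 2) \<Rightarrow> complex)"

definition elem_tensor :: "nat \<Rightarrow> (nat \<Rightarrow> complex^2^2) \<Rightarrow> tensor_op" where
  "elem_tensor N a \<psi> s =
     (\<Sum>t \<in> {t. \<forall>i. i \<notin> {1..N} \<longrightarrow> t i = s i}. (\<Prod>i\<in>{1..N}. a i $ s i $ t i) * \<psi> t)"

definition car_gen :: "nat \<Rightarrow> tensor_op" where
  "car_gen j = (let n = (j + 1) div 2 in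
     elem_tensor n (\<lambda>i. if i < n then pauli0 else if odd j then pauli1 else pauli2))"

definition car_index :: "nat set set" where
  "car_index = {A. finite A \<and> 0 \<notin> A}"

definition car_prod :: "nat set \<Rightarrow> tensor_op" where
  "car_prod A = foldr (\<lambda>k X. car_gen k \<circ> X) (sorted_list_of_set A) id"

definition car_max :: "nat set \<Rightarrow> nat" where
  "car_max A = (if A = {} then 1 else Max A)"

definition car_comb :: "(nat set \<Rightarrow> complex) \<Rightarrow> tensor_op" where
  "car_comb \<alpha> \<psi> s = (\<Sum>A \<in> {A. \<alpha> A \<noteq> 0}. \<alpha> A * car_prod A \<psi> s)"

definition fin_coeffs :: "(nat set \<Rightarrow> complex) set" where
  "fin_coeffs = {\<alpha>. finite {A. \<alpha> A \<noteq> 0} \<and> {A. \<alpha> A \<noteq> 0} \<subseteq> car_index}"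

definition car_span :: "tensor_op set" where
  "car_span = car_comb ` fin_coeffs"


section \<open>The GNS space\<close>

text \<open>
  For the inner product \<open>\<langle>X, Y\<rangle> = \<tau>(Y\<^sup>* X)\<close> on \<^const>\<open>car_span\<close> the \<open>c\<^sub>A\<close> are orthonormal, so the
  completion is the space of square summable families of coefficients indexed by \<^const>\<open>car_index\<close>.
  This Hilbert space is \<open>L\<^sub>2(C)\<close>.
\<close>

typedef car_L2 = "{x :: nat set \<Rightarrow> complex.
    (\<forall>A. A \<notin> car_index \<longrightarrow> x A = 0) \<and> (\<lambda>A. (cmod (x A))\<^sup>2) summable_on UNIV}"
  morphisms coeff_L2 Abs_car_L2
  by (rule exI[of _ "\<lambda>_. 0"]) simp

setup_lifting type_definition_car_L2

lemma car_L2_mult_summable: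
  fixes x y :: "nat set \<Rightarrow> complex"
  assumes "(\<lambda>A. (cmod (x A))\<^sup>2) summable_on UNIV" "(\<lambda>A. (cmod (y A))\<^sup>2) summable_on UNIV"
  shows "(\<lambda>A. norm (x A * cnj (y A))) summable_on UNIV"
proof (rule summable_on_comparison_test)
  show "(\<lambda>A. (cmod (x A))\<^sup>2 + (cmod (y A))\<^sup>2) summable_on UNIV"
    using assms by (rule summable_on_add)
  show "norm (x A * cnj (y A)) \<le> (cmod (x A))\<^sup>2 + (cmod (y A))\<^sup>2" for A
  proof -
    have "2 * (cmod (x A) * cmod (y A)) \<le> (cmod (x A))\<^sup>2 + (cmod (y A))\<^sup>2"
      using sum_squares_bound[of "cmod (x A)" "cmod (y A)"] by (simp add: mult.assoc)
    moreover have "0 \<le> cmod (x A) * cmod (y A)" by simp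
    ultimately show ?thesis by (simp only: norm_mult complex_mod_cnj)
  qed
qed simp

lemma car_L2_add_summable:
  fixes x y :: "nat set \<Rightarrow> complex"
  assumes "(\<lambda>A. (cmod (x A))\<^sup>2) summable_on UNIV" "(\<lambda>A. (cmod (y A))\<^sup>2) summable_on UNIV"
  shows "(\<lambda>A. (cmod (x A + y A))\<^sup>2) summable_on UNIV"
proof (rule summable_on_comparison_test)
  show "(\<lambda>A. 2 * ((cmod (x A))\<^sup>2 + (cmod (y A))\<^sup>2)) summable_on UNIV"
    using assms by (intro summable_on_cmult_right summable_on_add)
  show "(cmod (x A + y A))\<^sup>2 \<le> 2 * ((cmod (x A))\<^sup>2 + (cmod (y A))\<^sup>2)" for A
  proof -
    have "(cmod (x A + y A))\<^sup>2 \<le> (cmod (x A) + cmod (y A))\<^sup>2"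
      by (intro power_mono norm_triangle_ineq) simp
    also have "\<dots> \<le> 2 * ((cmod (x A))\<^sup>2 + (cmod (y A))\<^sup>2)"
      using sum_squares_bound[of "cmod (x A)" "cmod (y A)"] by (simp add: power2_sum)
    finally show ?thesis .
  qed
qed simp

lift_definition cscale :: "complex \<Rightarrow> car_L2 \<Rightarrow> car_L2" is "\<lambda>c x A. c * x A"
proof (intro conjI allI impI; elim conjE)
  fix c :: complex and x :: "nat set \<Rightarrow> complex" and A
  show "c * x A = 0" if "\<forall>A. A \<notin> car_index \<longrightarrow> x A = 0" "A \<notin> car_index"
    using that by simp
  show "(\<lambda>A. (cmod (c * x A))\<^sup>2) summable_on UNIV" if "(\<lambda>A. (cmod (x A))\<^sup>2) summable_on UNIV"
    using summable_on_cmult_right[OF that, of "(cmod c)\<^sup>2"] by (simp add: norm_mult power_mult_distrib)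
qed

text \<open>Linear in the first argument, as in \<open>\<langle>X, Y\<rangle> = \<tau>(Y\<^sup>* X)\<close>.\<close>

definition cinner :: "car_L2 \<Rightarrow> car_L2 \<Rightarrow> complex" where
  "cinner x y = (\<Sum>\<^sub>\<infinity>A. coeff_L2 x A * cnj (coeff_L2 y A))"

lemma coeff_L2_summable: "(\<lambda>A. (cmod (coeff_L2 x A))\<^sup>2) summable_on UNIV"
  using coeff_L2[of x] by simp

lemma cinner_summable: "(\<lambda>A. coeff_L2 x A * cnj (coeff_L2 y A)) summable_on UNIV"
  by (rule abs_summable_summable[OF car_L2_mult_summable[OF coeff_L2_summable coeff_L2_summable]])

instantiation car_L2 :: real_inner
begin

lift_definition zero_car_L2 :: car_L2 is "\<lambda>_. 0" by simp

lift_definition plus_car_L2 :: "car_L2 \<Rightarrow> car_L2 \<Rightarrow> car_L2" is "\<lambda>x y A. x A + y A"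
  by (auto intro: car_L2_add_summable)

lift_definition uminus_car_L2 :: "car_L2 \<Rightarrow> car_L2" is "\<lambda>x A. - x A" by simp

definition minus_car_L2 :: "car_L2 \<Rightarrow> car_L2 \<Rightarrow> car_L2" where
  "minus_car_L2 x y = x + (- y)"

definition scaleR_car_L2 :: "real \<Rightarrow> car_L2 \<Rightarrow> car_L2" where
  "scaleR_car_L2 r x = cscale (complex_of_real r) x"

definition inner_car_L2 :: "car_L2 \<Rightarrow> car_L2 \<Rightarrow> real" where
  "inner_car_L2 x y = Re (cinner x y)"

definition norm_car_L2 :: "car_L2 \<Rightarrow> real" where
  "norm_car_L2 x = sqrt (inner x x)"

definition sgn_car_L2 :: "car_L2 \<Rightarrow> car_L2" where
  "sgn_car_L2 x = inverse (norm x) *\<^sub>R x"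

definition dist_car_L2 :: "car_L2 \<Rightarrow> car_L2 \<Rightarrow> real" where
  "dist_car_L2 x y = norm (x - y)"

definition uniformity_car_L2 :: "(car_L2 \<times> car_L2) filter" where
  "uniformity_car_L2 = (INF e\<in>{0<..}. principal {(x, y). dist x y < e})"

definition open_car_L2 :: "car_L2 set \<Rightarrow> bool" where
  "open_car_L2 U = (\<forall>x\<in>U. eventually (\<lambda>(x', y). x' = x \<longrightarrow> y \<in> U) uniformity)"

instance
proof
  fix x y z :: car_L2 and r s :: real
  show "x + y + z = x + (y + z)" by transfer (simp add: add.assoc)
  show "x + y = y + x" by transfer (simp add: add.commute)
  show "0 + x = x" by transfer simp
  show "- x + x = 0" by transfer simp
  show "x - y = x + - y" by (simp add: minus_car_L2_def)
  show "r *\<^sub>R (x + y) = r *\<^sub>R x + r *\<^sub>R y"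
    unfolding scaleR_car_L2_def by transfer (simp add: algebra_simps)
  show "(r + s) *\<^sub>R x = r *\<^sub>R x + s *\<^sub>R x"
    unfolding scaleR_car_L2_def by transfer (simp add: algebra_simps)
  show "r *\<^sub>R s *\<^sub>R x = (r * s) *\<^sub>R x"
    unfolding scaleR_car_L2_def by transfer (simp add: algebra_simps)
  show "1 *\<^sub>R x = x" unfolding scaleR_car_L2_def by transfer simp
  show "dist x y = norm (x - y)" by (rule dist_car_L2_def)
  show "sgn x = inverse (norm x) *\<^sub>R x" by (rule sgn_car_L2_def)
  show "(uniformity :: (car_L2 \<times> car_L2) filter) = (INF e\<in>{0<..}. principal {(x, y). dist x y < e})"
    by (rule uniformity_car_L2_def)
  show "open U = (\<forall>x\<in>U. eventually (\<lambda>(x', y). x' = x \<longrightarrow> y \<in> U) uniformity)" for U :: "car_L2 set"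
    by (rule open_car_L2_def)
  show "norm x = sqrt (inner x x)" by (rule norm_car_L2_def)
  have "cinner y x = cnj (cinner x y)"
    unfolding cinner_def infsum_cnj[symmetric] by (simp add: mult.commute)
  thus "inner x y = inner y x" by (simp add: inner_car_L2_def)
  have "cinner (x + y) z = cinner x z + cinner y z"
    unfolding cinner_def
    by (simp add: plus_car_L2.rep_eq distrib_right infsum_add cinner_summable)
  thus "inner (x + y) z = inner x z + inner y z" by (simp add: inner_car_L2_def)
  have "cinner (r *\<^sub>R x) y = of_real r * cinner x y"
    unfolding cinner_def
    by (simp add: scaleR_car_L2_def cscale.rep_eq mult.assoc infsum_cmult_right cinner_summable)
  thus "inner (r *\<^sub>R x) y = r * inner x y" by (simp add: inner_car_L2_def)
  have self: "inner x x = (\<Sum>\<^sub>\<infinity>A. (cmod (coeff_L2 x A))\<^sup>2)"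
  proof -
    have "inner x x = (\<Sum>\<^sub>\<infinity>A. Re (coeff_L2 x A * cnj (coeff_L2 x A)))"
      unfolding inner_car_L2_def cinner_def using cinner_summable by (simp only: infsum_Re)
    also have "\<dots> = (\<Sum>\<^sub>\<infinity>A. (cmod (coeff_L2 x A))\<^sup>2)"
      by (intro infsum_cong) (simp only: complex_norm_square[symmetric] Re_complex_of_real)
    finally show ?thesis .
  qed
  show "0 \<le> inner x x" unfolding self by (intro infsum_nonneg) simp
  show "(inner x x = 0) = (x = 0)"
  proof
    assume "inner x x = 0"
    hence le: "(\<Sum>\<^sub>\<infinity>A. (cmod (coeff_L2 x A))\<^sup>2) \<le> 0" by (simp only: self order_refl)
    have "(cmod (coeff_L2 x A))\<^sup>2 = 0" for A
      by (rule nonneg_infsum_le_0D[OF le coeff_L2_summable]) simp_all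
    hence "coeff_L2 x = coeff_L2 0" by (auto simp: zero_car_L2.rep_eq)
    thus "x = 0" by (simp only: coeff_L2_inject)
  next
    assume "x = 0"
    hence "coeff_L2 x A = 0" for A by (simp only: zero_car_L2.rep_eq)
    thus "inner x x = 0" by (simp add: self)
  qed
qed

end

lift_definition basis_L2 :: "nat set \<Rightarrow> car_L2" is
  "\<lambda>A B. if A \<in> car_index \<and> B = A then 1 else 0"
proof -
  fix A :: "nat set"
  have "(\<lambda>B. (cmod (if A \<in> car_index \<and> B = A then 1 else 0))\<^sup>2) summable_on UNIV
      \<longleftrightarrow> (\<lambda>B. (cmod (if A \<in> car_index \<and> B = A then 1 else 0))\<^sup>2) summable_on {A}"
    by (rule summable_on_cong_neutral) auto
  thus "(\<forall>B. B \<notin> car_index \<longrightarrow> (if A \<in> car_index \<and> B = A then 1 else 0) = (0::complex)) \<and>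
      (\<lambda>B. (cmod (if A \<in> car_index \<and> B = A then 1 else 0))\<^sup>2) summable_on UNIV"
    by auto
qed

text \<open>The GNS map \<open>X \<mapsto> X\<Omega>\<close> sends \<open>\<Sum>\<^sub>A \<alpha>\<^sub>A c\<^sub>A\<close> to the family of its coefficients.\<close>

definition gns_vec :: "tensor_op \<Rightarrow> car_L2" where
  "gns_vec X = (THE v. coeff_L2 v \<in> fin_coeffs \<and> X = car_comb (coeff_L2 v))"

definition vacuum :: car_L2 where
  "vacuum = basis_L2 {}"


section \<open>Operators on the GNS space\<close>

type_synonym car_op = "car_L2 \<Rightarrow>\<^sub>L car_L2"

text \<open>Elements of \<^typ>\<open>car_op\<close> are only real linear; the bounded operators of the complex Hilbert
  space are those in \<open>clinear_ops\<close>.\<close>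

definition clinear_ops :: "car_op set" where
  "clinear_ops = {T. \<forall>c x. blinfun_apply T (cscale c x) = cscale c (blinfun_apply T x)}"

lemma bounded_linear_cscale: "bounded_linear (cscale c)"
proof (rule bounded_linear_intro)
  fix x y :: car_L2 and r :: real
  show "cscale c (x + y) = cscale c x + cscale c y" by transfer (simp add: algebra_simps)
  show "cscale c (r *\<^sub>R x) = r *\<^sub>R cscale c x"
    unfolding scaleR_car_L2_def by transfer (simp add: algebra_simps)
  have "cinner (cscale c x) (cscale c x) = (\<Sum>\<^sub>\<infinity>A. (c * cnj c) * (coeff_L2 x A * cnj (coeff_L2 x A)))"
    unfolding cinner_def by (simp add: cscale.rep_eq mult_ac)
  also have "\<dots> = (c * cnj c) * cinner x x"
    unfolding cinner_def by (intro infsum_cmult_right cinner_summable)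
  also have "c * cnj c = of_real ((cmod c)\<^sup>2)" by (rule complex_norm_square[symmetric])
  finally have "norm (cscale c x) = norm x * cmod c"
    by (simp add: norm_car_L2_def inner_car_L2_def real_sqrt_mult mult.commute)
  thus "norm (cscale c x) \<le> norm x * cmod c" by simp
qed

definition cscale_op :: "complex \<Rightarrow> car_op \<Rightarrow> car_op" where
  "cscale_op c T = Blinfun (cscale c) o\<^sub>L T"

definition adj :: "car_op \<Rightarrow> car_op" where
  "adj T = (THE S. \<forall>x y. cinner (blinfun_apply T x) y = cinner x (blinfun_apply S y))"

definition positive_op :: "car_op \<Rightarrow> bool" where
  "positive_op T \<longleftrightarrow> T \<in> clinear_ops \<and> (\<forall>x. cinner (blinfun_apply T x) x \<in> \<real>\<^sub>\<ge>\<^sub>0)"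

definition op_power :: "car_op \<Rightarrow> nat \<Rightarrow> car_op" where
  "op_power T n = ((\<lambda>S. T o\<^sub>L S) ^^ n) id_blinfun"

definition poly_op :: "real poly \<Rightarrow> car_op \<Rightarrow> car_op" where
  "poly_op q T = (\<Sum>i\<le>degree q. coeff q i *\<^sub>R op_power T i)"

text \<open>Continuous functional calculus of a positive operator \<open>T\<close> (whose spectrum lies in
  \<open>[0, \<parallel>T\<parallel>]\<close>) at a continuous function \<open>f\<close>: the limit of \<open>q\<^sub>n(T)\<close> for any polynomials \<open>q\<^sub>n\<close>
  converging to \<open>f\<close> uniformly on that interval.\<close>

definition fun_calc :: "(real \<Rightarrow> real) \<Rightarrow> car_op \<Rightarrow> car_op" where
  "fun_calc f T = (THE S. \<forall>q. uniform_limit {0..norm T} (\<lambda>n. poly (q n)) f sequentially \<longrightarrow>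
      (\<lambda>n. poly_op (q n) T) \<longlonglongrightarrow> S)"

text \<open>\<open>|T|\<^sup>p = (T\<^sup>*T)\<^sup>p\<^sup>/\<^sup>2\<close>; note \<open>0 powr (p/2) = 0\<close>.\<close>

definition abs_powr :: "car_op \<Rightarrow> real \<Rightarrow> car_op" where
  "abs_powr T p = fun_calc (\<lambda>t. t powr (p / 2)) (adj T o\<^sub>L T)"

definition schatten :: "real \<Rightarrow> (car_L2 \<Rightarrow> car_L2) set" where
  "schatten p = {T. bounded_linear T \<and> Blinfun T \<in> clinear_ops \<and>
     (\<lambda>A. Re (cinner (blinfun_apply (abs_powr (Blinfun T) p) (basis_L2 A)) (basis_L2 A)))
       summable_on car_index}"

definition schatten_norm :: "real \<Rightarrow> (car_L2 \<Rightarrow> car_L2) \<Rightarrow> real" where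
  "schatten_norm p T = (\<Sum>\<^sub>\<infinity>A\<in>car_index.
     Re (cinner (blinfun_apply (abs_powr (Blinfun T) p) (basis_L2 A)) (basis_L2 A))) powr (1 / p)"


section \<open>The CAR algebra, its filtration and conditional expectations\<close>

definition gns_rep :: "tensor_op \<Rightarrow> car_op" where
  "gns_rep X = (THE T. T \<in> clinear_ops \<and>
     (\<forall>Y\<in>car_span. blinfun_apply T (gns_vec Y) = gns_vec (X \<circ> Y)))"

definition commutant :: "car_op set \<Rightarrow> car_op set" where
  "commutant M = {T \<in> clinear_ops. \<forall>S\<in>M. T o\<^sub>L S = S o\<^sub>L T}"

text \<open>Von Neumann algebra generated by a set whose linear span is closed under adjoints.\<close>

definition vn_generated :: "car_op set \<Rightarrow> car_op set" where
  "vn_generated M = commutant (commutant M)"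

definition CAR :: "car_op set" where
  "CAR = vn_generated (gns_rep ` car_span)"

definition CAR_fil :: "nat \<Rightarrow> car_op set" where
  "CAR_fil n = vn_generated ((\<lambda>A. gns_rep (car_prod A)) ` {A \<in> car_index. car_max A \<le> n})"

text \<open>The vector state of the vacuum extends \<open>\<Sum>\<^sub>A \<alpha>\<^sub>A c\<^sub>A \<mapsto> \<alpha>\<^sub>\<emptyset>\<close>.\<close>

definition car_trace :: "car_op \<Rightarrow> complex" where
  "car_trace x = cinner (blinfun_apply x vacuum) vacuum"

definition Lp_norm :: "real \<Rightarrow> car_op \<Rightarrow> real" where
  "Lp_norm p x = Re (car_trace (abs_powr x p)) powr (1 / p)"

definition is_cond_exp :: "car_op set \<Rightarrow> (car_op \<Rightarrow> car_op) \<Rightarrow> bool" where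
  "is_cond_exp N E \<longleftrightarrow>
     (\<forall>x\<in>CAR. E x \<in> N) \<and>
     (\<forall>x\<in>CAR. \<forall>y\<in>CAR. E (x + y) = E x + E y) \<and>
     (\<forall>x\<in>CAR. \<forall>c. E (cscale_op c x) = cscale_op c (E x)) \<and>
     (\<forall>x\<in>CAR. positive_op x \<longrightarrow> positive_op (E x)) \<and>
     (\<forall>y\<in>N. E y = y) \<and>
     (\<forall>x\<in>CAR. \<forall>y\<in>N. \<forall>z\<in>N. E (y o\<^sub>L x o\<^sub>L z) = y o\<^sub>L E x o\<^sub>L z) \<and>
     (\<forall>x\<in>CAR. car_trace (E x) = car_trace x)"

text \<open>These properties determine \<open>E\<close> on \<^const>\<open>CAR\<close>; values elsewhere are never used.\<close>

definition cond_exp :: "nat \<Rightarrow> car_op \<Rightarrow> car_op" where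
  "cond_exp n = (SOME E. is_cond_exp (CAR_fil n) E)"

text \<open>Continuous extension to \<open>L\<^sub>2(C)\<close>, in which \<open>y \<in> C\<close> is the vector \<open>y\<Omega>\<close>.\<close>

definition cond_exp_L2 :: "nat \<Rightarrow> car_op" where
  "cond_exp_L2 n = (THE P. \<forall>y\<in>CAR.
     blinfun_apply P (blinfun_apply y vacuum) = blinfun_apply (cond_exp n y) vacuum)"


section \<open>Martingales\<close>

text \<open>
  \<open>L\<^sub>1(C)\<close> is the completion of \<open>C\<close> for \<open>\<parallel>\<cdot>\<parallel>\<^sub>1\<close>.  Its element \<open>X\<close> is represented by the functional
  \<open>z \<mapsto> \<tau>(X z)\<close> on \<open>C\<close> (this is the identification of \<open>L\<^sub>1(C)\<close> with the predual of \<open>C\<close>), set to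
  \<open>0\<close> outside \<open>C\<close> so that the representation is unique.
\<close>

type_synonym car_functional = "car_op \<Rightarrow> complex"

definition embed_L1 :: "car_op \<Rightarrow> car_functional" where
  "embed_L1 x = (\<lambda>z. if z \<in> CAR then car_trace (x o\<^sub>L z) else 0)"

definition L1 :: "car_functional set" where
  "L1 = {\<phi>. \<exists>x :: nat \<Rightarrow> car_op. (\<forall>m. x m \<in> CAR) \<and>
     (\<forall>e>0. \<exists>M. \<forall>m\<ge>M. \<forall>n\<ge>M. Lp_norm 1 (x m - x n) < e) \<and>
     (\<forall>z. (\<lambda>m. embed_L1 (x m) z) \<longlonglongrightarrow> \<phi> z)}"

text \<open>The extension of \<open>E\<^sub>n\<close> to \<open>L\<^sub>1(C)\<close>: if \<open>x\<^sub>m \<rightarrow> X\<close> in \<open>L\<^sub>1(C)\<close>, then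
  \<open>\<tau>(E\<^sub>n(X) z) = lim \<tau>(E\<^sub>n(x\<^sub>m) z) = lim \<tau>(x\<^sub>m E\<^sub>n(z)) = \<tau>(X E\<^sub>n(z))\<close>.\<close>

definition cond_exp_L1 :: "nat \<Rightarrow> car_functional \<Rightarrow> car_functional" where
  "cond_exp_L1 n \<phi> = (\<lambda>z. if z \<in> CAR then \<phi> (cond_exp n z) else 0)"

text \<open>Martingales are indexed by \<open>n \<ge> 1\<close>; the value at index \<open>0\<close> is never used.\<close>

type_synonym car_martingale = "nat \<Rightarrow> car_functional"

definition martingale :: "car_martingale \<Rightarrow> bool" where
  "martingale b \<longleftrightarrow> (\<forall>n\<ge>1. b n \<in> L1 \<and> cond_exp_L1 n (b (Suc n)) = b n)"

definition martingale_of :: "car_op \<Rightarrow> car_martingale" where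
  "martingale_of x = (\<lambda>n. embed_L1 (cond_exp n x))"

text \<open>Since \<open>C\<^sub>n\<close> is finite dimensional, \<open>L\<^sub>1(C\<^sub>n) = C\<^sub>n\<close> and the differences of a martingale are
  elements of \<open>C\<close>; \<open>bounded_element\<close> recovers such an element from its functional.\<close>

definition bounded_element :: "car_functional \<Rightarrow> car_op" where
  "bounded_element \<phi> = (THE x. x \<in> CAR \<and> embed_L1 x = \<phi>)"

definition mdiff :: "car_martingale \<Rightarrow> nat \<Rightarrow> car_op" where
  "mdiff b n = bounded_element (\<lambda>z. b n z - (if n = 1 then 0 else b (n - 1) z))"


section \<open>Paraproducts and Besov spaces\<close>

text \<open>The martingale \<open>(f\<^sub>k)\<close> of \<open>f \<in> L\<^sub>2(C)\<close>, with the convention \<open>f\<^sub>0 = 0\<close>.\<close>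

definition martingale_L2 :: "car_L2 \<Rightarrow> nat \<Rightarrow> car_L2" where
  "martingale_L2 f k = (if k = 0 then 0 else blinfun_apply (cond_exp_L2 k) f)"

text \<open>The index is \<open>k - 1\<close>.  As \<open>f\<^sub>0 = 0\<close>, the first summand vanishes, so \<open>\<pi>\<^sub>b\<close> does not depend
  on \<open>d\<^sub>1 b = b\<^sub>1\<close>: the symbol \<open>b = 1\<close> has \<open>\<pi>\<^sub>b = 0\<close> and Besov norm \<open>2\<^sup>1\<^sup>/\<^sup>p\<close>.\<close>

definition paraproduct_terms :: "car_martingale \<Rightarrow> car_L2 \<Rightarrow> nat \<Rightarrow> car_L2" where
  "paraproduct_terms b f = (\<lambda>k. blinfun_apply (mdiff b (Suc k)) (martingale_L2 f k))"

definition paraproduct :: "car_martingale \<Rightarrow> car_L2 \<Rightarrow> car_L2" where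
  "paraproduct b f = (\<Sum>k. paraproduct_terms b f k)"

definition paraproduct_in_schatten :: "real \<Rightarrow> car_martingale \<Rightarrow> bool" where
  "paraproduct_in_schatten p b \<longleftrightarrow>
     (\<forall>f. summable (paraproduct_terms b f)) \<and> paraproduct b \<in> schatten p"

definition besov_finite :: "real \<Rightarrow> car_martingale \<Rightarrow> bool" where
  "besov_finite p b \<longleftrightarrow> (\<lambda>k. 2 ^ k * Lp_norm p (mdiff b k) powr p) summable_on {1..}"

definition besov_norm :: "real \<Rightarrow> car_martingale \<Rightarrow> real" where
  "besov_norm p b = (\<Sum>\<^sub>\<infinity>k\<in>{1..}. 2 ^ k * Lp_norm p (mdiff b k) powr p) powr (1 / p)"

text \<open>The completion of \<open>{y \<in> C. \<parallel>y\<parallel>\<^sub>B < \<infinity>}\<close>, realised inside the space of martingales (which is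
  complete for the Besov norm).\<close>

definition besov :: "real \<Rightarrow> car_martingale set" where
  "besov p = {b. martingale b \<and> (\<exists>y :: nat \<Rightarrow> car_op.
     (\<forall>m. y m \<in> CAR \<and> besov_finite p (martingale_of (y m)) \<and>
          besov_finite p (\<lambda>n z. b n z - martingale_of (y m) n z)) \<and>
     (\<lambda>m. besov_norm p (\<lambda>n z. b n z - martingale_of (y m) n z)) \<longlonglongrightarrow> 0)}"

end

theory Submission
  imports Defs
begin

text \<open>
  Write \<open>P\<^sub>k\<close> for the projection onto \<open>L\<^sub>2(C\<^sub>k)\<close>, the span of the \<open>2\<^sup>k\<close> vectors
  \<open>e\<^sub>A = c\<^sub>A \<Omega>\<close> with \<open>A \<subseteq> {1..k}\<close>. Then \<open>\<pi>\<^sub>b = \<Sum>\<^sub>k d\<^sub>k\<^sub>+\<^sub>1 b P\<^sub>k\<close>, and the \<open>k\<close>-th summand takes values in the span of the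
  \<open>e\<^sub>A\<close> with \<open>max A = k + 1\<close>. The ranges being orthogonal, \<open>X = \<pi>\<^sub>b\<^sup>* \<pi>\<^sub>b\<close> is the sum of the operators \<open>P\<^sub>k h\<^sub>k P\<^sub>k\<close>
  with \<open>h\<^sub>k = |d\<^sub>k\<^sub>+\<^sub>1 b|\<^sup>2\<close>. Here \<open>h\<^sub>k\<close> commutes with \<open>P\<^sub>k\<close>, and all diagonal entries of \<open>h\<^sub>k\<^sup>p\<^sup>/\<^sup>2\<close> are equal to
  \<open>\<tau>(|d\<^sub>k\<^sub>+\<^sub>1 b|\<^sup>p)\<close>, because \<open>h\<^sub>k\<close> commutes with right multiplications. Hence
  \<open>Tr (P\<^sub>k h\<^sub>k P\<^sub>k)\<^sup>p\<^sup>/\<^sup>2 = 2\<^sup>k \<tau>(|d\<^sub>k\<^sub>+\<^sub>1 b|\<^sup>p)\<close>, half of the summand of index \<open>k + 1\<close> in the \<open>p\<close>-th power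
  of the Besov norm, and the theorem says that \<open>Tr X\<^sup>q\<close>, for \<open>q = p / 2\<close>, is comparable with
  \<open>\<Sum>\<^sub>k Tr (P\<^sub>k h\<^sub>k P\<^sub>k)\<^sup>q\<close>. The summand of index \<open>1\<close> is invisible to \<open>\<pi>\<^sub>b\<close>, which is why the estimate of the Besov
  norm by the Schatten norm is for \<open>d\<^sub>1 b = 0\<close>.

  For \<open>q \<ge> 1\<close> the inequality \<open>\<ge>\<close>, and for \<open>q \<le> 1\<close> the inequality \<open>\<le>\<close>, holds for arbitrary positive operators
  (\<open>trace_powr_decomposition\<close>). The other two inequalities use that at least half of the basis of \<open>L\<^sub>2(C\<^sub>k)\<close> consists of
  vectors \<open>e\<^sub>A\<close> with \<open>max A = k\<close>. For \<open>q \<le> 1\<close>, the Loewner--Heinz inequality \<open>c (P\<^sub>k h\<^sub>k P\<^sub>k)\<^sup>q \<le> X\<^sup>q\<close> is summed over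
  exactly these vectors (\<open>trunc_trace_lower\<close>). For \<open>q \<ge> 1\<close>, the contributions of the other levels \<open>m < k\<close> to the
  \<open>k\<close>-th term decay like \<open>2\<^sup>m\<^sup>-\<^sup>k\<close>, which leaves room for separating the levels by Jensen's inequality with
  geometric weights (\<open>trunc_trace_upper\<close>).

  These estimates are made for the truncations of \<open>\<pi>\<^sub>b\<close>, which act on finite-dimensional spaces. There every
  function of a positive operator is given by an orthonormal eigenbasis, and traces are finite sums. As real
  inner products are sufficient for this, \<open>L\<^sub>2(C)\<close> is treated as a real Hilbert space. The truncations converge
  strongly, their traces are increasing, and the functional calculus is strongly continuous; so the estimates
  pass to the limit.

  It remains to identify the objects in the statement. Products of generators satisfy \<open>c\<^sub>A c\<^sub>B = \<plusminus> c\<^bsub>A \<triangle> B\<^esub>\<close> and are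
  linearly independent. Right multiplications commute with the algebra, so an element \<open>x\<close> is determined by
  \<open>x \<Omega>\<close>. Consequently \<open>C\<^sub>n\<close> is the span of the \<open>c\<^sub>A\<close> with \<open>A \<subseteq> {1..n}\<close>, the conditional expectations restrict the
  coefficients of \<open>x \<Omega>\<close> (\<open>cond_exp_eq\<close>), and every martingale is given by a single family of coefficients
  (\<open>martingale_coeffs\<close>).
\<close>

section \<open>Scalar inequalities\<close>

lemma bernoulli_powr_concave:
  fixes r x :: real
  assumes "0 \<le> r" "r \<le> 1" "0 < x"
  shows "x powr r \<le> 1 + r * (x - 1)"
  using Youngs_inequality_0[of r "1 - r" x 1] assms by (simp add: algebra_simps)

lemma bernoulli_powr_convex:
  fixes q x :: real
  assumes "1 \<le> q" "0 \<le> x"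
  shows "1 + q * (x - 1) \<le> x powr q"
proof (cases "x = 0")
  case True
  then show ?thesis using assms by simp
next
  case False
  have "(x powr q) powr (1/q) \<le> 1 + (1/q) * (x powr q - 1)"
    using assms False by (intro bernoulli_powr_concave) auto
  then have "x \<le> 1 + (1/q) * (x powr q - 1)"
    using assms False by (simp add: powr_powr)
  then have "q * x \<le> q * (1 + (1/q) * (x powr q - 1))"
    using assms by (intro mult_left_mono) auto
  then show ?thesis using assms by (simp add: algebra_simps)
qed

lemma bernoulli_powr_neg:
  fixes r x :: real
  assumes "0 \<le> r" "0 < x"
  shows "1 - r * (x - 1) \<le> x powr (- r)"
proof -
  have "1 - r * (x - 1) \<le> 1 + (- r) * ln x"
    using mult_left_mono[OF ln_le_minus_one[OF assms(2)] assms(1)] by simp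
  also have "\<dots> \<le> exp ((- r) * ln x)" by (rule exp_ge_add_one_self)
  also have "\<dots> = x powr (- r)" using assms by (simp add: powr_def)
  finally show ?thesis .
qed

lemma powr_tangent_le:
  fixes q s t :: real
  assumes "1 \<le> q" "0 < s" "0 \<le> t"
  shows "s powr q + q * s powr (q - 1) * (t - s) \<le> t powr q"
proof -
  have "s powr q * (1 + q * (t/s - 1)) \<le> s powr q * (t/s) powr q"
    using assms by (intro mult_left_mono bernoulli_powr_convex) auto
  also have "s powr q * (t/s) powr q = t powr q"
    using assms by (simp add: powr_divide)
  also have "s powr q * (1 + q * (t/s - 1)) = s powr q + q * s powr (q - 1) * (t - s)"
    using assms by (simp add: powr_diff field_simps)
  finally show ?thesis .
qed

text \<open>
  Jensen's inequality for \<open>t\<^sup>q\<close> with unnormalised weights, by comparison with the tangent at the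
  weighted mean.
\<close>

lemma weighted_power_mean:
  fixes w y :: "'i \<Rightarrow> real"
  assumes "1 \<le> q" and w: "\<And>i. i \<in> I \<Longrightarrow> 0 \<le> w i" and y: "\<And>i. i \<in> I \<Longrightarrow> 0 \<le> y i"
  shows "(\<Sum>i\<in>I. w i * y i) powr q \<le> (\<Sum>i\<in>I. w i) powr (q - 1) * (\<Sum>i\<in>I. w i * y i powr q)"
proof (cases "(\<Sum>i\<in>I. w i * y i) = 0")
  case True
  then show ?thesis using w y by (auto intro!: mult_nonneg_nonneg sum_nonneg)
next
  case False
  define R Y where "R = (\<Sum>i\<in>I. w i)" and "Y = (\<Sum>i\<in>I. w i * y i)"
  have "0 \<le> Y" unfolding Y_def using w y by (intro sum_nonneg mult_nonneg_nonneg) auto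
  then have Y: "0 < Y" using False by (simp add: Y_def)
  have "R \<noteq> 0"
  proof
    assume "R = 0"
    then have "\<forall>i\<in>I. w i = 0"
    proof (cases "finite I")
      case True
      then show ?thesis using \<open>R = 0\<close> w by (simp add: R_def sum_nonneg_eq_0_iff)
    next
      case False
      then show ?thesis using Y by (simp add: Y_def)
    qed
    then show False using Y by (simp add: Y_def)
  qed
  moreover have "0 \<le> R" unfolding R_def using w by (intro sum_nonneg) auto
  ultimately have R: "0 < R" by simp
  define s where "s = Y / R"
  have s: "0 < s" using Y R by (simp add: s_def)
  have "(\<Sum>i\<in>I. w i * (s powr q + q * s powr (q - 1) * (y i - s))) \<le> (\<Sum>i\<in>I. w i * y i powr q)"
    using assms s by (intro sum_mono mult_left_mono powr_tangent_le) auto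
  also have "(\<Sum>i\<in>I. w i * (s powr q + q * s powr (q - 1) * (y i - s))) =
     R * s powr q + q * s powr (q - 1) * (Y - R * s)"
    unfolding R_def Y_def
    by (simp add: algebra_simps sum.distrib sum_subtractf sum_distrib_left sum_distrib_right)
  also have "\<dots> = R * s powr q" using R by (simp add: s_def)
  finally have 1: "R * s powr q \<le> (\<Sum>i\<in>I. w i * y i powr q)" .
  have "Y powr q = R powr (q - 1) * (R * s powr q)"
    using R Y by (simp add: s_def powr_divide powr_diff)
  also have "\<dots> \<le> R powr (q - 1) * (\<Sum>i\<in>I. w i * y i powr q)"
    using 1 by (intro mult_left_mono) auto
  finally show ?thesis by (simp add: R_def Y_def)
qed

lemma powr_add_le:
  fixes a b q :: real
  assumes "0 \<le> a" "0 \<le> b" "0 \<le> q"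
  shows "(a + b) powr q \<le> 2 powr q * (a powr q + b powr q)"
proof -
  have "(a + b) powr q \<le> (2 * max a b) powr q"
    using assms by (intro powr_mono2) auto
  also have "\<dots> = 2 powr q * max a b powr q" using assms by (simp add: powr_mult)
  also have "\<dots> \<le> 2 powr q * (a powr q + b powr q)"
    by (intro mult_left_mono) (auto simp: max_def)
  finally show ?thesis .
qed

lemma geometric_int_sum_le:
  fixes x :: real
  assumes "finite J" "0 < x" "x < 1"
  shows "(\<Sum>j\<in>J. x powr (real_of_int \<bar>j\<bar>)) \<le> 2 / (1 - x)"
proof -
  have half: "(\<Sum>j\<in>K. x powr (real_of_int \<bar>j\<bar>)) \<le> 1 / (1 - x)"
    if "finite K" "inj_on (\<lambda>j. nat \<bar>j\<bar>) K" for K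
  proof -
    have "(\<Sum>j\<in>K. x powr (real_of_int \<bar>j\<bar>)) = (\<Sum>j\<in>K. x ^ nat \<bar>j\<bar>)"
      using assms by (intro sum.cong) (auto simp: powr_realpow[symmetric])
    also have "\<dots> = (\<Sum>n\<in>(\<lambda>j. nat \<bar>j\<bar>) ` K. x ^ n)"
      using that by (simp add: sum.reindex)
    also have "\<dots> \<le> (\<Sum>n. x ^ n)"
      using assms that by (intro sum_le_suminf summable_geometric) auto
    also have "\<dots> = 1 / (1 - x)" using assms by (intro suminf_geometric) auto
    finally show ?thesis .
  qed
  have "(\<Sum>j\<in>J. x powr (real_of_int \<bar>j\<bar>)) =
      (\<Sum>j\<in>J \<inter> {0..}. x powr (real_of_int \<bar>j\<bar>)) + (\<Sum>j\<in>J - {0..}. x powr (real_of_int \<bar>j\<bar>))"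
    using assms(1) by (rule sum.Int_Diff)
  also have "\<dots> \<le> 1 / (1 - x) + 1 / (1 - x)"
    using assms(1) by (intro add_mono half) (auto simp: inj_on_def)
  finally show ?thesis by simp
qed

text \<open>
  For \<open>0 < q < 1\<close> the function \<open>t\<^sup>q\<close> is comparable with \<open>\<Sum>\<^sub>n 2\<^sup>n\<^sup>q t / (t + 2\<^sup>n)\<close>, a discrete form of its
  representation as an integral of the operator monotone functions \<open>t / (t + s)\<close>. The summands with
  \<open>2\<^sup>n \<le> t\<close> and with \<open>2\<^sup>n > t\<close> each form a geometric series with largest term of order \<open>t\<^sup>q\<close>. This
  half is uniform over finite sets of \<open>n\<close>.
\<close>

lemma powr_dyadic_upper:
  fixes q t :: real
  assumes q: "0 < q" "q < 1" and t: "0 \<le> t" and J: "finite J"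
  shows "(\<Sum>n\<in>J. 2 powr (real_of_int n * q) * (t / (t + 2 powr real_of_int n)))
    \<le> 4 / (1 - 2 powr - min q (1 - q)) * t powr q"
proof (cases "t = 0")
  case False
  then have t: "0 < t" using t by simp
  define m where "m = \<lfloor>log 2 t\<rfloor>"
  have m1: "2 powr real_of_int m \<le> t" "t \<le> 2 * 2 powr real_of_int m"
  proof -
    have "2 powr real_of_int m \<le> 2 powr log 2 t" unfolding m_def by (intro powr_mono) auto
    then show "2 powr real_of_int m \<le> t" using t by simp
    have "2 powr log 2 t \<le> 2 powr (real_of_int m + 1)" unfolding m_def
      by (intro powr_mono) linarith+
    then show "t \<le> 2 * 2 powr real_of_int m" using t by (simp add: powr_add)
  qed
  define x where "x = 2 powr - min q (1 - q)"
  have x: "0 < x" "x < 1"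
    using q by (auto simp: x_def min_def powr_less_one)
  have summand: "2 powr (real_of_int n * q) * (t / (t + 2 powr real_of_int n))
      \<le> 2 * t powr q * x powr real_of_int \<bar>n - m\<bar>" for n
  proof -
    have xp: "x powr real_of_int \<bar>n - m\<bar> = 2 powr (- min q (1 - q) * real_of_int \<bar>n - m\<bar>)"
      by (simp add: x_def powr_powr)
    have xle: "2 powr (- c * real_of_int \<bar>n - m\<bar>) \<le> x powr real_of_int \<bar>n - m\<bar>"
      if "min q (1 - q) \<le> c" for c
      unfolding xp using that by (intro powr_mono mult_right_mono) auto
    show ?thesis
    proof (cases "n \<le> m")
      case True
      have "2 powr (real_of_int n * q) * (t / (t + 2 powr real_of_int n)) \<le> 2 powr (real_of_int n * q) * 1"
        using t by (intro mult_left_mono) (auto simp: field_simps add_pos_pos)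
      also have "\<dots> = (2 powr real_of_int m) powr q * 2 powr (- q * real_of_int \<bar>n - m\<bar>)"
        using True by (simp add: powr_powr powr_add[symmetric] algebra_simps)
      also have "\<dots> \<le> t powr q * x powr real_of_int \<bar>n - m\<bar>"
        using m1 q t by (intro mult_mono powr_mono2 xle) auto
      also have "\<dots> \<le> 2 * (t powr q * x powr real_of_int \<bar>n - m\<bar>)" by simp
      finally show ?thesis by (simp add: mult.assoc)
    next
      case False
      have "2 powr (real_of_int n * q) * (t / (t + 2 powr real_of_int n))
          \<le> 2 powr (real_of_int n * q) * (t / 2 powr real_of_int n)"
        using t by (intro mult_left_mono divide_left_mono) (auto intro!: mult_pos_pos add_pos_pos)
      also have "\<dots> = t * 2 powr (- ((1 - q) * real_of_int n))"
        by (simp add: powr_minus powr_add[symmetric] powr_diff[symmetric] field_simps)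
      also have "\<dots> = t * (2 powr real_of_int m) powr (- (1 - q)) * 2 powr (- (1 - q) * real_of_int \<bar>n - m\<bar>)"
        using False by (simp add: powr_powr powr_add[symmetric] mult.assoc algebra_simps)
      also have "\<dots> \<le> t * (t/2) powr (- (1 - q)) * x powr real_of_int \<bar>n - m\<bar>"
        using m1 q t by (intro mult_mono powr_mono2' xle) auto
      also have "\<dots> = 2 powr (1 - q) * t powr q * x powr real_of_int \<bar>n - m\<bar>"
        using t by (simp add: powr_divide powr_diff powr_minus field_simps)
      also have "\<dots> \<le> 2 powr 1 * t powr q * x powr real_of_int \<bar>n - m\<bar>"
        using q by (intro mult_right_mono powr_mono) auto
      finally show ?thesis by simp
    qed
  qed
  have "(\<Sum>n\<in>J. 2 powr (real_of_int n * q) * (t / (t + 2 powr real_of_int n)))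
     \<le> (\<Sum>n\<in>J. 2 * t powr q * x powr real_of_int \<bar>n - m\<bar>)"
    by (intro sum_mono summand)
  also have "\<dots> = 2 * t powr q * (\<Sum>j\<in>(\<lambda>n. n - m) ` J. x powr real_of_int \<bar>j\<bar>)"
    by (simp add: sum_distrib_left sum.reindex inj_on_def)
  also have "\<dots> \<le> 2 * t powr q * (2 / (1 - x))"
    using J x by (intro mult_left_mono geometric_int_sum_le) auto
  finally show ?thesis by (simp add: x_def field_simps)
qed (use q in simp)

text \<open>
  A single summand already has the right size, the one with \<open>2\<^sup>n \<le> t < 2\<^sup>n\<^sup>+\<^sup>1\<close>.
\<close>

lemma powr_dyadic_lower:
  fixes q t :: real
  assumes q: "0 < q" and t: "0 < t" and J: "finite J" "\<lfloor>log 2 t\<rfloor> \<in> J"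
  shows "t powr q \<le> 2 * 2 powr q * (\<Sum>n\<in>J. 2 powr (real_of_int n * q) * (t / (t + 2 powr real_of_int n)))"
proof -
  define m where "m = \<lfloor>log 2 t\<rfloor>"
  have "2 powr real_of_int m \<le> 2 powr log 2 t" unfolding m_def by (intro powr_mono) auto
  then have m1: "2 powr real_of_int m \<le> t" using t by simp
  have "2 powr log 2 t \<le> 2 powr (real_of_int m + 1)" unfolding m_def
    by (intro powr_mono) linarith+
  then have m2: "t \<le> 2 * 2 powr real_of_int m" using t by (simp add: powr_add)
  have "t powr q \<le> (2 * 2 powr real_of_int m) powr q" using m2 t q by (intro powr_mono2) auto
  also have "\<dots> = 2 * 2 powr q * (2 powr (real_of_int m * q) * (1/2))"
    by (simp add: powr_mult powr_powr)
  also have "\<dots> \<le> 2 * 2 powr q * (2 powr (real_of_int m * q) * (t / (t + 2 powr real_of_int m)))"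
    using m1 t by (intro mult_left_mono) (auto simp: field_simps add_pos_pos)
  also have "\<dots> \<le> 2 * 2 powr q * (\<Sum>n\<in>J. 2 powr (real_of_int n * q) * (t / (t + 2 powr real_of_int n)))"
    using J t unfolding m_def
    by (intro mult_left_mono member_le_sum) (auto intro!: mult_nonneg_nonneg divide_nonneg_nonneg add_nonneg_nonneg)
  finally show ?thesis .
qed

section \<open>Finite orthonormal bases and the spectral theorem\<close>

text \<open>
  The ambient space is infinite dimensional, and all finite-dimensional arguments take place in a
  subspace \<open>V\<close> with a finite orthonormal basis. Being a basis is expressed by the expansion of
  vectors, which is the form in which it is applied.
\<close>

definition is_onb :: "'a::real_inner set \<Rightarrow> 'a set \<Rightarrow> bool" where
  "is_onb V U \<longleftrightarrow> subspace V \<and> finite U \<and> U \<subseteq> V \<and>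
     (\<forall>u\<in>U. \<forall>w\<in>U. inner u w = (if u = w then 1 else 0)) \<and>
     (\<forall>v\<in>V. v = (\<Sum>u\<in>U. inner v u *\<^sub>R u))"

lemma is_onbD:
  assumes "is_onb V U"
  shows "subspace V" "finite U" "\<And>u. u \<in> U \<Longrightarrow> u \<in> V"
    "\<And>u w. u \<in> U \<Longrightarrow> w \<in> U \<Longrightarrow> inner u w = (if u = w then 1 else 0)"
    "\<And>v. v \<in> V \<Longrightarrow> (\<Sum>u\<in>U. inner v u *\<^sub>R u) = v"
    "\<And>u. u \<in> U \<Longrightarrow> norm u = 1"
  using assms by (auto simp: is_onb_def norm_eq_sqrt_inner)

lemma inner_orthonormal_sum:
  assumes "finite U" "\<And>u w. u \<in> U \<Longrightarrow> w \<in> U \<Longrightarrow> inner u w = (if u = w then 1 else (0::real))" "u \<in> U"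
  shows "inner (\<Sum>w\<in>U. c w *\<^sub>R w) u = c u"
proof -
  have "inner (\<Sum>w\<in>U. c w *\<^sub>R w) u = (\<Sum>w\<in>U. c w * inner w u)"
    by (simp add: inner_sum_left)
  also have "\<dots> = (\<Sum>w\<in>U. if w = u then c w else 0)"
    using assms by (intro sum.cong) auto
  finally show ?thesis using assms by simp
qed

lemma bessel:
  fixes v :: "'a::real_inner"
  assumes "finite U" "\<And>u w. u \<in> U \<Longrightarrow> w \<in> U \<Longrightarrow> inner u w = (if u = w then 1 else 0)"
  shows "(\<Sum>u\<in>U. (inner v u)\<^sup>2) \<le> (norm v)\<^sup>2"
proof -
  define y where "y = (\<Sum>u\<in>U. inner v u *\<^sub>R u)"
  have 1: "inner y y = (\<Sum>u\<in>U. (inner v u)\<^sup>2)"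
  proof -
    have "inner y y = (\<Sum>u\<in>U. inner v u * inner y u)"
      by (subst (2) y_def) (simp add: inner_sum_right)
    also have "\<dots> = (\<Sum>u\<in>U. (inner v u)\<^sup>2)"
      using assms by (intro sum.cong) (auto simp: y_def inner_orthonormal_sum power2_eq_square)
    finally show ?thesis .
  qed
  have 2: "inner v y = (\<Sum>u\<in>U. (inner v u)\<^sup>2)"
    by (simp add: y_def inner_sum_right power2_eq_square)
  have "0 \<le> inner (v - y) (v - y)" by simp
  then show ?thesis using 1 2
    by (simp add: inner_diff_left inner_diff_right inner_commute[of y v] power2_norm_eq_inner)
qed

lemma onb_inner:
  assumes "is_onb V U" "v \<in> V"
  shows "inner v x = (\<Sum>u\<in>U. inner v u * inner u x)"
proof -
  have "inner v x = inner (\<Sum>u\<in>U. inner v u *\<^sub>R u) x"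
    using is_onbD(5)[OF assms] by simp
  then show ?thesis by (simp add: inner_sum_left)
qed

lemma parseval:
  assumes "is_onb V U" "v \<in> V"
  shows "(\<Sum>u\<in>U. (inner v u)\<^sup>2) = (norm v)\<^sup>2"
proof -
  have "(norm v)\<^sup>2 = (\<Sum>u\<in>U. inner v u * inner u v)"
    unfolding power2_norm_eq_inner by (rule onb_inner[OF assms])
  also have "\<dots> = (\<Sum>u\<in>U. (inner v u)\<^sup>2)"
    by (intro sum.cong) (simp_all add: power2_eq_square inner_commute[of _ v])
  finally show ?thesis by simp
qed

lemma bessel_onb:
  assumes "is_onb V U"
  shows "(\<Sum>u\<in>U. (inner v u)\<^sup>2) \<le> (norm v)\<^sup>2"
  using assms by (intro bessel) (auto simp: is_onb_def)

lemma orthonormal_card_le: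
  assumes V: "is_onb V B" and U: "finite U" "U \<subseteq> V"
    "\<And>u w. u \<in> U \<Longrightarrow> w \<in> U \<Longrightarrow> inner u w = (if u = w then 1 else 0)"
  shows "card U \<le> card B"
proof -
  have "real (card U) = (\<Sum>u\<in>U. (norm u)\<^sup>2)"
    using U by (simp add: norm_eq_sqrt_inner)
  also have "\<dots> = (\<Sum>u\<in>U. \<Sum>b\<in>B. (inner u b)\<^sup>2)"
    using U parseval[OF V] by (intro sum.cong) auto
  also have "\<dots> = (\<Sum>b\<in>B. \<Sum>u\<in>U. (inner b u)\<^sup>2)"
    by (subst sum.swap) (simp add: inner_commute)
  also have "\<dots> \<le> (\<Sum>b\<in>B. (norm b)\<^sup>2)"
    using U by (intro sum_mono bessel) auto
  also have "\<dots> = real (card B)" using is_onbD[OF V] by simp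
  finally show ?thesis by simp
qed

text \<open>
  Supplies the compactness of the unit sphere of a finite-dimensional subspace, which is not
  available from the ambient space.
\<close>

lemma compact_coefficient_box:
  fixes B :: "'a::real_inner set"
  assumes "finite B"
  shows "compact {(\<Sum>b\<in>B. c b *\<^sub>R b) | c. \<forall>b. \<bar>c b\<bar> \<le> (1::real)}"
  using assms
proof (induction B rule: finite_induct)
  case empty
  have "{(\<Sum>b\<in>{}. c b *\<^sub>R b) | c. \<forall>b. \<bar>c b\<bar> \<le> (1::real)} = {0::'a}"
    by (auto intro!: exI[of _ "\<lambda>_. 0"])
  then show ?case by simp
next
  case (insert b B)
  let ?K = "\<lambda>B. {(\<Sum>b\<in>B. c b *\<^sub>R b) | c. \<forall>b. \<bar>c b\<bar> \<le> (1::real)} :: 'a set"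
  have "?K (insert b B) = (\<lambda>(t, y). t *\<^sub>R b + y) ` ({-1..1} \<times> ?K B)"
  proof (intro equalityI subsetI)
    fix x assume "x \<in> ?K (insert b B)"
    then obtain c where c: "\<forall>b. \<bar>c b\<bar> \<le> 1" "x = (\<Sum>b\<in>insert b B. c b *\<^sub>R b)" by blast
    then have "x = (\<lambda>(t, y). t *\<^sub>R b + y) (c b, \<Sum>b\<in>B. c b *\<^sub>R b)" using insert by simp
    moreover have "(c b, \<Sum>b\<in>B. c b *\<^sub>R b) \<in> {-1..1} \<times> ?K B"
      using c by (auto simp: abs_le_iff minus_le_iff)
    ultimately show "x \<in> (\<lambda>(t, y). t *\<^sub>R b + y) ` ({-1..1} \<times> ?K B)" by blast
  next
    fix x assume "x \<in> (\<lambda>(t, y). t *\<^sub>R b + y) ` ({-1..1} \<times> ?K B)"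
    then obtain t c where c: "\<forall>b. \<bar>c b\<bar> \<le> 1" "-1 \<le> t" "t \<le> 1" "x = t *\<^sub>R b + (\<Sum>b\<in>B. c b *\<^sub>R b)" by auto
    have "(\<Sum>a\<in>insert b B. (c(b := t)) a *\<^sub>R a) = t *\<^sub>R b + (\<Sum>a\<in>B. (c(b := t)) a *\<^sub>R a)"
      using insert by simp
    also have "(\<Sum>a\<in>B. (c(b := t)) a *\<^sub>R a) = (\<Sum>a\<in>B. c a *\<^sub>R a)"
      using insert by (intro sum.cong) auto
    finally have "x = (\<Sum>a\<in>insert b B. (c(b := t)) a *\<^sub>R a)" using c by simp
    moreover have "\<forall>a. \<bar>(c(b := t)) a\<bar> \<le> 1" using c by auto
    ultimately show "x \<in> ?K (insert b B)" by blast
  qed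
  moreover have "compact ((\<lambda>(t, y). t *\<^sub>R b + y) ` ({-1..1::real} \<times> ?K B))"
    using insert.IH
    by (intro compact_continuous_image compact_Times) (auto simp: case_prod_beta intro!: continuous_intros)
  ultimately show ?case by simp
qed

lemma quadratic_nonneg_linear_zero:
  fixes a c :: real
  assumes "\<And>t. 0 \<le> 2 * t * a + t\<^sup>2 * c"
  shows "a = 0"
proof (rule ccontr)
  assume a: "a \<noteq> 0"
  define t where "t = - a / (\<bar>c\<bar> + 1)"
  have "t\<^sup>2 * c \<le> t\<^sup>2 * (\<bar>c\<bar> + 1)" by (intro mult_left_mono) auto
  also have "\<dots> = t * - a"
    by (simp add: t_def power2_eq_square)
  finally have "0 \<le> t * a" using assms[of t] by simp
  moreover have "t * a = - (a\<^sup>2 / (\<bar>c\<bar> + 1))" by (simp add: t_def power2_eq_square)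
  ultimately have "a\<^sup>2 / (\<bar>c\<bar> + 1) \<le> 0" by simp
  moreover have "0 < a\<^sup>2 / (\<bar>c\<bar> + 1)" using a by (intro divide_pos_pos) auto
  ultimately show False by simp
qed

text \<open>
  The Rayleigh quotient attains its maximum \<open>l\<close> on the unit sphere of the orthogonal complement of
  \<open>U\<close>. There \<open>l - T\<close> is positive semidefinite and its form vanishes at the maximiser \<open>e\<close>, so
  perturbing \<open>e\<close> in all directions of the complement shows \<open>T e = l e\<close>.
\<close>

lemma rayleigh_eigenvector:
  fixes T :: "'a::real_inner \<Rightarrow> 'a"
  assumes T: "bounded_linear T" and V: "is_onb V B"
    and inv: "\<And>x. x \<in> V \<Longrightarrow> T x \<in> V"
    and sym: "\<And>x y. x \<in> V \<Longrightarrow> y \<in> V \<Longrightarrow> inner (T x) y = inner x (T y)"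
    and U: "U \<subseteq> V" "\<And>u. u \<in> U \<Longrightarrow> \<exists>c. T u = c *\<^sub>R u"
    and v: "v \<in> V" "v \<noteq> 0" "\<And>u. u \<in> U \<Longrightarrow> inner v u = 0"
  shows "\<exists>e\<in>V. norm e = 1 \<and> (\<forall>u\<in>U. inner e u = 0) \<and> (\<exists>c. T e = c *\<^sub>R e)"
proof -
  interpret T: bounded_linear T by (rule T)
  note V' = is_onbD[OF V]
  define W where "W = {x\<in>V. \<forall>u\<in>U. inner x u = 0}"
  have W: "subspace W"
    using V'(1) unfolding W_def subspace_def by (auto simp: inner_add_left)
  have TW: "T x \<in> W" if "x \<in> W" for x
  proof -
    have x: "x \<in> V" "\<And>u. u \<in> U \<Longrightarrow> inner x u = 0" using that by (auto simp: W_def)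
    have "inner (T x) u = 0" if "u \<in> U" for u
    proof -
      have "inner (T x) u = inner x (T u)" using sym x U that by blast
      then show ?thesis using U(2)[OF that] x(2)[OF that] by auto
    qed
    then show ?thesis using inv x by (auto simp: W_def)
  qed
  define S where "S = W \<inter> {x. norm x = 1}"
  have "S = {(\<Sum>b\<in>B. c b *\<^sub>R b) | c. \<forall>b. \<bar>c b\<bar> \<le> (1::real)} \<inter> ({x. norm x = 1} \<inter> (\<Inter>u\<in>U. {x. inner x u = 0}))"
    (is "_ = ?K \<inter> ?C")
  proof (intro equalityI subsetI)
    fix x assume x: "x \<in> S"
    define c where "c = (\<lambda>b. if b \<in> B then inner x b else 0)"
    have "x = (\<Sum>b\<in>B. inner x b *\<^sub>R b)" using x V'(5) by (auto simp: S_def W_def)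
    also have "\<dots> = (\<Sum>b\<in>B. c b *\<^sub>R b)" by (intro sum.cong) (auto simp: c_def)
    finally have "x = (\<Sum>b\<in>B. c b *\<^sub>R b)" .
    moreover have "\<forall>b. \<bar>c b\<bar> \<le> 1"
    proof
      fix b show "\<bar>c b\<bar> \<le> 1"
        using Cauchy_Schwarz_ineq2[of x b] x V'(6)[of b] by (auto simp: c_def S_def)
    qed
    ultimately have "x \<in> ?K" by blast
    then show "x \<in> ?K \<inter> ?C" using x by (auto simp: S_def W_def)
  next
    fix x assume x: "x \<in> ?K \<inter> ?C"
    then obtain c where "x = (\<Sum>b\<in>B. c b *\<^sub>R b)" by blast
    then have "x \<in> V" using V' by (auto intro!: subspace_sum subspace_scale)
    then show "x \<in> S" using x by (auto simp: S_def W_def)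
  qed
  moreover have "compact (?K \<inter> ?C)"
    using V'(2) by (intro compact_Int_closed compact_coefficient_box closed_Int closed_INT ballI
        closed_Collect_eq continuous_intros) auto
  ultimately have "compact S" by simp
  moreover have "S \<noteq> {}"
  proof -
    have "(1 / norm v) *\<^sub>R v \<in> S"
      using v W by (auto simp: S_def W_def intro!: subspace_scale[OF V'(1)])
    then show ?thesis by blast
  qed
  moreover have "continuous_on S (\<lambda>x. inner x (T x))"
    by (intro continuous_intros T.continuous_on)
  ultimately obtain e where e: "e \<in> S" "\<And>x. x \<in> S \<Longrightarrow> inner x (T x) \<le> inner e (T e)"
    using continuous_attains_sup by metis
  define l where "l = inner e (T e)"
  have eW: "e \<in> W" "norm e = 1" using e by (auto simp: S_def)
  have le: "0 \<le> inner (l *\<^sub>R w - T w) w" if "w \<in> W" for w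
  proof (cases "w = 0")
    case False
    have "(1 / norm w) *\<^sub>R w \<in> S" using False that W by (auto simp: S_def intro!: subspace_scale)
    from e(2)[OF this] have "inner w (T w) / (norm w)\<^sup>2 \<le> l"
      by (simp add: T.scaleR l_def power2_eq_square)
    then have "inner w (T w) \<le> l * inner w w"
      using False by (simp add: field_simps power2_norm_eq_inner)
    then show ?thesis by (simp add: inner_diff_left inner_commute[of "T w" w])
  qed simp
  have "inner (l *\<^sub>R e - T e) w = 0" if w: "w \<in> W" for w
  proof (rule quadratic_nonneg_linear_zero)
    fix t :: real
    have z: "e + t *\<^sub>R w \<in> W" using eW w W by (intro subspace_add subspace_scale)
    have s: "inner (T w) e = inner (T e) w"
      using sym[of w e] w eW by (auto simp: W_def inner_commute)
    have 0: "inner (l *\<^sub>R e - T e) e = 0"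
      using eW by (simp add: l_def inner_diff_left inner_commute[of "T e" e] norm_eq_sqrt_inner)
    have "inner (l *\<^sub>R (e + t *\<^sub>R w) - T (e + t *\<^sub>R w)) (e + t *\<^sub>R w) =
        inner (l *\<^sub>R e - T e) e + 2 * t * inner (l *\<^sub>R e - T e) w + t\<^sup>2 * inner (l *\<^sub>R w - T w) w"
      using s by (simp add: T.add T.scaleR algebra_simps inner_add_left inner_add_right
          inner_diff_left inner_diff_right power2_eq_square inner_commute[of w e])
    then show "0 \<le> 2 * t * inner (l *\<^sub>R e - T e) w + t\<^sup>2 * inner (l *\<^sub>R w - T w) w"
      using le[OF z] 0 by simp
  qed
  from this[of "l *\<^sub>R e - T e"] have "l *\<^sub>R e - T e = 0"
    using TW[OF eW(1)] eW W by (simp add: subspace_diff subspace_scale)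
  then have "T e = l *\<^sub>R e" by simp
  then show ?thesis using eW by (auto simp: W_def)
qed

text \<open>
  An orthonormal family of eigenvectors of maximal cardinality spans \<open>V\<close>: otherwise
  \<open>rayleigh_eigenvector\<close> would enlarge it.
\<close>

theorem finite_dim_spectral_theorem:
  fixes T :: "'a::real_inner \<Rightarrow> 'a"
  assumes T: "bounded_linear T" and V: "is_onb V B"
    and inv: "\<And>x. x \<in> V \<Longrightarrow> T x \<in> V"
    and sym: "\<And>x y. x \<in> V \<Longrightarrow> y \<in> V \<Longrightarrow> inner (T x) y = inner x (T y)"
  obtains U where "is_onb V U" "\<And>u. u \<in> U \<Longrightarrow> T u = inner (T u) u *\<^sub>R u"
proof -
  note V' = is_onbD[OF V]
  define good where "good = (\<lambda>U. finite U \<and> U \<subseteq> V \<and>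
     (\<forall>u\<in>U. \<forall>w\<in>U. inner u w = (if u = w then 1 else (0::real))) \<and> (\<forall>u\<in>U. \<exists>c. T u = c *\<^sub>R u))"
  have "good {}" by (simp add: good_def)
  moreover have "card U < Suc (card B)" if "good U" for U
    using orthonormal_card_le[OF V, of U] that by (auto simp: good_def)
  ultimately obtain U where U: "good U" and max: "\<And>U'. good U' \<Longrightarrow> card U' \<le> card U"
    using ex_has_greatest_nat[of good "{}" card "Suc (card B)"] by (auto simp: less_Suc_eq_le)
  have U': "finite U" "U \<subseteq> V" "\<And>u w. u \<in> U \<Longrightarrow> w \<in> U \<Longrightarrow> inner u w = (if u = w then 1 else 0)"
    "\<And>u. u \<in> U \<Longrightarrow> \<exists>c. T u = c *\<^sub>R u" using U by (auto simp: good_def)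
  have "v = (\<Sum>u\<in>U. inner v u *\<^sub>R u)" if v: "v \<in> V" for v
  proof (rule ccontr)
    define x where "x = v - (\<Sum>u\<in>U. inner v u *\<^sub>R u)"
    assume "v \<noteq> (\<Sum>u\<in>U. inner v u *\<^sub>R u)"
    then have "x \<noteq> 0" by (simp add: x_def)
    moreover have "x \<in> V" unfolding x_def using v U' V'(1)
      by (intro subspace_diff subspace_sum subspace_scale) auto
    moreover have "inner x u = 0" if "u \<in> U" for u
      unfolding x_def inner_diff_left using inner_orthonormal_sum[OF U'(1,3) that, of "inner v"] by simp
    ultimately obtain e c where e: "e \<in> V" "norm e = 1" "\<And>u. u \<in> U \<Longrightarrow> inner e u = 0" "T e = c *\<^sub>R e"
      using rayleigh_eigenvector[OF T V inv sym U'(2,4)] by metis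
    have ee: "inner e e = 1" using e(2) by (simp add: norm_eq_sqrt_inner)
    then have "e \<notin> U" using e(3) by force
    have e3: "inner u e = 0" if "u \<in> U" for u
      using e(3)[OF that] by (simp only: inner_commute[of u e])
    have "inner u w = (if u = w then 1 else 0)" if "u \<in> insert e U" "w \<in> insert e U" for u w
      using that e(3) U'(3) ee \<open>e \<notin> U\<close> e3 by auto
    then have "good (insert e U)" using e U' by (auto simp: good_def)
    then show False using max[of "insert e U"] \<open>e \<notin> U\<close> U'(1) by simp
  qed
  then have "is_onb V U" using U' V' by (simp add: is_onb_def)
  moreover have "T u = inner (T u) u *\<^sub>R u" if "u \<in> U" for u
    using U'(3)[OF that that] U'(4)[OF that] by auto
  ultimately show ?thesis using that by blast
qed

section \<open>Trace inequalities for finite spectral forms\<close>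

text \<open>
  If \<open>U\<close> consists of eigenvectors of \<open>X\<close> with eigenvalues \<open>\<mu>\<close>, this is the quadratic form
  \<open>\<langle>X v, v\<rangle>\<close>, and \<open>f \<circ> \<mu>\<close> in place of \<open>\<mu>\<close> gives the form of \<open>f(X)\<close>. Trace inequalities for functions of
  several operators thus become inequalities between finite sums.
\<close>

definition diag_form :: "'a::real_inner set \<Rightarrow> ('a \<Rightarrow> real) \<Rightarrow> 'a \<Rightarrow> real" where
  "diag_form U \<mu> v = (\<Sum>u\<in>U. \<mu> u * (inner v u)\<^sup>2)"

lemma diag_form_basis:
  assumes "is_onb V U" "u \<in> U"
  shows "diag_form U \<mu> u = \<mu> u"
proof -
  have "diag_form U \<mu> u = (\<Sum>w\<in>U. if u = w then \<mu> u else 0)"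
    unfolding diag_form_def using is_onbD[OF assms(1)] assms by (intro sum.cong) auto
  then show ?thesis using is_onbD[OF assms(1)] assms by simp
qed

lemma diag_form_combination:
  assumes "is_onb V U"
  shows "diag_form U \<mu> (\<Sum>u\<in>U. c u *\<^sub>R u) = (\<Sum>u\<in>U. \<mu> u * (c u)\<^sup>2)"
  unfolding diag_form_def using is_onbD[OF assms]
  by (intro sum.cong) (auto simp: inner_orthonormal_sum)

lemma sum_diag_form_onb:
  assumes B: "is_onb V B" and U: "\<And>u. u \<in> U \<Longrightarrow> u \<in> V" "\<And>u. u \<in> U \<Longrightarrow> norm u = 1"
  shows "(\<Sum>b\<in>B. diag_form U \<mu> b) = (\<Sum>u\<in>U. \<mu> u)"
proof -
  have "(\<Sum>b\<in>B. diag_form U \<mu> b) = (\<Sum>u\<in>U. \<mu> u * (\<Sum>b\<in>B. (inner u b)\<^sup>2))"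
    unfolding diag_form_def by (subst sum.swap) (simp add: sum_distrib_left inner_commute)
  also have "\<dots> = (\<Sum>u\<in>U. \<mu> u)"
    using parseval[OF B] U by (intro sum.cong) auto
  finally show ?thesis .
qed

text \<open>
  If \<open>X \<ge> l w \<otimes> w\<close>, then \<open>\<langle>X\<^sup>-\<^sup>1 w, w\<rangle> \<le> 1 / l\<close>: test the inequality on the vector \<open>X\<^sup>-\<^sup>1 w\<close>. Division by zero
  gives zero here, which is harmless since \<open>w\<close> is orthogonal to the kernel of \<open>X\<close>.
\<close>

lemma rank_one_resolvent:
  assumes U: "is_onb V U" and \<mu>: "\<And>u. u \<in> U \<Longrightarrow> 0 \<le> \<mu> u" and w: "w \<in> V"
    and l: "0 < l" and le: "\<And>v. v \<in> V \<Longrightarrow> l * (inner v w)\<^sup>2 \<le> diag_form U \<mu> v"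
  shows "\<And>u. u \<in> U \<Longrightarrow> \<mu> u = 0 \<Longrightarrow> inner w u = 0"
    and "(\<Sum>u\<in>U. (inner w u)\<^sup>2 / \<mu> u) \<le> 1 / l"
proof -
  note U' = is_onbD[OF U]
  show "inner w u = 0" if "u \<in> U" "\<mu> u = 0" for u
    using le[OF U'(3)[OF that(1)]] diag_form_basis[OF U that(1), of \<mu>] that l
    by (simp add: mult_le_0_iff inner_commute)
  define s where "s = (\<Sum>u\<in>U. (inner w u)\<^sup>2 / \<mu> u)"
  \<comment> \<open>\<open>v = X\<^sup>-\<^sup>1 w\<close>\<close>
  define v where "v = (\<Sum>u\<in>U. (inner w u / \<mu> u) *\<^sub>R u)"
  have v: "v \<in> V" unfolding v_def using U' by (intro subspace_sum subspace_scale) auto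
  have "diag_form U \<mu> v = s"
    unfolding v_def diag_form_combination[OF U] s_def
    by (intro sum.cong) (auto simp: power2_eq_square)
  moreover have "inner v w = s"
    unfolding v_def s_def inner_sum_left
    by (intro sum.cong) (simp_all add: inner_commute[of w] power2_eq_square)
  ultimately have "l * s * s \<le> s" using le[OF v] by (simp add: power2_eq_square)
  moreover have "0 \<le> s" unfolding s_def using \<mu> by (intro sum_nonneg) auto
  ultimately have "l * s \<le> 1"
    by (cases "s = 0") auto
  then show "s \<le> 1 / l" using l by (simp add: field_simps)
qed

text \<open>
  Operator monotonicity of all powers against rank one operators: by Jensen's inequality the bound on
  \<open>\<langle>X\<^sup>-\<^sup>1 w, w\<rangle>\<close> turns into \<open>\<langle>X\<^sup>r w, w\<rangle> \<ge> l\<^sup>r\<close>. Unlike for general operators there is no restriction to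
  \<open>r \<le> 1\<close>.
\<close>

lemma rank_one_powr_lower:
  assumes U: "is_onb V U" and \<mu>: "\<And>u. u \<in> U \<Longrightarrow> 0 \<le> \<mu> u" and w: "w \<in> V" "norm w = 1"
    and l: "0 \<le> l" and le: "\<And>v. v \<in> V \<Longrightarrow> l * (inner v w)\<^sup>2 \<le> diag_form U \<mu> v"
    and r: "0 \<le> r"
  shows "l powr r \<le> diag_form U (\<lambda>u. \<mu> u powr r) w"
proof (cases "l = 0")
  case True
  then show ?thesis by (auto simp: diag_form_def intro!: sum_nonneg)
next
  case False
  then have l: "0 < l" using l by simp
  have R1: "inner w u = 0" if "u \<in> U" "\<mu> u = 0" for u
    by (rule rank_one_resolvent(1)[of V U \<mu> w l]) (use U \<mu> w l le that in auto)
  have R2: "(\<Sum>u\<in>U. (inner w u)\<^sup>2 / \<mu> u) \<le> 1 / l"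
    by (rule rank_one_resolvent(2)[of V U \<mu> w l]) (use U \<mu> w l le in auto)
  have "l powr r * ((1 + r) - r * l * (1 / l)) \<le> l powr r * ((1 + r) - r * l * (\<Sum>u\<in>U. (inner w u)\<^sup>2 / \<mu> u))"
    using R2 r l by (intro mult_left_mono diff_left_mono) auto
  also have "\<dots> = l powr r * ((1 + r) * (\<Sum>u\<in>U. (inner w u)\<^sup>2) - r * l * (\<Sum>u\<in>U. (inner w u)\<^sup>2 / \<mu> u))"
    using parseval[OF U w(1)] w(2) by simp
  also have "\<dots> = (\<Sum>u\<in>U. l powr r * (((1 + r) - r * l / \<mu> u) * (inner w u)\<^sup>2))"
    by (simp add: sum_distrib_left sum_subtractf[symmetric] algebra_simps)
  also have "\<dots> \<le> diag_form U (\<lambda>u. \<mu> u powr r) w"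
    unfolding diag_form_def
  proof (rule sum_mono)
    fix u assume u: "u \<in> U"
    show "l powr r * (((1 + r) - r * l / \<mu> u) * (inner w u)\<^sup>2) \<le> \<mu> u powr r * (inner w u)\<^sup>2"
    proof (cases "\<mu> u = 0")
      case True
      then show ?thesis using R1[OF u] by simp
    next
      case False
      then have m: "0 < \<mu> u" using \<mu>[OF u] by simp
      have "l powr r * (1 - r * (l / \<mu> u - 1)) \<le> l powr r * (l / \<mu> u) powr (- r)"
        using r l m by (intro mult_left_mono bernoulli_powr_neg) auto
      also have "\<dots> = \<mu> u powr r" using l m by (simp add: powr_divide powr_minus)
      finally have "l powr r * ((1 + r) - r * l / \<mu> u) \<le> \<mu> u powr r" by (simp add: algebra_simps)
      from mult_right_mono[OF this, of "(inner w u)\<^sup>2"] show ?thesis by (simp add: mult.assoc)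
    qed
  qed
  finally show ?thesis using l by simp
qed

text \<open>
  The same argument for negative powers; here concavity of \<open>t\<^sup>r\<close> requires \<open>r \<le> 1\<close>.
\<close>

lemma rank_one_powr_neg_upper:
  assumes U: "is_onb V U" and \<mu>: "\<And>u. u \<in> U \<Longrightarrow> 0 \<le> \<mu> u" and w: "w \<in> V" "norm w = 1"
    and l: "0 < l" and le: "\<And>v. v \<in> V \<Longrightarrow> l * (inner v w)\<^sup>2 \<le> diag_form U \<mu> v"
    and r: "0 \<le> r" "r \<le> 1"
  shows "diag_form U (\<lambda>u. \<mu> u powr (- r)) w \<le> l powr (- r)"
proof -
  have R1: "inner w u = 0" if "u \<in> U" "\<mu> u = 0" for u
    by (rule rank_one_resolvent(1)[of V U \<mu> w l]) (use U \<mu> w l le that in auto)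
  have R2: "(\<Sum>u\<in>U. (inner w u)\<^sup>2 / \<mu> u) \<le> 1 / l"
    by (rule rank_one_resolvent(2)[of V U \<mu> w l]) (use U \<mu> w l le in auto)
  have "diag_form U (\<lambda>u. \<mu> u powr (- r)) w \<le>
     (\<Sum>u\<in>U. l powr (- r) * (((1 - r) + r * l / \<mu> u) * (inner w u)\<^sup>2))"
    unfolding diag_form_def
  proof (rule sum_mono)
    fix u assume u: "u \<in> U"
    show "\<mu> u powr (- r) * (inner w u)\<^sup>2 \<le> l powr (- r) * (((1 - r) + r * l / \<mu> u) * (inner w u)\<^sup>2)"
    proof (cases "\<mu> u = 0")
      case True
      then show ?thesis using R1[OF u] by simp
    next
      case False
      then have m: "0 < \<mu> u" using \<mu>[OF u] by simp
      have "\<mu> u powr (- r) = l powr (- r) * (l / \<mu> u) powr r"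
        using l m by (simp add: powr_divide powr_minus field_simps)
      also have "\<dots> \<le> l powr (- r) * (1 + r * (l / \<mu> u - 1))"
        using r l m by (intro mult_left_mono bernoulli_powr_concave) auto
      finally have "\<mu> u powr (- r) \<le> l powr (- r) * ((1 - r) + r * l / \<mu> u)" by (simp add: algebra_simps)
      from mult_right_mono[OF this, of "(inner w u)\<^sup>2"] show ?thesis by (simp add: mult.assoc)
    qed
  qed
  also have "\<dots> = l powr (- r) * ((1 - r) * (\<Sum>u\<in>U. (inner w u)\<^sup>2) + r * l * (\<Sum>u\<in>U. (inner w u)\<^sup>2 / \<mu> u))"
    by (simp add: sum_distrib_left sum.distrib[symmetric] algebra_simps)
  also have "\<dots> = l powr (- r) * ((1 - r) + r * l * (\<Sum>u\<in>U. (inner w u)\<^sup>2 / \<mu> u))"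
    using parseval[OF U w(1)] w(2) by simp
  also have "\<dots> \<le> l powr (- r) * ((1 - r) + r * l * (1 / l))"
    using R2 r l by (intro mult_left_mono add_left_mono) auto
  finally show ?thesis using l by simp
qed

text \<open>
  Superadditivity (\<open>q \<ge> 1\<close>) and subadditivity (\<open>q \<le> 1\<close>) of \<open>X \<mapsto> Tr X\<^sup>q\<close>. If \<open>X = \<Sum>\<^sub>j l\<^sub>j w\<^sub>j \<otimes> w\<^sub>j\<close>, then
  \<open>Tr X\<^sup>q = Tr X X\<^sup>q\<^sup>-\<^sup>1 = \<Sum>\<^sub>j l\<^sub>j \<langle>X\<^sup>q\<^sup>-\<^sup>1 w\<^sub>j, w\<^sub>j\<rangle>\<close>, and as \<open>X\<close> dominates each summand, the rank one estimates
  compare \<open>\<langle>X\<^sup>q\<^sup>-\<^sup>1 w\<^sub>j, w\<^sub>j\<rangle>\<close> with \<open>l\<^sub>j\<^sup>q\<^sup>-\<^sup>1\<close>.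
\<close>

lemma trace_powr_decomposition:
  assumes U: "is_onb V U" and \<mu>: "\<And>u. u \<in> U \<Longrightarrow> 0 \<le> \<mu> u" and J: "finite J"
    and w: "\<And>j. j \<in> J \<Longrightarrow> w j \<in> V" "\<And>j. j \<in> J \<Longrightarrow> norm (w j) = 1" and l: "\<And>j. j \<in> J \<Longrightarrow> 0 \<le> l j"
    and eq: "\<And>v. v \<in> V \<Longrightarrow> diag_form U \<mu> v = (\<Sum>j\<in>J. l j * (inner v (w j))\<^sup>2)"
  shows "1 \<le> q \<Longrightarrow> (\<Sum>j\<in>J. l j powr q) \<le> (\<Sum>u\<in>U. \<mu> u powr q)"
    and "0 < q \<Longrightarrow> q \<le> 1 \<Longrightarrow> (\<Sum>u\<in>U. \<mu> u powr q) \<le> (\<Sum>j\<in>J. l j powr q)"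
proof -
  have le: "l j * (inner v (w j))\<^sup>2 \<le> diag_form U \<mu> v" if "v \<in> V" "j \<in> J" for v j
    unfolding eq[OF that(1)] using J l that
    by (intro member_le_sum[of j J "\<lambda>j. l j * (inner v (w j))\<^sup>2"]) auto
  have tr: "(\<Sum>u\<in>U. \<mu> u powr q) = (\<Sum>j\<in>J. l j * diag_form U (\<lambda>u. \<mu> u powr (q - 1)) (w j))" for q
  proof -
    have "(\<Sum>u\<in>U. \<mu> u powr q) = (\<Sum>u\<in>U. \<mu> u powr (q - 1) * \<mu> u)"
      using \<mu> by (intro sum.cong) (auto simp: powr_diff divide_simps)
    also have "\<dots> = (\<Sum>u\<in>U. \<mu> u powr (q - 1) * (\<Sum>j\<in>J. l j * (inner u (w j))\<^sup>2))"
      using eq is_onbD(3)[OF U] diag_form_basis[OF U, of _ \<mu>] by (intro sum.cong) auto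
    also have "\<dots> = (\<Sum>u\<in>U. \<Sum>j\<in>J. l j * (\<mu> u powr (q - 1) * (inner (w j) u)\<^sup>2))"
      by (simp add: sum_distrib_left mult_ac inner_commute)
    also have "\<dots> = (\<Sum>j\<in>J. l j * diag_form U (\<lambda>u. \<mu> u powr (q - 1)) (w j))"
      unfolding diag_form_def sum_distrib_left by (rule sum.swap)
    finally show ?thesis .
  qed
  show "(\<Sum>j\<in>J. l j powr q) \<le> (\<Sum>u\<in>U. \<mu> u powr q)" if q: "1 \<le> q"
    unfolding tr[of q]
  proof (rule sum_mono)
    fix j assume j: "j \<in> J"
    have "l j powr q = l j * l j powr (q - 1)" using l[OF j] by (auto simp: powr_diff)
    also have "\<dots> \<le> l j * diag_form U (\<lambda>u. \<mu> u powr (q - 1)) (w j)"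
      using q j w l by (intro mult_left_mono rank_one_powr_lower[OF U \<mu>] le) auto
    finally show "l j powr q \<le> l j * diag_form U (\<lambda>u. \<mu> u powr (q - 1)) (w j)" .
  qed
  show "(\<Sum>u\<in>U. \<mu> u powr q) \<le> (\<Sum>j\<in>J. l j powr q)" if q: "0 < q" "q \<le> 1"
    unfolding tr[of q]
  proof (rule sum_mono)
    fix j assume j: "j \<in> J"
    show "l j * diag_form U (\<lambda>u. \<mu> u powr (q - 1)) (w j) \<le> l j powr q"
    proof (cases "l j = 0")
      case False
      then have lj: "0 < l j" using l[OF j] by simp
      have "diag_form U (\<lambda>u. \<mu> u powr (- (1 - q))) (w j) \<le> l j powr (- (1 - q))"
        using q j w lj by (intro rank_one_powr_neg_upper[OF U \<mu>] le) auto
      then have "l j * diag_form U (\<lambda>u. \<mu> u powr (q - 1)) (w j) \<le> l j * l j powr (q - 1)"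
        using lj by (intro mult_left_mono) auto
      then show ?thesis using lj by (simp add: powr_diff)
    qed simp
  qed
qed

text \<open>
  Monotonicity of the trace of a power, for every \<open>q > 0\<close>: the rank one estimate is applied to the
  eigenvectors of the smaller operator. The trace of the larger operator is taken only over the
  subspace carrying the smaller one.
\<close>

lemma trace_powr_mono:
  assumes U: "is_onb V U" and \<mu>: "\<And>u. u \<in> U \<Longrightarrow> 0 \<le> \<mu> u"
    and W: "is_onb V' W" "V' \<subseteq> V" and \<nu>: "\<And>w. w \<in> W \<Longrightarrow> 0 \<le> \<nu> w"
    and le: "\<And>v. v \<in> V \<Longrightarrow> diag_form W \<nu> v \<le> diag_form U \<mu> v" and q: "0 < q"
    and B: "is_onb V' B"
  shows "(\<Sum>w\<in>W. \<nu> w powr q) \<le> (\<Sum>b\<in>B. diag_form U (\<lambda>u. \<mu> u powr q) b)"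
proof -
  note W' = is_onbD[OF W(1)]
  have "\<nu> w powr q \<le> diag_form U (\<lambda>u. \<mu> u powr q) w" if w: "w \<in> W" for w
  proof (rule rank_one_powr_lower[OF U \<mu>])
    fix v assume "v \<in> V"
    have "\<nu> w * (inner v w)\<^sup>2 \<le> diag_form W \<nu> v"
      unfolding diag_form_def using w \<nu> W' by (intro member_le_sum[of w W "\<lambda>w. \<nu> w * (inner v w)\<^sup>2"]) auto
    then show "\<nu> w * (inner v w)\<^sup>2 \<le> diag_form U \<mu> v" using le[OF \<open>v \<in> V\<close>] by simp
  qed (use w W' W \<nu> q in auto)
  then have "(\<Sum>w\<in>W. \<nu> w powr q) \<le> (\<Sum>w\<in>W. diag_form U (\<lambda>u. \<mu> u powr q) w)" by (rule sum_mono)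
  also have "\<dots> = (\<Sum>b\<in>B. diag_form U (\<lambda>u. \<mu> u powr q) b)"
  proof -
    have "(\<Sum>w\<in>C. (inner w u)\<^sup>2) = (\<Sum>w\<in>W. (inner w u)\<^sup>2)" if C: "is_onb V' C" for C u
    proof -
      define y where "y = (\<Sum>w\<in>W. inner u w *\<^sub>R w)"
      have y: "y \<in> V'" unfolding y_def using W' by (intro subspace_sum subspace_scale) auto
      have yv: "inner v u = inner v y" if "v \<in> V'" for v
        using onb_inner[OF W(1) that, of u] unfolding y_def by (simp add: inner_sum_right mult.commute inner_commute)
      have "(\<Sum>w\<in>C. (inner w u)\<^sup>2) = (norm y)\<^sup>2"
        using parseval[OF C y] is_onbD(3)[OF C] yv by (simp add: inner_commute)
      moreover have "(\<Sum>w\<in>W. (inner w u)\<^sup>2) = (norm y)\<^sup>2"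
        using parseval[OF W(1) y] W'(3) yv by (simp add: inner_commute)
      ultimately show ?thesis by simp
    qed
    then show ?thesis unfolding diag_form_def
      by (subst (1 2) sum.swap) (simp add: sum_distrib_left[symmetric] B)
  qed
  finally show ?thesis .
qed

lemma diag_form_powr_jensen:
  assumes U: "is_onb V U" and \<mu>: "\<And>u. u \<in> U \<Longrightarrow> 0 \<le> \<mu> u" and v: "v \<in> V" "norm v = 1" and q: "1 \<le> q"
  shows "diag_form U \<mu> v powr q \<le> diag_form U (\<lambda>u. \<mu> u powr q) v"
  using weighted_power_mean[of q U "\<lambda>u. (inner v u)\<^sup>2" \<mu>] \<mu> q parseval[OF U v(1)] v(2)
  by (simp add: diag_form_def mult.commute)

text \<open>
  The number \<open>\<langle>s X (X + s)\<^sup>-\<^sup>1 v, v\<rangle>\<close> is the minimum over \<open>z\<close> of \<open>\<langle>X z, z\<rangle> + s \<parallel>v - z\<parallel>\<^sup>2\<close>, and such a minimum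
  is monotone in \<open>X\<close>. The proof inserts the minimiser for the larger operator.
\<close>

lemma resolvent_form_mono:
  assumes U: "is_onb V U" and \<mu>: "\<And>u. u \<in> U \<Longrightarrow> 0 \<le> \<mu> u"
    and W: "is_onb V' W" and \<nu>: "\<And>w. w \<in> W \<Longrightarrow> 0 \<le> \<nu> w"
    and le: "\<And>z. z \<in> V \<Longrightarrow> diag_form W \<nu> z \<le> diag_form U \<mu> z" and s: "0 < s" and v: "v \<in> V"
  shows "diag_form W (\<lambda>w. \<nu> w / (\<nu> w + s)) v \<le> diag_form U (\<lambda>u. \<mu> u / (\<mu> u + s)) v"
proof -
  note U' = is_onbD[OF U]
  \<comment> \<open>The minimiser \<open>s (X + s)\<^sup>-\<^sup>1 v\<close>.\<close>
  define z where "z = (\<Sum>u\<in>U. (s / (\<mu> u + s) * inner v u) *\<^sub>R u)"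
  have z: "z \<in> V" unfolding z_def using U' by (intro subspace_sum subspace_scale) auto
  have vz: "v - z = (\<Sum>u\<in>U. (\<mu> u / (\<mu> u + s) * inner v u) *\<^sub>R u)"
  proof -
    have "v - z = (\<Sum>u\<in>U. inner v u *\<^sub>R u - (s / (\<mu> u + s) * inner v u) *\<^sub>R u)"
      unfolding z_def sum_subtractf using U'(5)[OF v] by simp
    also have "\<dots> = (\<Sum>u\<in>U. (\<mu> u / (\<mu> u + s) * inner v u) *\<^sub>R u)"
    proof (rule sum.cong)
      fix u assume "u \<in> U"
      then have "\<mu> u + s > 0" using \<mu> s by (simp add: add_nonneg_pos)
      then have "1 - s / (\<mu> u + s) = \<mu> u / (\<mu> u + s)" by (simp add: field_simps)
      then show "inner v u *\<^sub>R u - (s / (\<mu> u + s) * inner v u) *\<^sub>R u = (\<mu> u / (\<mu> u + s) * inner v u) *\<^sub>R u"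
        by (metis scaleR_left_diff_distrib left_diff_distrib mult_1)
    qed simp
    finally show ?thesis .
  qed
  have nvz: "(norm (v - z))\<^sup>2 = (\<Sum>u\<in>U. (\<mu> u / (\<mu> u + s) * inner v u)\<^sup>2)"
    using diag_form_combination[OF U, of "\<lambda>_. 1"] parseval[OF U, of "v - z"] v z U'(1)
    by (simp add: vz[symmetric] diag_form_def subspace_diff)
       (simp add: vz)
  have "s * diag_form W (\<lambda>w. \<nu> w / (\<nu> w + s)) v \<le> (\<Sum>w\<in>W. \<nu> w * (inner z w)\<^sup>2 + s * (inner (v - z) w)\<^sup>2)"
    unfolding diag_form_def sum_distrib_left
  proof (rule sum_mono)
    fix w assume w: "w \<in> W"
    define a b n where "a = inner z w" and "b = inner (v - z) w" and "n = \<nu> w"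
    have n: "0 \<le> n" "0 < n + s" using \<nu>[OF w] s by (auto simp: n_def add_nonneg_pos)
    have vw: "inner v w = a + b" by (simp add: a_def b_def inner_diff_left)
    have "s * n * (a + b)\<^sup>2 \<le> (n + s) * (n * a\<^sup>2 + s * b\<^sup>2)"
    proof -
      have "(n + s) * (n * a\<^sup>2 + s * b\<^sup>2) - s * n * (a + b)\<^sup>2 = (n * a - s * b)\<^sup>2"
        by (simp add: power2_eq_square algebra_simps)
      then show ?thesis by (metis zero_le_power2 diff_ge_0_iff_ge)
    qed
    then have "s * (n / (n + s) * (a + b)\<^sup>2) \<le> n * a\<^sup>2 + s * b\<^sup>2"
      using n by (simp add: field_simps)
    then show "s * (\<nu> w / (\<nu> w + s) * (inner v w)\<^sup>2) \<le> \<nu> w * (inner z w)\<^sup>2 + s * (inner (v - z) w)\<^sup>2"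
      unfolding vw by (simp add: a_def b_def n_def)
  qed
  also have "\<dots> = diag_form W \<nu> z + s * (\<Sum>w\<in>W. (inner (v - z) w)\<^sup>2)"
    by (simp add: diag_form_def sum.distrib sum_distrib_left)
  also have "\<dots> \<le> diag_form U \<mu> z + s * (norm (v - z))\<^sup>2"
    using le[OF z] s bessel_onb[OF W] by (intro add_mono mult_left_mono) auto
  also have "\<dots> = s * diag_form U (\<lambda>u. \<mu> u / (\<mu> u + s)) v"
    unfolding nvz
    unfolding z_def diag_form_combination[OF U]
    unfolding diag_form_def sum_distrib_left sum.distrib[symmetric]
  proof (rule sum.cong)
    fix u assume "u \<in> U"
    then have "\<mu> u + s > 0" using \<mu> s by (simp add: add_nonneg_pos)
    then show "\<mu> u * (s / (\<mu> u + s) * inner v u)\<^sup>2 + s * (\<mu> u / (\<mu> u + s) * inner v u)\<^sup>2 =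
        s * (\<mu> u / (\<mu> u + s) * (inner v u)\<^sup>2)"
      by (simp add: divide_simps power2_eq_square) (simp add: algebra_simps)
  qed simp
  finally show ?thesis using s by simp
qed

definition loewner_const :: "real \<Rightarrow> real" where
  "loewner_const q = (if q = 1 then 1 else 2 * 2 powr q * (4 / (1 - 2 powr - min q (1 - q))))"

lemma loewner_const_pos: "0 < q \<Longrightarrow> q \<le> 1 \<Longrightarrow> 0 < loewner_const q"
  by (auto simp: loewner_const_def min_def powr_less_one intro!: mult_pos_pos divide_pos_pos)

text \<open>
  The Loewner--Heinz inequality up to a constant: \<open>t\<^sup>q\<close> is comparable with a positive combination of
  the functions \<open>t / (t + 2\<^sup>n)\<close>, for each of which monotonicity holds. Only the finitely many \<open>n\<close> belonging
  to the eigenvalues of the smaller operator are needed.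
\<close>

lemma loewner_heinz:
  assumes q: "0 < q" "q \<le> 1"
    and U: "is_onb V U" and \<mu>: "\<And>u. u \<in> U \<Longrightarrow> 0 \<le> \<mu> u"
    and W: "is_onb V' W" and \<nu>: "\<And>w. w \<in> W \<Longrightarrow> 0 \<le> \<nu> w"
    and le: "\<And>z. z \<in> V \<Longrightarrow> diag_form W \<nu> z \<le> diag_form U \<mu> z" and v: "v \<in> V"
  shows "diag_form W (\<lambda>w. \<nu> w powr q) v \<le> loewner_const q * diag_form U (\<lambda>u. \<mu> u powr q) v"
proof (cases "q = 1")
  case True
  have "diag_form W (\<lambda>w. \<nu> w powr q) v = diag_form W \<nu> v"
    unfolding diag_form_def using \<nu> True by (intro sum.cong) auto
  moreover have "diag_form U (\<lambda>w. \<mu> w powr q) v = diag_form U \<mu> v"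
    unfolding diag_form_def using \<mu> True by (intro sum.cong) auto
  ultimately show ?thesis using le[OF v] True by (simp add: loewner_const_def)
next
  case False
  then have q: "0 < q" "q < 1" using q by auto
  define C1 C2 :: real where "C1 = 2 * 2 powr q" and "C2 = 4 / (1 - 2 powr - min q (1 - q))"
  have C: "0 < C1" "0 < C2" using q by (auto simp: C1_def C2_def min_def powr_less_one)
  define J where "J = (\<lambda>w. \<lfloor>log 2 (\<nu> w)\<rfloor>) ` W"
  have J: "finite J" using is_onbD[OF W] by (simp add: J_def)
  define g where "g = (\<lambda>t. \<Sum>n\<in>J. 2 powr (real_of_int n * q) * (t / (t + 2 powr real_of_int n)))"
  have dg: "diag_form A (\<lambda>u. g (f u)) v =
    (\<Sum>n\<in>J. 2 powr (real_of_int n * q) * diag_form A (\<lambda>u. f u / (f u + 2 powr real_of_int n)) v)"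
    for A :: "'a set" and f
    unfolding diag_form_def g_def sum_distrib_left sum_distrib_right
    by (subst sum.swap) (simp add: mult_ac)
  have "diag_form W (\<lambda>w. \<nu> w powr q) v \<le> (\<Sum>w\<in>W. C1 * (g (\<nu> w) * (inner v w)\<^sup>2))"
    unfolding diag_form_def
  proof (rule sum_mono)
    fix w assume w: "w \<in> W"
    have "\<nu> w powr q \<le> C1 * g (\<nu> w)"
    proof (cases "\<nu> w = 0")
      case False
      then show ?thesis unfolding C1_def g_def using \<nu>[OF w] q J w
        by (intro powr_dyadic_lower) (auto simp: J_def)
    qed (simp add: g_def)
    from mult_right_mono[OF this, of "(inner v w)\<^sup>2"]
    show "\<nu> w powr q * (inner v w)\<^sup>2 \<le> C1 * (g (\<nu> w) * (inner v w)\<^sup>2)" by (simp add: mult.assoc)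
  qed
  also have "\<dots> = C1 * diag_form W (\<lambda>w. g (\<nu> w)) v" by (simp add: diag_form_def sum_distrib_left)
  also have "\<dots> \<le> C1 * diag_form U (\<lambda>w. g (\<mu> w)) v"
    unfolding dg using C \<mu> \<nu> le v
    by (intro mult_left_mono sum_mono resolvent_form_mono[OF U _ W]) auto
  also have "diag_form U (\<lambda>w. g (\<mu> w)) v \<le> (\<Sum>u\<in>U. C2 * (\<mu> u powr q * (inner v u)\<^sup>2))"
    unfolding diag_form_def
  proof (rule sum_mono)
    fix u assume u: "u \<in> U"
    have "g (\<mu> u) \<le> C2 * \<mu> u powr q"
      unfolding C2_def g_def using \<mu>[OF u] q J by (intro powr_dyadic_upper) auto
    from mult_right_mono[OF this, of "(inner v u)\<^sup>2"]
    show "g (\<mu> u) * (inner v u)\<^sup>2 \<le> C2 * (\<mu> u powr q * (inner v u)\<^sup>2)" by (simp add: mult.assoc)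
  qed
  also have "\<dots> = C2 * diag_form U (\<lambda>u. \<mu> u powr q) v" by (simp add: diag_form_def sum_distrib_left)
  finally show ?thesis
    using C False by (simp add: loewner_const_def C1_def C2_def mult.assoc)
qed

section \<open>The Hilbert space \<open>L\<^sub>2(C)\<close>\<close>

lemma coeff_zero [simp]: "coeff_L2 0 A = 0" by (simp add: zero_car_L2.rep_eq)
lemma coeff_add [simp]: "coeff_L2 (x + y) A = coeff_L2 x A + coeff_L2 y A" by (simp add: plus_car_L2.rep_eq)
lemma coeff_uminus [simp]: "coeff_L2 (- x) A = - coeff_L2 x A" by (simp only: uminus_car_L2.rep_eq)
lemma coeff_diff [simp]: "coeff_L2 (x - y) A = coeff_L2 x A - coeff_L2 y A" unfolding minus_car_L2_def coeff_add coeff_uminus by simp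
lemma coeff_cscale [simp]: "coeff_L2 (cscale c x) A = c * coeff_L2 x A" by (simp add: cscale.rep_eq)
lemma coeff_scaleR [simp]: "coeff_L2 (r *\<^sub>R x) A = of_real r * coeff_L2 x A" by (simp add: scaleR_car_L2_def)
lemma coeff_sum [simp]: "coeff_L2 (\<Sum>i\<in>I. f i) A = (\<Sum>i\<in>I. coeff_L2 (f i) A)"
  by (induction I rule: infinite_finite_induct) auto
lemma coeff_basis: "coeff_L2 (basis_L2 A) B = (if A \<in> car_index \<and> B = A then 1 else 0)"
  by (simp add: basis_L2.rep_eq)
lemma coeff_outside: "A \<notin> car_index \<Longrightarrow> coeff_L2 x A = 0" using coeff_L2[of x] by auto
lemma car_L2_eqI: "(\<And>A. A \<in> car_index \<Longrightarrow> coeff_L2 x A = coeff_L2 y A) \<Longrightarrow> x = y"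
  by (metis coeff_L2_inject coeff_outside ext)

lemma cscale_simps [simp]:
  "cscale c (x + y) = cscale c x + cscale c y" "cscale c (x - y) = cscale c x - cscale c y"
  "cscale c (- x) = - cscale c x" "cscale c 0 = 0" "cscale 0 x = 0" "cscale 1 x = x"
  "cscale c (cscale d x) = cscale (c * d) x" "cscale (- 1) x = - x"
  by (auto intro!: car_L2_eqI simp: algebra_simps)

lemma cscale_sum: "cscale c (\<Sum>i\<in>I. f i) = (\<Sum>i\<in>I. cscale c (f i))"
  by (auto intro!: car_L2_eqI simp: sum_distrib_left)

lemma cscale_add_left: "cscale (c + d) x = cscale c x + cscale d x"
  by (auto intro!: car_L2_eqI simp: algebra_simps)

lemma scaleR_eq_cscale: "r *\<^sub>R x = cscale (of_real r) x" by (simp add: scaleR_car_L2_def)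

lemma cinner_left [simp]:
  "cinner (x + y) z = cinner x z + cinner y z" "cinner (x - y) z = cinner x z - cinner y z"
  "cinner (cscale c x) z = c * cinner x z" "cinner 0 z = 0" "cinner (- x) z = - cinner x z"
proof -
  show add: "cinner (x + y) z = cinner x z + cinner y z" for x y
    unfolding cinner_def by (simp add: distrib_right infsum_add cinner_summable)
  show sc: "cinner (cscale c x) z = c * cinner x z" for c x
    unfolding cinner_def by (simp add: mult.assoc infsum_cmult_right cinner_summable)
  show "cinner (- x) z = - cinner x z" for x using sc[of "-1" x] by simp
  then show "cinner (x - y) z = cinner x z - cinner y z" using add[of x "- y"] by simp
  show "cinner 0 z = 0" by (simp add: cinner_def)
qed

lemma cinner_commute: "cinner y x = cnj (cinner x y)"
  unfolding cinner_def infsum_cnj[symmetric] by (simp add: mult.commute)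

lemma cinner_right [simp]:
  "cinner z (x + y) = cinner z x + cinner z y" "cinner z (x - y) = cinner z x - cinner z y"
  "cinner z (cscale c x) = cnj c * cinner z x" "cinner z 0 = 0" "cinner z (- x) = - cinner z x"
  by (simp_all add: cinner_commute[of z])

lemma cinner_sum_left: "cinner (\<Sum>i\<in>I. f i) z = (\<Sum>i\<in>I. cinner (f i) z)"
  by (induction I rule: infinite_finite_induct) auto

lemma cinner_basis: "cinner x (basis_L2 A) = coeff_L2 x A"
proof -
  have "cinner x (basis_L2 A) = (\<Sum>\<^sub>\<infinity>B\<in>{A}. coeff_L2 x B * cnj (coeff_L2 (basis_L2 A) B))"
    unfolding cinner_def by (rule infsum_cong_neutral) (auto simp: coeff_basis)
  then show ?thesis by (auto simp: coeff_basis coeff_outside)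
qed

lemma cinner_basis_left: "cinner (basis_L2 A) x = cnj (coeff_L2 x A)"
  by (simp add: cinner_commute[of _ x] cinner_basis)

lemma inner_eq_Re: "inner x y = Re (cinner x y)" by (simp add: inner_car_L2_def)

lemma cinner_self: "cinner x x = of_real ((norm x)\<^sup>2)"
proof -
  have "cinner x x = cnj (cinner x x)" by (rule cinner_commute)
  then have "Im (cinner x x) = 0" by (metis complex_cnj_cancel_iff complex_is_Real_iff Reals_cnj_iff)
  then show ?thesis by (simp add: complex_eq_iff power2_norm_eq_inner inner_eq_Re)
qed

lemma cinner_eq_inner: "cinner x y = Complex (inner x y) (inner x (cscale \<i> y))"
  by (simp add: complex_eq_iff inner_eq_Re)

lemma norm_cscale [simp]: "norm (cscale c x) = cmod c * norm x"
proof -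
  have "cinner (cscale c x) (cscale c x) = (c * cnj c) * cinner x x" by (simp add: mult_ac)
  then have "of_real ((norm (cscale c x))\<^sup>2) = (of_real ((cmod c * norm x)\<^sup>2) :: complex)"
    by (simp only: cinner_self complex_norm_square[symmetric] of_real_mult[symmetric] power_mult_distrib)
  then have "(norm (cscale c x))\<^sup>2 = (cmod c * norm x)\<^sup>2" by (simp only: of_real_eq_iff)
  then show ?thesis by (metis abs_of_nonneg mult_nonneg_nonneg norm_ge_zero power2_abs real_sqrt_abs)
qed

lemma norm_sq_has_sum: "((\<lambda>A. (cmod (coeff_L2 x A))\<^sup>2) has_sum (norm x)\<^sup>2) UNIV"
proof -
  have "((\<lambda>A. coeff_L2 x A * cnj (coeff_L2 x A)) has_sum cinner x x) UNIV"
    unfolding cinner_def using cinner_summable by (rule has_sum_infsum)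
  then have "((\<lambda>A. Re (coeff_L2 x A * cnj (coeff_L2 x A))) has_sum Re (cinner x x)) UNIV"
    by (rule has_sum_Re)
  then show ?thesis
    by (simp only: cinner_self Re_complex_of_real complex_norm_square[symmetric])
qed

lemma norm_sq_sum_le:
  assumes "finite F"
  shows "(\<Sum>A\<in>F. (cmod (coeff_L2 x A))\<^sup>2) \<le> (norm x)\<^sup>2"
  using finite_sum_le_infsum[OF coeff_L2_summable assms, of x] norm_sq_has_sum[THEN infsumI, of x]
  by simp

lemma coeff_le_norm: "cmod (coeff_L2 x A) \<le> norm x"
  using norm_sq_sum_le[of "{A}" x] by (simp add: power2_le_iff_abs_le)

lemma norm_le_of_sum_le:
  assumes "0 \<le> c" "\<And>F. finite F \<Longrightarrow> (\<Sum>A\<in>F. (cmod (coeff_L2 x A))\<^sup>2) \<le> c\<^sup>2"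
  shows "norm x \<le> c"
proof -
  have "(norm x)\<^sup>2 \<le> c\<^sup>2"
    using has_sum_le_finite_sums[OF norm_sq_has_sum] assms(2) by blast
  then show ?thesis using assms(1) by (rule power2_le_imp_le)
qed

text \<open>
  Produces elements of \<open>L\<^sub>2(C)\<close> from coefficients with bounded partial sums of squares; completeness
  and the existence of adjoints both rest on it.
\<close>

lemma bounded_sums_vector:
  assumes out: "\<And>A. A \<notin> car_index \<Longrightarrow> f A = 0"
    and le: "\<And>F. finite F \<Longrightarrow> (\<Sum>A\<in>F. (cmod (f A))\<^sup>2) \<le> c\<^sup>2" and "0 \<le> c"
  obtains y where "coeff_L2 y = f" "norm y \<le> c"
proof -
  have "(\<lambda>A. (cmod (f A))\<^sup>2) summable_on UNIV"
    by (rule nonneg_bdd_above_summable_on) (auto intro!: bdd_aboveI[of _ "c\<^sup>2"] le)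
  then have y: "coeff_L2 (Abs_car_L2 f) = f"
    using out by (intro Abs_car_L2_inverse) auto
  then show ?thesis using that norm_le_of_sum_le[of c "Abs_car_L2 f"] le \<open>0 \<le> c\<close> by auto
qed

text \<open>
  Completeness turns the operators into a Banach space, in which the limits defining the functional
  calculus exist.
\<close>

instance car_L2 :: banach
proof
  fix X :: "nat \<Rightarrow> car_L2" assume X: "Cauchy X"
  have "Cauchy (\<lambda>n. coeff_L2 (X n) A)" for A
    unfolding Cauchy_def
  proof (intro allI impI)
    fix e :: real assume "0 < e"
    then obtain M where "\<And>m n. m \<ge> M \<Longrightarrow> n \<ge> M \<Longrightarrow> dist (X m) (X n) < e" using X unfolding Cauchy_def by blast
    moreover have "dist (coeff_L2 (X m) A) (coeff_L2 (X n) A) \<le> dist (X m) (X n)" for m n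
      using coeff_le_norm[of "X m - X n" A] by (simp add: dist_norm)
    ultimately show "\<exists>M. \<forall>m\<ge>M. \<forall>n\<ge>M. dist (coeff_L2 (X m) A) (coeff_L2 (X n) A) < e"
      by (meson order_le_less_trans)
  qed
  then have "\<exists>l. (\<lambda>n. coeff_L2 (X n) A) \<longlonglongrightarrow> l" for A using Cauchy_convergent convergent_def by blast
  then obtain f where f: "\<And>A. (\<lambda>n. coeff_L2 (X n) A) \<longlonglongrightarrow> f A" by metis
  have f0: "f A = 0" if "A \<notin> car_index" for A
    using f[of A] that by (simp add: coeff_outside LIMSEQ_const_iff)
  have fin: "(\<Sum>A\<in>F. (cmod (f A - coeff_L2 (X m) A))\<^sup>2) \<le> e\<^sup>2"
    if F: "finite F" and M: "\<And>n. n \<ge> M \<Longrightarrow> norm (X n - X m) \<le> e" for F M e m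
  proof (rule LIMSEQ_le_const2)
    show "(\<lambda>n. \<Sum>A\<in>F. (cmod (coeff_L2 (X n) A - coeff_L2 (X m) A))\<^sup>2)
        \<longlonglongrightarrow> (\<Sum>A\<in>F. (cmod (f A - coeff_L2 (X m) A))\<^sup>2)"
      by (intro tendsto_intros f)
    have "(\<Sum>A\<in>F. (cmod (coeff_L2 (X n) A - coeff_L2 (X m) A))\<^sup>2) \<le> e\<^sup>2" if "n \<ge> M" for n
      using norm_sq_sum_le[OF F, of "X n - X m"] power_mono[OF M[OF that], of 2] by simp
    then show "\<exists>N. \<forall>n\<ge>N. (\<Sum>A\<in>F. (cmod (coeff_L2 (X n) A - coeff_L2 (X m) A))\<^sup>2) \<le> e\<^sup>2" by blast
  qed
  have C: "\<exists>M. \<forall>m\<ge>M. \<forall>n\<ge>M. norm (X n - X m) \<le> e" if "0 < e" for e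
    using X that unfolding Cauchy_def dist_norm by (meson less_imp_le)
  have lim: "\<exists>y. coeff_L2 y = (\<lambda>A. f A - coeff_L2 (X m) A) \<and> norm y \<le> e"
    if "0 < e" "\<And>n. n \<ge> M \<Longrightarrow> norm (X n - X m) \<le> e" for m e M
  proof -
    have 1: "f A - coeff_L2 (X m) A = 0" if "A \<notin> car_index" for A
      using that by (simp add: f0 coeff_outside)
    have 2: "(\<Sum>A\<in>F. (cmod (f A - coeff_L2 (X m) A))\<^sup>2) \<le> e\<^sup>2" if "finite F" for F
      by (rule fin[OF that]) (rule \<open>\<And>n. n \<ge> M \<Longrightarrow> norm (X n - X m) \<le> e\<close>)
    show ?thesis using bounded_sums_vector[OF 1 2] \<open>0 < e\<close> by (metis less_imp_le)
  qed
  obtain M1 where "\<forall>m\<ge>M1. \<forall>n\<ge>M1. norm (X n - X m) \<le> 1" using C[of 1] by auto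
  then obtain y where y: "coeff_L2 y = (\<lambda>A. f A - coeff_L2 (X M1) A)" using lim[of 1 M1 M1] by auto
  define x where "x = y + X M1"
  have x: "coeff_L2 x A = f A" for A by (simp add: x_def y)
  have "X \<longlonglongrightarrow> x"
  proof (rule LIMSEQ_I)
    fix r :: real assume "0 < r"
    then obtain M where M: "\<And>m n. m\<ge>M \<Longrightarrow> n\<ge>M \<Longrightarrow> norm (X n - X m) \<le> r/2" using C[of "r/2"] by auto
    have "norm (X m - x) < r" if "m \<ge> M" for m
    proof -
      have "norm (X n - X m) \<le> r/2" if "n \<ge> M" for n using M \<open>m \<ge> M\<close> that by blast
      then obtain z where z: "coeff_L2 z = (\<lambda>A. f A - coeff_L2 (X m) A)" "norm z \<le> r/2"
        using lim[of "r/2" M m] \<open>0 < r\<close> by (metis half_gt_zero)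
      have "x - X m = z" by (rule car_L2_eqI) (simp add: x z)
      then show ?thesis using z \<open>0 < r\<close> by (simp add: norm_minus_commute)
    qed
    then show "\<exists>M. \<forall>m\<ge>M. norm (X m - x) < r" by blast
  qed
  then show "convergent X" by (auto simp: convergent_def)
qed

lift_definition restrict_L2 :: "nat set set \<Rightarrow> car_L2 \<Rightarrow> car_L2" is
  "\<lambda>S x A. if A \<in> S then x A else 0"
  by (auto intro: summable_on_comparison_test)

lemma coeff_restrict [simp]: "coeff_L2 (restrict_L2 S x) A = (if A \<in> S then coeff_L2 x A else 0)"
  by (simp add: restrict_L2.rep_eq)

lemma restrict_linear [simp]:
  "restrict_L2 S (x + y) = restrict_L2 S x + restrict_L2 S y"
  "restrict_L2 S (x - y) = restrict_L2 S x - restrict_L2 S y"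
  "restrict_L2 S (cscale c x) = cscale c (restrict_L2 S x)"
  "restrict_L2 S (r *\<^sub>R x) = r *\<^sub>R restrict_L2 S x"
  "restrict_L2 S 0 = 0"
  "restrict_L2 S (restrict_L2 S' x) = restrict_L2 (S \<inter> S') x"
  by (auto intro!: car_L2_eqI)

lemma restrict_basis: "restrict_L2 S (basis_L2 A) = (if A \<in> S then basis_L2 A else 0)"
  by (auto intro!: car_L2_eqI simp: coeff_basis)

lemma cinner_restrict: "cinner (restrict_L2 S x) y = cinner x (restrict_L2 S y)"
  unfolding cinner_def by (intro infsum_cong) auto

lemma inner_restrict: "inner (restrict_L2 S x) y = inner x (restrict_L2 S y)"
  by (simp add: inner_eq_Re cinner_restrict)

lemma norm_restrict_le: "norm (restrict_L2 S x) \<le> norm x"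
proof (rule norm_le_of_sum_le)
  fix F :: "nat set set" assume F: "finite F"
  have "(\<Sum>A\<in>F. (cmod (coeff_L2 (restrict_L2 S x) A))\<^sup>2) \<le> (\<Sum>A\<in>F. (cmod (coeff_L2 x A))\<^sup>2)"
    by (intro sum_mono) auto
  then show "(\<Sum>A\<in>F. (cmod (coeff_L2 (restrict_L2 S x) A))\<^sup>2) \<le> (norm x)\<^sup>2"
    using norm_sq_sum_le[OF F, of x] by simp
qed simp

lemma bounded_linear_restrict: "bounded_linear (restrict_L2 S)"
  by (rule bounded_linear_intro[of _ 1]) (auto simp: norm_restrict_le)

lemma restrict_pythagoras:
  "(norm x)\<^sup>2 = (norm (restrict_L2 S x))\<^sup>2 + (norm (restrict_L2 (- S) x))\<^sup>2"
proof -
  define y z where "y = restrict_L2 S x" and "z = restrict_L2 (- S) x"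
  have x: "x = y + z" by (auto intro!: car_L2_eqI simp: y_def z_def)
  have "inner y z = inner x (restrict_L2 {} x)" by (simp add: y_def z_def inner_restrict)
  also have "restrict_L2 {} x = 0" by (rule car_L2_eqI) simp
  finally have "inner y z = 0" by simp
  then show ?thesis unfolding y_def[symmetric] z_def[symmetric]
    by (subst (1) x) (simp add: power2_norm_eq_inner inner_add_left inner_add_right inner_commute)
qed

text \<open>
  For finite \<open>S\<close> these are the finite-dimensional subspaces in which spectral theory is done.
\<close>

definition fin_space :: "nat set set \<Rightarrow> car_L2 set" where
  "fin_space S = {x. \<forall>A. A \<notin> S \<longrightarrow> coeff_L2 x A = 0}"

lemma subspace_fin_space: "subspace (fin_space S)"
  by (auto simp: fin_space_def subspace_def)

lemma restrict_fin_space: "x \<in> fin_space S \<longleftrightarrow> restrict_L2 S x = x"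
proof
  assume "x \<in> fin_space S"
  then show "restrict_L2 S x = x" by (auto simp: fin_space_def intro!: car_L2_eqI)
next
  assume "restrict_L2 S x = x"
  show "x \<in> fin_space S" unfolding fin_space_def
  proof (intro CollectI allI impI)
    fix A assume "A \<notin> S"
    then have "coeff_L2 (restrict_L2 S x) A = 0" by simp
    then show "coeff_L2 x A = 0" by (simp only: \<open>restrict_L2 S x = x\<close>)
  qed
qed

lemma restrict_in_fin_space [simp]: "restrict_L2 S x \<in> fin_space S"
  by (simp add: fin_space_def)

lemma fin_space_cscale: "x \<in> fin_space S \<Longrightarrow> cscale c x \<in> fin_space S"
  by (auto simp: fin_space_def)

lemma basis_in_fin_space: "A \<in> S \<Longrightarrow> basis_L2 A \<in> fin_space S"
  by (auto simp: fin_space_def coeff_basis)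

lemma coeff_combination:
  assumes "finite S" "S \<subseteq> car_index"
  shows "coeff_L2 (\<Sum>A\<in>S. cscale (c A) (basis_L2 A)) B = (if B \<in> S then c B else 0)"
proof -
  have "coeff_L2 (\<Sum>A\<in>S. cscale (c A) (basis_L2 A)) B = (\<Sum>A\<in>S. if A = B then c A else 0)"
    unfolding coeff_sum using assms by (intro sum.cong) (auto simp: coeff_basis)
  then show ?thesis using assms by simp
qed

lemma restrict_expand:
  assumes "finite S" "S \<subseteq> car_index"
  shows "restrict_L2 S x = (\<Sum>A\<in>S. cscale (coeff_L2 x A) (basis_L2 A))"
  by (rule car_L2_eqI) (simp add: coeff_combination[OF assms] del: coeff_sum)

text \<open>
  \<open>L\<^sub>2(C)\<close> is treated as a real Hilbert space, in which a complex basis vector has to be accompanied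
  by its multiple by \<open>\<i>\<close>. All traces are therefore doubled.
\<close>

definition real_basis :: "nat set set \<Rightarrow> car_L2 set" where
  "real_basis S = basis_L2 ` S \<union> (\<lambda>A. cscale \<i> (basis_L2 A)) ` S"

lemma basis_L2_inj: "inj_on basis_L2 car_index"
  by (rule inj_onI) (metis coeff_basis zero_neq_one)

lemma basis_neq: "A \<in> car_index \<Longrightarrow> basis_L2 A \<noteq> cscale \<i> (basis_L2 B)"
proof
  assume "A \<in> car_index" "basis_L2 A = cscale \<i> (basis_L2 B)"
  then have "coeff_L2 (basis_L2 A) A = coeff_L2 (cscale \<i> (basis_L2 B)) A" by simp
  then show False using \<open>A \<in> car_index\<close> by (auto simp: coeff_basis complex_eq_iff split: if_splits)
qed

lemma sum_real_basis:
  fixes f :: "car_L2 \<Rightarrow> real"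
  assumes "finite S" "S \<subseteq> car_index"
  shows "(\<Sum>b\<in>real_basis S. f b) = (\<Sum>A\<in>S. f (basis_L2 A) + f (cscale \<i> (basis_L2 A)))"
proof -
  have i1: "inj_on basis_L2 S" using basis_L2_inj assms inj_on_subset by blast
  have i2: "inj_on (\<lambda>A. cscale \<i> (basis_L2 A)) S"
  proof (rule inj_onI)
    fix A B assume h: "A \<in> S" "B \<in> S" "cscale \<i> (basis_L2 A) = cscale \<i> (basis_L2 B)"
    from arg_cong[OF h(3), of "cscale (- \<i>)"] have "basis_L2 A = basis_L2 B" by simp
    then show "A = B" using i1 h by (auto dest: inj_onD)
  qed
  have "basis_L2 ` S \<inter> (\<lambda>A. cscale \<i> (basis_L2 A)) ` S = {}" using basis_neq assms by blast
  then have "(\<Sum>b\<in>real_basis S. f b) = (\<Sum>b\<in>basis_L2 ` S. f b) + (\<Sum>b\<in>(\<lambda>A. cscale \<i> (basis_L2 A)) ` S. f b)"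
    unfolding real_basis_def using assms by (intro sum.union_disjoint) auto
  then show ?thesis using i1 i2 by (simp add: sum.reindex sum.distrib)
qed

lemma inner_basis: "inner x (basis_L2 A) = Re (coeff_L2 x A)" "inner x (cscale \<i> (basis_L2 A)) = Im (coeff_L2 x A)"
  by (simp_all add: inner_eq_Re cinner_basis)

lemma onb_real_basis:
  assumes "finite S" "S \<subseteq> car_index"
  shows "is_onb (fin_space S) (real_basis S)"
  unfolding is_onb_def
proof (intro conjI ballI)
  show "finite (real_basis S)" using assms by (simp add: real_basis_def)
  show "real_basis S \<subseteq> fin_space S" by (auto simp: real_basis_def intro!: basis_in_fin_space fin_space_cscale)
  show "inner u w = (if u = w then 1 else 0)" if "u \<in> real_basis S" "w \<in> real_basis S" for u w
    using that assms basis_neq basis_neq[symmetric]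
    by (auto simp: real_basis_def inner_basis coeff_basis)
  show "v = (\<Sum>u\<in>real_basis S. inner v u *\<^sub>R u)" if "v \<in> fin_space S" for v
  proof -
    have i1: "inj_on basis_L2 S" using basis_L2_inj assms inj_on_subset by blast
    have "v = (\<Sum>A\<in>S. cscale (coeff_L2 v A) (basis_L2 A))"
      using that restrict_expand[OF assms, of v] by (simp add: restrict_fin_space)
    also have "\<dots> = (\<Sum>A\<in>S. inner v (basis_L2 A) *\<^sub>R basis_L2 A + inner v (cscale \<i> (basis_L2 A)) *\<^sub>R cscale \<i> (basis_L2 A))"
    proof (rule sum.cong)
      fix A
      have "coeff_L2 v A = of_real (Re (coeff_L2 v A)) + of_real (Im (coeff_L2 v A)) * \<i>"
        by (simp add: complex_eq_iff)
      then show "cscale (coeff_L2 v A) (basis_L2 A) =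
        inner v (basis_L2 A) *\<^sub>R basis_L2 A + inner v (cscale \<i> (basis_L2 A)) *\<^sub>R cscale \<i> (basis_L2 A)"
        by (simp add: inner_basis scaleR_eq_cscale cscale_add_left[symmetric])
    qed simp
    also have "\<dots> = (\<Sum>u\<in>real_basis S. inner v u *\<^sub>R u)"
    proof (rule car_L2_eqI)
      fix C
      have "Re (coeff_L2 (\<Sum>u\<in>real_basis S. inner v u *\<^sub>R u) C) = (\<Sum>u\<in>real_basis S. Re (coeff_L2 (inner v u *\<^sub>R u) C))"
        by simp
      moreover have "Im (coeff_L2 (\<Sum>u\<in>real_basis S. inner v u *\<^sub>R u) C) = (\<Sum>u\<in>real_basis S. Im (coeff_L2 (inner v u *\<^sub>R u) C))"
        by simp
      ultimately show "coeff_L2 (\<Sum>A\<in>S. inner v (basis_L2 A) *\<^sub>R basis_L2 A + inner v (cscale \<i> (basis_L2 A)) *\<^sub>R cscale \<i> (basis_L2 A)) C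
        = coeff_L2 (\<Sum>u\<in>real_basis S. inner v u *\<^sub>R u) C"
        unfolding complex_eq_iff sum_real_basis[OF assms] by simp
    qed
    finally show ?thesis .
  qed
qed (rule subspace_fin_space)

text \<open>
  Indexes the basis of \<open>L\<^sub>2(C\<^sub>n)\<close>. It agrees with \<open>{A. max A \<le> n}\<close> only for \<open>n \<ge> 1\<close>, because
  \<open>max \<emptyset> = 1\<close>.
\<close>

definition idx :: "nat \<Rightarrow> nat set set" where "idx n = Pow {1..n}"

lemma mem_idx: "A \<in> idx n \<longleftrightarrow> A \<subseteq> {1..n}" by (simp add: idx_def)
lemma finite_idx [simp]: "finite (idx n)" by (simp add: idx_def)
lemma empty_idx [simp]: "{} \<in> idx n" by (simp add: idx_def)
lemma idx_mono: "m \<le> n \<Longrightarrow> idx m \<subseteq> idx n" by (auto simp: idx_def)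

lemma idx_car_index: "idx n \<subseteq> car_index"
  by (auto simp: idx_def car_index_def intro: finite_subset)

lemma finite_subset_idx:
  assumes "finite F" "F \<subseteq> car_index"
  obtains N where "F \<subseteq> idx N"
proof -
  have "finite (\<Union>F)" using assms by (auto simp: car_index_def)
  then obtain N where N: "\<And>x. x \<in> \<Union>F \<Longrightarrow> x \<le> N" by (meson finite_nat_set_iff_bounded_le)
  have "F \<subseteq> idx N"
  proof
    fix A assume A: "A \<in> F"
    have "x \<in> {1..N}" if "x \<in> A" for x
      using N[of x] A that assms(2) by (cases "x = 0") (auto simp: car_index_def)
    then show "A \<in> idx N" by (auto simp: mem_idx)
  qed
  then show ?thesis using that by blast
qed

lemma restrict_idx_tendsto: "(\<lambda>n. restrict_L2 (idx n) x) \<longlonglongrightarrow> x"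
proof (rule LIMSEQ_I)
  fix r :: real assume r: "0 < r"
  obtain F where F: "finite F" "dist (\<Sum>A\<in>F. (cmod (coeff_L2 x A))\<^sup>2) ((norm x)\<^sup>2) \<le> r\<^sup>2 / 2"
    using has_sum_finite_approximation[OF norm_sq_has_sum[of x], of "r\<^sup>2 / 2"] r by auto
  have "finite (F \<inter> car_index)" "F \<inter> car_index \<subseteq> car_index" using F by auto
  then obtain N where N: "F \<inter> car_index \<subseteq> idx N" using finite_subset_idx by metis
  have "norm (restrict_L2 (idx n) x - x) < r" if n: "n \<ge> N" for n
  proof -
    have sub: "idx N \<subseteq> idx n" using n by (rule idx_mono)
    have "(norm x)\<^sup>2 - r\<^sup>2 / 2 \<le> (\<Sum>A\<in>F. (cmod (coeff_L2 x A))\<^sup>2)"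
      using F(2) unfolding dist_real_def by linarith
    also have "\<dots> = (\<Sum>A\<in>F \<inter> car_index. (cmod (coeff_L2 x A))\<^sup>2)"
      using F(1) coeff_outside by (intro sum.mono_neutral_right) auto
    also have "\<dots> \<le> (\<Sum>A\<in>idx n. (cmod (coeff_L2 x A))\<^sup>2)"
      using N sub by (intro sum_mono2) auto
    also have "\<dots> = (\<Sum>A\<in>idx n. (cmod (coeff_L2 (restrict_L2 (idx n) x) A))\<^sup>2)"
      by (intro sum.cong) auto
    also have "\<dots> \<le> (norm (restrict_L2 (idx n) x))\<^sup>2" by (intro norm_sq_sum_le) simp
    finally have "(norm x)\<^sup>2 - (norm (restrict_L2 (idx n) x))\<^sup>2 < r\<^sup>2"
      using zero_less_power[OF r, of 2] by linarith
    then have "(norm (restrict_L2 (- idx n) x))\<^sup>2 < r\<^sup>2"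
      using restrict_pythagoras[of x "idx n"] by simp
    then have "norm (restrict_L2 (- idx n) x) < r" using r by (simp add: power2_less_imp_less)
    moreover have "restrict_L2 (idx n) x - x = - restrict_L2 (- idx n) x" by (auto intro!: car_L2_eqI)
    ultimately show ?thesis by simp
  qed
  then show "\<exists>N. \<forall>n\<ge>N. norm (restrict_L2 (idx n) x - x) < r" by blast
qed

section \<open>Complex linear operators and adjoints\<close>

lemma clinear_cscale: "T \<in> clinear_ops \<Longrightarrow> blinfun_apply T (cscale c x) = cscale c (blinfun_apply T x)"
  by (simp add: clinear_ops_def)

lemma clinear_restrict_expand:
  assumes T: "T \<in> clinear_ops" and S: "finite S" "S \<subseteq> car_index"
  shows "blinfun_apply T (restrict_L2 S x) = (\<Sum>A\<in>S. cscale (coeff_L2 x A) (blinfun_apply T (basis_L2 A)))"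
  by (simp add: restrict_expand[OF S] blinfun.sum_right clinear_cscale[OF T])

lemma clinear_ops_eqI:
  assumes "T \<in> clinear_ops" "S \<in> clinear_ops"
    and eq: "\<And>A. A \<in> car_index \<Longrightarrow> blinfun_apply T (basis_L2 A) = blinfun_apply S (basis_L2 A)"
  shows "T = S"
proof (rule blinfun_eqI)
  fix x
  have "blinfun_apply T (restrict_L2 (idx n) x) = blinfun_apply S (restrict_L2 (idx n) x)" for n
    unfolding clinear_restrict_expand[OF assms(1) finite_idx idx_car_index]
      clinear_restrict_expand[OF assms(2) finite_idx idx_car_index]
    using eq idx_car_index by (intro sum.cong refl arg_cong2[where f = cscale]) auto
  moreover have "(\<lambda>n. blinfun_apply T (restrict_L2 (idx n) x)) \<longlonglongrightarrow> blinfun_apply T x"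
    "(\<lambda>n. blinfun_apply S (restrict_L2 (idx n) x)) \<longlonglongrightarrow> blinfun_apply S x"
    by (intro blinfun.tendsto tendsto_const restrict_idx_tendsto)+
  ultimately show "blinfun_apply T x = blinfun_apply S x" using LIMSEQ_unique by simp
qed

lemma clinear_ops_compose: "S \<in> clinear_ops \<Longrightarrow> T \<in> clinear_ops \<Longrightarrow> S o\<^sub>L T \<in> clinear_ops"
  by (simp add: clinear_ops_def)
lemma clinear_ops_add: "S \<in> clinear_ops \<Longrightarrow> T \<in> clinear_ops \<Longrightarrow> S + T \<in> clinear_ops"
  by (simp add: clinear_ops_def blinfun.add_left)
lemma clinear_ops_diff: "S \<in> clinear_ops \<Longrightarrow> T \<in> clinear_ops \<Longrightarrow> S - T \<in> clinear_ops"
  by (simp add: clinear_ops_def blinfun.diff_left)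
lemma clinear_ops_zero: "0 \<in> clinear_ops"
  by (simp add: clinear_ops_def)
lemma clinear_ops_id: "id_blinfun \<in> clinear_ops"
  by (simp add: clinear_ops_def)
lemma cscale_op_apply [simp]: "blinfun_apply (cscale_op c T) x = cscale c (blinfun_apply T x)"
  by (simp add: cscale_op_def bounded_linear_Blinfun_apply[OF bounded_linear_cscale])
lemma clinear_ops_cscale: "T \<in> clinear_ops \<Longrightarrow> cscale_op c T \<in> clinear_ops"
  by (simp add: clinear_ops_def mult.commute)
lemma clinear_ops_sum: "(\<And>i. i \<in> I \<Longrightarrow> f i \<in> clinear_ops) \<Longrightarrow> (\<Sum>i\<in>I. f i) \<in> clinear_ops"
  by (induction I rule: infinite_finite_induct) (auto intro: clinear_ops_add clinear_ops_zero)

lemma inner_clinear_i: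
  assumes "T \<in> clinear_ops"
  shows "inner (blinfun_apply T (cscale \<i> x)) (cscale \<i> x) = inner (blinfun_apply T x) x"
  by (simp add: clinear_cscale[OF assms] inner_eq_Re mult.assoc[symmetric])

text \<open>
  The coefficients of \<open>S y\<close> must be \<open>\<langle>y, T e\<^sub>A\<rangle>\<close>. Applying \<open>T\<close> to a finite part \<open>w\<close> of this family gives
  \<open>\<parallel>w\<parallel>\<^sup>2 = \<langle>T w, y\<rangle> \<le> \<parallel>T\<parallel> \<parallel>w\<parallel> \<parallel>y\<parallel>\<close>, so the family is square summable.
\<close>

lemma adjoint_exists:
  assumes T: "T \<in> clinear_ops"
  obtains S where "S \<in> clinear_ops" "\<And>x y. cinner (blinfun_apply T x) y = cinner x (blinfun_apply S y)"
proof -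
  define f where "f y A = (if A \<in> car_index then cinner y (blinfun_apply T (basis_L2 A)) else 0)" for y A
  have "\<exists>z. coeff_L2 z = f y \<and> norm z \<le> norm T * norm y" for y
  proof (rule bounded_sums_vector[of "f y" "norm T * norm y"])
    show "f y A = 0" if "A \<notin> car_index" for A using that by (simp add: f_def)
    fix F :: "nat set set" assume F: "finite F"
    define G where "G = F \<inter> car_index"
    define s where "s = (\<Sum>A\<in>G. (cmod (f y A))\<^sup>2)"
    define w where "w = (\<Sum>A\<in>G. cscale (f y A) (basis_L2 A))"
    have G: "finite G" "G \<subseteq> car_index" using F by (auto simp: G_def)
    have nw: "(norm w)\<^sup>2 = s"
    proof -
      have "cinner w w = (\<Sum>A\<in>G. f y A * cnj (coeff_L2 w A))"
        by (subst (1) w_def) (simp add: cinner_sum_left cinner_basis_left)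
      also have "\<dots> = (\<Sum>A\<in>G. f y A * cnj (f y A))"
      proof (rule sum.cong)
        fix A assume A: "A \<in> G"
        show "f y A * cnj (coeff_L2 w A) = f y A * cnj (f y A)"
          unfolding w_def coeff_combination[OF G] using A by simp
      qed simp
      also have "\<dots> = of_real s" by (simp only: s_def of_real_sum complex_norm_square)
      finally have "complex_of_real ((norm w)\<^sup>2) = of_real s" by (simp only: cinner_self)
      then show ?thesis by (simp only: of_real_eq_iff)
    qed
    have "cinner (blinfun_apply T w) y = (\<Sum>A\<in>G. f y A * cnj (f y A))"
      unfolding w_def using G
      by (auto simp: blinfun.sum_right clinear_cscale[OF T] cinner_sum_left f_def cinner_commute[of y] intro!: sum.cong)
    also have "\<dots> = of_real s" by (simp only: s_def of_real_sum complex_norm_square)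
    finally have "inner (blinfun_apply T w) y = s" by (simp add: inner_eq_Re)
    then have "s \<le> norm (blinfun_apply T w) * norm y" using norm_cauchy_schwarz by metis
    also have "\<dots> \<le> norm T * norm w * norm y" by (intro mult_right_mono norm_blinfun) auto
    finally have "(norm w)\<^sup>2 \<le> norm w * (norm T * norm y)" by (simp add: nw mult_ac)
    then have "norm w \<le> norm T * norm y"
      by (cases "norm w = 0") (auto simp: power2_eq_square)
    then have "(norm w)\<^sup>2 \<le> (norm T * norm y)\<^sup>2" by (intro power_mono) auto
    moreover have "(\<Sum>A\<in>F. (cmod (f y A))\<^sup>2) = s"
      unfolding s_def using F by (intro sum.mono_neutral_right) (auto simp: G_def f_def)
    ultimately show "(\<Sum>A\<in>F. (cmod (f y A))\<^sup>2) \<le> (norm T * norm y)\<^sup>2" by (simp add: nw)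
  qed auto
  then obtain g where g: "\<And>y. coeff_L2 (g y) = f y" "\<And>y. norm (g y) \<le> norm T * norm y" by metis
  have add: "g (x + y) = g x + g y" for x y
    by (rule car_L2_eqI) (simp add: g f_def)
  have sc: "g (cscale c x) = cscale c (g x)" for c x
    by (rule car_L2_eqI) (simp add: g f_def)
  have bl: "bounded_linear g"
    by (rule bounded_linear_intro[of _ "norm T"]) (use g(2) in \<open>auto simp: add sc scaleR_eq_cscale mult.commute\<close>)
  have app: "blinfun_apply (Blinfun g) = g" by (rule bounded_linear_Blinfun_apply[OF bl])
  have basis: "cinner (blinfun_apply T (basis_L2 A)) y = cinner (basis_L2 A) (g y)" if "A \<in> car_index" for A y
    using that by (simp add: cinner_basis_left g f_def cinner_commute[of y])
  have "cinner (blinfun_apply T x) y = cinner x (g y)" for x y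
  proof -
    have tc: "(\<lambda>n. cinner (h n) z) \<longlonglongrightarrow> cinner l z" if "h \<longlonglongrightarrow> l" for h :: "nat \<Rightarrow> car_L2" and l z
      unfolding cinner_eq_inner Complex_eq by (intro tendsto_intros that)
    have "cinner (blinfun_apply T (restrict_L2 (idx n) x)) y = cinner (restrict_L2 (idx n) x) (g y)" for n
      using basis idx_car_index[of n]
      by (auto simp: restrict_expand blinfun.sum_right clinear_cscale[OF T] cinner_sum_left intro!: sum.cong)
    moreover have "(\<lambda>n. cinner (blinfun_apply T (restrict_L2 (idx n) x)) y) \<longlonglongrightarrow> cinner (blinfun_apply T x) y"
      by (intro tc blinfun.tendsto tendsto_const restrict_idx_tendsto)
    moreover have "(\<lambda>n. cinner (restrict_L2 (idx n) x) (g y)) \<longlonglongrightarrow> cinner x (g y)"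
      by (intro tc restrict_idx_tendsto)
    ultimately show ?thesis using LIMSEQ_unique by simp
  qed
  then show ?thesis using that[of "Blinfun g"] by (simp add: app sc clinear_ops_def)
qed

lemma cinner_ext: "(\<And>x. cinner x y = cinner x z) \<Longrightarrow> y = z"
  by (rule car_L2_eqI) (metis cinner_basis_left complex_cnj_cancel_iff)

lemma adj_props:
  assumes T: "T \<in> clinear_ops"
  shows "adj T \<in> clinear_ops"
    and "cinner (blinfun_apply T x) y = cinner x (blinfun_apply (adj T) y)"
    and "inner (blinfun_apply T x) y = inner x (blinfun_apply (adj T) y)"
proof -
  obtain S where S: "S \<in> clinear_ops" "\<And>x y. cinner (blinfun_apply T x) y = cinner x (blinfun_apply S y)"
    using adjoint_exists[OF T] by metis
  have "adj T = S" unfolding adj_def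
  proof (rule the_equality)
    fix S' assume "\<forall>x y. cinner (blinfun_apply T x) y = cinner x (blinfun_apply S' y)"
    then show "S' = S" using S by (intro blinfun_eqI cinner_ext) metis
  qed (use S in blast)
  then show "adj T \<in> clinear_ops" "cinner (blinfun_apply T x) y = cinner x (blinfun_apply (adj T) y)"
    "inner (blinfun_apply T x) y = inner x (blinfun_apply (adj T) y)"
    using S by (auto simp: inner_eq_Re)
qed

lemma adj_unique:
  assumes "T \<in> clinear_ops" "\<And>x y. cinner (blinfun_apply T x) y = cinner x (blinfun_apply S y)"
  shows "adj T = S"
  using assms adj_props by (intro blinfun_eqI cinner_ext) metis

lemma adj_zero: "adj 0 = 0"
  by (rule adj_unique) (auto simp: clinear_ops_zero)

text \<open>
  Positivity expressed through the real inner product, so that the real spectral theorem applies;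
  symmetry, automatic over the complex numbers, has to be required.
\<close>

definition psd :: "car_op \<Rightarrow> bool" where
  "psd T \<longleftrightarrow> T \<in> clinear_ops \<and>
     (\<forall>x y. inner (blinfun_apply T x) y = inner x (blinfun_apply T y)) \<and> (\<forall>x. 0 \<le> inner (blinfun_apply T x) x)"

lemma psdD:
  assumes "psd T"
  shows "T \<in> clinear_ops" "inner (blinfun_apply T x) y = inner x (blinfun_apply T y)" "0 \<le> inner (blinfun_apply T x) x"
  using assms by (auto simp: psd_def)

lemma psd_adj_compose:
  assumes "T \<in> clinear_ops"
  shows "psd (adj T o\<^sub>L T)"
    and "inner (blinfun_apply (adj T o\<^sub>L T) x) x = (norm (blinfun_apply T x))\<^sup>2"
proof -
  have *: "inner (blinfun_apply (adj T o\<^sub>L T) x) y = inner (blinfun_apply T x) (blinfun_apply T y)" for x y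
    using adj_props(3)[OF assms, of y "blinfun_apply T x"] by (simp add: inner_commute)
  show "inner (blinfun_apply (adj T o\<^sub>L T) x) x = (norm (blinfun_apply T x))\<^sup>2" for x
    by (simp only: * power2_norm_eq_inner)
  then show "psd (adj T o\<^sub>L T)" unfolding psd_def
    using * adj_props(1)[OF assms] assms
    by (auto intro!: clinear_ops_compose simp del: blinfun_apply_blinfun_compose) (metis inner_commute)
qed

section \<open>Functional calculus of positive operators\<close>

lemma op_power_apply: "blinfun_apply (op_power T n) x = (blinfun_apply T ^^ n) x"
proof (induction n)
  case 0
  then show ?case by (simp add: op_power_def)
next
  case (Suc n)
  have "op_power T (Suc n) = T o\<^sub>L op_power T n" by (simp add: op_power_def)
  then show ?case using Suc by simp
qed

lemma poly_op_apply:
  "blinfun_apply (poly_op q T) x = (\<Sum>i\<le>degree q. coeff q i *\<^sub>R (blinfun_apply T ^^ i) x)"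
  by (simp add: poly_op_def blinfun.sum_left blinfun.scaleR_left op_power_apply)

lemma poly_op_diff: "poly_op (p - q) T = poly_op p T - poly_op q T"
proof -
  have *: "poly_op q T = (\<Sum>i\<le>n. coeff q i *\<^sub>R op_power T i)" if "degree q \<le> n" for q n
    unfolding poly_op_def using that by (intro sum.mono_neutral_left) (auto simp: coeff_eq_0)
  define n where "n = max (degree (p - q)) (max (degree p) (degree q))"
  have "poly_op (p - q) T = (\<Sum>i\<le>n. coeff (p - q) i *\<^sub>R op_power T i)"
    "poly_op p T = (\<Sum>i\<le>n. coeff p i *\<^sub>R op_power T i)"
    "poly_op q T = (\<Sum>i\<le>n. coeff q i *\<^sub>R op_power T i)"
    by (rule *; simp add: n_def)+
  then show ?thesis by (simp add: scaleR_left_diff_distrib sum_subtractf)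
qed

lemma funpow_eigenvector:
  assumes "blinfun_apply T u = c *\<^sub>R u"
  shows "(blinfun_apply T ^^ i) u = (c ^ i) *\<^sub>R u"
  by (induction i) (simp_all add: assms blinfun.scaleR_right)

lemma poly_op_eigenvector:
  assumes "blinfun_apply T u = c *\<^sub>R u"
  shows "blinfun_apply (poly_op q T) u = poly q c *\<^sub>R u"
  by (simp add: poly_op_apply funpow_eigenvector[OF assms] poly_altdef scaleR_sum_left)

lemma funpow_tendsto:
  fixes T :: "nat \<Rightarrow> car_op"
  assumes T: "\<And>x. (\<lambda>n. blinfun_apply (T n) x) \<longlonglongrightarrow> blinfun_apply S x"
    and M: "\<And>n. norm (T n) \<le> M" and x: "x \<longlonglongrightarrow> y"
  shows "(\<lambda>n. (blinfun_apply (T n) ^^ i) (x n)) \<longlonglongrightarrow> (blinfun_apply S ^^ i) y"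
proof (induction i)
  case 0
  then show ?case using x by simp
next
  case (Suc i)
  define a b where "a = (\<lambda>n. (blinfun_apply (T n) ^^ i) (x n))" and "b = (blinfun_apply S ^^ i) y"
  have ab: "(\<lambda>n. M * norm (a n - b)) \<longlonglongrightarrow> M * norm (b - b)"
    using Suc unfolding a_def b_def by (intro tendsto_intros)
  have "(\<lambda>n. blinfun_apply (T n) (a n - b)) \<longlonglongrightarrow> 0"
  proof (rule Lim_null_comparison)
    show "\<forall>\<^sub>F n in sequentially. norm (blinfun_apply (T n) (a n - b)) \<le> M * norm (a n - b)"
      by (intro always_eventually allI order_trans[OF norm_blinfun] mult_right_mono M) simp
  qed (use ab in simp)
  from tendsto_add[OF this T[of b]] show ?case
    by (simp add: blinfun.diff_right a_def b_def)
qed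

lemma poly_op_tendsto:
  fixes T :: "nat \<Rightarrow> car_op"
  assumes "\<And>x. (\<lambda>n. blinfun_apply (T n) x) \<longlonglongrightarrow> blinfun_apply S x" "\<And>n. norm (T n) \<le> M" "x \<longlonglongrightarrow> y"
  shows "(\<lambda>n. blinfun_apply (poly_op q (T n)) (x n)) \<longlonglongrightarrow> blinfun_apply (poly_op q S) y"
  unfolding poly_op_apply by (intro tendsto_intros funpow_tendsto[OF assms])

lemma eigenvalue_bounds:
  assumes "psd T" "norm u = 1" "blinfun_apply T u = c *\<^sub>R u"
  shows "c \<in> {0..norm T}"
proof -
  have "0 \<le> inner (blinfun_apply T u) u" using psdD(3)[OF assms(1)] .
  then have "0 \<le> c" using assms by (simp add: norm_eq_sqrt_inner)
  moreover have "norm (blinfun_apply T u) \<le> norm T" using norm_blinfun[of T u] assms(2) by simp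
  ultimately show ?thesis using assms by simp
qed

definition spectral_basis :: "car_op \<Rightarrow> car_L2 set \<Rightarrow> car_L2 set \<Rightarrow> bool" where
  "spectral_basis T V U \<longleftrightarrow> is_onb V U \<and> (\<forall>u\<in>U. blinfun_apply T u = inner (blinfun_apply T u) u *\<^sub>R u)"

abbreviation eigval :: "car_op \<Rightarrow> car_L2 \<Rightarrow> real" where
  "eigval T u \<equiv> inner (blinfun_apply T u) u"

lemma spectral_basisD:
  assumes "spectral_basis T V U"
  shows "is_onb V U" "\<And>u. u \<in> U \<Longrightarrow> blinfun_apply T u = eigval T u *\<^sub>R u"
  using assms by (auto simp: spectral_basis_def)

lemma spectral_basis_exists:
  assumes S: "finite S" "S \<subseteq> car_index" and T: "psd T"
    and inv: "\<And>x. x \<in> fin_space S \<Longrightarrow> blinfun_apply T x \<in> fin_space S"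
  obtains U where "spectral_basis T (fin_space S) U"
proof -
  obtain U where "is_onb (fin_space S) U" "\<And>u. u \<in> U \<Longrightarrow> blinfun_apply T u = eigval T u *\<^sub>R u"
    by (rule finite_dim_spectral_theorem[OF blinfun.bounded_linear_right onb_real_basis[OF S], of T])
       (use inv psdD(2)[OF T] in auto)
  then show ?thesis using that by (auto simp: spectral_basis_def)
qed

lemma spectral_apply:
  assumes U: "spectral_basis T V U" and v: "v \<in> V"
    and S: "\<And>u. u \<in> U \<Longrightarrow> blinfun_apply S u = g u *\<^sub>R u"
  shows "blinfun_apply S v = (\<Sum>u\<in>U. (g u * inner v u) *\<^sub>R u)"
    and "inner (blinfun_apply S v) v = diag_form U g v"
    and "(norm (blinfun_apply S v))\<^sup>2 = (\<Sum>u\<in>U. (g u * inner v u)\<^sup>2)"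
proof -
  note onb = spectral_basisD(1)[OF U]
  note onb' = is_onbD[OF onb]
  have "blinfun_apply S v = blinfun_apply S (\<Sum>u\<in>U. inner v u *\<^sub>R u)" using onb'(5)[OF v] by simp
  also have "\<dots> = (\<Sum>u\<in>U. (g u * inner v u) *\<^sub>R u)"
    by (simp add: blinfun.sum_right blinfun.scaleR_right S mult.commute)
  finally show *: "blinfun_apply S v = (\<Sum>u\<in>U. (g u * inner v u) *\<^sub>R u)" .
  show "inner (blinfun_apply S v) v = diag_form U g v"
    unfolding * diag_form_def inner_sum_left
    by (intro sum.cong) (auto simp: power2_eq_square inner_commute[of v])
  have V: "blinfun_apply S v \<in> V" unfolding * using onb' by (intro subspace_sum subspace_scale) auto
  show "(norm (blinfun_apply S v))\<^sup>2 = (\<Sum>u\<in>U. (g u * inner v u)\<^sup>2)"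
    unfolding parseval[OF onb V, symmetric] unfolding *
    using onb' by (intro sum.cong) (auto simp: inner_orthonormal_sum)
qed

text \<open>
  The inequality \<open>\<parallel>q(T)\<parallel> \<le> sup |q|\<close> on which the functional calculus rests. The compressions of \<open>T\<close> to
  \<open>L\<^sub>2(C\<^sub>n)\<close> act on finite-dimensional spaces, where it follows from the spectral theorem, and they
  converge strongly to \<open>T\<close>.
\<close>

lemma poly_op_bound:
  assumes T: "psd T" and le: "\<And>t. t \<in> {0..norm T} \<Longrightarrow> \<bar>poly q t\<bar> \<le> c"
  shows "norm (poly_op q T) \<le> c"
proof -
  have c: "0 \<le> c" using le[of 0] by force
  define P where "P n = Blinfun (restrict_L2 (idx n))" for n
  have P: "blinfun_apply (P n) = restrict_L2 (idx n)" for n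
    unfolding P_def by (rule bounded_linear_Blinfun_apply[OF bounded_linear_restrict])
  define R where "R n = P n o\<^sub>L T o\<^sub>L P n" for n
  have R: "blinfun_apply (R n) x = restrict_L2 (idx n) (blinfun_apply T (restrict_L2 (idx n) x))" for n x
    by (simp add: R_def P)
  have psdR: "psd (R n)" for n
    unfolding psd_def using psdD[OF T]
    by (auto simp: R inner_restrict clinear_ops_def)
       (metis inner_restrict)
  have nR: "norm (R n) \<le> norm T" for n
  proof (rule norm_blinfun_bound)
    fix x
    have "norm (blinfun_apply (R n) x) \<le> norm T * norm (restrict_L2 (idx n) x)"
      unfolding R by (rule order_trans[OF norm_restrict_le norm_blinfun])
    also have "\<dots> \<le> norm T * norm x" by (intro mult_left_mono norm_restrict_le) simp
    finally show "norm (blinfun_apply (R n) x) \<le> norm T * norm x" .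
  qed simp
  have "norm (blinfun_apply (poly_op q T) x) \<le> c * norm x" for x
  proof (rule LIMSEQ_le_const2)
    have "(\<lambda>n. blinfun_apply (R n) x) \<longlonglongrightarrow> blinfun_apply T x" for x
    proof -
      have "(\<lambda>n. restrict_L2 (idx n) (blinfun_apply T (restrict_L2 (idx n) x) - blinfun_apply T x)) \<longlonglongrightarrow> 0"
      proof (rule Lim_null_comparison)
        show "\<forall>\<^sub>F n in sequentially. norm (restrict_L2 (idx n) (blinfun_apply T (restrict_L2 (idx n) x) - blinfun_apply T x))
           \<le> norm (blinfun_apply T (restrict_L2 (idx n) x) - blinfun_apply T x)"
          by (intro always_eventually allI norm_restrict_le)
        have "(\<lambda>n. norm (blinfun_apply T (restrict_L2 (idx n) x) - blinfun_apply T x))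
           \<longlonglongrightarrow> norm (blinfun_apply T x - blinfun_apply T x)"
          by (intro tendsto_intros blinfun.tendsto restrict_idx_tendsto)
        then show "(\<lambda>n. norm (blinfun_apply T (restrict_L2 (idx n) x) - blinfun_apply T x)) \<longlonglongrightarrow> 0" by simp
      qed
      from tendsto_add[OF this restrict_idx_tendsto[of "blinfun_apply T x"]] show ?thesis by (simp add: R)
    qed
    then show "(\<lambda>n. norm (blinfun_apply (poly_op q (R n)) (restrict_L2 (idx n) x))) \<longlonglongrightarrow> norm (blinfun_apply (poly_op q T) x)"
      by (intro tendsto_norm poly_op_tendsto[OF _ nR] restrict_idx_tendsto)
    have "norm (blinfun_apply (poly_op q (R n)) (restrict_L2 (idx n) x)) \<le> c * norm x" for n
    proof -
      define v where "v = restrict_L2 (idx n) x"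
      have v: "v \<in> fin_space (idx n)" by (simp add: v_def)
      obtain U where U: "spectral_basis (R n) (fin_space (idx n)) U"
        by (rule spectral_basis_exists[OF _ idx_car_index psdR]) (auto simp: R)
      note onb = spectral_basisD(1)[OF U]
      have "(norm (blinfun_apply (poly_op q (R n)) v))\<^sup>2 = (\<Sum>u\<in>U. (poly q (eigval (R n) u) * inner v u)\<^sup>2)"
        by (rule spectral_apply(3)[OF U v]) (rule poly_op_eigenvector[OF spectral_basisD(2)[OF U]])
      also have "\<dots> \<le> (\<Sum>u\<in>U. c\<^sup>2 * (inner v u)\<^sup>2)"
      proof (rule sum_mono)
        fix u assume u: "u \<in> U"
        have "eigval (R n) u \<in> {0..norm (R n)}"
          using eigenvalue_bounds[OF psdR is_onbD(6)[OF onb u] spectral_basisD(2)[OF U u]] .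
        then have "eigval (R n) u \<in> {0..norm T}" using nR[of n] by auto
        then have "(poly q (eigval (R n) u))\<^sup>2 \<le> c\<^sup>2" using le c by (simp add: abs_le_square_iff[symmetric])
        then show "(poly q (eigval (R n) u) * inner v u)\<^sup>2 \<le> c\<^sup>2 * (inner v u)\<^sup>2"
          by (simp add: power_mult_distrib mult_right_mono)
      qed
      also have "\<dots> = (c * norm v)\<^sup>2"
        using parseval[OF onb v] by (simp add: sum_distrib_left[symmetric] power_mult_distrib)
      finally have "norm (blinfun_apply (poly_op q (R n)) v) \<le> c * norm v"
        by (rule power2_le_imp_le) (use c in simp)
      also have "\<dots> \<le> c * norm x" unfolding v_def using c by (intro mult_left_mono norm_restrict_le)
      finally show ?thesis by (simp add: v_def)
    qed
    then show "\<exists>N. \<forall>n\<ge>N. norm (blinfun_apply (poly_op q (R n)) (restrict_L2 (idx n) x)) \<le> c * norm x" by blast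
  qed
  then show ?thesis using c by (rule norm_blinfun_bound[rotated])
qed

lemma weierstrass_poly:
  fixes f :: "real \<Rightarrow> real"
  assumes "continuous_on {0..c} f" "0 < e"
  obtains q :: "real poly" where "\<And>t. t \<in> {0..c} \<Longrightarrow> \<bar>poly q t - f t\<bar> < e"
proof -
  obtain g where g: "real_polynomial_function g" "\<And>t. t \<in> {0..c} \<Longrightarrow> \<bar>f t - g t\<bar> < e"
    using Stone_Weierstrass_real_polynomial_function[OF compact_Icc assms] by blast
  obtain a n where a: "g = (\<lambda>x. \<Sum>i\<le>n. a i * x ^ i)"
    using g(1) by (auto simp: real_polynomial_function_iff_sum)
  define q where "q = (\<Sum>i\<le>n. monom (a i) i)"
  have "poly q t = g t" for t by (simp add: q_def a poly_sum poly_monom)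
  then show ?thesis using that[of q] g(2) by (simp add: abs_minus_commute)
qed

lemma weierstrass_poly_seq:
  fixes f :: "real \<Rightarrow> real"
  assumes "continuous_on {0..c} f"
  obtains q :: "nat \<Rightarrow> real poly" where "uniform_limit {0..c} (\<lambda>n. poly (q n)) f sequentially"
proof -
  have "\<exists>q::real poly. \<forall>t\<in>{0..c}. \<bar>poly q t - f t\<bar> < inverse (real (Suc n))" for n
    using weierstrass_poly[OF assms, of "inverse (real (Suc n))"] by (metis inverse_positive_iff_positive of_nat_0_less_iff zero_less_Suc)
  then obtain q :: "nat \<Rightarrow> real poly" where q: "\<And>n t. t\<in>{0..c} \<Longrightarrow> \<bar>poly (q n) t - f t\<bar> < inverse (real (Suc n))" by metis
  have "uniform_limit {0..c} (\<lambda>n. poly (q n)) f sequentially"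
  proof (rule uniform_limitI)
    fix e :: real assume "0 < e"
    then obtain N where N: "inverse (real (Suc N)) < e" using reals_Archimedean by blast
    show "\<forall>\<^sub>F n in sequentially. \<forall>t\<in>{0..c}. dist (poly (q n) t) (f t) < e"
    proof (rule eventually_sequentiallyI[of N], intro ballI)
      fix n t assume "N \<le> n" "t \<in> {0..c}"
      then have "\<bar>poly (q n) t - f t\<bar> < inverse (real (Suc n))" using q by blast
      also have "\<dots> \<le> inverse (real (Suc N))" using \<open>N \<le> n\<close> by (intro le_imp_inverse_le) auto
      finally show "dist (poly (q n) t) (f t) < e" using N by (simp add: dist_real_def)
    qed
  qed
  then show ?thesis using that by blast
qed

text \<open>
  The unique description in the definition of \<open>fun_calc\<close> is justified: polynomials close to
  each other on \<open>[0, \<parallel>T\<parallel>]\<close> give operators close in norm, and by the Weierstrass theorem approximating sequences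
  exist.
\<close>

lemma fun_calc_tendsto:
  assumes T: "psd T" and f: "continuous_on {0..norm T} f"
    and q: "uniform_limit {0..norm T} (\<lambda>n. poly (q n)) f sequentially"
  shows "(\<lambda>n. poly_op (q n) T) \<longlonglongrightarrow> fun_calc f T"
proof -
  obtain q0 :: "nat \<Rightarrow> real poly" where q0: "uniform_limit {0..norm T} (\<lambda>n. poly (q0 n)) f sequentially"
    using weierstrass_poly_seq[OF f] by blast
  have close: "\<exists>N. \<forall>m\<ge>N. \<forall>n\<ge>N. norm (poly_op (a m) T - poly_op (b n) T) \<le> e"
    if a: "uniform_limit {0..norm T} (\<lambda>n. poly (a n)) f sequentially"
      and b: "uniform_limit {0..norm T} (\<lambda>n. poly (b n)) f sequentially" and e: "0 < e" for a b e
  proof -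
    obtain N1 where N1: "\<forall>n\<ge>N1. \<forall>t\<in>{0..norm T}. dist (poly (a n) t) (f t) < e/2"
      using uniform_limitD[OF a half_gt_zero[OF e]] unfolding eventually_sequentially by blast
    obtain N2 where N2: "\<forall>n\<ge>N2. \<forall>t\<in>{0..norm T}. dist (poly (b n) t) (f t) < e/2"
      using uniform_limitD[OF b half_gt_zero[OF e]] unfolding eventually_sequentially by blast
    have "norm (poly_op (a m) T - poly_op (b n) T) \<le> e" if "m \<ge> max N1 N2" "n \<ge> max N1 N2" for m n
      unfolding poly_op_diff[symmetric]
    proof (rule poly_op_bound[OF T])
      fix t assume "t \<in> {0..norm T}"
      then have "dist (poly (a m) t) (f t) < e/2" "dist (poly (b n) t) (f t) < e/2"
        using N1 N2 that by auto
      then show "\<bar>poly (a m - b n) t\<bar> \<le> e" unfolding dist_real_def poly_diff by linarith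
    qed
    then show ?thesis by blast
  qed
  have "Cauchy (\<lambda>n. poly_op (q0 n) T)"
    unfolding Cauchy_def dist_norm
  proof (intro allI impI)
    fix e :: real assume "0 < e"
    then obtain N where N: "\<forall>m\<ge>N. \<forall>n\<ge>N. norm (poly_op (q0 m) T - poly_op (q0 n) T) \<le> e/2"
      using close[OF q0 q0, of "e/2"] by auto
    have "norm (poly_op (q0 m) T - poly_op (q0 n) T) < e" if "m \<ge> N" "n \<ge> N" for m n
    proof -
      have "norm (poly_op (q0 m) T - poly_op (q0 n) T) \<le> e/2" using N that by blast
      then show ?thesis using \<open>0 < e\<close> by simp
    qed
    then show "\<exists>M. \<forall>m\<ge>M. \<forall>n\<ge>M. norm (poly_op (q0 m) T - poly_op (q0 n) T) < e" by blast
  qed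
  then obtain S where S: "(\<lambda>n. poly_op (q0 n) T) \<longlonglongrightarrow> S" using Cauchy_convergent convergent_def by blast
  have all: "(\<lambda>n. poly_op (a n) T) \<longlonglongrightarrow> S"
    if a: "uniform_limit {0..norm T} (\<lambda>n. poly (a n)) f sequentially" for a
  proof -
    have "(\<lambda>n. poly_op (a n) T - poly_op (q0 n) T) \<longlonglongrightarrow> 0"
    proof (rule LIMSEQ_I)
      fix r :: real assume "0 < r"
      then obtain N where N: "\<forall>m\<ge>N. \<forall>n\<ge>N. norm (poly_op (a m) T - poly_op (q0 n) T) \<le> r/2"
        using close[OF a q0, of "r/2"] by auto
      have "norm (poly_op (a n) T - poly_op (q0 n) T - 0) < r" if "n \<ge> N" for n
      proof -
        have "norm (poly_op (a n) T - poly_op (q0 n) T) \<le> r/2" using N that by blast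
        then show ?thesis using \<open>0 < r\<close> by simp
      qed
      then show "\<exists>N. \<forall>n\<ge>N. norm (poly_op (a n) T - poly_op (q0 n) T - 0) < r" by blast
    qed
    from tendsto_add[OF this S] show ?thesis by simp
  qed
  have "fun_calc f T = S" unfolding fun_calc_def
  proof (rule the_equality)
    fix S' assume "\<forall>q. uniform_limit {0..norm T} (\<lambda>n. poly (q n)) f sequentially \<longrightarrow> (\<lambda>n. poly_op (q n) T) \<longlonglongrightarrow> S'"
    then show "S' = S" using q0 S LIMSEQ_unique by blast
  qed (use all in blast)
  then show ?thesis using all[OF q] by simp
qed

lemma fun_calc_approx:
  assumes T: "psd T" and f: "continuous_on {0..norm T} f"
    and e: "\<And>t. t \<in> {0..norm T} \<Longrightarrow> \<bar>poly p t - f t\<bar> \<le> e"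
  shows "norm (poly_op p T - fun_calc f T) \<le> e"
proof -
  obtain q :: "nat \<Rightarrow> real poly" where q: "uniform_limit {0..norm T} (\<lambda>n. poly (q n)) f sequentially"
    using weierstrass_poly_seq[OF f] by blast
  have lim: "(\<lambda>n. norm (poly_op p T - poly_op (q n) T)) \<longlonglongrightarrow> norm (poly_op p T - fun_calc f T)"
    by (intro tendsto_intros fun_calc_tendsto[OF T f q])
  show ?thesis
  proof (rule field_le_epsilon)
    fix d :: real assume d: "0 < d"
    have "\<forall>\<^sub>F n in sequentially. norm (poly_op p T - poly_op (q n) T) \<le> e + d"
      using uniform_limitD[OF q d]
    proof eventually_elim
      case (elim n)
      show ?case unfolding poly_op_diff[symmetric]
      proof (rule poly_op_bound[OF T])
        fix t assume t: "t \<in> {0..norm T}"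
        then have "dist (poly (q n) t) (f t) < d" using elim by blast
        then show "\<bar>poly (p - q n) t\<bar> \<le> e + d" using e[OF t] unfolding dist_real_def poly_diff by linarith
      qed
    qed
    then show "norm (poly_op p T - fun_calc f T) \<le> e + d"
      by (rule tendsto_upperbound[OF lim]) simp
  qed
qed

lemma fun_calc_apply_tendsto:
  assumes T: "psd T" and f: "continuous_on {0..norm T} f"
    and q: "uniform_limit {0..norm T} (\<lambda>n. poly (q n)) f sequentially"
  shows "(\<lambda>n. blinfun_apply (poly_op (q n) T) x) \<longlonglongrightarrow> blinfun_apply (fun_calc f T) x"
  by (intro blinfun.tendsto fun_calc_tendsto[OF T f q] tendsto_const)

lemma fun_calc_eigenvector:
  assumes T: "psd T" and f: "continuous_on {0..norm T} f"
    and u: "norm u = 1" "blinfun_apply T u = c *\<^sub>R u"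
  shows "blinfun_apply (fun_calc f T) u = f c *\<^sub>R u"
proof -
  obtain q :: "nat \<Rightarrow> real poly" where q: "uniform_limit {0..norm T} (\<lambda>n. poly (q n)) f sequentially"
    using weierstrass_poly_seq[OF f] by blast
  have "(\<lambda>n. blinfun_apply (poly_op (q n) T) u) \<longlonglongrightarrow> blinfun_apply (fun_calc f T) u"
    by (rule fun_calc_apply_tendsto[OF T f q])
  moreover have "(\<lambda>n. blinfun_apply (poly_op (q n) T) u) \<longlonglongrightarrow> f c *\<^sub>R u"
    unfolding poly_op_eigenvector[OF u(2)]
    by (intro tendsto_intros tendsto_uniform_limitI[OF q] eigenvalue_bounds[OF T u])
  ultimately show ?thesis using LIMSEQ_unique by blast
qed

text \<open>
  An operator commuting with \<open>T\<close> commutes with \<open>f(T)\<close>; this is applied to right multiplications and to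
  multiplication by complex scalars.
\<close>

lemma fun_calc_intertwine:
  assumes T: "psd T" and f: "continuous_on {0..norm T} f"
    and L: "bounded_linear L" "\<And>x. L (blinfun_apply T x) = blinfun_apply T (L x)"
  shows "L (blinfun_apply (fun_calc f T) x) = blinfun_apply (fun_calc f T) (L x)"
proof -
  interpret L: bounded_linear L by (rule L)
  obtain q :: "nat \<Rightarrow> real poly" where q: "uniform_limit {0..norm T} (\<lambda>n. poly (q n)) f sequentially"
    using weierstrass_poly_seq[OF f] by blast
  have "L ((blinfun_apply T ^^ i) x) = (blinfun_apply T ^^ i) (L x)" for i x
    by (induction i) (simp_all add: L(2))
  then have *: "L (blinfun_apply (poly_op q T) x) = blinfun_apply (poly_op q T) (L x)" for q x
    by (simp add: poly_op_apply L.sum L.scaleR)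
  have "(\<lambda>n. L (blinfun_apply (poly_op (q n) T) x)) \<longlonglongrightarrow> L (blinfun_apply (fun_calc f T) x)"
    by (intro L.tendsto fun_calc_apply_tendsto[OF T f q])
  moreover have "(\<lambda>n. L (blinfun_apply (poly_op (q n) T) x)) \<longlonglongrightarrow> blinfun_apply (fun_calc f T) (L x)"
    unfolding * by (rule fun_calc_apply_tendsto[OF T f q])
  ultimately show ?thesis using LIMSEQ_unique by blast
qed

lemma fun_calc_clinear:
  assumes T: "psd T" and f: "continuous_on {0..norm T} f"
  shows "fun_calc f T \<in> clinear_ops"
  using fun_calc_intertwine[OF T f bounded_linear_cscale] psdD(1)[OF T]
  by (simp add: clinear_ops_def)

text \<open>
  Allows to compute diagonal entries of \<open>|\<pi>\<^sub>b|\<^sup>p\<close> as limits of those of the truncations, which are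
  finite rank operators.
\<close>

lemma fun_calc_strong_tendsto:
  fixes T :: "nat \<Rightarrow> car_op"
  assumes S: "psd S" and T: "\<And>n. psd (T n)" and M: "\<And>n. norm (T n) \<le> norm S"
    and f: "continuous_on {0..norm S} f"
    and lim: "\<And>x. (\<lambda>n. blinfun_apply (T n) x) \<longlonglongrightarrow> blinfun_apply S x"
  shows "(\<lambda>n. blinfun_apply (fun_calc f (T n)) x) \<longlonglongrightarrow> blinfun_apply (fun_calc f S) x"
proof (rule LIMSEQ_I)
  fix r :: real assume r: "0 < r"
  define e where "e = r / (3 * (norm x + 1))"
  have e: "0 < e" using r by (simp add: e_def add_nonneg_pos)
  have ex: "e * norm x < r / 3"
  proof -
    have "e * norm x < e * (norm x + 1)" using e by simp
    also have "\<dots> = r / 3" using norm_ge_zero[of x] unfolding e_def by (simp add: add_nonneg_eq_0_iff field_simps)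
    finally show ?thesis .
  qed
  obtain p :: "real poly" where p: "\<And>t. t \<in> {0..norm S} \<Longrightarrow> \<bar>poly p t - f t\<bar> < e"
    using weierstrass_poly[OF f e] by blast
  have close: "norm (blinfun_apply (poly_op p R) x - blinfun_apply (fun_calc f R) x) < r / 3"
    if R: "psd R" "norm R \<le> norm S" for R
  proof -
    have sub: "{0..norm R} \<subseteq> {0..norm S}" using R by auto
    have "norm (poly_op p R - fun_calc f R) \<le> e"
      using p sub by (intro fun_calc_approx[OF R(1) continuous_on_subset[OF f sub]]) (auto intro: less_imp_le)
    then have "norm (poly_op p R - fun_calc f R) * norm x \<le> e * norm x" by (intro mult_right_mono) auto
    then show ?thesis using norm_blinfun[of "poly_op p R - fun_calc f R" x] ex by (simp add: blinfun.diff_left)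
  qed
  have "(\<lambda>n. blinfun_apply (poly_op p (T n)) x) \<longlonglongrightarrow> blinfun_apply (poly_op p S) x"
    by (rule poly_op_tendsto[OF lim M tendsto_const])
  then obtain N where N: "\<And>n. n \<ge> N \<Longrightarrow> norm (blinfun_apply (poly_op p (T n)) x - blinfun_apply (poly_op p S) x) < r / 3"
    using LIMSEQ_D[of _ _ "r/3"] r by (metis divide_pos_pos zero_less_numeral)
  have "norm (blinfun_apply (fun_calc f (T n)) x - blinfun_apply (fun_calc f S) x) < r" if "n \<ge> N" for n
  proof -
    have tri: "norm (a - d) < r" if "norm (b - a) < r/3" "norm (b - c) < r/3" "norm (c - d) < r/3" for a b c d :: car_L2
    proof -
      have "a - d = (b - c) + (c - d) - (b - a)" by simp
      then have "norm (a - d) \<le> norm ((b - c) + (c - d)) + norm (b - a)" by (metis norm_triangle_ineq4)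
      also have "\<dots> \<le> norm (b - c) + norm (c - d) + norm (b - a)" by (intro add_right_mono norm_triangle_ineq)
      finally show ?thesis using that by simp
    qed
    show ?thesis by (rule tri[OF close[OF T M] N[OF that] close[OF S order_refl]])
  qed
  then show "\<exists>N. \<forall>n\<ge>N. norm (blinfun_apply (fun_calc f (T n)) x - blinfun_apply (fun_calc f S) x) < r" by blast
qed

lemma continuous_on_powr_nonneg:
  assumes "0 < p"
  shows "continuous_on {0..c} (\<lambda>t::real. t powr p)"
  using assms by (intro continuous_on_powr' continuous_intros) auto

lemma fun_calc_form:
  assumes T: "psd T" and f: "continuous_on {0..norm T} f" and U: "spectral_basis T V U" and v: "v \<in> V"
  shows "inner (blinfun_apply (fun_calc f T) v) v = diag_form U (\<lambda>u. f (eigval T u)) v"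
  by (rule spectral_apply(2)[OF U v], rule fun_calc_eigenvector[OF T f])
     (use is_onbD(6)[OF spectral_basisD(1)[OF U]] spectral_basisD(2)[OF U] in auto)

lemma operator_form:
  assumes U: "spectral_basis T V U" and v: "v \<in> V"
  shows "inner (blinfun_apply T v) v = diag_form U (eigval T) v"
  by (rule spectral_apply(2)[OF U v spectral_basisD(2)[OF U]])

section \<open>The anticommutation relations\<close>

definition spin_flip :: "nat \<Rightarrow> (nat \<Rightarrow> 2) \<Rightarrow> nat \<Rightarrow> 2" where
  "spin_flip n s = s(n := if s n = 1 then 2 else 1)"

text \<open>
  Every row of the matrix of \<open>c\<^sub>j\<close> has a single nonzero entry. With \<open>n = (j + 1) div 2\<close>, the product
  comes from the factors \<open>\<sigma>\<^sub>0\<close> in front of position \<open>n\<close> and the last factor is the entry of \<open>\<sigma>\<^sub>1\<close> or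
  \<open>\<sigma>\<^sub>2\<close>.
\<close>

definition spin_phase :: "nat \<Rightarrow> (nat \<Rightarrow> 2) \<Rightarrow> complex" where
  "spin_phase j s = (let n = (j + 1) div 2 in (\<Prod>i\<in>{1..<n}. if s i = 1 then 1 else - 1) *
     (if odd j then 1 else if s n = 1 then - \<i> else \<i>))"

lemma two_cases: "(x::2) = 1 \<or> x = 2" by (rule exhaust_2)

lemma spin_flip_flip [simp]: "spin_flip n (spin_flip n s) = s"
  using two_cases[of "s n"] by (auto simp: spin_flip_def fun_eq_iff)

lemma spin_flip_commute: "spin_flip m (spin_flip n s) = spin_flip n (spin_flip m s)"
  by (cases "m = n") (auto simp: spin_flip_def fun_eq_iff)

lemma car_gen_apply:
  assumes j: "1 \<le> j"
  shows "car_gen j \<psi> s = spin_phase j s * \<psi> (spin_flip ((j + 1) div 2) s)"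
proof -
  define n where "n = (j + 1) div 2"
  have n: "1 \<le> n" using j by (simp add: n_def)
  define a where "a = (\<lambda>i. if i < n then pauli0 else if odd j then pauli1 else pauli2)"
  define X where "X = {t. \<forall>i. i \<notin> {1..n} \<longrightarrow> t i = s i}"
  have "X \<subseteq> (\<lambda>g i. if i \<in> {1..n} then g i else s i) ` (PiE {1..n} (\<lambda>_. UNIV))"
  proof
    fix t assume "t \<in> X"
    then have "t = (\<lambda>i. if i \<in> {1..n} then (restrict t {1..n}) i else s i)" by (auto simp: X_def)
    moreover have "restrict t {1..n} \<in> PiE {1..n} (\<lambda>_. UNIV)" by simp
    ultimately show "t \<in> (\<lambda>g i. if i \<in> {1..n} then g i else s i) ` (PiE {1..n} (\<lambda>_. UNIV))" by blast
  qed
  moreover have "finite (PiE {1..n} (\<lambda>_. UNIV :: 2 set))" by (intro finite_PiE) auto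
  ultimately have fin: "finite X" by (meson finite_imageI finite_subset)
  define t0 where "t0 = spin_flip n s"
  have t0: "t0 \<in> X" using n by (auto simp: t0_def X_def spin_flip_def)
  have zero: "(\<Prod>i\<in>{1..n}. a i $ s i $ t i) = 0" if t: "t \<in> X - {t0}" for t
  proof -
    have "\<exists>i\<in>{1..n}. a i $ s i $ t i = 0"
    proof (cases "t n = t0 n")
      case True
      obtain i where i: "t i \<noteq> t0 i" using t by blast
      then have "i \<noteq> n" "t i \<noteq> s i" using True by (auto simp: t0_def spin_flip_def split: if_splits)
      moreover from this have "i \<in> {1..n}" using t by (auto simp: X_def)
      ultimately show ?thesis using two_cases[of "t i"] two_cases[of "s i"]
        by (intro bexI[of _ i]) (auto simp: a_def pauli0_def)
    next
      case False
      then have "t n = s n" using two_cases[of "t n"] two_cases[of "s n"] by (auto simp: t0_def spin_flip_def)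
      then show ?thesis using n two_cases[of "s n"]
        by (intro bexI[of _ n]) (auto simp: a_def pauli1_def pauli2_def)
    qed
    then show ?thesis by (auto intro: prod_zero)
  qed
  have "car_gen j \<psi> s = (\<Sum>t\<in>X. (\<Prod>i\<in>{1..n}. a i $ s i $ t i) * \<psi> t)"
    by (simp add: car_gen_def elem_tensor_def X_def a_def n_def Let_def)
  also have "\<dots> = (\<Sum>t\<in>{t0}. (\<Prod>i\<in>{1..n}. a i $ s i $ t i) * \<psi> t)"
    using fin t0 zero by (intro sum.mono_neutral_right) auto
  also have "\<dots> = (\<Prod>i\<in>{1..n}. a i $ s i $ t0 i) * \<psi> t0" by simp
  also have "(\<Prod>i\<in>{1..n}. a i $ s i $ t0 i) = spin_phase j s"
  proof -
    have "{1..n} = insert n {1..<n}" using n by auto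
    then have "(\<Prod>i\<in>{1..n}. a i $ s i $ t0 i) = a n $ s n $ t0 n * (\<Prod>i\<in>{1..<n}. a i $ s i $ t0 i)" by simp
    also have "(\<Prod>i\<in>{1..<n}. a i $ s i $ t0 i) = (\<Prod>i\<in>{1..<n}. if s i = 1 then 1 else - 1)"
    proof (rule prod.cong)
      fix i assume "i \<in> {1..<n}"
      then show "a i $ s i $ t0 i = (if s i = 1 then 1 else - 1)"
        using two_cases[of "s i"] by (auto simp: a_def t0_def spin_flip_def pauli0_def)
    qed simp
    also have "a n $ s n $ t0 n = (if odd j then 1 else if s n = 1 then - \<i> else \<i>)"
      using two_cases[of "s n"]
      by (cases "s n = 1") (simp_all add: a_def t0_def spin_flip_def pauli1_def pauli2_def)
    finally show ?thesis by (simp add: spin_phase_def n_def Let_def)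
  qed
  finally show ?thesis by (simp add: t0_def n_def)
qed

lemma car_gen_scale: "1 \<le> j \<Longrightarrow> car_gen j (\<lambda>s. c * \<psi> s) = (\<lambda>s. c * car_gen j \<psi> s)"
  by (simp add: fun_eq_iff car_gen_apply)

lemma car_gen_sum: "1 \<le> j \<Longrightarrow> car_gen j (\<lambda>s. \<Sum>i\<in>I. f i s) = (\<lambda>s. \<Sum>i\<in>I. car_gen j (f i) s)"
  by (simp add: fun_eq_iff car_gen_apply sum_distrib_left)

lemma car_gen_square:
  assumes j: "1 \<le> j"
  shows "car_gen j (car_gen j \<psi>) = \<psi>"
proof
  fix s
  define n where "n = (j + 1) div 2"
  have "spin_phase j s * spin_phase j (spin_flip n s) = 1"
  proof -
    have "(\<Prod>i\<in>{1..<n}. if spin_flip n s i = 1 then 1 else - 1) = (\<Prod>i\<in>{1..<n}. if s i = 1 then 1 else - 1 :: complex)"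
      by (intro prod.cong) (auto simp: spin_flip_def)
    moreover have "(\<Prod>i\<in>{1..<n}. if s i = 1 then 1 else - 1 :: complex) * (\<Prod>i\<in>{1..<n}. if s i = 1 then 1 else - 1) = 1"
      unfolding prod.distrib[symmetric] by (intro prod.neutral) auto
    ultimately show ?thesis using two_cases[of "s n"]
      unfolding spin_phase_def n_def[symmetric] Let_def
      by (auto simp: spin_flip_def mult_ac)
  qed
  then show "car_gen j (car_gen j \<psi>) s = \<psi> s"
    by (simp add: car_gen_apply[OF j] n_def mult.assoc[symmetric] del: mult.assoc)
qed

lemma spin_phase_flip_before:
  assumes "(j + 1) div 2 < m"
  shows "spin_phase j (spin_flip m s) = spin_phase j s"
proof -
  define n where "n = (j + 1) div 2"
  have "(\<Prod>i\<in>{1..<n}. if spin_flip m s i = 1 then 1 else - 1) = (\<Prod>i\<in>{1..<n}. if s i = 1 then 1 else - 1 :: complex)"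
    using assms by (intro prod.cong) (auto simp: spin_flip_def n_def)
  then show ?thesis using assms
    unfolding spin_phase_def n_def[symmetric] Let_def by (simp add: spin_flip_def)
qed

lemma spin_phase_flip_after:
  assumes "1 \<le> m" "m < (j + 1) div 2"
  shows "spin_phase j (spin_flip m s) = - spin_phase j s"
proof -
  define n where "n = (j + 1) div 2"
  have n: "m \<in> {1..<n}" "m \<noteq> n" using assms by (auto simp: n_def)
  have "(\<Prod>i\<in>{1..<n} - {m}. if spin_flip m s i = 1 then 1 else - 1) = (\<Prod>i\<in>{1..<n} - {m}. if s i = 1 then 1 else - 1 :: complex)"
    by (intro prod.cong) (auto simp: spin_flip_def)
  moreover have "(if spin_flip m s m = 1 then 1 else - 1 :: complex) = - (if s m = 1 then 1 else - 1)"
    using two_cases[of "s m"] by (auto simp: spin_flip_def)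
  ultimately have "(\<Prod>i\<in>{1..<n}. if spin_flip m s i = 1 then 1 else - 1) = - (\<Prod>i\<in>{1..<n}. if s i = 1 then 1 else - 1 :: complex)"
    using n(1) by (simp only: prod.remove[OF finite_atLeastLessThan n(1)] mult_minus_left)
  then show ?thesis using n(2)
    unfolding spin_phase_def n_def[symmetric] Let_def by (simp add: spin_flip_def)
qed

text \<open>
  If the generators sit at different positions, flipping the earlier spin changes one sign in the
  phase of the later generator; at the same position this is the relation \<open>\<sigma>\<^sub>1 \<sigma>\<^sub>2 = - \<sigma>\<^sub>2 \<sigma>\<^sub>1\<close>.
\<close>

lemma car_gen_anticommute:
  assumes j: "1 \<le> j" and k: "1 \<le> k" and "j \<noteq> k"
  shows "car_gen j (car_gen k \<psi>) = (\<lambda>s. - car_gen k (car_gen j \<psi>) s)"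
proof
  fix s
  define m n where "m = (j + 1) div 2" and "n = (k + 1) div 2"
  have mn: "1 \<le> m" "1 \<le> n" using j k by (auto simp: m_def n_def)
  have "spin_phase j s * spin_phase k (spin_flip m s) = - (spin_phase k s * spin_phase j (spin_flip n s))"
  proof (cases "m = n")
    case True
    have "(\<Prod>i\<in>{1..<n}. if spin_flip n s i = 1 then 1 else - 1) = (\<Prod>i\<in>{1..<n}. if s i = 1 then 1 else - 1 :: complex)"
      by (intro prod.cong) (auto simp: spin_flip_def)
    moreover have "odd j \<noteq> odd k" using True \<open>j \<noteq> k\<close> unfolding m_def n_def by presburger
    ultimately show ?thesis using two_cases[of "s n"] True
      unfolding spin_phase_def n_def[symmetric] m_def[symmetric] Let_def
      by (auto simp: spin_flip_def)
  next
    case False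
    then consider "m < n" | "n < m" by linarith
    then show ?thesis
      using mn by cases (simp_all add: spin_phase_flip_before spin_phase_flip_after m_def n_def)
  qed
  then show "car_gen j (car_gen k \<psi>) s = - car_gen k (car_gen j \<psi>) s"
    unfolding car_gen_apply[OF j] car_gen_apply[OF k] m_def[symmetric] n_def[symmetric]
    by (simp add: spin_flip_commute[of n m] mult.assoc[symmetric] del: mult.assoc)
qed

definition sdiff :: "nat set \<Rightarrow> nat set \<Rightarrow> nat set" where
  "sdiff A B = (A - B) \<union> (B - A)"

lemma sdiff_simps [simp]:
  "sdiff A {} = A" "sdiff {} A = A" "sdiff A A = {}" "sdiff A (sdiff A B) = B" "sdiff (sdiff B A) A = B"
  by (auto simp: sdiff_def)
lemma sdiff_commute: "sdiff A B = sdiff B A" by (auto simp: sdiff_def)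
lemma sdiff_assoc: "sdiff (sdiff A B) C = sdiff A (sdiff B C)" by (auto simp: sdiff_def)
lemma sdiff_empty_iff: "sdiff A B = {} \<longleftrightarrow> A = B" by (auto simp: sdiff_def)
lemma sdiff_car_index: "A \<in> car_index \<Longrightarrow> B \<in> car_index \<Longrightarrow> sdiff A B \<in> car_index"
  by (auto simp: sdiff_def car_index_def)
lemma empty_car_index [simp]: "{} \<in> car_index" by (simp add: car_index_def)
lemma car_indexD: "A \<in> car_index \<Longrightarrow> finite A" "A \<in> car_index \<Longrightarrow> 0 \<notin> A"
  by (auto simp: car_index_def)

lemma car_prod_empty: "car_prod {} \<psi> = \<psi>" by (simp add: car_prod_def)

lemma car_prod_insert_min:
  assumes "finite A" "\<forall>a\<in>A. k < a"
  shows "car_prod (insert k A) \<psi> = car_gen k (car_prod A \<psi>)"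
proof -
  have "k \<notin> A" using assms by auto
  then have "sorted_list_of_set (insert k A) = insort k (sorted_list_of_set A)"
    using assms(1) by (simp add: sorted_list_of_set_insert)
  also have "\<dots> = k # sorted_list_of_set A"
    using assms by (intro insort_is_Cons) (auto intro: less_imp_le)
  finally show ?thesis by (simp add: car_prod_def)
qed

lemma car_prod_singleton: "car_prod {k} = car_gen k"
  using car_prod_insert_min[of "{}" k] by (auto simp: fun_eq_iff car_prod_empty)

lemma car_prod_scale:
  assumes "A \<in> car_index"
  shows "car_prod A (\<lambda>s. c * \<psi> s) = (\<lambda>s. c * car_prod A \<psi> s)"
  using car_indexD[OF assms]
proof (induction A rule: finite_linorder_min_induct)
  case (insert b A)
  then show ?case by (simp add: car_prod_insert_min car_gen_scale)
qed (simp add: car_prod_empty)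

lemma car_prod_sum:
  assumes "A \<in> car_index"
  shows "car_prod A (\<lambda>s. \<Sum>i\<in>I. f i s) = (\<lambda>s. \<Sum>i\<in>I. car_prod A (f i) s)"
  using car_indexD[OF assms]
proof (induction A rule: finite_linorder_min_induct)
  case (insert b A)
  then show ?case by (simp add: car_prod_insert_min car_gen_sum)
qed (simp add: car_prod_empty)

lemma car_gen_car_prod:
  assumes "A \<in> car_index" and j: "1 \<le> j"
  shows "\<exists>e::complex. (e = 1 \<or> e = -1) \<and> (\<forall>\<psi>. car_gen j (car_prod A \<psi>) = (\<lambda>s. e * car_prod (sdiff {j} A) \<psi> s))"
  using car_indexD[OF assms(1)]
proof (induction A rule: finite_linorder_min_induct)
  case empty
  then show ?case by (auto simp: car_prod_singleton car_prod_empty)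
next
  case (insert b A)
  have b: "1 \<le> b" using insert.prems by auto
  obtain e :: complex where e: "e = 1 \<or> e = -1" "\<And>\<psi>. car_gen j (car_prod A \<psi>) = (\<lambda>s. e * car_prod (sdiff {j} A) \<psi> s)"
    using insert.IH insert.prems by auto
  consider "j < b" | "j = b" | "b < j" by linarith
  then show ?case
  proof cases
    case 1
    then have "sdiff {j} (insert b A) = insert j (insert b A)" using insert.hyps by (auto simp: sdiff_def)
    moreover have "car_prod (insert j (insert b A)) \<psi> = car_gen j (car_prod (insert b A) \<psi>)" for \<psi>
      using 1 insert.hyps by (intro car_prod_insert_min) auto
    ultimately show ?thesis by (intro exI[of _ 1]) simp
  next
    case 2
    then have "sdiff {j} (insert b A) = A" using insert.hyps by (auto simp: sdiff_def)
    then show ?thesis using 2 insert.hyps b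
      by (intro exI[of _ 1]) (simp add: car_prod_insert_min car_gen_square)
  next
    case 3
    then have eq: "sdiff {j} (insert b A) = insert b (sdiff {j} A)" using insert.hyps by (auto simp: sdiff_def)
    have "car_gen j (car_prod (insert b A) \<psi>) = (\<lambda>s. - e * car_prod (sdiff {j} (insert b A)) \<psi> s)" for \<psi>
    proof -
      have "car_gen j (car_prod (insert b A) \<psi>) = (\<lambda>s. - car_gen b (car_gen j (car_prod A \<psi>)) s)"
        using insert.hyps 3 b j by (simp add: car_prod_insert_min car_gen_anticommute[of j b])
      also have "\<dots> = (\<lambda>s. - e * car_gen b (car_prod (sdiff {j} A) \<psi>) s)"
        using b by (simp add: e(2) car_gen_scale)
      also have "car_gen b (car_prod (sdiff {j} A) \<psi>) = car_prod (sdiff {j} (insert b A)) \<psi>"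
        unfolding eq using insert.hyps 3 by (intro car_prod_insert_min[symmetric]) (auto simp: sdiff_def)
      finally show ?thesis .
    qed
    then show ?thesis using e(1) by (intro exI[of _ "- e"]) auto
  qed
qed

lemma car_prod_car_prod:
  assumes "A \<in> car_index" and B: "B \<in> car_index"
  shows "\<exists>e::complex. (e = 1 \<or> e = -1) \<and> (\<forall>\<psi> s. car_prod A (car_prod B \<psi>) s = e * car_prod (sdiff A B) \<psi> s)"
  using car_indexD[OF assms(1)]
proof (induction A rule: finite_linorder_min_induct)
  case empty
  then show ?case by (intro exI[of _ 1]) (simp add: car_prod_empty)
next
  case (insert b A)
  have b: "1 \<le> b" using insert.prems by auto
  have A: "A \<in> car_index" using insert by (simp add: car_index_def)
  obtain e :: complex where e: "e = 1 \<or> e = -1" "\<And>\<psi> s. car_prod A (car_prod B \<psi>) s = e * car_prod (sdiff A B) \<psi> s"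
    using insert.IH insert.prems by auto
  obtain d :: complex where d: "d = 1 \<or> d = -1" "\<And>\<psi>. car_gen b (car_prod (sdiff A B) \<psi>) = (\<lambda>s. d * car_prod (sdiff {b} (sdiff A B)) \<psi> s)"
    using car_gen_car_prod[OF sdiff_car_index[OF A B] b] by blast
  have eq: "sdiff {b} (sdiff A B) = sdiff (insert b A) B" using insert.hyps by (auto simp: sdiff_def)
  have "car_prod (insert b A) (car_prod B \<psi>) s = e * d * car_prod (sdiff (insert b A) B) \<psi> s" for \<psi> s
  proof -
    have "car_prod (insert b A) (car_prod B \<psi>) s = car_gen b (\<lambda>s. e * car_prod (sdiff A B) \<psi> s) s"
      using insert.hyps by (simp add: car_prod_insert_min e(2)[abs_def])
    then show ?thesis using b by (simp add: car_gen_scale d(2) eq)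
  qed
  then show ?case using e(1) d(1) by (intro exI[of _ "e * d"]) auto
qed

text \<open>
  The cocycle of the twisted group algebra of finite sets under symmetric difference:
  \<open>c\<^sub>A c\<^sub>B = car_sign A B c\<^bsub>A \<triangle> B\<^esub>\<close>. From here on only this rule is used.
\<close>

definition car_sign :: "nat set \<Rightarrow> nat set \<Rightarrow> complex" where
  "car_sign A B = (SOME e. (e = 1 \<or> e = -1) \<and> (\<forall>\<psi> s. car_prod A (car_prod B \<psi>) s = e * car_prod (sdiff A B) \<psi> s))"

lemma car_sign:
  assumes "A \<in> car_index" "B \<in> car_index"
  shows "car_sign A B = 1 \<or> car_sign A B = -1"
    and "car_prod A (car_prod B \<psi>) s = car_sign A B * car_prod (sdiff A B) \<psi> s"
  using someI_ex[OF car_prod_car_prod[OF assms], folded car_sign_def] by auto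

lemma car_prod_nonzero:
  assumes "A \<in> car_index"
  obtains \<psi> s where "car_prod A \<psi> s \<noteq> 0"
proof -
  have "car_prod A (car_prod A (\<lambda>_. 1)) s = car_sign A A" for s
    using car_sign(2)[OF assms assms] by (simp add: car_prod_empty)
  moreover have "car_sign A A \<noteq> 0" using car_sign(1)[OF assms assms] by auto
  ultimately show ?thesis using that[of "car_prod A (\<lambda>_. 1)" undefined] by simp
qed

lemma car_sign_assoc:
  assumes A: "A \<in> car_index" and B: "B \<in> car_index" and C: "C \<in> car_index"
  shows "car_sign A B * car_sign (sdiff A B) C = car_sign B C * car_sign A (sdiff B C)"
proof -
  obtain \<psi> s where nz: "car_prod (sdiff A (sdiff B C)) \<psi> s \<noteq> 0"
    using car_prod_nonzero[OF sdiff_car_index[OF A sdiff_car_index[OF B C]]] .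
  have "car_prod A (car_prod B (car_prod C \<psi>)) s = car_sign A B * car_sign (sdiff A B) C * car_prod (sdiff A (sdiff B C)) \<psi> s"
    using car_sign(2) assms sdiff_car_index by (simp add: sdiff_assoc)
  moreover have "car_prod A (car_prod B (car_prod C \<psi>)) s = car_prod A (\<lambda>s. car_sign B C * car_prod (sdiff B C) \<psi> s) s"
    using car_sign(2)[OF B C, abs_def] by presburger
  then have "car_prod A (car_prod B (car_prod C \<psi>)) s = car_sign B C * car_sign A (sdiff B C) * car_prod (sdiff A (sdiff B C)) \<psi> s"
    using car_sign(2) assms sdiff_car_index by (simp add: car_prod_scale)
  ultimately show ?thesis using nz by simp
qed

lemma car_sign_empty [simp]:
  assumes "A \<in> car_index"
  shows "car_sign A {} = 1" "car_sign {} A = 1"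
proof -
  obtain \<psi> s where nz: "car_prod A \<psi> s \<noteq> 0" using car_prod_nonzero[OF assms] .
  show "car_sign A {} = 1" using car_sign(2)[OF assms empty_car_index, of \<psi> s] nz by (simp add: car_prod_empty)
  show "car_sign {} A = 1" using car_sign(2)[OF empty_car_index assms, of \<psi> s] nz by (simp add: car_prod_empty)
qed

lemma car_sign_cmod [simp]: "A \<in> car_index \<Longrightarrow> B \<in> car_index \<Longrightarrow> cmod (car_sign A B) = 1"
  and car_sign_cnj [simp]: "A \<in> car_index \<Longrightarrow> B \<in> car_index \<Longrightarrow> cnj (car_sign A B) = car_sign A B"
  and car_sign_sq [simp]: "A \<in> car_index \<Longrightarrow> B \<in> car_index \<Longrightarrow> car_sign A B * car_sign A B = 1"
  using car_sign(1)[of A B] by auto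

lemma car_gen_past_car_prod:
  assumes "A \<in> car_index" and j: "1 \<le> j"
  shows "car_gen j (car_prod A \<psi>) = (\<lambda>s. (-1) ^ card (A - {j}) * car_prod A (car_gen j \<psi>) s)"
  using car_indexD[OF assms(1)]
proof (induction A rule: finite_linorder_min_induct)
  case empty
  then show ?case by (simp add: car_prod_empty)
next
  case (insert b A)
  have b: "1 \<le> b" "b \<notin> A" using insert by auto
  have IH: "car_gen j (car_prod A \<psi>) = (\<lambda>s. (-1) ^ card (A - {j}) * car_prod A (car_gen j \<psi>) s)"
    using insert by simp
  show ?case
  proof (cases "j = b")
    case True
    then have "A - {j} = A" "insert b A - {j} = A" using b by auto
    then show ?thesis using True insert.hyps b IH
      by (simp add: car_prod_insert_min car_gen_scale)
  next
    case False
    then have "insert b A - {j} = insert b (A - {j})" by auto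
    then have card: "card (insert b A - {j}) = Suc (card (A - {j}))" using insert.hyps b by simp
    show ?thesis unfolding card
      using False insert.hyps b j by (simp add: car_prod_insert_min car_gen_anticommute[of j b] IH car_gen_scale)
  qed
qed

text \<open>
  Conjugation with \<open>c\<^sub>j\<close> multiplies each \<open>c\<^sub>A\<close> by a sign. For \<open>A \<noteq> B\<close> some \<open>j\<close> gives different signs: an
  element of \<open>A \<triangle> B\<close> if \<open>|A| + |B|\<close> is even, an index outside \<open>A \<union> B\<close> if it is odd. Hence one summand of
  a linear relation can be eliminated while keeping the coefficient of another.
\<close>

lemma car_prod_independent:
  assumes "finite F" "F \<subseteq> car_index" "\<And>\<psi> s. (\<Sum>A\<in>F. \<alpha> A * car_prod A \<psi> s) = 0" "A \<in> F"
  shows "\<alpha> A = 0"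
  using assms
proof (induction "card F" arbitrary: F \<alpha> rule: less_induct)
  case less
  have A: "A \<in> car_index" using less.prems by auto
  show ?case
  proof (cases "F = {A}")
    case True
    obtain \<psi> s where "car_prod A \<psi> s \<noteq> 0" using car_prod_nonzero[OF A] .
    then show ?thesis using less.prems(3)[of \<psi> s] True by simp
  next
    case False
    then obtain B where B: "B \<in> F" "B \<noteq> A" using less.prems by auto
    have Bi: "B \<in> car_index" using B less.prems by auto
    have fin: "finite A" "finite B" "0 \<notin> A" "0 \<notin> B" using car_indexD A Bi by auto
    define e :: "nat \<Rightarrow> nat set \<Rightarrow> complex" where "e j D = (-1) ^ card (D - {j})" for j D
    obtain j where j: "1 \<le> j" "e j A \<noteq> e j B"
    proof (cases "even (card A + card B)")
      case True
      obtain j where j: "j \<in> sdiff A B" using B sdiff_empty_iff[of A B] by blast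
      have "j \<in> A \<longleftrightarrow> j \<notin> B" using j by (auto simp: sdiff_def)
      then have "odd (card (A - {j}) + card (B - {j}))"
        using True fin card_gt_0_iff[of A] card_gt_0_iff[of B]
        by (cases "j \<in> A") (auto simp: card_Diff_singleton)
      then have "e j A \<noteq> e j B" unfolding e_def
        by (cases "even (card (A - {j}))") auto
      moreover have "1 \<le> j" using j fin by (cases "j = 0") (auto simp: sdiff_def)
      ultimately show ?thesis using that by blast
    next
      case False
      obtain j where "j \<notin> A \<union> B \<union> {0}" using fin by (meson ex_new_if_finite infinite_UNIV_nat finite_Un finite.intros)
      then have j: "j \<notin> A" "j \<notin> B" "1 \<le> j" by auto
      then have "e j A \<noteq> e j B" using False unfolding e_def
        by (cases "even (card A)") auto
      then show ?thesis using that j by blast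
    qed
    have conj: "(\<Sum>D\<in>F. (\<alpha> D * e j D) * car_prod D \<psi> s) = 0" for \<psi> s
    proof -
      have "(\<Sum>D\<in>F. (\<alpha> D * e j D) * car_prod D \<psi> s) = (\<Sum>D\<in>F. \<alpha> D * car_gen j (car_prod D (car_gen j \<psi>)) s)"
        using less.prems(2) j by (intro sum.cong) (auto simp: car_gen_past_car_prod car_gen_square e_def)
      also have "\<dots> = car_gen j (\<lambda>s. \<Sum>D\<in>F. \<alpha> D * car_prod D (car_gen j \<psi>) s) s"
        using j by (simp add: car_gen_sum car_gen_scale)
      also have "\<dots> = 0" using j less.prems(3) by (simp add: car_gen_apply)
      finally show ?thesis .
    qed
    have "\<alpha> A * (e j A - e j B) = 0"
    proof (rule less.hyps[of "F - {B}" "\<lambda>D. \<alpha> D * (e j D - e j B)"])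
      show "card (F - {B}) < card F" using B less.prems(1) by (intro card_Diff1_less)
      fix \<psi> s
      have "(\<Sum>D\<in>F - {B}. \<alpha> D * (e j D - e j B) * car_prod D \<psi> s) = (\<Sum>D\<in>F. \<alpha> D * (e j D - e j B) * car_prod D \<psi> s)"
        using B less.prems(1) by (intro sum.mono_neutral_left) auto
      also have "\<dots> = (\<Sum>D\<in>F. (\<alpha> D * e j D) * car_prod D \<psi> s) - e j B * (\<Sum>D\<in>F. \<alpha> D * car_prod D \<psi> s)"
        by (simp add: algebra_simps sum_subtractf sum_distrib_left)
      finally show "(\<Sum>D\<in>F - {B}. \<alpha> D * (e j D - e j B) * car_prod D \<psi> s) = 0" using conj less.prems(3) by simp
    qed (use less.prems B in auto)
    then show ?thesis using j by simp
  qed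
qed

section \<open>Left and right multiplication on \<open>L\<^sub>2(C)\<close>\<close>

lemma shifted_coeffs_sum_le:
  fixes x :: "nat set \<Rightarrow> complex"
  assumes x: "(\<lambda>B. (cmod (x B))\<^sup>2) summable_on UNIV" and F: "finite F" and s: "\<And>B. B \<in> car_index \<Longrightarrow> A \<in> car_index \<Longrightarrow> cmod (s B) = 1"
  shows "(\<Sum>B\<in>F. (cmod (if A \<in> car_index \<and> B \<in> car_index then s B * x (sdiff A B) else 0))\<^sup>2) \<le> (\<Sum>\<^sub>\<infinity>B. (cmod (x B))\<^sup>2)"
proof -
  have "(\<Sum>B\<in>F. (cmod (if A \<in> car_index \<and> B \<in> car_index then s B * x (sdiff A B) else 0))\<^sup>2) \<le> (\<Sum>B\<in>F. (cmod (x (sdiff A B)))\<^sup>2)"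
    using s by (intro sum_mono) (auto simp: norm_mult)
  also have "\<dots> = (\<Sum>B\<in>sdiff A ` F. (cmod (x B))\<^sup>2)"
  proof -
    have "inj_on (sdiff A) F" by (rule inj_onI) (metis sdiff_simps(4))
    then show ?thesis by (simp add: sum.reindex)
  qed
  also have "\<dots> \<le> (\<Sum>\<^sub>\<infinity>B. (cmod (x B))\<^sup>2)"
    using F by (intro finite_sum_le_infsum[OF x]) auto
  finally show ?thesis .
qed

lemma shifted_coeffs_summable:
  fixes x :: "nat set \<Rightarrow> complex"
  assumes "(\<lambda>B. (cmod (x B))\<^sup>2) summable_on UNIV" and "\<And>B. B \<in> car_index \<Longrightarrow> A \<in> car_index \<Longrightarrow> cmod (s B) = 1"
  shows "(\<lambda>B. (cmod (if A \<in> car_index \<and> B \<in> car_index then s B * x (sdiff A B) else 0))\<^sup>2) summable_on UNIV"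
proof (rule nonneg_bdd_above_summable_on)
  show "bdd_above (sum (\<lambda>B. (cmod (if A \<in> car_index \<and> B \<in> car_index then s B * x (sdiff A B) else 0))\<^sup>2) ` {F. F \<subseteq> UNIV \<and> finite F})"
    by (rule bdd_aboveI[of _ "\<Sum>\<^sub>\<infinity>B. (cmod (x B))\<^sup>2"]) (use shifted_coeffs_sum_le[OF assms(1) _ assms(2)] in auto)
qed simp

lift_definition lmul :: "nat set \<Rightarrow> car_L2 \<Rightarrow> car_L2" is
  "\<lambda>A x B. if A \<in> car_index \<and> B \<in> car_index then car_sign A (sdiff A B) * x (sdiff A B) else 0"
  by (intro conjI shifted_coeffs_summable) (auto simp: sdiff_car_index)

lift_definition rmul :: "nat set \<Rightarrow> car_L2 \<Rightarrow> car_L2" is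
  "\<lambda>A x B. if A \<in> car_index \<and> B \<in> car_index then car_sign (sdiff A B) A * x (sdiff A B) else 0"
  by (intro conjI shifted_coeffs_summable) (auto simp: sdiff_car_index)

lemma coeff_lmul: "coeff_L2 (lmul A x) B = (if A \<in> car_index \<and> B \<in> car_index then car_sign A (sdiff A B) * coeff_L2 x (sdiff A B) else 0)"
  by (simp add: lmul.rep_eq)
lemma coeff_rmul: "coeff_L2 (rmul A x) B = (if A \<in> car_index \<and> B \<in> car_index then car_sign (sdiff A B) A * coeff_L2 x (sdiff A B) else 0)"
  by (simp add: rmul.rep_eq)

lemma infsum_norm_sq: "(\<Sum>\<^sub>\<infinity>B. (cmod (coeff_L2 x B))\<^sup>2) = (norm x)\<^sup>2"
  by (rule infsumI[OF norm_sq_has_sum])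

lemma norm_lmul_le: "norm (lmul A x) \<le> norm x"
proof (rule norm_le_of_sum_le)
  fix F :: "nat set set" assume "finite F"
  then show "(\<Sum>B\<in>F. (cmod (coeff_L2 (lmul A x) B))\<^sup>2) \<le> (norm x)\<^sup>2"
    unfolding coeff_lmul infsum_norm_sq[symmetric]
    by (rule shifted_coeffs_sum_le[OF coeff_L2_summable]) (simp add: sdiff_car_index)
qed simp

lemma norm_rmul_le: "norm (rmul A x) \<le> norm x"
proof (rule norm_le_of_sum_le)
  fix F :: "nat set set" assume "finite F"
  then show "(\<Sum>B\<in>F. (cmod (coeff_L2 (rmul A x) B))\<^sup>2) \<le> (norm x)\<^sup>2"
    unfolding coeff_rmul infsum_norm_sq[symmetric]
    by (rule shifted_coeffs_sum_le[OF coeff_L2_summable]) (simp add: sdiff_car_index)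
qed simp

lemma lmul_cscale: "lmul A (cscale c x) = cscale c (lmul A x)"
  by (rule car_L2_eqI) (simp add: coeff_lmul)
lemma rmul_cscale: "rmul A (cscale c x) = cscale c (rmul A x)"
  by (rule car_L2_eqI) (simp add: coeff_rmul)

lemma bounded_linear_lmul: "bounded_linear (lmul A)"
proof (rule bounded_linear_intro[of _ 1])
  show "lmul A (x + y) = lmul A x + lmul A y" for x y
    by (rule car_L2_eqI) (simp add: coeff_lmul algebra_simps)
qed (auto simp: lmul_cscale scaleR_eq_cscale norm_lmul_le)

lemma bounded_linear_rmul: "bounded_linear (rmul A)"
proof (rule bounded_linear_intro[of _ 1])
  show "rmul A (x + y) = rmul A x + rmul A y" for x y
    by (rule car_L2_eqI) (simp add: coeff_rmul algebra_simps)
qed (auto simp: rmul_cscale scaleR_eq_cscale norm_rmul_le)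

definition Lop :: "nat set \<Rightarrow> car_op" where "Lop A = Blinfun (lmul A)"
definition Rop :: "nat set \<Rightarrow> car_op" where "Rop A = Blinfun (rmul A)"
definition Pop :: "nat \<Rightarrow> car_op" where "Pop n = Blinfun (restrict_L2 (idx n))"

lemma Lop_apply [simp]: "blinfun_apply (Lop A) = lmul A"
  unfolding Lop_def by (rule bounded_linear_Blinfun_apply[OF bounded_linear_lmul])
lemma Rop_apply [simp]: "blinfun_apply (Rop A) = rmul A"
  unfolding Rop_def by (rule bounded_linear_Blinfun_apply[OF bounded_linear_rmul])
lemma Pop_apply [simp]: "blinfun_apply (Pop n) = restrict_L2 (idx n)"
  unfolding Pop_def by (rule bounded_linear_Blinfun_apply[OF bounded_linear_restrict])

lemma Lop_clinear: "Lop A \<in> clinear_ops" by (simp add: clinear_ops_def lmul_cscale)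
lemma Rop_clinear: "Rop A \<in> clinear_ops" by (simp add: clinear_ops_def rmul_cscale)
lemma Pop_clinear: "Pop n \<in> clinear_ops" by (simp add: clinear_ops_def)

lemma sdiff_swap_iff: "C = sdiff A B \<longleftrightarrow> sdiff A C = B"
  by (metis sdiff_simps(4))

lemma lmul_basis:
  assumes "A \<in> car_index" "B \<in> car_index"
  shows "lmul A (basis_L2 B) = cscale (car_sign A B) (basis_L2 (sdiff A B))"
  by (rule car_L2_eqI) (use assms in \<open>auto simp: coeff_lmul coeff_basis sdiff_swap_iff sdiff_car_index\<close>)

lemma rmul_basis:
  assumes "A \<in> car_index" "B \<in> car_index"
  shows "rmul A (basis_L2 B) = cscale (car_sign B A) (basis_L2 (sdiff A B))"
  by (rule car_L2_eqI) (use assms in \<open>auto simp: coeff_rmul coeff_basis sdiff_swap_iff sdiff_car_index\<close>)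

lemma rmul_vacuum: "A \<in> car_index \<Longrightarrow> rmul A vacuum = basis_L2 A"
  by (simp add: vacuum_def rmul_basis)
lemma lmul_vacuum: "A \<in> car_index \<Longrightarrow> lmul A vacuum = basis_L2 A"
  by (simp add: vacuum_def lmul_basis)

lemma Lop_Rop_commute:
  assumes A: "A \<in> car_index" and B: "B \<in> car_index"
  shows "Lop A o\<^sub>L Rop B = Rop B o\<^sub>L Lop A"
proof (rule clinear_ops_eqI)
  fix C assume C: "C \<in> car_index"
  have eq: "sdiff A (sdiff B C) = sdiff B (sdiff A C)" by (auto simp: sdiff_def)
  have "car_sign C B * car_sign A (sdiff B C) = car_sign A C * car_sign (sdiff A C) B"
    using car_sign_assoc[OF A C B] by (simp add: sdiff_commute[of C B])
  then show "blinfun_apply (Lop A o\<^sub>L Rop B) (basis_L2 C) = blinfun_apply (Rop B o\<^sub>L Lop A) (basis_L2 C)"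
    using A B C by (simp add: lmul_basis rmul_basis lmul_cscale rmul_cscale sdiff_car_index eq)
qed (auto intro!: clinear_ops_compose Lop_clinear Rop_clinear)

lemma rmul_rmul:
  assumes A: "A \<in> car_index"
  shows "rmul A (rmul A x) = cscale (car_sign A A) x"
proof -
  have "Rop A o\<^sub>L Rop A = cscale_op (car_sign A A) id_blinfun"
  proof (rule clinear_ops_eqI)
    fix C assume C: "C \<in> car_index"
    have "car_sign C A * car_sign (sdiff A C) A = car_sign A A"
      using car_sign_assoc[OF C A A] C by (simp add: sdiff_commute[of C A])
    then show "blinfun_apply (Rop A o\<^sub>L Rop A) (basis_L2 C) = blinfun_apply (cscale_op (car_sign A A) id_blinfun) (basis_L2 C)"
      using A C by (simp add: rmul_basis rmul_cscale sdiff_car_index)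
  qed (auto intro!: clinear_ops_compose Rop_clinear clinear_ops_cscale clinear_ops_id)
  then show ?thesis by (metis Rop_apply blinfun_apply_blinfun_compose cscale_op_apply id_blinfun.rep_eq)
qed

lemma norm_rmul:
  assumes A: "A \<in> car_index"
  shows "norm (rmul A x) = norm x"
proof (rule antisym[OF norm_rmul_le])
  have "norm x = norm (rmul A (rmul A x))" using A by (simp add: rmul_rmul)
  also have "\<dots> \<le> norm (rmul A x)" by (rule norm_rmul_le)
  finally show "norm x \<le> norm (rmul A x)" .
qed

lemma inner_rmul:
  assumes A: "A \<in> car_index"
  shows "inner (rmul A x) (rmul A y) = inner x y"
proof -
  have "rmul A (x + y) = rmul A x + rmul A y" using bounded_linear_rmul by (rule linear_simps)
  then have "norm (rmul A x + rmul A y) = norm (x + y)" using norm_rmul[OF A] by metis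
  then show ?thesis unfolding dot_norm[of "rmul A x"] dot_norm[of x] by (simp add: norm_rmul[OF A])
qed

lemma cinner_rmul:
  assumes A: "A \<in> car_index"
  shows "cinner (rmul A x) (rmul A y) = cinner x y"
  by (simp add: cinner_eq_inner inner_rmul[OF A] rmul_cscale[symmetric])

lemma cinner_rmul_left:
  assumes A: "A \<in> car_index"
  shows "cinner (rmul A x) y = car_sign A A * cinner x (rmul A y)"
proof -
  have "y = cscale (car_sign A A) (rmul A (rmul A y))" using A by (simp add: rmul_rmul)
  then have "cinner (rmul A x) y = cinner (rmul A x) (cscale (car_sign A A) (rmul A (rmul A y)))" by simp
  then show ?thesis using A by (simp only: cinner_right cinner_rmul[OF A] car_sign_cnj)
qed

text \<open>
  The commutation theorem in the form needed: right multiplications commute with the CAR algebra,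
  and an operator commuting with them is determined by its value at the vacuum vector. Elements of
  the algebra can therefore be compared as vectors.
\<close>

definition right_inv :: "car_op \<Rightarrow> bool" where
  "right_inv T \<longleftrightarrow> T \<in> clinear_ops \<and> (\<forall>A\<in>car_index. \<forall>x. blinfun_apply T (rmul A x) = rmul A (blinfun_apply T x))"

lemma right_invD:
  assumes "right_inv T"
  shows "T \<in> clinear_ops" "A \<in> car_index \<Longrightarrow> blinfun_apply T (rmul A x) = rmul A (blinfun_apply T x)"
  using assms by (auto simp: right_inv_def)

lemma right_inv_basis:
  assumes "right_inv T" "A \<in> car_index"
  shows "blinfun_apply T (basis_L2 A) = rmul A (blinfun_apply T vacuum)"
  using right_invD(2)[OF assms, of vacuum] rmul_vacuum[OF assms(2)] by simp

lemma right_inv_eqI: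
  assumes "right_inv T" "right_inv S" "blinfun_apply T vacuum = blinfun_apply S vacuum"
  shows "T = S"
  using right_inv_basis assms by (intro clinear_ops_eqI) (auto simp: right_inv_def)

lemma right_inv_compose: "right_inv S \<Longrightarrow> right_inv T \<Longrightarrow> right_inv (S o\<^sub>L T)"
  by (simp add: right_inv_def clinear_ops_compose)

lemma right_inv_adj:
  assumes T: "right_inv T"
  shows "right_inv (adj T)"
  unfolding right_inv_def
proof (intro conjI ballI allI)
  note Tc = right_invD(1)[OF T]
  show "adj T \<in> clinear_ops" by (rule adj_props(1)[OF Tc])
  fix A x assume A: "A \<in> car_index"
  show "blinfun_apply (adj T) (rmul A x) = rmul A (blinfun_apply (adj T) x)"
  proof (rule cinner_ext)
    fix y
    have "car_sign A A * cinner y (blinfun_apply (adj T) (rmul A x)) = car_sign A A * cinner (blinfun_apply T y) (rmul A x)"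
      by (simp add: adj_props(2)[OF Tc])
    also have "\<dots> = cinner (blinfun_apply T (rmul A y)) x"
      by (simp add: cinner_rmul_left[OF A] right_invD(2)[OF T A])
    also have "\<dots> = car_sign A A * cinner y (rmul A (blinfun_apply (adj T) x))"
      by (simp add: adj_props(2)[OF Tc] cinner_rmul_left[OF A])
    finally show "cinner y (blinfun_apply (adj T) (rmul A x)) = cinner y (rmul A (blinfun_apply (adj T) x))"
      using car_sign(1)[OF A A] by auto
  qed
qed

text \<open>
  For finite \<open>S\<close> this is the element \<open>\<Sum>\<^sub>A \<beta>\<^sub>A c\<^sub>A\<close> in the GNS representation.
\<close>

definition combo :: "nat set set \<Rightarrow> (nat set \<Rightarrow> complex) \<Rightarrow> car_op" where
  "combo S \<beta> = (\<Sum>A\<in>S. cscale_op (\<beta> A) (Lop A))"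

lemma combo_apply: "blinfun_apply (combo S \<beta>) x = (\<Sum>A\<in>S. cscale (\<beta> A) (lmul A x))"
  by (simp add: combo_def blinfun.sum_left)

lemma combo_clinear: "combo S \<beta> \<in> clinear_ops"
  unfolding combo_def by (intro clinear_ops_sum clinear_ops_cscale Lop_clinear)

lemma combo_right_inv: "S \<subseteq> car_index \<Longrightarrow> right_inv (combo S \<beta>)"
  unfolding right_inv_def
proof (intro conjI ballI allI combo_clinear)
  fix A x assume S: "S \<subseteq> car_index" and A: "A \<in> car_index"
  interpret R: bounded_linear "rmul A" by (rule bounded_linear_rmul)
  have "lmul B (rmul A x) = rmul A (lmul B x)" if "B \<in> S" for B
  proof -
    have "B \<in> car_index" using S that by blast
    from arg_cong[OF Lop_Rop_commute[OF this A], of "\<lambda>T. blinfun_apply T x"] show ?thesis by simp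
  qed
  then show "blinfun_apply (combo S \<beta>) (rmul A x) = rmul A (blinfun_apply (combo S \<beta>) x)"
    by (simp add: combo_apply R.sum rmul_cscale)
qed

lemma combo_vacuum:
  assumes "finite S" "S \<subseteq> car_index"
  shows "coeff_L2 (blinfun_apply (combo S \<beta>) vacuum) B = (if B \<in> S then \<beta> B else 0)"
proof -
  have "blinfun_apply (combo S \<beta>) vacuum = (\<Sum>A\<in>S. cscale (\<beta> A) (basis_L2 A))"
    unfolding combo_apply using assms by (intro sum.cong) (auto simp: lmul_vacuum)
  then show ?thesis by (simp add: coeff_combination[OF assms] del: coeff_sum)
qed

lemma combo_diff_coeffs: "combo S (\<lambda>A. \<beta> A - \<gamma> A) = combo S \<beta> - combo S \<gamma>"
  by (rule blinfun_eqI)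
     (auto simp: combo_apply blinfun.diff_left sum_subtractf[symmetric] algebra_simps intro!: car_L2_eqI sum.cong)

lemma combo_diff_sets: "finite S \<Longrightarrow> S' \<subseteq> S \<Longrightarrow> combo (S - S') \<beta> = combo S \<beta> - combo S' \<beta>"
  unfolding combo_def by (simp add: sum_diff)

section \<open>The GNS representation\<close>

lemma car_comb_superset:
  assumes "finite F" "{A. \<alpha> A \<noteq> 0} \<subseteq> F"
  shows "car_comb \<alpha> \<psi> s = (\<Sum>A\<in>F. \<alpha> A * car_prod A \<psi> s)"
  unfolding car_comb_def using assms by (intro sum.mono_neutral_left) auto

lemma car_comb_inj:
  assumes \<alpha>: "\<alpha> \<in> fin_coeffs" and \<beta>: "\<beta> \<in> fin_coeffs" and eq: "car_comb \<alpha> = car_comb \<beta>"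
  shows "\<alpha> = \<beta>"
proof
  fix A
  define F where "F = {A. \<alpha> A \<noteq> 0} \<union> {A. \<beta> A \<noteq> 0}"
  have F: "finite F" "F \<subseteq> car_index" using \<alpha> \<beta> by (auto simp: F_def fin_coeffs_def)
  have z: "(\<Sum>A\<in>F. (\<alpha> A - \<beta> A) * car_prod A \<psi> s) = 0" for \<psi> s
  proof -
    have "(\<Sum>A\<in>F. (\<alpha> A - \<beta> A) * car_prod A \<psi> s) = car_comb \<alpha> \<psi> s - car_comb \<beta> \<psi> s"
      using F(1) by (simp add: car_comb_superset[of F] F_def left_diff_distrib sum_subtractf)
    then show ?thesis by (simp add: eq)
  qed
  show "\<alpha> A = \<beta> A"
  proof (cases "A \<in> F")
    case True
    then show ?thesis using car_prod_independent[OF F z] by force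
  qed (auto simp: F_def)
qed

lemma gns_vec_eqI:
  assumes "coeff_L2 v \<in> fin_coeffs" "X = car_comb (coeff_L2 v)"
  shows "gns_vec X = v"
  unfolding gns_vec_def
proof (rule the_equality)
  fix w assume "coeff_L2 w \<in> fin_coeffs \<and> X = car_comb (coeff_L2 w)"
  then have "coeff_L2 w = coeff_L2 v" using car_comb_inj assms by metis
  then show "w = v" by (simp add: coeff_L2_inject)
qed (use assms in blast)

lemma gns_vec_combination:
  assumes I: "finite I" and A: "\<And>i. i \<in> I \<Longrightarrow> A i \<in> car_index"
  shows "gns_vec (\<lambda>\<psi> s. \<Sum>i\<in>I. c i * car_prod (A i) \<psi> s) = (\<Sum>i\<in>I. cscale (c i) (basis_L2 (A i)))"
proof (rule gns_vec_eqI)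
  define v where "v = (\<Sum>i\<in>I. cscale (c i) (basis_L2 (A i)))"
  have v: "coeff_L2 v B = (\<Sum>i\<in>I. if A i = B then c i else 0)" for B
    unfolding v_def coeff_sum using A by (intro sum.cong) (auto simp: coeff_basis)
  have sub: "{B. coeff_L2 v B \<noteq> 0} \<subseteq> A ` I"
  proof
    fix B assume B: "B \<in> {B. coeff_L2 v B \<noteq> 0}"
    show "B \<in> A ` I"
    proof (rule ccontr)
      assume "B \<notin> A ` I"
      then have "coeff_L2 v B = 0" unfolding v by (intro sum.neutral) auto
      then show False using B by simp
    qed
  qed
  then show "coeff_L2 (\<Sum>i\<in>I. cscale (c i) (basis_L2 (A i))) \<in> fin_coeffs"
    unfolding v_def[symmetric] fin_coeffs_def using I A by (auto intro: finite_subset[of _ "A ` I"])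
  show "(\<lambda>\<psi> s. \<Sum>i\<in>I. c i * car_prod (A i) \<psi> s) = car_comb (coeff_L2 (\<Sum>i\<in>I. cscale (c i) (basis_L2 (A i))))"
  proof (intro ext)
    fix \<psi> s
    have "car_comb (coeff_L2 v) \<psi> s = (\<Sum>B\<in>A ` I. (\<Sum>i\<in>I. if A i = B then c i else 0) * car_prod B \<psi> s)"
      using I sub by (simp add: car_comb_superset[of "A ` I"] v)
    also have "\<dots> = (\<Sum>i\<in>I. \<Sum>B\<in>A ` I. if A i = B then c i * car_prod B \<psi> s else 0)"
      unfolding sum_distrib_right by (subst sum.swap) (intro sum.cong refl, simp)
    also have "\<dots> = (\<Sum>i\<in>I. c i * car_prod (A i) \<psi> s)"
      using I by (intro sum.cong) auto
    finally show "(\<Sum>i\<in>I. c i * car_prod (A i) \<psi> s) = car_comb (coeff_L2 (\<Sum>i\<in>I. cscale (c i) (basis_L2 (A i)))) \<psi> s"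
      by (simp add: v_def)
  qed
qed

lemma car_span_iff:
  "X \<in> car_span \<longleftrightarrow> (\<exists>F \<alpha>. finite F \<and> F \<subseteq> car_index \<and> X = (\<lambda>\<psi> s. \<Sum>A\<in>F. \<alpha> A * car_prod A \<psi> s))"
proof
  assume "X \<in> car_span"
  then obtain \<alpha> where \<alpha>: "\<alpha> \<in> fin_coeffs" "X = car_comb \<alpha>" by (auto simp: car_span_def)
  then have "X = (\<lambda>\<psi> s. \<Sum>A\<in>{A. \<alpha> A \<noteq> 0}. \<alpha> A * car_prod A \<psi> s)" by (auto simp: car_comb_def fun_eq_iff)
  then show "\<exists>F \<alpha>. finite F \<and> F \<subseteq> car_index \<and> X = (\<lambda>\<psi> s. \<Sum>A\<in>F. \<alpha> A * car_prod A \<psi> s)"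
    using \<alpha>(1) unfolding fin_coeffs_def by blast
next
  assume "\<exists>F \<alpha>. finite F \<and> F \<subseteq> car_index \<and> X = (\<lambda>\<psi> s. \<Sum>A\<in>F. \<alpha> A * car_prod A \<psi> s)"
  then obtain F \<alpha> where F: "finite F" "F \<subseteq> car_index" "X = (\<lambda>\<psi> s. \<Sum>A\<in>F. \<alpha> A * car_prod A \<psi> s)" by blast
  define \<beta> where "\<beta> = (\<lambda>A. if A \<in> F then \<alpha> A else 0)"
  have "\<beta> \<in> fin_coeffs" using F by (auto simp: fin_coeffs_def \<beta>_def intro: finite_subset)
  moreover have "X = car_comb \<beta>"
  proof (intro ext)
    fix \<psi> s
    have "car_comb \<beta> \<psi> s = (\<Sum>A\<in>F. \<beta> A * car_prod A \<psi> s)" using F by (intro car_comb_superset) (auto simp: \<beta>_def)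
    then show "X \<psi> s = car_comb \<beta> \<psi> s" by (simp add: F(3) \<beta>_def)
  qed
  ultimately show "X \<in> car_span" by (simp add: car_span_def)
qed

lemma gns_rep_combination:
  assumes F: "finite F" "F \<subseteq> car_index"
  shows "gns_rep (\<lambda>\<psi> s. \<Sum>A\<in>F. \<alpha> A * car_prod A \<psi> s) = combo F \<alpha>"
  unfolding gns_rep_def
proof (rule the_equality)
  let ?X = "\<lambda>\<psi> s. \<Sum>A\<in>F. \<alpha> A * car_prod A \<psi> s"
  have key: "blinfun_apply (combo F \<alpha>) (gns_vec Y) = gns_vec (?X \<circ> Y)" if Y: "Y \<in> car_span" for Y
  proof -
    obtain G \<beta> where G: "finite G" "G \<subseteq> car_index" "Y = (\<lambda>\<psi> s. \<Sum>B\<in>G. \<beta> B * car_prod B \<psi> s)"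
      using Y unfolding car_span_iff by blast
    have "?X \<circ> Y = (\<lambda>\<psi> s. \<Sum>i\<in>F \<times> G. (\<alpha> (fst i) * \<beta> (snd i) * car_sign (fst i) (snd i)) * car_prod (sdiff (fst i) (snd i)) \<psi> s)"
    proof (intro ext)
      fix \<psi> s
      have "(?X \<circ> Y) \<psi> s = (\<Sum>A\<in>F. \<alpha> A * (\<Sum>B\<in>G. \<beta> B * car_prod A (car_prod B \<psi>) s))"
        using F(2) unfolding comp_def G(3)
        by (intro sum.cong refl arg_cong2[where f = "(*)"]) (simp add: car_prod_sum car_prod_scale subset_iff)
      also have "\<dots> = (\<Sum>A\<in>F. \<Sum>B\<in>G. (\<alpha> A * \<beta> B * car_sign A B) * car_prod (sdiff A B) \<psi> s)"
        unfolding sum_distrib_left using F(2) G(2) by (intro sum.cong) (auto simp: car_sign(2) subset_iff)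
      also have "\<dots> = (\<Sum>i\<in>F \<times> G. (\<alpha> (fst i) * \<beta> (snd i) * car_sign (fst i) (snd i)) * car_prod (sdiff (fst i) (snd i)) \<psi> s)"
        by (simp add: sum.cartesian_product case_prod_beta)
      finally show "(?X \<circ> Y) \<psi> s = \<dots>" .
    qed
    then have "gns_vec (?X \<circ> Y) = gns_vec (\<lambda>\<psi> s. \<Sum>i\<in>F \<times> G. (\<alpha> (fst i) * \<beta> (snd i) * car_sign (fst i) (snd i)) * car_prod (sdiff (fst i) (snd i)) \<psi> s)"
      by (rule arg_cong)
    also have "\<dots> = (\<Sum>i\<in>F \<times> G. cscale (\<alpha> (fst i) * \<beta> (snd i) * car_sign (fst i) (snd i)) (basis_L2 (sdiff (fst i) (snd i))))"
      using F G by (intro gns_vec_combination) (auto intro!: sdiff_car_index)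
    also have "\<dots> = (\<Sum>A\<in>F. \<Sum>B\<in>G. cscale (\<alpha> A * \<beta> B * car_sign A B) (basis_L2 (sdiff A B)))"
      by (simp add: sum.cartesian_product case_prod_beta)
    also have "\<dots> = (\<Sum>A\<in>F. \<Sum>B\<in>G. cscale (\<alpha> A) (lmul A (cscale (\<beta> B) (basis_L2 B))))"
      using F(2) G(2) by (intro sum.cong refl) (simp add: lmul_cscale lmul_basis subset_iff mult.assoc)
    also have "\<dots> = blinfun_apply (combo F \<alpha>) (\<Sum>B\<in>G. cscale (\<beta> B) (basis_L2 B))"
      unfolding combo_apply
      by (intro sum.cong refl) (simp add: bounded_linear.linear[OF bounded_linear_lmul] linear_sum cscale_sum)
    also have "(\<Sum>B\<in>G. cscale (\<beta> B) (basis_L2 B)) = gns_vec Y"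
      unfolding G(3) using G by (intro gns_vec_combination[symmetric]) auto
    finally show ?thesis by (rule sym)
  qed
  then show "combo F \<alpha> \<in> clinear_ops \<and> (\<forall>Y\<in>car_span. blinfun_apply (combo F \<alpha>) (gns_vec Y) = gns_vec (?X \<circ> Y))"
    using combo_clinear by blast
  fix T assume T: "T \<in> clinear_ops \<and> (\<forall>Y\<in>car_span. blinfun_apply T (gns_vec Y) = gns_vec (?X \<circ> Y))"
  show "T = combo F \<alpha>"
  proof (rule clinear_ops_eqI)
    fix B assume B: "B \<in> car_index"
    define Y :: tensor_op where "Y = (\<lambda>\<psi> s. \<Sum>A\<in>{B}. 1 * car_prod A \<psi> s)"
    have "Y \<in> car_span" unfolding car_span_iff Y_def using B by (intro exI[of _ "{B}"] exI[of _ "\<lambda>_. 1"]) simp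
    moreover have "gns_vec Y = basis_L2 B"
      unfolding Y_def using B by (subst gns_vec_combination) auto
    moreover have "blinfun_apply T (gns_vec Y) = blinfun_apply (combo F \<alpha>) (gns_vec Y)" if "Y \<in> car_span"
      using T that unfolding key[OF that] by blast
    ultimately show "blinfun_apply T (basis_L2 B) = blinfun_apply (combo F \<alpha>) (basis_L2 B)" by metis
  qed (use T combo_clinear in auto)
qed

lemma gns_rep_car_prod:
  assumes "A \<in> car_index"
  shows "gns_rep (car_prod A) = Lop A"
proof -
  have "gns_rep (\<lambda>\<psi> s. \<Sum>B\<in>{A}. 1 * car_prod B \<psi> s) = combo {A} (\<lambda>_. 1)"
    using assms by (intro gns_rep_combination) auto
  moreover have "combo {A} (\<lambda>_. 1) = Lop A" by (rule blinfun_eqI) (simp add: combo_apply)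
  ultimately show ?thesis by simp
qed

section \<open>The von Neumann algebras and the conditional expectations\<close>

lemma commutantD:
  assumes "T \<in> commutant M"
  shows "T \<in> clinear_ops" "S \<in> M \<Longrightarrow> blinfun_apply T (blinfun_apply S x) = blinfun_apply S (blinfun_apply T x)"
  using assms unfolding commutant_def by (auto, metis blinfun_apply_blinfun_compose)

lemma commutantI:
  assumes "T \<in> clinear_ops" "\<And>S x. S \<in> M \<Longrightarrow> blinfun_apply T (blinfun_apply S x) = blinfun_apply S (blinfun_apply T x)"
  shows "T \<in> commutant M"
  using assms unfolding commutant_def by (auto intro!: blinfun_eqI)

lemma generators_in_vn_generated: "M \<subseteq> clinear_ops \<Longrightarrow> M \<subseteq> vn_generated M"
  unfolding vn_generated_def by (auto intro!: commutantI simp: commutantD)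

lemma vn_generated_closed:
  shows "x \<in> vn_generated M \<Longrightarrow> y \<in> vn_generated M \<Longrightarrow> x + y \<in> vn_generated M"
    and "x \<in> vn_generated M \<Longrightarrow> y \<in> vn_generated M \<Longrightarrow> x - y \<in> vn_generated M"
    and "x \<in> vn_generated M \<Longrightarrow> y \<in> vn_generated M \<Longrightarrow> x o\<^sub>L y \<in> vn_generated M"
    and "x \<in> vn_generated M \<Longrightarrow> cscale_op c x \<in> vn_generated M"
    and "0 \<in> vn_generated M" and "id_blinfun \<in> vn_generated M"
  unfolding vn_generated_def
  by (auto intro!: commutantI clinear_ops_add clinear_ops_diff clinear_ops_compose clinear_ops_cscale clinear_ops_zero clinear_ops_id
      simp: commutantD blinfun.add_left blinfun.diff_left blinfun.add_right blinfun.diff_right clinear_cscale)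

lemma vn_generated_sum: "(\<And>i. i \<in> I \<Longrightarrow> f i \<in> vn_generated M) \<Longrightarrow> (\<Sum>i\<in>I. f i) \<in> vn_generated M"
  by (induction I rule: infinite_finite_induct) (auto intro: vn_generated_closed)

lemma combo_rmul_commute:
  assumes "S \<subseteq> car_index" "A \<in> car_index"
  shows "blinfun_apply (combo S \<beta>) (rmul A x) = rmul A (blinfun_apply (combo S \<beta>) x)"
  using right_invD(2)[OF combo_right_inv[OF assms(1)] assms(2)] .

lemma CAR_right_inv:
  assumes "T \<in> CAR"
  shows "right_inv T"
proof -
  have "Rop A \<in> commutant (gns_rep ` car_span)" if A: "A \<in> car_index" for A
  proof (rule commutantI[OF Rop_clinear])
    fix S x assume "S \<in> gns_rep ` car_span"
    then obtain F \<alpha> where "finite F" "F \<subseteq> car_index" "S = combo F \<alpha>"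
      by (auto simp: car_span_iff gns_rep_combination)
    then show "blinfun_apply (Rop A) (blinfun_apply S x) = blinfun_apply S (blinfun_apply (Rop A) x)"
      using combo_rmul_commute A by simp
  qed
  then show ?thesis using assms unfolding CAR_def vn_generated_def right_inv_def
    by (auto simp: commutantD(1)) (metis Rop_apply commutantD(2))
qed

lemma Lop_CAR: "A \<in> car_index \<Longrightarrow> Lop A \<in> CAR"
proof -
  assume A: "A \<in> car_index"
  have "gns_rep ` car_span \<subseteq> clinear_ops"
    using combo_clinear by (auto simp: car_span_iff gns_rep_combination)
  moreover have "Lop A \<in> gns_rep ` car_span"
  proof
    show "Lop A = gns_rep (car_prod A)" using A by (simp add: gns_rep_car_prod)
    show "car_prod A \<in> car_span" unfolding car_span_iff
      using A by (intro exI[of _ "{A}"] exI[of _ "\<lambda>_. 1"]) auto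
  qed
  ultimately show ?thesis unfolding CAR_def using generators_in_vn_generated by blast
qed

lemmas CAR_closed = vn_generated_closed[where M = "gns_rep ` car_span", folded CAR_def]

lemma combo_CAR: "S \<subseteq> car_index \<Longrightarrow> combo S \<beta> \<in> CAR"
  using vn_generated_sum[of S "\<lambda>A. cscale_op (\<beta> A) (Lop A)" "gns_rep ` car_span"] CAR_closed(4) Lop_CAR
  unfolding CAR_def[symmetric] combo_def by blast

lemma mul_restrict_commute:
  assumes "A \<in> idx n"
  shows "restrict_L2 (idx n) (lmul A x) = lmul A (restrict_L2 (idx n) x)"
    and "restrict_L2 (idx n) (rmul A x) = rmul A (restrict_L2 (idx n) x)"
proof -
  have "sdiff A B \<in> idx n \<longleftrightarrow> B \<in> idx n" for B using assms unfolding sdiff_def mem_idx by blast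
  then show "restrict_L2 (idx n) (lmul A x) = lmul A (restrict_L2 (idx n) x)"
    "restrict_L2 (idx n) (rmul A x) = rmul A (restrict_L2 (idx n) x)"
    by (auto intro!: car_L2_eqI simp: coeff_lmul coeff_rmul)
qed

lemma combo_restrict_commute:
  assumes "S \<subseteq> idx n"
  shows "restrict_L2 (idx n) (blinfun_apply (combo S \<beta>) x) = blinfun_apply (combo S \<beta>) (restrict_L2 (idx n) x)"
proof -
  interpret P: bounded_linear "restrict_L2 (idx n)" by (rule bounded_linear_restrict)
  have "restrict_L2 (idx n) (lmul A x) = lmul A (restrict_L2 (idx n) x)" if "A \<in> S" for A
    using mul_restrict_commute(1) assms that by blast
  then show ?thesis by (simp add: combo_apply P.sum cong: sum.cong)
qed

lemma car_max_idx: "1 \<le> n \<Longrightarrow> {A \<in> car_index. car_max A \<le> n} = idx n"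
proof (intro equalityI subsetI)
  fix A assume "1 \<le> n" "A \<in> {A \<in> car_index. car_max A \<le> n}"
  then have A: "finite A" "0 \<notin> A" "car_max A \<le> n" by (auto simp: car_index_def)
  have "x \<in> {1..n}" if "x \<in> A" for x
  proof -
    have "x \<le> Max A" using A that by simp
    then show ?thesis using A that by (cases "x = 0") (auto simp: car_max_def split: if_splits)
  qed
  then show "A \<in> idx n" by (auto simp: mem_idx)
next
  fix A assume n: "1 \<le> n" and A: "A \<in> idx n"
  then have "finite A" by (auto simp: mem_idx intro: finite_subset)
  then have "car_max A \<le> n" using A n by (auto simp: mem_idx car_max_def)
  then show "A \<in> {A \<in> car_index. car_max A \<le> n}" using A idx_car_index by blast
qed

text \<open>
  \<open>C\<^sub>n\<close> is the linear span of the \<open>c\<^sub>A\<close>, \<open>A \<subseteq> {1..n}\<close>. The projection onto \<open>L\<^sub>2(C\<^sub>n)\<close> commutes with the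
  generators, hence with \<open>C\<^sub>n\<close>, so that \<open>T \<Omega>\<close> lies in \<open>L\<^sub>2(C\<^sub>n)\<close>; and \<open>T \<Omega>\<close> determines \<open>T\<close>.
\<close>

lemma CAR_fil_iff:
  assumes n: "1 \<le> n"
  shows "T \<in> CAR_fil n \<longleftrightarrow> T = combo (idx n) (coeff_L2 (blinfun_apply T vacuum))"
proof
  have gens: "(\<lambda>A. gns_rep (car_prod A)) ` {A \<in> car_index. car_max A \<le> n} = Lop ` idx n"
    unfolding car_max_idx[OF n] by (intro image_cong gns_rep_car_prod subsetD[OF idx_car_index]) auto
  {
    assume T: "T \<in> CAR_fil n"
    then have T: "T \<in> commutant (commutant (Lop ` idx n))" by (simp add: CAR_fil_def vn_generated_def gens)
    have R: "Rop B \<in> commutant (Lop ` idx n)" if B: "B \<in> car_index" for B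
    proof (rule commutantI[OF Rop_clinear])
      fix S x assume "S \<in> Lop ` idx n"
      then obtain A where A: "A \<in> car_index" "S = Lop A" using idx_car_index by blast
      show "blinfun_apply (Rop B) (blinfun_apply S x) = blinfun_apply S (blinfun_apply (Rop B) x)"
        using arg_cong[OF Lop_Rop_commute[OF A(1) B], of "\<lambda>T. blinfun_apply T x"] A by simp
    qed
    have "Pop n \<in> commutant (Lop ` idx n)"
      by (rule commutantI[OF Pop_clinear]) (auto simp: mul_restrict_commute)
    from commutantD(2)[OF T this, of vacuum]
    have v: "restrict_L2 (idx n) (blinfun_apply T vacuum) = blinfun_apply T vacuum"
      by (simp add: vacuum_def restrict_basis)
    have "right_inv T" unfolding right_inv_def
      using commutantD(1)[OF T] commutantD(2)[OF T R] by simp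
    then show "T = combo (idx n) (coeff_L2 (blinfun_apply T vacuum))"
    proof (rule right_inv_eqI[OF _ combo_right_inv[OF idx_car_index]])
      show "blinfun_apply T vacuum = blinfun_apply (combo (idx n) (coeff_L2 (blinfun_apply T vacuum))) vacuum"
        by (subst (1) v[symmetric], rule car_L2_eqI, subst combo_vacuum)
           (use idx_car_index in auto)
    qed
  }
  assume T: "T = combo (idx n) (coeff_L2 (blinfun_apply T vacuum))"
  have "Lop A \<in> CAR_fil n" if "A \<in> idx n" for A
    unfolding CAR_fil_def gens using generators_in_vn_generated[of "Lop ` idx n"] that Lop_clinear by blast
  then have "combo (idx n) \<beta> \<in> CAR_fil n" for \<beta>
    unfolding combo_def CAR_fil_def by (intro vn_generated_sum vn_generated_closed(4)) auto
  then show "T \<in> CAR_fil n" by (subst T)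
qed

lemma combo_idx_vacuum: "blinfun_apply (combo (idx n) (coeff_L2 v)) vacuum = restrict_L2 (idx n) v"
  by (rule car_L2_eqI) (subst combo_vacuum, use idx_car_index in auto)

lemma combo_CAR_fil:
  assumes "1 \<le> n"
  shows "combo (idx n) \<beta> \<in> CAR_fil n"
proof -
  have "combo (idx n) (coeff_L2 (blinfun_apply (combo (idx n) \<beta>) vacuum)) = combo (idx n) \<beta>"
    unfolding combo_def by (intro sum.cong refl arg_cong2[where f = cscale_op])
      (subst combo_def[symmetric], subst combo_vacuum, use idx_car_index in auto)
  then show ?thesis using CAR_fil_iff[OF assms] by simp
qed

lemma CAR_fil_CAR: "1 \<le> n \<Longrightarrow> T \<in> CAR_fil n \<Longrightarrow> T \<in> CAR"
  using CAR_fil_iff combo_CAR[OF idx_car_index] by metis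

lemma cinner_disjoint:
  assumes "\<And>A. coeff_L2 x A = 0 \<or> coeff_L2 y A = 0"
  shows "cinner x y = 0"
  unfolding cinner_def using assms by (intro infsum_0) auto

text \<open>
  The candidate for the conditional expectation: the orthogonal projection onto \<open>L\<^sub>2(C\<^sub>n)\<close> applied to
  \<open>x \<Omega>\<close>, read as an element of \<open>C\<^sub>n\<close>.
\<close>

definition cexp :: "nat \<Rightarrow> car_op \<Rightarrow> car_op" where
  "cexp n x = combo (idx n) (coeff_L2 (blinfun_apply x vacuum))"

text \<open>
  On \<open>L\<^sub>2(C\<^sub>n)\<close> the expectation is compression by the orthogonal projection, since the projection
  commutes with right multiplication by elements of \<open>C\<^sub>n\<close>.
\<close>

lemma cexp_compression:
  assumes x: "right_inv x" and v: "v \<in> fin_space (idx n)"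
  shows "blinfun_apply (cexp n x) v = restrict_L2 (idx n) (blinfun_apply x v)"
proof -
  have fin: "finite (idx n)" by simp
  have basis: "blinfun_apply (cexp n x) (basis_L2 B) = restrict_L2 (idx n) (blinfun_apply x (basis_L2 B))" if B: "B \<in> idx n" for B
  proof -
    have Bi: "B \<in> car_index" using B idx_car_index by blast
    have "blinfun_apply (cexp n x) (basis_L2 B) = rmul B (restrict_L2 (idx n) (blinfun_apply x vacuum))"
      unfolding cexp_def right_inv_basis[OF combo_right_inv[OF idx_car_index] Bi] combo_idx_vacuum ..
    also have "\<dots> = restrict_L2 (idx n) (rmul B (blinfun_apply x vacuum))"
      by (rule mul_restrict_commute(2)[OF B, symmetric])
    finally show ?thesis using right_inv_basis[OF x Bi] by simp
  qed
  have "blinfun_apply (cexp n x) (restrict_L2 (idx n) v) = restrict_L2 (idx n) (blinfun_apply x (restrict_L2 (idx n) v))"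
  proof -
    interpret P: bounded_linear "restrict_L2 (idx n)" by (rule bounded_linear_restrict)
    have "cexp n x \<in> clinear_ops" unfolding cexp_def by (rule combo_clinear)
    then show ?thesis
      by (simp only: clinear_restrict_expand[OF _ fin idx_car_index] right_invD(1)[OF x] P.sum restrict_linear basis cong: sum.cong)
  qed
  then show ?thesis using v by (simp add: restrict_fin_space)
qed

lemma nonneg_Reals_closed_limit:
  assumes "f \<longlonglongrightarrow> (l::complex)" "\<And>n. f n \<in> \<real>\<^sub>\<ge>\<^sub>0"
  shows "l \<in> \<real>\<^sub>\<ge>\<^sub>0"
proof -
  have "(\<lambda>n. Re (f n)) \<longlonglongrightarrow> Re l" "(\<lambda>n. Im (f n)) \<longlonglongrightarrow> Im l" using assms(1) by (auto intro: tendsto_intros)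
  moreover have "Re (f n) \<ge> 0" "Im (f n) = 0" for n using assms(2)[of n] by (auto simp: complex_nonneg_Reals_iff)
  ultimately have "Re l \<ge> 0" "Im l = 0" by (auto intro: LIMSEQ_le_const simp: LIMSEQ_const_iff)
  then show ?thesis by (simp add: complex_nonneg_Reals_iff)
qed

text \<open>
  On \<open>L\<^sub>2(C\<^sub>n)\<close> the form of \<open>E\<^sub>n(x)\<close> agrees with that of \<open>x\<close>. It is positive on \<open>L\<^sub>2(C\<^sub>N)\<close> for all \<open>N \<ge> n\<close>
  by induction: \<open>L\<^sub>2(C\<^sub>N\<^sub>+\<^sub>1)\<close> is the orthogonal sum of \<open>L\<^sub>2(C\<^sub>N)\<close> and its image under right multiplication by
  \<open>c\<^sub>N\<^sub>+\<^sub>1\<close>, an isometry commuting with \<open>E\<^sub>n(x)\<close>. The union of these spaces is dense.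
\<close>

lemma cexp_positive:
  assumes x: "right_inv x" and pos: "positive_op x"
  shows "positive_op (cexp n x)"
proof -
  define E where "E = cexp n x"
  have Ec: "E \<in> clinear_ops" by (simp add: E_def cexp_def combo_clinear)
  have Er: "right_inv E" unfolding E_def cexp_def by (rule combo_right_inv[OF idx_car_index])
  have EP: "restrict_L2 (idx N) (blinfun_apply E v) = blinfun_apply E (restrict_L2 (idx N) v)" if "n \<le> N" for N v
    unfolding E_def cexp_def using that by (intro combo_restrict_commute idx_mono)
  have fin: "cinner (blinfun_apply E v) v \<in> \<real>\<^sub>\<ge>\<^sub>0" if "n \<le> N" "v \<in> fin_space (idx N)" for N v
    using that
  proof (induction N arbitrary: v rule: dec_induct)
    case base
    have "cinner (blinfun_apply E v) v = cinner (blinfun_apply x v) (restrict_L2 (idx n) v)"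
      unfolding E_def cexp_compression[OF x base] by (rule cinner_restrict)
    also have "restrict_L2 (idx n) v = v" using base by (simp add: restrict_fin_space)
    finally show ?case using pos by (simp add: positive_op_def)
  next
    case (step N)
    \<comment> \<open>\<open>v = v0 + v1\<close> with \<open>v0 \<in> L\<^sub>2(C\<^sub>N)\<close> and \<open>v1 = \<plusminus> w c\<^sub>N\<^sub>+\<^sub>1\<close>, \<open>w \<in> L\<^sub>2(C\<^sub>N)\<close>\<close>
    define v0 v1 w where "v0 = restrict_L2 (idx N) v" and "v1 = v - v0" and "w = rmul {Suc N} v1"
    have S: "{Suc N} \<in> car_index" by (simp add: car_index_def)
    have c1: "coeff_L2 v1 A = 0" if "A \<notin> idx (Suc N) \<or> Suc N \<notin> A" for A
    proof (cases "A \<in> idx (Suc N)")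
      case True
      then have "A \<in> idx N" using that by (auto simp: mem_idx subset_iff le_Suc_eq)
      then show ?thesis by (simp add: v1_def v0_def)
    next
      case False
      then have "A \<notin> idx N" using idx_mono[of N "Suc N"] by auto
      then show ?thesis using False step.prems by (simp add: v1_def v0_def fin_space_def)
    qed
    have v0: "v0 \<in> fin_space (idx N)" by (simp add: v0_def)
    have w: "w \<in> fin_space (idx N)"
      unfolding fin_space_def
    proof (intro CollectI allI impI)
      fix A assume "A \<notin> idx N"
      then have "sdiff {Suc N} A \<notin> idx (Suc N) \<or> Suc N \<notin> sdiff {Suc N} A"
        by (auto simp: sdiff_def mem_idx subset_iff le_Suc_eq)
      then show "coeff_L2 w A = 0" using c1 by (simp add: w_def coeff_rmul)
    qed
    have v1: "v1 = cscale (car_sign {Suc N} {Suc N}) (rmul {Suc N} w)"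
      using S by (simp add: w_def rmul_rmul)
    have E0: "blinfun_apply E v0 \<in> fin_space (idx N)"
      using EP[of N v] step.hyps by (simp add: v0_def) (metis restrict_in_fin_space)
    have Ew: "blinfun_apply E w \<in> fin_space (idx N)"
      using EP[of N w] step.hyps w by (simp add: restrict_fin_space)
    have E1: "blinfun_apply E v1 = cscale (car_sign {Suc N} {Suc N}) (rmul {Suc N} (blinfun_apply E w))"
      by (simp add: v1 clinear_cscale[OF Ec] right_invD(2)[OF Er S])
    have E1c: "coeff_L2 (blinfun_apply E v1) A = 0" if "A \<in> idx N" for A
    proof -
      have "Suc N \<in> sdiff {Suc N} A" using that by (auto simp: sdiff_def mem_idx)
      then have "sdiff {Suc N} A \<notin> idx N" by (auto simp: mem_idx)
      then show ?thesis using Ew by (simp add: E1 coeff_rmul fin_space_def)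
    qed
    have "cinner (blinfun_apply E v) v = cinner (blinfun_apply E v0 + blinfun_apply E v1) (v0 + v1)"
      by (simp add: v1_def blinfun.diff_right)
    also have "\<dots> = cinner (blinfun_apply E v0) v0 + cinner (blinfun_apply E v1) v1"
    proof -
      have "cinner (blinfun_apply E v0) v1 = 0"
      proof (rule cinner_disjoint)
        fix A
        show "coeff_L2 (blinfun_apply E v0) A = 0 \<or> coeff_L2 v1 A = 0"
        proof (cases "A \<in> idx N")
          case True
          then have "Suc N \<notin> A" by (auto simp: mem_idx)
          then show ?thesis using c1 by blast
        next
          case False
          then show ?thesis using E0 by (simp add: fin_space_def)
        qed
      qed
      moreover have "cinner (blinfun_apply E v1) v0 = 0"
        using E1c v0 by (intro cinner_disjoint) (auto simp: fin_space_def)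
      ultimately show ?thesis by simp
    qed
    also have "cinner (blinfun_apply E v1) v1 = cinner (blinfun_apply E w) w"
      unfolding E1 unfolding v1 using S by (simp add: cinner_rmul mult.assoc[symmetric])
    finally show ?case
      using step.IH[OF v0] step.IH[OF w] by (auto intro: nonneg_Reals_add_I)
  qed
  have "cinner (blinfun_apply E v) v \<in> \<real>\<^sub>\<ge>\<^sub>0" for v
  proof (rule nonneg_Reals_closed_limit)
    show "(\<lambda>k. cinner (blinfun_apply E (restrict_L2 (idx (n + k)) v)) (restrict_L2 (idx (n + k)) v)) \<longlonglongrightarrow> cinner (blinfun_apply E v) v"
    proof -
      have "(\<lambda>k. restrict_L2 (idx (n + k)) v) \<longlonglongrightarrow> v"
        using LIMSEQ_ignore_initial_segment[OF restrict_idx_tendsto[of v], of n] by (simp add: add.commute)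
      then show ?thesis unfolding cinner_eq_inner Complex_eq
        by (intro tendsto_intros blinfun.tendsto bounded_linear.tendsto[OF bounded_linear_cscale])
    qed
  qed (rule fin[OF le_add1 restrict_in_fin_space])
  then show ?thesis using Ec by (simp add: positive_op_def E_def)
qed

lemma trace_cexp: "car_trace (cexp n x) = car_trace x"
  by (simp add: car_trace_def cexp_def combo_idx_vacuum cinner_restrict)
     (simp add: vacuum_def restrict_basis)

lemma cexp_eqI:
  assumes "right_inv y" "blinfun_apply y vacuum = restrict_L2 (idx n) (blinfun_apply x vacuum)"
  shows "cexp n x = y"
  using assms combo_right_inv[OF idx_car_index]
  by (intro right_inv_eqI) (auto simp: cexp_def combo_idx_vacuum)

text \<open>
  Both sides commute with right multiplications, so it suffices to compare them at the vacuum vector.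
\<close>

lemma cexp_bimodule:
  assumes n: "1 \<le> n" and x: "right_inv x" and y: "y \<in> CAR_fil n" and z: "z \<in> CAR_fil n"
  shows "cexp n (y o\<^sub>L x o\<^sub>L z) = y o\<^sub>L cexp n x o\<^sub>L z"
proof (rule cexp_eqI)
  have yr: "right_inv y" and zr: "right_inv z" using CAR_right_inv CAR_fil_CAR n y z by blast+
  have Er: "right_inv (cexp n x)" unfolding cexp_def by (rule combo_right_inv[OF idx_car_index])
  show "right_inv (y o\<^sub>L cexp n x o\<^sub>L z)" by (intro right_inv_compose yr zr Er)
  define \<zeta> where "\<zeta> = blinfun_apply z vacuum"
  have zz: "\<zeta> \<in> fin_space (idx n)"
  proof -
    have "\<zeta> = restrict_L2 (idx n) \<zeta>"
      unfolding \<zeta>_def by (subst (1) CAR_fil_iff[OF n, THEN iffD1, OF z]) (rule combo_idx_vacuum)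
    then show ?thesis by (metis restrict_in_fin_space)
  qed
  have yP: "restrict_L2 (idx n) (blinfun_apply y v) = blinfun_apply y (restrict_L2 (idx n) v)" for v
    using combo_restrict_commute[of "idx n" n] CAR_fil_iff[OF n, THEN iffD1, OF y] by (metis order_refl)
  show "blinfun_apply (y o\<^sub>L cexp n x o\<^sub>L z) vacuum = restrict_L2 (idx n) (blinfun_apply (y o\<^sub>L x o\<^sub>L z) vacuum)"
    by (simp add: \<zeta>_def[symmetric] yP cexp_compression[OF x zz])
qed

lemma is_cond_exp_cexp:
  assumes n: "1 \<le> n"
  shows "is_cond_exp (CAR_fil n) (cexp n)"
  unfolding is_cond_exp_def
proof (intro conjI ballI allI impI)
  show "cexp n x \<in> CAR_fil n" for x unfolding cexp_def by (rule combo_CAR_fil[OF n])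
  show "cexp n (x + y) = cexp n x + cexp n y" for x y
    by (rule blinfun_eqI, rule car_L2_eqI)
       (simp add: cexp_def combo_apply blinfun.add_left sum.distrib[symmetric] distrib_right)
  show "cexp n (cscale_op c x) = cscale_op c (cexp n x)" for x c
    by (rule blinfun_eqI, rule car_L2_eqI)
       (simp add: cexp_def combo_apply sum_distrib_left mult.assoc)
  show "positive_op (cexp n x)" if "x \<in> CAR" "positive_op x" for x
    using cexp_positive CAR_right_inv that by blast
  show "cexp n y = y" if "y \<in> CAR_fil n" for y
    using CAR_fil_iff[OF n] that unfolding cexp_def by metis
  show "cexp n (y o\<^sub>L x o\<^sub>L z) = y o\<^sub>L cexp n x o\<^sub>L z" if "x \<in> CAR" "y \<in> CAR_fil n" "z \<in> CAR_fil n" for x y z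
    using cexp_bimodule[OF n] CAR_right_inv that by blast
  show "car_trace (cexp n x) = car_trace x" for x by (rule trace_cexp)
qed

lemma trace_Lop_right:
  assumes x: "right_inv x" and A: "A \<in> car_index"
  shows "car_trace (x o\<^sub>L Lop A) = car_sign A A * coeff_L2 (blinfun_apply x vacuum) A"
proof -
  have "car_trace (x o\<^sub>L Lop A) = cinner (rmul A (blinfun_apply x vacuum)) vacuum"
    using A by (simp add: car_trace_def lmul_vacuum right_inv_basis[OF x])
  also have "\<dots> = car_sign A A * cinner (blinfun_apply x vacuum) (basis_L2 A)"
    using A by (simp add: cinner_rmul_left rmul_vacuum)
  finally show ?thesis by (simp add: cinner_basis)
qed

lemma right_inv_trace_eqI:
  assumes x: "right_inv x" and y: "right_inv y"
    and "\<And>A. A \<in> car_index \<Longrightarrow> car_trace (x o\<^sub>L Lop A) = car_trace (y o\<^sub>L Lop A)"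
  shows "x = y"
proof (rule right_inv_eqI[OF x y], rule car_L2_eqI)
  fix A assume A: "A \<in> car_index"
  show "coeff_L2 (blinfun_apply x vacuum) A = coeff_L2 (blinfun_apply y vacuum) A"
    using assms(3)[OF A] car_sign(1)[OF A A] by (auto simp: trace_Lop_right x y A)
qed

text \<open>
  Any conditional expectation \<open>E\<close> onto \<open>C\<^sub>n\<close> has the same coefficients, as
  \<open>\<tau>(E(x) c\<^sub>A) = \<tau>(E(x c\<^sub>A)) = \<tau>(x c\<^sub>A)\<close> for \<open>A \<subseteq> {1..n}\<close>.
\<close>

lemma cond_exp_eq:
  assumes n: "1 \<le> n" and x: "x \<in> CAR"
  shows "cond_exp n x = cexp n x"
proof -
  define E where "E = cond_exp n"
  have E: "is_cond_exp (CAR_fil n) E"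
    unfolding E_def cond_exp_def by (rule someI[where P = "is_cond_exp (CAR_fil n)"], rule is_cond_exp_cexp[OF n])
  have ExF: "E x \<in> CAR_fil n" using E x by (simp add: is_cond_exp_def)
  have "E x = combo (idx n) (coeff_L2 (blinfun_apply (E x) vacuum))" using CAR_fil_iff[OF n] ExF by blast
  also have "\<dots> = cexp n x"
    unfolding cexp_def combo_def
  proof (intro sum.cong refl arg_cong2[where f = cscale_op])
    fix A assume A: "A \<in> idx n"
    then have Ai: "A \<in> car_index" using idx_car_index by blast
    have LA: "Lop A \<in> CAR_fil n"
    proof -
      have "Lop A = combo (idx n) (\<lambda>B. if B = A then 1 else 0)"
        unfolding combo_def using A
        by (intro blinfun_eqI) (simp add: blinfun.sum_left if_distrib[of "\<lambda>c. cscale c _"] cong: if_cong)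
      then show ?thesis using combo_CAR_fil[OF n] by simp
    qed
    have id: "id_blinfun \<in> CAR_fil n" unfolding CAR_fil_def by (rule vn_generated_closed(6))
    have comp: "id_blinfun o\<^sub>L T = T" for T :: car_op by (rule blinfun_eqI) simp
    have "E (id_blinfun o\<^sub>L x o\<^sub>L Lop A) = id_blinfun o\<^sub>L E x o\<^sub>L Lop A"
      using E x id LA unfolding is_cond_exp_def by blast
    then have "E (x o\<^sub>L Lop A) = E x o\<^sub>L Lop A" by (simp only: comp)
    moreover have "car_trace (E (x o\<^sub>L Lop A)) = car_trace (x o\<^sub>L Lop A)"
      using E CAR_closed(3)[OF x Lop_CAR[OF Ai]] by (simp add: is_cond_exp_def)
    ultimately have "car_trace (E x o\<^sub>L Lop A) = car_trace (x o\<^sub>L Lop A)" by simp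
    then show "coeff_L2 (blinfun_apply (E x) vacuum) A = coeff_L2 (blinfun_apply x vacuum) A"
      using car_sign(1)[OF Ai Ai] CAR_right_inv[OF x] CAR_right_inv[OF CAR_fil_CAR[OF n ExF]] Ai
      by (auto simp: trace_Lop_right)
  qed
  finally show ?thesis by (simp add: E_def)
qed

lemma cond_exp_L2_eq:
  assumes n: "1 \<le> n"
  shows "cond_exp_L2 n = Pop n"
  unfolding cond_exp_L2_def
proof (rule the_equality)
  have ce: "blinfun_apply (cond_exp n y) vacuum = restrict_L2 (idx n) (blinfun_apply y vacuum)" if "y \<in> CAR" for y
    using that n by (simp add: cond_exp_eq cexp_def combo_idx_vacuum)
  then show "\<forall>y\<in>CAR. blinfun_apply (Pop n) (blinfun_apply y vacuum) = blinfun_apply (cond_exp n y) vacuum" by simp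
  fix P assume P: "\<forall>y\<in>CAR. blinfun_apply P (blinfun_apply y vacuum) = blinfun_apply (cond_exp n y) vacuum"
  show "P = Pop n"
  proof (rule blinfun_eqI)
    fix x
    have eq: "blinfun_apply P (restrict_L2 (idx m) x) = blinfun_apply (Pop n) (restrict_L2 (idx m) x)" for m
    proof -
      have "combo (idx m) (coeff_L2 x) \<in> CAR" by (rule combo_CAR[OF idx_car_index])
      then have "blinfun_apply P (blinfun_apply (combo (idx m) (coeff_L2 x)) vacuum) = restrict_L2 (idx n) (blinfun_apply (combo (idx m) (coeff_L2 x)) vacuum)"
        using P ce by simp
      then show ?thesis unfolding combo_idx_vacuum by simp
    qed
    have "(\<lambda>m. blinfun_apply P (restrict_L2 (idx m) x)) \<longlonglongrightarrow> blinfun_apply P x"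
      "(\<lambda>m. blinfun_apply (Pop n) (restrict_L2 (idx m) x)) \<longlonglongrightarrow> blinfun_apply (Pop n) x"
      by (intro blinfun.tendsto tendsto_const restrict_idx_tendsto)+
    then show "blinfun_apply P x = blinfun_apply (Pop n) x" unfolding eq by (rule LIMSEQ_unique)
  qed
qed

section \<open>Martingales as coefficient families\<close>

text \<open>
  A martingale is a single, possibly not square summable, family of coefficients; \<open>b\<^sub>n\<close> is its
  restriction to the subsets of \<open>{1..n}\<close>.
\<close>

definition has_coeffs :: "car_martingale \<Rightarrow> (nat set \<Rightarrow> complex) \<Rightarrow> bool" where
  "has_coeffs b \<beta> \<longleftrightarrow> (\<forall>n\<ge>1. b n = embed_L1 (combo (idx n) \<beta>))"

lemma embed_L1_diff: "embed_L1 (x - y) z = embed_L1 x z - embed_L1 y z"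
  by (simp add: embed_L1_def car_trace_def blinfun.diff_left)

lemma embed_L1_inj:
  assumes "x \<in> CAR" "y \<in> CAR" "embed_L1 x = embed_L1 y"
  shows "x = y"
proof (rule right_inv_trace_eqI[OF CAR_right_inv[OF assms(1)] CAR_right_inv[OF assms(2)]])
  fix A assume "A \<in> car_index"
  then show "car_trace (x o\<^sub>L Lop A) = car_trace (y o\<^sub>L Lop A)"
    using fun_cong[OF assms(3), of "Lop A"] Lop_CAR by (simp add: embed_L1_def)
qed

lemma bounded_element_embed: "x \<in> CAR \<Longrightarrow> bounded_element (embed_L1 x) = x"
  unfolding bounded_element_def by (rule the_equality) (use embed_L1_inj in auto)

lemma has_coeffs_diff:
  assumes "has_coeffs b \<beta>" "has_coeffs c \<gamma>"
  shows "has_coeffs (\<lambda>n z. b n z - c n z) (\<lambda>A. \<beta> A - \<gamma> A)"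
  unfolding has_coeffs_def
proof (intro allI impI ext)
  fix n :: nat and z assume "1 \<le> n"
  then show "b n z - c n z = embed_L1 (combo (idx n) (\<lambda>A. \<beta> A - \<gamma> A)) z"
    using assms unfolding has_coeffs_def combo_diff_coeffs embed_L1_diff by metis
qed

lemma has_coeffs_martingale_of:
  assumes "y \<in> CAR"
  shows "has_coeffs (martingale_of y) (coeff_L2 (blinfun_apply y vacuum))"
  using assms by (simp add: has_coeffs_def martingale_of_def cond_exp_eq cexp_def)

text \<open>
  The sets with \<open>max A = n\<close>, the convention \<open>max \<emptyset> = 1\<close> included.
\<close>

definition diff_idx :: "nat \<Rightarrow> nat set set" where
  "diff_idx n = (if n = 1 then idx 1 else idx n - idx (n - 1))"

lemma diff_idx_facts: "finite (diff_idx n)" "diff_idx n \<subseteq> idx n" "diff_idx n \<subseteq> car_index"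
  using idx_car_index[of n] idx_car_index[of 1] by (auto simp: diff_idx_def)

lemma diff_idx_Suc: "1 \<le> k \<Longrightarrow> A \<in> diff_idx (Suc k) \<longleftrightarrow> A \<in> idx (Suc k) \<and> Suc k \<in> A"
  by (auto simp: diff_idx_def mem_idx subset_iff le_Suc_eq)

lemma mdiff_eq_combo:
  assumes b: "has_coeffs b \<beta>" and n: "1 \<le> n"
  shows "mdiff b n = combo (diff_idx n) \<beta>"
proof -
  have "(\<lambda>z. b n z - (if n = 1 then 0 else b (n - 1) z)) = embed_L1 (combo (diff_idx n) \<beta>)"
  proof
    fix z
    show "b n z - (if n = 1 then 0 else b (n - 1) z) = embed_L1 (combo (diff_idx n) \<beta>) z"
    proof (cases "n = 1")
      case True
      then show ?thesis using b by (simp add: has_coeffs_def diff_idx_def)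
    next
      case False
      then have "combo (diff_idx n) \<beta> = combo (idx n) \<beta> - combo (idx (n - 1)) \<beta>"
        by (simp add: diff_idx_def) (rule combo_diff_sets, simp, rule idx_mono, simp)
      moreover have "1 \<le> n - 1" using n False by simp
      ultimately show ?thesis using b n False by (simp add: has_coeffs_def embed_L1_diff)
    qed
  qed
  then show ?thesis unfolding mdiff_def using bounded_element_embed[OF combo_CAR[OF diff_idx_facts(3)]] by simp
qed

lemma trace_cexp_compose:
  assumes n: "1 \<le> n" and x: "x \<in> CAR_fil n" and z: "right_inv z"
  shows "car_trace (x o\<^sub>L cexp n z) = car_trace (x o\<^sub>L z)"
proof -
  have id: "id_blinfun \<in> CAR_fil n" unfolding CAR_fil_def by (rule vn_generated_closed(6))
  have comp: "T o\<^sub>L id_blinfun = T" for T :: car_op by (rule blinfun_eqI) simp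
  have "x o\<^sub>L cexp n z = cexp n (x o\<^sub>L z)"
    using cexp_bimodule[OF n z x id] by (simp only: comp)
  then show ?thesis by (simp add: trace_cexp)
qed

lemma trace_cexp_compose':
  assumes n: "1 \<le> n" and z: "z \<in> CAR_fil n" and x: "right_inv x"
  shows "car_trace (cexp n x o\<^sub>L z) = car_trace (x o\<^sub>L z)"
proof -
  have id: "id_blinfun \<in> CAR_fil n" unfolding CAR_fil_def by (rule vn_generated_closed(6))
  have comp: "id_blinfun o\<^sub>L T = T" for T :: car_op by (rule blinfun_eqI) simp
  have "cexp n x o\<^sub>L z = cexp n (x o\<^sub>L z)"
    using cexp_bimodule[OF n x id z] by (simp only: comp)
  then show ?thesis by (simp add: trace_cexp)
qed

lemma L1_linear:
  assumes "\<phi> \<in> L1"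
  shows "x \<in> CAR \<Longrightarrow> y \<in> CAR \<Longrightarrow> \<phi> (x + y) = \<phi> x + \<phi> y"
    and "x \<in> CAR \<Longrightarrow> \<phi> (cscale_op c x) = c * \<phi> x"
    and "z \<notin> CAR \<Longrightarrow> \<phi> z = 0"
proof -
  obtain a where a: "\<And>m. a m \<in> CAR" "\<And>z. (\<lambda>m. embed_L1 (a m) z) \<longlonglongrightarrow> \<phi> z"
    using assms unfolding L1_def by blast
  show "\<phi> (x + y) = \<phi> x + \<phi> y" if "x \<in> CAR" "y \<in> CAR"
  proof (rule LIMSEQ_unique[OF a(2)])
    have "embed_L1 (a m) (x + y) = embed_L1 (a m) x + embed_L1 (a m) y" for m
      using that CAR_closed(1) by (simp add: embed_L1_def car_trace_def blinfun.add_left blinfun.add_right)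
    then show "(\<lambda>m. embed_L1 (a m) (x + y)) \<longlonglongrightarrow> \<phi> x + \<phi> y" using tendsto_add[OF a(2)[of x] a(2)[of y]] by simp
  qed
  show "\<phi> (cscale_op c x) = c * \<phi> x" if "x \<in> CAR"
  proof (rule LIMSEQ_unique[OF a(2)])
    have "embed_L1 (a m) (cscale_op c x) = c * embed_L1 (a m) x" for m
      using that CAR_closed(4) right_invD(1)[OF CAR_right_inv[OF a(1)[of m]]]
      by (simp add: embed_L1_def car_trace_def clinear_cscale)
    then show "(\<lambda>m. embed_L1 (a m) (cscale_op c x)) \<longlonglongrightarrow> c * \<phi> x" using tendsto_mult_left[OF a(2)[of x], of c] by simp
  qed
  show "\<phi> z = 0" if "z \<notin> CAR" using a(2)[of z] that by (simp add: embed_L1_def LIMSEQ_const_iff)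
qed

lemma L1_combo:
  assumes \<phi>: "\<phi> \<in> L1" and S: "finite S" "S \<subseteq> car_index"
  shows "\<phi> (combo S \<alpha>) = (\<Sum>A\<in>S. \<alpha> A * \<phi> (Lop A))"
  using S
proof (induction S rule: finite_induct)
  case empty
  have "\<phi> (cscale_op 0 id_blinfun) = 0 * \<phi> id_blinfun"
    by (rule L1_linear(2)[OF \<phi> CAR_closed(6)])
  moreover have "cscale_op 0 id_blinfun = (0 :: car_op)" by (rule blinfun_eqI) simp
  ultimately show ?case by (simp add: combo_def)
next
  case (insert A S)
  have "combo (insert A S) \<alpha> = cscale_op (\<alpha> A) (Lop A) + combo S \<alpha>" using insert by (simp add: combo_def)
  moreover have "\<phi> (cscale_op (\<alpha> A) (Lop A) + combo S \<alpha>) = \<phi> (cscale_op (\<alpha> A) (Lop A)) + \<phi> (combo S \<alpha>)"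
    using insert by (intro L1_linear(1)[OF \<phi>] CAR_closed(4) Lop_CAR combo_CAR) auto
  ultimately show ?case using insert L1_linear(2)[OF \<phi> Lop_CAR[of A]] by simp
qed

text \<open>
  The functional \<open>b\<^sub>n\<close> is invariant under \<open>E\<^sub>n\<close>, so it depends only on its finitely many values at the
  \<open>c\<^sub>A\<close> with \<open>A \<subseteq> {1..n}\<close>, and an element of \<open>C\<^sub>n\<close> with these values is written down.
\<close>

lemma martingale_element:
  assumes b: "martingale b" and n: "1 \<le> n"
  obtains x where "x \<in> CAR_fil n" "b n = embed_L1 x"
proof -
  define \<phi> where "\<phi> = b n"
  have \<phi>: "\<phi> \<in> L1" using b n by (simp add: martingale_def \<phi>_def)
  have Suc: "b (Suc n) \<in> L1" using b n by (simp add: martingale_def)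
  have inv: "\<phi> (cexp n z) = \<phi> z" if "z \<in> CAR" for z
  proof -
    have "cexp n z \<in> CAR" unfolding cexp_def by (rule combo_CAR[OF idx_car_index])
    moreover have "cexp n (cexp n z) = cexp n z"
      using is_cond_exp_cexp[OF n] that unfolding is_cond_exp_def by blast
    moreover have eq: "\<phi> = (\<lambda>z. if z \<in> CAR then b (Suc n) (cond_exp n z) else 0)"
      using b n unfolding martingale_def cond_exp_L1_def \<phi>_def by metis
    ultimately show ?thesis using that n by (simp add: cond_exp_eq)
  qed
  define x where "x = combo (idx n) (\<lambda>A. car_sign A A * \<phi> (Lop A))"
  have x: "x \<in> CAR_fil n" unfolding x_def by (rule combo_CAR_fil[OF n])
  have xr: "right_inv x" using x CAR_fil_CAR[OF n] CAR_right_inv by blast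
  have "\<phi> z = embed_L1 x z" for z
  proof (cases "z \<in> CAR")
    case True
    define \<gamma> where "\<gamma> = coeff_L2 (blinfun_apply z vacuum)"
    have "\<phi> z = (\<Sum>A\<in>idx n. \<gamma> A * \<phi> (Lop A))"
      unfolding inv[OF True, symmetric] cexp_def \<gamma>_def by (rule L1_combo[OF \<phi> _ idx_car_index]) simp
    also have "\<dots> = (\<Sum>A\<in>idx n. \<gamma> A * car_trace (x o\<^sub>L Lop A))"
    proof (intro sum.cong refl arg_cong2[where f = "(*)"])
      fix A assume A: "A \<in> idx n"
      then have Ai: "A \<in> car_index" using idx_car_index by blast
      have "coeff_L2 (blinfun_apply x vacuum) A = car_sign A A * \<phi> (Lop A)"
        unfolding x_def using A idx_car_index by (subst combo_vacuum) auto
      then show "\<phi> (Lop A) = car_trace (x o\<^sub>L Lop A)"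
        using Ai by (simp add: trace_Lop_right[OF xr] mult.assoc[symmetric])
    qed
    also have "\<dots> = car_trace (x o\<^sub>L cexp n z)"
      unfolding cexp_def \<gamma>_def[symmetric]
      by (simp add: car_trace_def combo_apply blinfun.sum_right cinner_sum_left clinear_cscale[OF right_invD(1)[OF xr]])
    also have "\<dots> = car_trace (x o\<^sub>L z)"
      by (rule trace_cexp_compose[OF n x CAR_right_inv[OF True]])
    finally show ?thesis using True by (simp add: embed_L1_def)
  next
    case False
    then show ?thesis using L1_linear(3)[OF \<phi>] by (simp add: embed_L1_def)
  qed
  then show ?thesis using that[OF x] by (simp add: \<phi>_def fun_eq_iff)
qed

text \<open>
  The elements \<open>x\<^sub>n\<close> representing \<open>b\<^sub>n\<close> satisfy \<open>E\<^sub>n(x\<^sub>n\<^sub>+\<^sub>1) = x\<^sub>n\<close>, so their coefficients are compatible.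
  The coefficient at \<open>A\<close> is read off at the first level containing \<open>A\<close>.
\<close>

lemma martingale_coeffs:
  assumes b: "martingale b"
  obtains \<beta> where "has_coeffs b \<beta>"
proof -
  have "\<exists>x. x \<in> CAR_fil n \<and> b n = embed_L1 x" if "1 \<le> n" for n
    using martingale_element[OF b that] by metis
  then obtain X where X: "\<And>n. 1 \<le> n \<Longrightarrow> X n \<in> CAR_fil n" "\<And>n. 1 \<le> n \<Longrightarrow> b n = embed_L1 (X n)" by metis
  have XC: "X n \<in> CAR" if "1 \<le> n" for n using X(1) CAR_fil_CAR that by blast
  have step: "cexp n (X (Suc n)) = X n" if n: "1 \<le> n" for n
  proof (rule embed_L1_inj[OF _ XC[OF n]])
    show c: "cexp n (X (Suc n)) \<in> CAR" unfolding cexp_def by (rule combo_CAR[OF idx_car_index])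
    have XS: "right_inv (X (Suc n))" using XC[of "Suc n"] CAR_right_inv by simp
    have "embed_L1 (cexp n (X (Suc n))) z = embed_L1 (X n) z" for z
    proof (cases "z \<in> CAR")
      case True
      have zF: "cexp n z \<in> CAR_fil n" unfolding cexp_def by (rule combo_CAR_fil[OF n])
      have zC: "cexp n z \<in> CAR" by (rule CAR_fil_CAR[OF n zF])
      have "cond_exp_L1 n (b (Suc n)) = b n" using b n unfolding martingale_def by blast
      then have "b n z = cond_exp_L1 n (b (Suc n)) z" by simp
      also have "\<dots> = b (Suc n) (cexp n z)" using True by (simp add: cond_exp_L1_def cond_exp_eq[OF n True])
      finally have "b n z = b (Suc n) (cexp n z)" .
      also have "\<dots> = car_trace (X (Suc n) o\<^sub>L cexp n z)" using X(2)[of "Suc n"] zC by (simp add: embed_L1_def)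
      also have "\<dots> = car_trace (cexp n (X (Suc n)) o\<^sub>L cexp n z)"
        by (rule trace_cexp_compose'[OF n zF XS, symmetric])
      also have "\<dots> = car_trace (cexp n (X (Suc n)) o\<^sub>L z)"
        by (rule trace_cexp_compose[OF n _ CAR_right_inv[OF True]]) (simp add: cexp_def combo_CAR_fil[OF n])
      finally show ?thesis using X(2)[OF n] True by (simp add: embed_L1_def)
    qed (simp add: embed_L1_def)
    then show "embed_L1 (cexp n (X (Suc n))) = embed_L1 (X n)" by blast
  qed
  define \<xi> where "\<xi> n = blinfun_apply (X n) vacuum" for n
  have \<xi>: "restrict_L2 (idx n) (\<xi> (Suc n)) = \<xi> n" if "1 \<le> n" for n
    using arg_cong[OF step[OF that], of "\<lambda>T. blinfun_apply T vacuum"] by (simp add: \<xi>_def cexp_def combo_idx_vacuum)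
  define m where "m A = (LEAST n. 1 \<le> n \<and> A \<in> idx n)" for A
  define \<beta> where "\<beta> A = coeff_L2 (\<xi> (m A)) A" for A
  have same: "coeff_L2 (\<xi> (k + n)) A = coeff_L2 (\<xi> n) A" if "1 \<le> n" "A \<in> idx n" for k n A
  proof (induction k)
    case (Suc k)
    have "A \<in> idx (k + n)" using that idx_mono[of n "k + n"] by auto
    then show ?case using Suc \<xi>[of "k + n"] that coeff_restrict[of "idx (k + n)" "\<xi> (Suc (k + n))" A] by simp
  qed simp
  have "b n = embed_L1 (combo (idx n) \<beta>)" if n: "1 \<le> n" for n
  proof -
    have "X n = combo (idx n) (coeff_L2 (\<xi> n))" unfolding \<xi>_def using X(1)[OF n] CAR_fil_iff[OF n] by blast
    also have "\<dots> = combo (idx n) \<beta>"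
      unfolding combo_def
    proof (intro sum.cong refl arg_cong2[where f = cscale_op])
      fix A assume A: "A \<in> idx n"
      have mA: "1 \<le> m A \<and> A \<in> idx (m A)" unfolding m_def by (rule LeastI[of _ n]) (use n A in simp)
      have "m A \<le> n" unfolding m_def by (rule Least_le) (use n A in simp)
      then show "coeff_L2 (\<xi> n) A = \<beta> A" using same[of "m A" A "n - m A"] mA by (simp add: \<beta>_def)
    qed
    finally show ?thesis using X(2)[OF n] by simp
  qed
  then show ?thesis using that[of \<beta>] by (simp add: has_coeffs_def)
qed

section \<open>Moments of operators commuting with right multiplications\<close>

definition gram :: "car_op \<Rightarrow> car_op" where "gram T = adj T o\<^sub>L T"

text \<open>
  \<open>\<tau>(|T|\<^sup>p)\<close>, defined with the real inner product.
\<close>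

definition moment :: "real \<Rightarrow> car_op \<Rightarrow> real" where
  "moment p T = inner (blinfun_apply (fun_calc (\<lambda>t. t powr (p / 2)) (gram T)) vacuum) vacuum"

lemma gram_psd: "T \<in> clinear_ops \<Longrightarrow> psd (gram T)"
  unfolding gram_def by (rule psd_adj_compose(1))

lemma gram_form: "T \<in> clinear_ops \<Longrightarrow> inner (blinfun_apply (gram T) x) x = (norm (blinfun_apply T x))\<^sup>2"
  unfolding gram_def by (rule psd_adj_compose(2))

lemma gram_cinner: "T \<in> clinear_ops \<Longrightarrow> cinner (blinfun_apply (gram T) x) y = cinner (blinfun_apply T x) (blinfun_apply T y)"
  unfolding gram_def by (subst (1) cinner_commute, subst (2) cinner_commute) (simp add: adj_props(2))

lemma gram_right_inv: "right_inv T \<Longrightarrow> right_inv (gram T)"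
  unfolding gram_def by (intro right_inv_compose right_inv_adj)

lemma eigval_gram: "T \<in> clinear_ops \<Longrightarrow> 0 \<le> eigval (gram T) u"
  by (simp add: gram_form)

lemma powr_cont: "0 < p \<Longrightarrow> continuous_on {0..c} (\<lambda>t::real. t powr (p / 2))"
  by (rule continuous_on_powr_nonneg) simp

lemma Lp_norm_powr:
  assumes "0 < p" "0 \<le> moment p T"
  shows "Lp_norm p T powr p = moment p T"
  using assms by (simp add: Lp_norm_def car_trace_def abs_powr_def moment_def gram_def inner_eq_Re powr_powr)

lemma moment_zero:
  assumes "0 < p"
  shows "moment p 0 = 0"
proof -
  have g: "gram 0 = 0" by (simp add: gram_def adj_zero)
  have "norm vacuum = 1"
  proof -
    have "cinner vacuum vacuum = 1" by (simp add: vacuum_def cinner_basis coeff_basis)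
    then have "(norm vacuum)\<^sup>2 = 1" by (metis cinner_self of_real_eq_1_iff)
    then show ?thesis using norm_ge_zero[of vacuum] by (simp add: power2_eq_1_iff)
  qed
  then have "blinfun_apply (fun_calc (\<lambda>t. t powr (p / 2)) (gram 0)) vacuum = (0 powr (p / 2)) *\<^sub>R vacuum"
    by (intro fun_calc_eigenvector gram_psd clinear_ops_zero powr_cont assms) (simp_all add: g)
  then show ?thesis by (simp add: moment_def)
qed

lemma combo_support:
  assumes SW: "\<And>A C. A \<in> S \<Longrightarrow> C \<notin> W' \<Longrightarrow> sdiff A C \<notin> W" and x: "x \<in> fin_space W"
  shows "blinfun_apply (combo S \<beta>) x \<in> fin_space W'"
  unfolding fin_space_def combo_apply
proof (intro CollectI allI impI)
  fix C assume C: "C \<notin> W'"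
  have "coeff_L2 (lmul A x) C = 0" if "A \<in> S" for A
    using SW[OF that C] x by (simp add: coeff_lmul fin_space_def)
  then show "coeff_L2 (\<Sum>A\<in>S. cscale (\<beta> A) (lmul A x)) C = 0" by simp
qed

text \<open>
  Multiplication by \<open>c\<^sub>A\<close> permutes the basis vectors up to sign by \<open>B \<mapsto> A \<triangle> B\<close>. If all \<open>A\<close> in the support
  of \<open>T\<close> carry \<open>W\<close> and its complement into \<open>W'\<close> and its complement, then \<open>T\<close> respects the corresponding
  orthogonal decompositions, and \<open>T\<^sup>* T\<close> preserves the span of \<open>W\<close>.
\<close>

lemma gram_invariant:
  assumes S: "S \<subseteq> car_index" and SW: "\<And>A B. A \<in> S \<Longrightarrow> B \<in> car_index \<Longrightarrow> sdiff A B \<in> W' \<longleftrightarrow> B \<in> W"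
    and W: "W \<subseteq> car_index" "W' \<subseteq> car_index" and x: "x \<in> fin_space W"
  shows "blinfun_apply (gram (combo S \<beta>)) x \<in> fin_space W"
  unfolding fin_space_def
proof (intro CollectI allI impI)
  fix B assume B: "B \<notin> W"
  show "coeff_L2 (blinfun_apply (gram (combo S \<beta>)) x) B = 0"
  proof (cases "B \<in> car_index")
    case True
    have Tx: "coeff_L2 (blinfun_apply (combo S \<beta>) x) C = 0" if C: "C \<notin> W'" for C
    proof (cases "C \<in> car_index")
      case Ci: True
      have "coeff_L2 (lmul A x) C = 0" if A: "A \<in> S" for A
      proof -
        have "sdiff A C \<in> car_index" using A S Ci by (auto intro: sdiff_car_index)
        then have "sdiff A C \<notin> W" using SW[OF A, of "sdiff A C"] C by simp
        then show ?thesis using x by (simp add: coeff_lmul fin_space_def)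
      qed
      then show ?thesis by (simp add: combo_apply)
    qed (rule coeff_outside)
    have TB: "coeff_L2 (blinfun_apply (combo S \<beta>) (basis_L2 B)) C = 0" if C: "C \<in> W'" for C
    proof -
      have "coeff_L2 (lmul A (basis_L2 B)) C = 0" if A: "A \<in> S" for A
      proof -
        have "sdiff A C \<noteq> B" using SW[OF A True] B C sdiff_simps(4)[of A C] by auto
        then show ?thesis by (simp add: coeff_lmul coeff_basis)
      qed
      then show ?thesis by (simp add: combo_apply)
    qed
    have "coeff_L2 (blinfun_apply (gram (combo S \<beta>)) x) B
        = cinner (blinfun_apply (combo S \<beta>) x) (blinfun_apply (combo S \<beta>) (basis_L2 B))"
      unfolding cinner_basis[symmetric] by (rule gram_cinner[OF combo_clinear])
    also have "\<dots> = 0" using Tx TB by (intro cinner_disjoint) blast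
    finally show ?thesis .
  qed (rule coeff_outside)
qed

text \<open>
  All diagonal entries of \<open>|T|\<^sup>p\<close> are equal to \<open>\<tau>(|T|\<^sup>p)\<close>, because \<open>e\<^sub>A\<close> is the image of the vacuum vector
  under an isometry commuting with \<open>|T|\<^sup>p\<close>.
\<close>

lemma moment_form:
  assumes p: "0 < p" and T: "right_inv T" and W: "finite W" "W \<subseteq> car_index"
    and U: "spectral_basis (gram T) (fin_space W) U" and b: "b \<in> real_basis W"
  shows "diag_form U (\<lambda>u. eigval (gram T) u powr (p / 2)) b = moment p T"
proof -
  define f where "f = fun_calc (\<lambda>t. t powr (p / 2)) (gram T)"
  note Tc = right_invD(1)[OF T]
  note psd = gram_psd[OF Tc]
  have bV: "b \<in> fin_space W" using is_onbD(3)[OF onb_real_basis[OF W] b] .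
  have eq: "diag_form U (\<lambda>u. eigval (gram T) u powr (p / 2)) b = inner (blinfun_apply f b) b"
    unfolding f_def by (rule fun_calc_form[OF psd powr_cont[OF p] U bV, symmetric])
  have fc: "f \<in> clinear_ops" unfolding f_def by (rule fun_calc_clinear[OF psd powr_cont[OF p]])
  have basis: "inner (blinfun_apply f (basis_L2 A)) (basis_L2 A) = moment p T" if A: "A \<in> W" for A
  proof -
    have Ai: "A \<in> car_index" using A W by blast
    have "rmul A (blinfun_apply f vacuum) = blinfun_apply f (rmul A vacuum)"
      unfolding f_def
      by (rule fun_calc_intertwine[OF psd powr_cont[OF p] bounded_linear_rmul])
         (use right_invD(2)[OF gram_right_inv[OF T] Ai] in simp)
    then have "blinfun_apply f (basis_L2 A) = rmul A (blinfun_apply f vacuum)"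
      using Ai by (simp add: rmul_vacuum)
    then have "inner (blinfun_apply f (basis_L2 A)) (basis_L2 A) = inner (rmul A (blinfun_apply f vacuum)) (rmul A vacuum)"
      using Ai by (simp add: rmul_vacuum)
    then show ?thesis by (simp add: inner_rmul[OF Ai] moment_def f_def)
  qed
  from b consider A where "A \<in> W" "b = basis_L2 A" | A where "A \<in> W" "b = cscale \<i> (basis_L2 A)"
    by (auto simp: real_basis_def)
  then show ?thesis
    unfolding eq using basis inner_clinear_i[OF fc] by cases auto
qed

text \<open>
  The trace of \<open>|T|\<^sup>p\<close> on the span of \<open>W\<close>, doubled by passing to the real space. For \<open>W = Pow {1..k}\<close> this
  is the source of the weight \<open>2\<^sup>k\<close> in the Besov norm.
\<close>

lemma moment_sum:
  assumes p: "0 < p" and T: "right_inv T" and W: "finite W" "W \<subseteq> car_index"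
    and U: "spectral_basis (gram T) (fin_space W) U"
  shows "(\<Sum>u\<in>U. eigval (gram T) u powr (p / 2)) = 2 * real (card W) * moment p T"
proof -
  note onb = spectral_basisD(1)[OF U]
  have "(\<Sum>u\<in>U. eigval (gram T) u powr (p / 2)) = (\<Sum>b\<in>real_basis W. diag_form U (\<lambda>u. eigval (gram T) u powr (p / 2)) b)"
    using is_onbD[OF onb] by (intro sum_diag_form_onb[OF onb_real_basis[OF W], symmetric]) auto
  also have "\<dots> = (\<Sum>b\<in>real_basis W. moment p T)"
    by (intro sum.cong refl moment_form[OF p T W U])
  also have "\<dots> = 2 * real (card W) * moment p T" by (subst sum_real_basis[OF W]) simp
  finally show ?thesis .
qed

lemma moment_nonneg:
  assumes p: "0 < p" and T: "right_inv T" and W: "finite W" "W \<subseteq> car_index" "W \<noteq> {}"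
    and inv: "\<And>x. x \<in> fin_space W \<Longrightarrow> blinfun_apply (gram T) x \<in> fin_space W"
  shows "0 \<le> moment p T"
proof -
  obtain U where U: "spectral_basis (gram T) (fin_space W) U"
    using spectral_basis_exists[OF W(1,2) gram_psd[OF right_invD(1)[OF T]] inv] by blast
  have "0 \<le> (\<Sum>u\<in>U. eigval (gram T) u powr (p / 2))" by (intro sum_nonneg) simp
  then have "0 \<le> 2 * real (card W) * moment p T" unfolding moment_sum[OF p T W(1,2) U] .
  moreover have "0 < real (card W)" using W by (simp add: card_gt_0_iff)
  ultimately show ?thesis by (simp add: zero_le_mult_iff)
qed

lemma psd_add: "psd S \<Longrightarrow> psd T \<Longrightarrow> psd (S + T)"
  unfolding psd_def by (auto simp: clinear_ops_add blinfun.add_left inner_add_left inner_add_right)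

lemma combo_add_coeffs: "combo S (\<lambda>A. \<beta> A + \<gamma> A) = combo S \<beta> + combo S \<gamma>"
  by (rule blinfun_eqI)
     (auto simp: combo_apply blinfun.add_left sum.distrib[symmetric] algebra_simps intro!: car_L2_eqI sum.cong)

lemma norm_add_sq_le: "(norm (x + y))\<^sup>2 \<le> 2 * (norm x)\<^sup>2 + 2 * (norm (y::'a::real_normed_vector))\<^sup>2"
proof -
  have "(norm (x + y))\<^sup>2 \<le> (norm x + norm y)\<^sup>2" by (intro power_mono norm_triangle_ineq) simp
  also have "\<dots> \<le> 2 * (norm x)\<^sup>2 + 2 * (norm y)\<^sup>2" using sum_squares_bound[of "norm x" "norm y"] by (simp add: power2_sum)
  finally show ?thesis .
qed

text \<open>
  The quasi-triangle inequality for \<open>\<tau>(|x|\<^sup>p)\<close> on \<open>C\<^sub>n\<close>, obtained from \<open>|x + y|\<^sup>2 \<le> 2 |x|\<^sup>2 + 2 |y|\<^sup>2\<close> by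
  comparing traces of powers \<open>q = p / 2\<close> on \<open>L\<^sub>2(C\<^sub>n)\<close>. For \<open>q \<ge> 1\<close> Jensen's inequality in an eigenbasis of
  \<open>|x + y|\<^sup>2\<close> suffices; for \<open>q \<le> 1\<close> monotonicity and subadditivity of the trace are used.
\<close>

lemma moment_combo_add:
  assumes p: "0 < p" and S: "S \<subseteq> idx n"
  shows "moment p (combo S (\<lambda>A. \<beta> A + \<gamma> A)) \<le> 16 powr p * (moment p (combo S \<beta>) + moment p (combo S \<gamma>))"
proof -
  define V where "V = fin_space (idx n)"
  define T1 T2 T where "T1 = combo S \<beta>" and "T2 = combo S \<gamma>" and "T = combo S (\<lambda>A. \<beta> A + \<gamma> A)"
  have Sc: "S \<subseteq> car_index" using S idx_car_index by blast
  have r: "right_inv T1" "right_inv T2" "right_inv T" unfolding T1_def T2_def T_def by (intro combo_right_inv Sc)+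
  note cl = r[THEN right_invD(1)]
  have inv: "blinfun_apply (gram (combo S \<alpha>)) x \<in> fin_space (idx n)" if "x \<in> fin_space (idx n)" for \<alpha> x
  proof (rule gram_invariant[OF Sc _ idx_car_index idx_car_index that])
    fix A B assume "A \<in> S"
    then have "A \<in> idx n" using S by blast
    then show "sdiff A B \<in> idx n \<longleftrightarrow> B \<in> idx n" unfolding sdiff_def mem_idx by blast
  qed
  obtain U where U: "spectral_basis (gram T) V U" unfolding V_def
    by (rule spectral_basis_exists[OF finite_idx idx_car_index gram_psd[OF cl(3)]]) (auto simp: T_def inv)
  obtain U1 where U1: "spectral_basis (gram T1) V U1" unfolding V_def
    by (rule spectral_basis_exists[OF finite_idx idx_car_index gram_psd[OF cl(1)]]) (auto simp: T1_def inv)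
  obtain U2 where U2: "spectral_basis (gram T2) V U2" unfolding V_def
    by (rule spectral_basis_exists[OF finite_idx idx_car_index gram_psd[OF cl(2)]]) (auto simp: T2_def inv)
  note onb = spectral_basisD(1)[OF U] and onb1 = spectral_basisD(1)[OF U1] and onb2 = spectral_basisD(1)[OF U2]
  define l l1 l2 where "l = eigval (gram T)" and "l1 = eigval (gram T1)" and "l2 = eigval (gram T2)"
  have l: "0 \<le> l u" "0 \<le> l1 u" "0 \<le> l2 u" for u
    unfolding l_def l1_def l2_def by (intro eigval_gram cl)+
  have f: "diag_form U l v = (norm (blinfun_apply T v))\<^sup>2" "diag_form U1 l1 v = (norm (blinfun_apply T1 v))\<^sup>2"
    "diag_form U2 l2 v = (norm (blinfun_apply T2 v))\<^sup>2" if "v \<in> V" for v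
    unfolding l_def l1_def l2_def
    using operator_form[OF U that] operator_form[OF U1 that] operator_form[OF U2 that] by (simp_all add: gram_form cl)
  have le: "diag_form U l v \<le> 2 * diag_form U1 l1 v + 2 * diag_form U2 l2 v" if "v \<in> V" for v
    unfolding f[OF that] T_def combo_add_coeffs T1_def T2_def blinfun.add_left by (rule norm_add_sq_le)
  define q where "q = p / 2"
  have q: "0 < q" using p by (simp add: q_def)
  have "(\<Sum>u\<in>U. l u powr q) \<le> 16 powr p * ((\<Sum>u\<in>U1. l1 u powr q) + (\<Sum>u\<in>U2. l2 u powr q))"
  proof (cases "1 \<le> q")
    case True
    have c: "(4::real) powr q * 1 \<le> 16 powr p"
    proof -
      have "(4::real) powr q \<le> 16 powr q" using q by (intro powr_mono2) auto
      also have "\<dots> \<le> 16 powr p" using p by (intro powr_mono) (auto simp: q_def)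
      finally show ?thesis by simp
    qed
    have s1: "(\<Sum>u\<in>U. diag_form U1 (\<lambda>w. l1 w powr q) u) = (\<Sum>u\<in>U1. l1 u powr q)"
      by (rule sum_diag_form_onb[OF onb]) (use is_onbD[OF onb1] in auto)
    have s2: "(\<Sum>u\<in>U. diag_form U2 (\<lambda>w. l2 w powr q) u) = (\<Sum>u\<in>U2. l2 u powr q)"
      by (rule sum_diag_form_onb[OF onb]) (use is_onbD[OF onb2] in auto)
    have "(\<Sum>u\<in>U. l u powr q) \<le> (\<Sum>u\<in>U. 4 powr q * (diag_form U1 (\<lambda>w. l1 w powr q) u + diag_form U2 (\<lambda>w. l2 w powr q) u))"
    proof (rule sum_mono)
      fix u assume u: "u \<in> U"
      have uV: "u \<in> V" and nu: "norm u = 1" using is_onbD[OF onb] u by auto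
      have d: "0 \<le> diag_form U1 l1 u" "0 \<le> diag_form U2 l2 u" using l by (auto simp: diag_form_def intro!: sum_nonneg)
      have "l u = diag_form U l u" using diag_form_basis[OF onb u] by simp
      also have "\<dots> \<le> 2 * (diag_form U1 l1 u + diag_form U2 l2 u)" using le[OF uV] by simp
      finally have "l u powr q \<le> (2 * (diag_form U1 l1 u + diag_form U2 l2 u)) powr q"
        using l q by (intro powr_mono2) auto
      also have "\<dots> = 2 powr q * (diag_form U1 l1 u + diag_form U2 l2 u) powr q" using d by (intro powr_mult)
      also have "\<dots> \<le> 2 powr q * (2 powr q * (diag_form U1 l1 u powr q + diag_form U2 l2 u powr q))"
        using d q by (intro mult_left_mono powr_add_le) auto
      also have "\<dots> \<le> 2 powr q * (2 powr q * (diag_form U1 (\<lambda>w. l1 w powr q) u + diag_form U2 (\<lambda>w. l2 w powr q) u))"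
        using l uV nu True
        by (intro mult_left_mono add_mono diag_form_powr_jensen[OF onb1] diag_form_powr_jensen[OF onb2]) auto
      also have "\<dots> = 4 powr q * (diag_form U1 (\<lambda>w. l1 w powr q) u + diag_form U2 (\<lambda>w. l2 w powr q) u)"
        using powr_mult[of 2 2 q] by simp
      finally show "l u powr q \<le> 4 powr q * (diag_form U1 (\<lambda>w. l1 w powr q) u + diag_form U2 (\<lambda>w. l2 w powr q) u)" .
    qed
    also have "\<dots> = 4 powr q * ((\<Sum>u\<in>U1. l1 u powr q) + (\<Sum>u\<in>U2. l2 u powr q))"
      by (simp add: sum_distrib_left[symmetric] sum.distrib s1 s2)
    also have "\<dots> \<le> 16 powr p * ((\<Sum>u\<in>U1. l1 u powr q) + (\<Sum>u\<in>U2. l2 u powr q))"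
      using c by (intro mult_right_mono add_nonneg_nonneg sum_nonneg) auto
    finally show ?thesis .
  next
    case False
    define Y where "Y = gram T1 + gram T2"
    have Y: "psd Y" unfolding Y_def by (intro psd_add gram_psd cl)
    obtain Z where Z: "spectral_basis Y V Z" unfolding V_def
      by (rule spectral_basis_exists[OF finite_idx idx_car_index Y])
         (auto simp: Y_def blinfun.add_left T1_def T2_def inv intro!: subspace_add[OF subspace_fin_space])
    note onbZ = spectral_basisD(1)[OF Z]
    define z where "z = eigval Y"
    have z: "0 \<le> z u" for u unfolding z_def by (rule psdD(3)[OF Y])
    have Yf: "diag_form Z z v = diag_form U1 l1 v + diag_form U2 l2 v" if v: "v \<in> V" for v
      using operator_form[OF Z v] unfolding f[OF v] z_def
      by (simp add: Y_def blinfun.add_left inner_add_left gram_form cl)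
    have "(\<Sum>u\<in>U. l u powr q) \<le> (\<Sum>b\<in>Z. diag_form Z (\<lambda>u. (2 * z u) powr q) b)"
    proof (rule trace_powr_mono[OF onbZ _ onb order_refl])
      fix v assume v: "v \<in> V"
      have "diag_form Z (\<lambda>u. 2 * z u) v = 2 * diag_form Z z v" by (simp add: diag_form_def sum_distrib_left mult.assoc)
      then show "diag_form U l v \<le> diag_form Z (\<lambda>u. 2 * z u) v" using le[OF v] Yf[OF v] by simp
    qed (use z l q onbZ in auto)
    also have "\<dots> = (\<Sum>u\<in>Z. (2 * z u) powr q)"
      by (rule sum_diag_form_onb[OF onbZ]) (use is_onbD[OF onbZ] in auto)
    also have "\<dots> = 2 powr q * (\<Sum>u\<in>Z. z u powr q)"
      using z by (simp add: powr_mult sum_distrib_left)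
    also have "(\<Sum>u\<in>Z. z u powr q) \<le> (\<Sum>j\<in>U1 <+> U2. (case j of Inl u \<Rightarrow> l1 u | Inr u \<Rightarrow> l2 u) powr q)"
    proof (rule trace_powr_decomposition(2)[OF onbZ, where w = "\<lambda>j. case j of Inl u \<Rightarrow> u | Inr u \<Rightarrow> u"])
      fix v assume v: "v \<in> V"
      show "diag_form Z z v = (\<Sum>j\<in>U1 <+> U2. (case j of Inl u \<Rightarrow> l1 u | Inr u \<Rightarrow> l2 u) * (inner v (case j of Inl u \<Rightarrow> u | Inr u \<Rightarrow> u))\<^sup>2)"
        unfolding Yf[OF v] using is_onbD(2)[OF onb1] is_onbD(2)[OF onb2] by (simp add: sum.Plus diag_form_def)
    qed (use z l q False is_onbD[OF onb1] is_onbD[OF onb2] in auto)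
    also have "\<dots> = (\<Sum>u\<in>U1. l1 u powr q) + (\<Sum>u\<in>U2. l2 u powr q)"
      using is_onbD(2)[OF onb1] is_onbD(2)[OF onb2] by (simp add: sum.Plus)
    finally have 1: "(\<Sum>u\<in>U. l u powr q) \<le> 2 powr q * ((\<Sum>u\<in>U1. l1 u powr q) + (\<Sum>u\<in>U2. l2 u powr q))" by simp
    have "(2::real) powr q \<le> 16 powr q" using q by (intro powr_mono2) auto
    also have "\<dots> \<le> 16 powr p" using p by (intro powr_mono) (auto simp: q_def)
    finally have "2 powr q * ((\<Sum>u\<in>U1. l1 u powr q) + (\<Sum>u\<in>U2. l2 u powr q)) \<le> 16 powr p * ((\<Sum>u\<in>U1. l1 u powr q) + (\<Sum>u\<in>U2. l2 u powr q))"
      by (intro mult_right_mono add_nonneg_nonneg sum_nonneg) auto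
    with 1 show ?thesis by simp
  qed
  then have "2 * real (card (idx n)) * moment p T \<le> 16 powr p * (2 * real (card (idx n)) * moment p T1 + 2 * real (card (idx n)) * moment p T2)"
    using moment_sum[OF p r(3) finite_idx idx_car_index U[unfolded V_def]] moment_sum[OF p r(1) finite_idx idx_car_index U1[unfolded V_def]]
      moment_sum[OF p r(2) finite_idx idx_car_index U2[unfolded V_def]]
    by (simp add: l_def l1_def l2_def q_def)
  then have "(2 * real (card (idx n))) * moment p T \<le> (2 * real (card (idx n))) * (16 powr p * (moment p T1 + moment p T2))"
    by (simp add: algebra_simps)
  moreover have "0 < real (card (idx n))" by (simp add: card_gt_0_iff) (use empty_idx in blast)
  ultimately show ?thesis unfolding T_def T1_def T2_def by simp
qed

section \<open>Truncated paraproducts\<close>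

text \<open>
  The operator \<open>d\<^sub>k\<^sub>+\<^sub>1 b\<close> of left multiplication, which \<open>\<pi>\<^sub>b\<close> applies to \<open>f\<^sub>k\<close>.
\<close>

definition dop :: "(nat set \<Rightarrow> complex) \<Rightarrow> nat \<Rightarrow> car_op" where
  "dop \<beta> k = combo (diff_idx (Suc k)) \<beta>"

text \<open>
  The partial sum \<open>\<Sum>\<^sub>k\<^sub>\<le>\<^sub>N d\<^sub>k\<^sub>+\<^sub>1 b \<cdot> f\<^sub>k\<close> of the paraproduct.
\<close>

definition trunc :: "(nat set \<Rightarrow> complex) \<Rightarrow> nat \<Rightarrow> car_op" where
  "trunc \<beta> N = (\<Sum>k\<in>{1..N}. dop \<beta> k o\<^sub>L Pop k)"

lemma dop_right_inv: "right_inv (dop \<beta> k)"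
  unfolding dop_def by (rule combo_right_inv[OF diff_idx_facts(3)])

lemma dop_clinear: "dop \<beta> k \<in> clinear_ops" by (rule right_invD(1)[OF dop_right_inv])

lemma trunc_clinear: "trunc \<beta> N \<in> clinear_ops"
  unfolding trunc_def by (intro clinear_ops_sum clinear_ops_compose dop_clinear Pop_clinear)

lemma trunc_apply: "blinfun_apply (trunc \<beta> N) x = (\<Sum>k\<in>{1..N}. blinfun_apply (dop \<beta> k) (restrict_L2 (idx k) x))"
  by (simp add: trunc_def blinfun.sum_left)

text \<open>
  The combinatorial reason why \<open>d\<^sub>k\<^sub>+\<^sub>1 b\<close> maps \<open>L\<^sub>2(C\<^sub>k)\<close> into the span of the \<open>e\<^sub>A\<close> with \<open>max A = k + 1\<close> and
  the orthogonal complement into the orthogonal complement of that span.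
\<close>

lemma sdiff_diff_idx:
  assumes k: "1 \<le> k" and A: "A \<in> diff_idx (Suc k)"
  shows "sdiff A B \<in> diff_idx (Suc k) \<longleftrightarrow> B \<in> idx k"
proof -
  have A': "A \<subseteq> {1..Suc k}" "Suc k \<in> A" using A by (auto simp: diff_idx_Suc[OF k] mem_idx)
  have iff: "B \<in> idx k \<longleftrightarrow> B \<subseteq> {1..Suc k} \<and> Suc k \<notin> B"
    by (auto simp: mem_idx subset_iff le_Suc_eq)
  have "sdiff A B \<in> diff_idx (Suc k) \<longleftrightarrow> sdiff A B \<subseteq> {1..Suc k} \<and> Suc k \<in> sdiff A B"
    by (simp only: diff_idx_Suc[OF k] mem_idx)
  also have "\<dots> \<longleftrightarrow> B \<subseteq> {1..Suc k} \<and> Suc k \<notin> B"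
  proof -
    have "sdiff A B \<subseteq> X \<longleftrightarrow> B \<subseteq> X" if "A \<subseteq> X" for X using that by (auto simp: sdiff_def)
    then show ?thesis using A' by (simp add: sdiff_def)
  qed
  finally show ?thesis unfolding iff .
qed

lemma dop_range:
  assumes k: "1 \<le> k" and x: "x \<in> fin_space (idx k)"
  shows "blinfun_apply (dop \<beta> k) x \<in> fin_space (diff_idx (Suc k))"
  unfolding dop_def
proof (rule combo_support[OF _ x])
  fix A C assume A: "A \<in> diff_idx (Suc k)" and C: "C \<notin> diff_idx (Suc k)"
  show "sdiff A C \<notin> idx k" using sdiff_diff_idx[OF k A, of "sdiff A C"] C by simp
qed

lemma gram_dop_invariant:
  assumes k: "1 \<le> k" and x: "x \<in> fin_space (idx k)"
  shows "blinfun_apply (gram (dop \<beta> k)) x \<in> fin_space (idx k)"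
  unfolding dop_def
  by (rule gram_invariant[OF diff_idx_facts(3) sdiff_diff_idx[OF k] idx_car_index diff_idx_facts(3) x])

lemma moment_dop_nonneg:
  assumes "0 < p" "1 \<le> k"
  shows "0 \<le> moment p (dop \<beta> k)"
proof (rule moment_nonneg[OF assms(1) dop_right_inv finite_idx idx_car_index])
  show "idx k \<noteq> {}" using empty_idx by blast
qed (rule gram_dop_invariant[OF assms(2)])

lemma diff_idx_disjoint:
  assumes "1 \<le> j" "j < k"
  shows "diff_idx j \<inter> diff_idx k = {}"
proof -
  have "j \<le> k - 1" using assms by simp
  then have "diff_idx j \<subseteq> idx (k - 1)" using diff_idx_facts(2)[of j] idx_mono[of j "k - 1"] by blast
  moreover have "diff_idx k \<inter> idx (k - 1) = {}" using assms by (auto simp: diff_idx_def)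
  ultimately show ?thesis by blast
qed

lemma norm_sum_disjoint:
  fixes f :: "nat \<Rightarrow> car_L2"
  assumes "finite K" "\<And>k. k \<in> K \<Longrightarrow> f k \<in> fin_space (W k)" "\<And>j k. j \<in> K \<Longrightarrow> k \<in> K \<Longrightarrow> j < k \<Longrightarrow> W j \<inter> W k = {}"
  shows "(norm (\<Sum>k\<in>K. f k))\<^sup>2 = (\<Sum>k\<in>K. (norm (f k))\<^sup>2)"
  using assms
proof (induction K rule: finite_induct)
  case (insert j K)
  have "inner (f j) (f k) = 0" if k: "k \<in> K" for k
  proof -
    have "j \<noteq> k" using insert.hyps k by auto
    then have "W j \<inter> W k = {}" using insert.prems(2)[of j k] insert.prems(2)[of k j] k by (metis Int_commute insertI1 insertI2 nat_neq_iff)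
    then have "cinner (f j) (f k) = 0"
      using insert.prems(1)[of j] insert.prems(1)[of k] k by (intro cinner_disjoint) (auto simp: fin_space_def)
    then show ?thesis by (simp add: inner_eq_Re)
  qed
  then have "inner (f j) (\<Sum>k\<in>K. f k) = 0" by (simp add: inner_sum_right)
  moreover have "(norm (\<Sum>k\<in>K. f k))\<^sup>2 = (\<Sum>k\<in>K. (norm (f k))\<^sup>2)" using insert by blast
  ultimately show ?case using insert.hyps
    by (simp add: power2_norm_eq_inner inner_add_left inner_add_right inner_commute)
qed simp

text \<open>
  The summands have orthogonal ranges, so \<open>\<pi>\<^sub>b\<^sup>* \<pi>\<^sub>b\<close> is the sum of the operators \<open>P\<^sub>k |d\<^sub>k\<^sub>+\<^sub>1 b|\<^sup>2 P\<^sub>k\<close>.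
\<close>

lemma trunc_norm:
  "(norm (blinfun_apply (trunc \<beta> N) x))\<^sup>2 = (\<Sum>k\<in>{1..N}. (norm (blinfun_apply (dop \<beta> k) (restrict_L2 (idx k) x)))\<^sup>2)"
  unfolding trunc_apply
  by (rule norm_sum_disjoint[where W = "\<lambda>k. diff_idx (Suc k)"]) (auto intro!: dop_range diff_idx_disjoint)

lemma trunc_norm_mono:
  assumes "M \<le> N"
  shows "norm (blinfun_apply (trunc \<beta> M) x) \<le> norm (blinfun_apply (trunc \<beta> N) x)"
proof (rule power2_le_imp_le)
  show "(norm (blinfun_apply (trunc \<beta> M) x))\<^sup>2 \<le> (norm (blinfun_apply (trunc \<beta> N) x))\<^sup>2"
    unfolding trunc_norm using assms by (intro sum_mono2) auto
qed simp

lemma restrict_restrict_idx: "k \<le> N \<Longrightarrow> restrict_L2 (idx k) (restrict_L2 (idx N) x) = restrict_L2 (idx k) x"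
  using idx_mono[of k N] by (simp add: Int_absorb2)

lemma trunc_restrict: "blinfun_apply (trunc \<beta> N) (restrict_L2 (idx N) x) = blinfun_apply (trunc \<beta> N) x"
  unfolding trunc_apply by (intro sum.cong refl) (simp add: restrict_restrict_idx del: restrict_linear)

lemma gram_trunc_invariant: "blinfun_apply (gram (trunc \<beta> N)) x \<in> fin_space (idx N)"
  unfolding fin_space_def
proof (intro CollectI allI impI)
  fix B assume B: "B \<notin> idx N"
  have "blinfun_apply (trunc \<beta> N) (basis_L2 B) = 0"
    using trunc_restrict[of \<beta> N "basis_L2 B"] B by (simp add: restrict_basis blinfun.zero_right)
  then have "cinner (blinfun_apply (gram (trunc \<beta> N)) x) (basis_L2 B) = 0"
    by (simp add: gram_cinner[OF trunc_clinear])
  then show "coeff_L2 (blinfun_apply (gram (trunc \<beta> N)) x) B = 0" by (simp add: cinner_basis)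
qed

lemma sum_idx_levels:
  fixes f :: "nat set \<Rightarrow> real"
  assumes "1 \<le> N"
  shows "(\<Sum>A\<in>idx N. f A) = (\<Sum>m\<in>{1..N}. \<Sum>A\<in>diff_idx m. f A)"
  using assms
proof (induction N rule: dec_induct)
  case base
  then show ?case by (simp add: diff_idx_def)
next
  case (step N)
  have "diff_idx (Suc N) = idx (Suc N) - idx N" using step.hyps by (simp add: diff_idx_def)
  moreover have "(\<Sum>A\<in>idx (Suc N). f A) = (\<Sum>A\<in>idx (Suc N) - idx N. f A) + (\<Sum>A\<in>idx N. f A)"
    by (rule sum.subset_diff) (auto intro: idx_mono[THEN subsetD, of N])
  ultimately show ?case using step.IH by simp
qed

lemma card_idx: "card (idx n) = 2 ^ n" by (simp add: idx_def card_Pow)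

lemma card_diff_idx:
  assumes "1 \<le> m"
  shows "2 * real (card (diff_idx m)) \<ge> 2 ^ m" "real (card (diff_idx m)) \<le> 2 ^ m"
proof -
  show "real (card (diff_idx m)) \<le> 2 ^ m"
    using card_mono[OF finite_idx diff_idx_facts(2), of m] by (simp add: card_idx)
  show "2 * real (card (diff_idx m)) \<ge> 2 ^ m"
  proof (cases "m = 1")
    case True
    then show ?thesis by (simp add: diff_idx_def card_idx)
  next
    case False
    then obtain k where k: "m = Suc k" using assms by (cases m) auto
    have "card (diff_idx m) = card (idx m) - card (idx k)"
      using False k by (simp add: diff_idx_def card_Diff_subset idx_mono)
    then show ?thesis by (simp add: card_idx k)
  qed
qed

text \<open>
  The trace of \<open>|\<pi>|\<^sup>p\<close> for the truncation \<open>\<pi>\<close>, which lives on \<open>L\<^sub>2(C\<^sub>N)\<close>.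
\<close>

definition trunc_trace :: "real \<Rightarrow> (nat set \<Rightarrow> complex) \<Rightarrow> nat \<Rightarrow> real" where
  "trunc_trace p \<beta> N = (\<Sum>A\<in>idx N. inner (blinfun_apply (fun_calc (\<lambda>t. t powr (p / 2)) (gram (trunc \<beta> N))) (basis_L2 A)) (basis_L2 A))"

lemma trunc_spectral_basis:
  obtains U where "spectral_basis (gram (trunc \<beta> N)) (fin_space (idx N)) U"
  using spectral_basis_exists[OF finite_idx idx_car_index gram_psd[OF trunc_clinear] gram_trunc_invariant] by blast

lemma dop_spectral_basis:
  assumes "1 \<le> k"
  obtains U where "spectral_basis (gram (dop \<beta> k)) (fin_space (idx k)) U"
  using spectral_basis_exists[OF finite_idx idx_car_index gram_psd[OF dop_clinear] gram_dop_invariant[OF assms]] by blast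

lemma trunc_fun_calc_form:
  assumes "0 < p" and U: "spectral_basis (gram (trunc \<beta> N)) (fin_space (idx N)) U" and v: "v \<in> fin_space (idx N)"
  shows "inner (blinfun_apply (fun_calc (\<lambda>t. t powr (p / 2)) (gram (trunc \<beta> N))) v) v =
     diag_form U (\<lambda>u. eigval (gram (trunc \<beta> N)) u powr (p / 2)) v"
  by (rule fun_calc_form[OF gram_psd[OF trunc_clinear] powr_cont[OF assms(1)] U v])

text \<open>
  Sums over a real basis are twice the sums over the complex basis, since the form of a complex linear
  operator does not change under multiplication of the vector by \<open>\<i>\<close>.
\<close>

lemma real_basis_sum_trunc:
  assumes p: "0 < p" and U: "spectral_basis (gram (trunc \<beta> N)) (fin_space (idx N)) U" and W: "W \<subseteq> idx N"
  shows "(\<Sum>b\<in>real_basis W. diag_form U (\<lambda>u. eigval (gram (trunc \<beta> N)) u powr (p / 2)) b)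
     = 2 * (\<Sum>A\<in>W. inner (blinfun_apply (fun_calc (\<lambda>t. t powr (p / 2)) (gram (trunc \<beta> N))) (basis_L2 A)) (basis_L2 A))"
proof -
  define f where "f = fun_calc (\<lambda>t. t powr (p / 2)) (gram (trunc \<beta> N))"
  have fc: "f \<in> clinear_ops" unfolding f_def by (rule fun_calc_clinear[OF gram_psd[OF trunc_clinear] powr_cont[OF p]])
  have W': "finite W" "W \<subseteq> car_index" using W finite_subset[OF W] idx_car_index by auto
  have eq: "diag_form U (\<lambda>u. eigval (gram (trunc \<beta> N)) u powr (p / 2)) b = inner (blinfun_apply f b) b" if "b \<in> fin_space (idx N)" for b
    unfolding f_def using trunc_fun_calc_form[OF p U that] by simp
  have "(\<Sum>b\<in>real_basis W. diag_form U (\<lambda>u. eigval (gram (trunc \<beta> N)) u powr (p / 2)) b)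
      = (\<Sum>A\<in>W. inner (blinfun_apply f (basis_L2 A)) (basis_L2 A) + inner (blinfun_apply f (cscale \<i> (basis_L2 A))) (cscale \<i> (basis_L2 A)))"
    unfolding sum_real_basis[OF W'] using W
    by (intro sum.cong refl arg_cong2[where f = "(+)"] eq fin_space_cscale basis_in_fin_space) auto
  then show ?thesis unfolding f_def[symmetric] inner_clinear_i[OF fc] by (simp add: sum_distrib_left)
qed

lemma trunc_trace_eigenvalues:
  assumes p: "0 < p" and U: "spectral_basis (gram (trunc \<beta> N)) (fin_space (idx N)) U"
  shows "(\<Sum>u\<in>U. eigval (gram (trunc \<beta> N)) u powr (p / 2)) = 2 * trunc_trace p \<beta> N"
proof -
  note onb = spectral_basisD(1)[OF U]
  have "(\<Sum>u\<in>U. eigval (gram (trunc \<beta> N)) u powr (p / 2)) = (\<Sum>b\<in>real_basis (idx N). diag_form U (\<lambda>u. eigval (gram (trunc \<beta> N)) u powr (p / 2)) b)"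
    using is_onbD[OF onb] by (intro sum_diag_form_onb[OF onb_real_basis[OF finite_idx idx_car_index], symmetric]) auto
  then show ?thesis unfolding real_basis_sum_trunc[OF p U order_refl] trunc_trace_def .
qed

lemma trunc_trace_nonneg:
  assumes "0 < p"
  shows "0 \<le> trunc_trace p \<beta> N"
proof -
  obtain U where U: "spectral_basis (gram (trunc \<beta> N)) (fin_space (idx N)) U" using trunc_spectral_basis .
  have "0 \<le> (\<Sum>u\<in>U. eigval (gram (trunc \<beta> N)) u powr (p / 2))" by (intro sum_nonneg) simp
  then show ?thesis unfolding trunc_trace_eigenvalues[OF assms U] by simp
qed

lemma inner_restrict_fixed: "w \<in> fin_space S \<Longrightarrow> inner (restrict_L2 S v) w = inner v w"
  by (simp add: inner_restrict restrict_fin_space)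

lemma diag_form_restrict:
  assumes "is_onb (fin_space S) U"
  shows "diag_form U \<mu> (restrict_L2 S v) = diag_form U \<mu> v"
  unfolding diag_form_def using is_onbD(3)[OF assms] by (intro sum.cong) (auto simp: inner_restrict_fixed)

lemma trunc_form:
  assumes U: "spectral_basis (gram (trunc \<beta> N)) (fin_space (idx N)) U" and v: "v \<in> fin_space (idx N)"
  shows "diag_form U (eigval (gram (trunc \<beta> N))) v = (norm (blinfun_apply (trunc \<beta> N) v))\<^sup>2"
  by (rule trans[OF operator_form[OF U v, symmetric] gram_form[OF trunc_clinear]])

lemma dop_form:
  assumes W: "spectral_basis (gram (dop \<beta> k)) (fin_space (idx k)) W"
  shows "diag_form W (eigval (gram (dop \<beta> k))) z = (norm (blinfun_apply (dop \<beta> k) (restrict_L2 (idx k) z)))\<^sup>2"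
proof -
  have "diag_form W (eigval (gram (dop \<beta> k))) z = diag_form W (eigval (gram (dop \<beta> k))) (restrict_L2 (idx k) z)"
    by (rule diag_form_restrict[OF spectral_basisD(1)[OF W], symmetric])
  also have "\<dots> = (norm (blinfun_apply (dop \<beta> k) (restrict_L2 (idx k) z)))\<^sup>2"
    by (rule trans[OF operator_form[OF W restrict_in_fin_space, symmetric] gram_form[OF dop_clinear]])
  finally show ?thesis .
qed

section \<open>Two-sided bounds for the truncated paraproduct\<close>

lemma geometric_tail_sum:
  fixes x :: real
  assumes "0 < x" "x < 1"
  shows "(\<Sum>m\<in>{1..k}. x ^ (k - m)) \<le> 1 / (1 - x)"
proof -
  have "(\<Sum>m\<in>{1..k}. x ^ (k - m)) = (\<Sum>j\<in>{0..<k}. x ^ j)"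
    by (rule sum.reindex_bij_witness[of _ "\<lambda>j. k - j" "\<lambda>m. k - m"]) auto
  also have "\<dots> \<le> (\<Sum>j. x ^ j)" using assms by (intro sum_le_suminf summable_geometric) auto
  also have "\<dots> = 1 / (1 - x)" using assms by (intro suminf_geometric) auto
  finally show ?thesis .
qed

lemma geometric_head_sum:
  fixes x :: real
  assumes "0 < x" "x < 1"
  shows "(\<Sum>k\<in>{m..N}. x ^ (k - m)) \<le> 1 / (1 - x)"
proof -
  have "(\<Sum>k\<in>{m..N}. x ^ (k - m)) = (\<Sum>j\<in>{0..<Suc N - m}. x ^ j)"
    by (rule sum.reindex_bij_witness[of _ "\<lambda>j. j + m" "\<lambda>k. k - m"]) auto
  also have "\<dots> \<le> (\<Sum>j. x ^ j)" using assms by (intro sum_le_suminf summable_geometric) auto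
  also have "\<dots> = 1 / (1 - x)" using assms by (intro suminf_geometric) auto
  finally show ?thesis .
qed

text \<open>
  The Cauchy--Schwarz inequality with geometric weights.
\<close>

lemma weighted_square_sum:
  fixes a :: "nat \<Rightarrow> real"
  assumes x: "0 < x" "x < 1" and a: "\<And>m. 0 \<le> a m"
  shows "(\<Sum>m\<in>{1..k}. a m)\<^sup>2 \<le> 1 / (1 - x) * (\<Sum>m\<in>{1..k}. (a m)\<^sup>2 / x ^ (k - m))"
proof -
  have "(\<Sum>m\<in>{1..k}. x ^ (k - m) * (a m / x ^ (k - m))) powr 2 \<le>
      (\<Sum>m\<in>{1..k}. x ^ (k - m)) powr (2 - 1) * (\<Sum>m\<in>{1..k}. x ^ (k - m) * (a m / x ^ (k - m)) powr 2)"
    using x a by (intro weighted_power_mean) auto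
  moreover have "(\<Sum>m\<in>{1..k}. x ^ (k - m) * (a m / x ^ (k - m))) = (\<Sum>m\<in>{1..k}. a m)"
    using x by (intro sum.cong) auto
  moreover have "(\<Sum>m\<in>{1..k}. x ^ (k - m) * (a m / x ^ (k - m)) powr 2) = (\<Sum>m\<in>{1..k}. (a m)\<^sup>2 / x ^ (k - m))"
    using x a by (intro sum.cong) (auto simp: power2_eq_square)
  moreover have "0 \<le> (\<Sum>m\<in>{1..k}. a m)" "0 \<le> (\<Sum>m\<in>{1..k}. x ^ (k - m))" using a x by (auto intro!: sum_nonneg)
  ultimately have "(\<Sum>m\<in>{1..k}. a m)\<^sup>2 \<le> (\<Sum>m\<in>{1..k}. x ^ (k - m)) * (\<Sum>m\<in>{1..k}. (a m)\<^sup>2 / x ^ (k - m))"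
    by simp
  also have "\<dots> \<le> 1 / (1 - x) * (\<Sum>m\<in>{1..k}. (a m)\<^sup>2 / x ^ (k - m))"
    using x by (intro mult_right_mono geometric_tail_sum sum_nonneg) auto
  finally show ?thesis .
qed

lemma diag_form_powr_jensen_scaled:
  assumes U: "is_onb V U" and \<mu>: "\<And>u. u \<in> U \<Longrightarrow> 0 \<le> \<mu> u" and v: "v \<in> V" and q: "1 \<le> q"
  shows "(norm v)\<^sup>2 * (diag_form U \<mu> v / (norm v)\<^sup>2) powr q \<le> diag_form U (\<lambda>u. \<mu> u powr q) v"
proof (cases "v = 0")
  case True
  then show ?thesis by (simp add: diag_form_def)
next
  case False
  then have n: "0 < (norm v)\<^sup>2" by simp
  have d: "0 \<le> diag_form U \<mu> v" using \<mu> by (auto simp: diag_form_def intro!: sum_nonneg)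
  have "diag_form U \<mu> v powr q \<le> ((norm v)\<^sup>2) powr (q - 1) * diag_form U (\<lambda>u. \<mu> u powr q) v"
    using weighted_power_mean[of q U "\<lambda>u. (inner v u)\<^sup>2" \<mu>] \<mu> q parseval[OF U v]
    by (simp add: diag_form_def mult.commute)
  then have "diag_form U \<mu> v powr q / ((norm v)\<^sup>2) powr (q - 1) \<le> diag_form U (\<lambda>u. \<mu> u powr q) v"
    using n by (simp add: divide_le_eq mult.commute)
  moreover have "(norm v)\<^sup>2 * (diag_form U \<mu> v / (norm v)\<^sup>2) powr q = diag_form U \<mu> v powr q / ((norm v)\<^sup>2) powr (q - 1)"
    using n d by (simp only: powr_divide powr_diff powr_one) (simp add: field_simps)
  ultimately show ?thesis by simp
qed

text \<open>
  With \<open>h\<^sub>k = |d\<^sub>k\<^sub>+\<^sub>1 b|\<^sup>2\<close>, the eigenvectors of all \<open>P\<^sub>k h\<^sub>k P\<^sub>k\<close> together decompose the operator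
  \<open>\<Sum>\<^sub>k P\<^sub>k h\<^sub>k P\<^sub>k\<close> into rank one operators, and
  \<open>Tr (P\<^sub>k h\<^sub>k P\<^sub>k)\<^sup>p\<^sup>/\<^sup>2 = 2\<^sup>k \<tau>(|d\<^sub>k\<^sub>+\<^sub>1 b|\<^sup>p)\<close>. So these are super- and subadditivity of the trace of a power.
\<close>

lemma trunc_trace_decomposition:
  assumes p: "0 < p"
  shows "2 \<le> p \<Longrightarrow> (\<Sum>k\<in>{1..N}. 2 ^ k * moment p (dop \<beta> k)) \<le> trunc_trace p \<beta> N"
    and "p \<le> 2 \<Longrightarrow> trunc_trace p \<beta> N \<le> (\<Sum>k\<in>{1..N}. 2 ^ k * moment p (dop \<beta> k))"
proof -
  obtain U where U: "spectral_basis (gram (trunc \<beta> N)) (fin_space (idx N)) U" using trunc_spectral_basis .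
  note onb = spectral_basisD(1)[OF U]
  have "\<exists>U. spectral_basis (gram (dop \<beta> k)) (fin_space (idx k)) U" if "1 \<le> k" for k
    using dop_spectral_basis[OF that] by blast
  then obtain W where W: "\<And>k. 1 \<le> k \<Longrightarrow> spectral_basis (gram (dop \<beta> k)) (fin_space (idx k)) (W k)" by metis
  note onbW = spectral_basisD(1)[OF W]
  define J where "J = Sigma {1..N} W"
  have J: "finite J" unfolding J_def using is_onbD(2)[OF onbW] by (intro finite_SigmaI) auto
  define l where "l = (\<lambda>j. eigval (gram (dop \<beta> (fst j))) (snd j))"
  have inV: "snd j \<in> fin_space (idx N)" "norm (snd j) = 1" "0 \<le> l j" if "j \<in> J" for j
  proof -
    have j: "1 \<le> fst j" "fst j \<le> N" "snd j \<in> W (fst j)" using that by (auto simp: J_def)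
    show "snd j \<in> fin_space (idx N)"
      using is_onbD(3)[OF onbW[OF j(1)] j(3)] idx_mono[OF j(2)] by (auto simp: fin_space_def)
    show "norm (snd j) = 1" by (rule is_onbD(6)[OF onbW[OF j(1)] j(3)])
    show "0 \<le> l j" unfolding l_def by (rule eigval_gram[OF dop_clinear])
  qed
  have eq: "diag_form U (eigval (gram (trunc \<beta> N))) v = (\<Sum>j\<in>J. l j * (inner v (snd j))\<^sup>2)" if v: "v \<in> fin_space (idx N)" for v
  proof -
    have "diag_form U (eigval (gram (trunc \<beta> N))) v = (\<Sum>k\<in>{1..N}. (norm (blinfun_apply (dop \<beta> k) (restrict_L2 (idx k) v)))\<^sup>2)"
      unfolding trunc_form[OF U v] by (rule trunc_norm)
    also have "\<dots> = (\<Sum>k\<in>{1..N}. diag_form (W k) (eigval (gram (dop \<beta> k))) v)"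
    proof (rule sum.cong)
      fix k assume k: "k \<in> {1..N}"
      then have k1: "1 \<le> k" by simp
      show "(norm (blinfun_apply (dop \<beta> k) (restrict_L2 (idx k) v)))\<^sup>2 = diag_form (W k) (eigval (gram (dop \<beta> k))) v"
        by (rule dop_form[OF W[OF k1], symmetric])
    qed simp
    also have "\<dots> = (\<Sum>j\<in>J. l j * (inner v (snd j))\<^sup>2)"
      unfolding J_def l_def diag_form_def using is_onbD(2)[OF onbW]
      by (subst sum.Sigma) (auto simp: case_prod_beta)
    finally show ?thesis .
  qed
  have sumJ: "(\<Sum>j\<in>J. l j powr (p / 2)) = 2 * (\<Sum>k\<in>{1..N}. 2 ^ k * moment p (dop \<beta> k))"
  proof -
    have "(\<Sum>j\<in>J. l j powr (p / 2)) = (\<Sum>k\<in>{1..N}. \<Sum>w\<in>W k. eigval (gram (dop \<beta> k)) w powr (p / 2))"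
      unfolding J_def l_def using is_onbD(2)[OF onbW] by (subst sum.Sigma) (auto simp: case_prod_beta)
    also have "\<dots> = (\<Sum>k\<in>{1..N}. 2 * (2 ^ k * moment p (dop \<beta> k)))"
      by (intro sum.cong refl) (simp add: moment_sum[OF p dop_right_inv finite_idx idx_car_index W] card_idx)
    finally show ?thesis by (simp add: sum_distrib_left)
  qed
  have pos: "0 \<le> eigval (gram (trunc \<beta> N)) u" for u by (rule eigval_gram[OF trunc_clinear])
  show "(\<Sum>k\<in>{1..N}. 2 ^ k * moment p (dop \<beta> k)) \<le> trunc_trace p \<beta> N" if "2 \<le> p"
  proof -
    have "(\<Sum>j\<in>J. l j powr (p / 2)) \<le> (\<Sum>u\<in>U. eigval (gram (trunc \<beta> N)) u powr (p / 2))"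
      by (rule trace_powr_decomposition(1)[OF onb pos J inV eq]) (use that in simp_all)
    then show ?thesis unfolding sumJ trunc_trace_eigenvalues[OF p U] by simp
  qed
  show "trunc_trace p \<beta> N \<le> (\<Sum>k\<in>{1..N}. 2 ^ k * moment p (dop \<beta> k))" if "p \<le> 2"
  proof -
    have "(\<Sum>u\<in>U. eigval (gram (trunc \<beta> N)) u powr (p / 2)) \<le> (\<Sum>j\<in>J. l j powr (p / 2))"
      by (rule trace_powr_decomposition(2)[OF onb pos J inV eq]) (use that p in simp_all)
    then show ?thesis unfolding sumJ trunc_trace_eigenvalues[OF p U] by simp
  qed
qed

text \<open>
  For \<open>p \<le> 2\<close> the operator inequality \<open>X\<^sup>p\<^sup>/\<^sup>2 \<ge> c (P\<^sub>m h\<^sub>m P\<^sub>m)\<^sup>p\<^sup>/\<^sup>2\<close>, where \<open>X\<close> is the sum over all levels and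
  \<open>h\<^sub>m = |d\<^sub>m\<^sub>+\<^sub>1 b|\<^sup>2\<close>, is tested on the \<open>e\<^sub>A\<close> with \<open>max A = m\<close>. These sets of vectors are disjoint for
  different \<open>m\<close>, each contains at least half of the basis of \<open>L\<^sub>2(C\<^sub>m)\<close>, and the diagonal entries of
  \<open>h\<^sub>m\<^sup>p\<^sup>/\<^sup>2\<close> are all equal. So nothing but a constant is lost by looking at one level at a time.
\<close>

lemma trunc_trace_lower:
  assumes p: "0 < p" "p \<le> 2"
  obtains c where "0 < c" "\<And>\<beta> N. 1 \<le> N \<Longrightarrow> c * (\<Sum>k\<in>{1..N}. 2 ^ k * moment p (dop \<beta> k)) \<le> trunc_trace p \<beta> N"
proof -
  define C where "C = loewner_const (p / 2)"
  have C: "0 < C" unfolding C_def using p by (intro loewner_const_pos) auto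
  have "1 / (2 * C) * (\<Sum>k\<in>{1..N}. 2 ^ k * moment p (dop \<beta> k)) \<le> trunc_trace p \<beta> N" if N: "1 \<le> N" for \<beta> N
  proof -
    obtain U where U: "spectral_basis (gram (trunc \<beta> N)) (fin_space (idx N)) U" using trunc_spectral_basis .
    note onb = spectral_basisD(1)[OF U]
    define g where "g = (\<lambda>A. inner (blinfun_apply (fun_calc (\<lambda>t. t powr (p / 2)) (gram (trunc \<beta> N))) (basis_L2 A)) (basis_L2 A))"
    have level: "2 ^ m * moment p (dop \<beta> m) \<le> 2 * C * (\<Sum>A\<in>diff_idx m. g A)" if m: "m \<in> {1..N}" for m
    proof -
      have m1: "1 \<le> m" "m \<le> N" using m by auto
      obtain W where W: "spectral_basis (gram (dop \<beta> m)) (fin_space (idx m)) W" using dop_spectral_basis[OF m1(1)] .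
      note onbW = spectral_basisD(1)[OF W]
      have sub: "diff_idx m \<subseteq> idx N" using diff_idx_facts(2) idx_mono[OF m1(2)] by blast
      have le: "moment p (dop \<beta> m) \<le> C * diag_form U (\<lambda>u. eigval (gram (trunc \<beta> N)) u powr (p / 2)) b"
        if b: "b \<in> real_basis (diff_idx m)" for b
      proof -
        have b1: "b \<in> real_basis (idx m)" using b diff_idx_facts(2) by (auto simp: real_basis_def)
        have b2: "b \<in> fin_space (idx N)"
          using b sub by (auto simp: real_basis_def intro!: basis_in_fin_space fin_space_cscale)
        have "moment p (dop \<beta> m) = diag_form W (\<lambda>u. eigval (gram (dop \<beta> m)) u powr (p / 2)) b"
          by (rule moment_form[OF p(1) dop_right_inv finite_idx idx_car_index W b1, symmetric])
        also have "\<dots> \<le> C * diag_form U (\<lambda>u. eigval (gram (trunc \<beta> N)) u powr (p / 2)) b"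
          unfolding C_def
        proof (rule loewner_heinz[OF _ _ onb _ onbW _ _ b2])
          fix z assume z: "z \<in> fin_space (idx N)"
          have "diag_form W (eigval (gram (dop \<beta> m))) z = (norm (blinfun_apply (dop \<beta> m) (restrict_L2 (idx m) z)))\<^sup>2"
            by (rule dop_form[OF W])
          also have "\<dots> \<le> (\<Sum>k\<in>{1..N}. (norm (blinfun_apply (dop \<beta> k) (restrict_L2 (idx k) z)))\<^sup>2)"
            using m by (intro member_le_sum) auto
          also have "\<dots> = diag_form U (eigval (gram (trunc \<beta> N))) z"
            unfolding trunc_form[OF U z] by (rule trunc_norm[symmetric])
          finally show "diag_form W (eigval (gram (dop \<beta> m))) z \<le> diag_form U (eigval (gram (trunc \<beta> N))) z" .
        qed (use p in \<open>auto intro: eigval_gram dop_clinear trunc_clinear\<close>)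
        finally show ?thesis .
      qed
      have "2 ^ m * moment p (dop \<beta> m) \<le> 2 * real (card (diff_idx m)) * moment p (dop \<beta> m)"
        using card_diff_idx(1)[OF m1(1)] moment_dop_nonneg[OF p(1) m1(1)] by (intro mult_right_mono) auto
      also have "\<dots> = (\<Sum>b\<in>real_basis (diff_idx m). moment p (dop \<beta> m))"
        by (subst sum_real_basis[OF diff_idx_facts(1,3)]) simp
      also have "\<dots> \<le> (\<Sum>b\<in>real_basis (diff_idx m). C * diag_form U (\<lambda>u. eigval (gram (trunc \<beta> N)) u powr (p / 2)) b)"
        by (rule sum_mono[OF le])
      also have "\<dots> = 2 * C * (\<Sum>A\<in>diff_idx m. g A)"
        unfolding sum_distrib_left[symmetric] real_basis_sum_trunc[OF p(1) U sub] g_def by simp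
      finally show ?thesis .
    qed
    have "(\<Sum>k\<in>{1..N}. 2 ^ k * moment p (dop \<beta> k)) \<le> (\<Sum>m\<in>{1..N}. 2 * C * (\<Sum>A\<in>diff_idx m. g A))"
      by (rule sum_mono[OF level])
    also have "\<dots> = 2 * C * trunc_trace p \<beta> N"
      unfolding trunc_trace_def g_def[symmetric] sum_idx_levels[OF N] by (simp add: sum_distrib_left)
    finally show ?thesis using C by (simp add: field_simps)
  qed
  moreover have "0 < 1 / (2 * C)" using C by simp
  ultimately show ?thesis using that by blast
qed

text \<open>
  For \<open>p \<ge> 2\<close> split \<open>P\<^sub>k = \<Sum>\<^sub>m\<^sub>\<le>\<^sub>k Q\<^sub>m\<close>, where \<open>Q\<^sub>m\<close> projects onto the \<open>e\<^sub>A\<close> with \<open>max A = m\<close>. The trace of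
  \<open>|d\<^sub>k\<^sub>+\<^sub>1 b|\<^sup>p\<close> over the range of \<open>Q\<^sub>m\<close> is about \<open>2\<^sup>m\<^sup>-\<^sup>k\<close> times that over \<open>L\<^sub>2(C\<^sub>k)\<close>. This decay in \<open>k - m\<close>
  pays for the geometric weights needed to separate the blocks by Cauchy--Schwarz and by Jensen's
  inequality, provided that the weights grow more slowly than \<open>2\<^sup>k\<^sup>-\<^sup>m\<close>: the ratio \<open>x\<close> is chosen such that
  the total loss is \<open>2\<^bsup>(k - m) / 2\<^esup>\<close>. The inequality is applied in an eigenbasis of the truncation, where the
  trace of the power is a sum of powers of diagonal entries.
\<close>

lemma trunc_trace_upper:
  assumes p: "2 \<le> p"
  obtains C where "0 < C" "\<And>\<beta> N. 1 \<le> N \<Longrightarrow> trunc_trace p \<beta> N \<le> C * (\<Sum>k\<in>{1..N}. 2 ^ k * moment p (dop \<beta> k))"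
proof -
  define q where "q = p / 2"
  have q: "1 \<le> q" using p by (simp add: q_def)
  have p0: "0 < p" using p by simp
  \<comment> \<open>The weights \<open>x\<^sup>k\<^sup>-\<^sup>m\<close> enter \<open>z\<^sup>q\<close> below with exponent \<open>- 2 q\<close>; this \<open>x\<close> makes the loss \<open>2\<^bsup>(k - m) / 2\<^esup> = (2 y)\<^sup>k\<^sup>-\<^sup>m\<close>.\<close>
  define x :: real where "x = 2 powr (- 1 / (4 * q))"
  have x: "0 < x" "x < 1" using q by (auto simp: x_def powr_less_one)
  define y :: real where "y = 2 powr (- 1 / 2)"
  have y: "0 < y" "y < 1" by (auto simp: y_def powr_less_one)
  have x2q: "(1 / (x ^ n)\<^sup>2) powr q = (2 * y) ^ n" for n
  proof -
    have a: "x ^ n = x powr real n" using x by (simp add: powr_realpow)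
    have "(x ^ n)\<^sup>2 = x powr (2 * real n)"
      unfolding a power2_eq_square powr_add[symmetric] by simp
    then have "1 / (x ^ n)\<^sup>2 = x powr (- (2 * real n))" by (simp only: powr_minus divide_inverse mult_1)
    then have "(1 / (x ^ n)\<^sup>2) powr q = x powr (- (2 * real n) * q)" by (simp only: powr_powr)
    also have "\<dots> = 2 powr ((- 1 / (4 * q)) * (- (2 * real n) * q))" unfolding x_def powr_powr ..
    also have "(- 1 / (4 * q)) * (- (2 * real n) * q) = 1 / 2 * real n" using q by (simp add: field_simps)
    also have "2 powr (1 / 2 * real n) = (2 powr (1 / 2)) powr real n" by (simp only: powr_powr)
    also have "\<dots> = (2 powr (1 / 2)) ^ n" by (rule powr_realpow) simp
    also have "(2::real) powr (1 / 2) = 2 * y"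
    proof -
      have "2 powr (1 + - 1 / 2) = (2::real) powr 1 * 2 powr (- 1 / 2)" by (rule powr_add)
      then show ?thesis by (simp add: y_def)
    qed
    finally show ?thesis .
  qed
  define C1 where "C1 = 1 / (1 - x)"
  have C1: "0 < C1" using x by (simp add: C1_def)
  define C where "C = C1 powr q * C1 powr (q - 1) * (1 / (1 - y))"
  have C: "0 < C" using C1 y by (simp add: C_def)
  have "trunc_trace p \<beta> N \<le> C * (\<Sum>k\<in>{1..N}. 2 ^ k * moment p (dop \<beta> k))" if N: "1 \<le> N" for \<beta> N
  proof -
    obtain U where U: "spectral_basis (gram (trunc \<beta> N)) (fin_space (idx N)) U" using trunc_spectral_basis .
    note onb = spectral_basisD(1)[OF U]
    have "\<exists>U. spectral_basis (gram (dop \<beta> k)) (fin_space (idx k)) U" if "1 \<le> k" for k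
      using dop_spectral_basis[OF that] by blast
    then obtain W where W: "\<And>k. 1 \<le> k \<Longrightarrow> spectral_basis (gram (dop \<beta> k)) (fin_space (idx k)) (W k)" by metis
    note onbW = spectral_basisD(1)[OF W]
    define l where "l k = eigval (gram (dop \<beta> k))" for k
    have l: "0 \<le> l k u" for k u unfolding l_def by (rule eigval_gram[OF dop_clinear])
    define Q where "Q m = restrict_L2 (diff_idx m)" for m
    define F where "F k v = diag_form (W k) (\<lambda>u. l k u powr q) v" for k v
    have F0: "0 \<le> F k v" for k v unfolding F_def diag_form_def by (intro sum_nonneg) simp
    have QV: "Q m v \<in> fin_space (idx k)" if "m \<in> {1..k}" for m k v
      using diff_idx_facts(2)[of m] idx_mono[of m k] that by (auto simp: Q_def fin_space_def)
    have PQ: "restrict_L2 (idx k) v = (\<Sum>m\<in>{1..k}. Q m v)" if k: "1 \<le> k" for k v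
    proof (rule car_L2_eqI)
      fix A
      have re: "Re (coeff_L2 (restrict_L2 (idx k) v) A) = Re (coeff_L2 (\<Sum>m\<in>{1..k}. Q m v) A)"
        and im: "Im (coeff_L2 (restrict_L2 (idx k) v) A) = Im (coeff_L2 (\<Sum>m\<in>{1..k}. Q m v) A)"
      proof -
        have *: "(if A \<in> idx k then r else 0) = (\<Sum>m\<in>{1..k}. if A \<in> diff_idx m then r else 0)" for r :: real
          using sum_idx_levels[OF k, of "\<lambda>B. if B = A then r else 0"]
          by (simp add: diff_idx_facts(1))
        show "Re (coeff_L2 (restrict_L2 (idx k) v) A) = Re (coeff_L2 (\<Sum>m\<in>{1..k}. Q m v) A)"
          using *[of "Re (coeff_L2 v A)"] by (simp add: Q_def if_distrib[of Re] cong: if_cong)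
        show "Im (coeff_L2 (restrict_L2 (idx k) v) A) = Im (coeff_L2 (\<Sum>m\<in>{1..k}. Q m v) A)"
          using *[of "Im (coeff_L2 v A)"] by (simp add: Q_def if_distrib[of Im] cong: if_cong)
      qed
      then show "coeff_L2 (restrict_L2 (idx k) v) A = coeff_L2 (\<Sum>m\<in>{1..k}. Q m v) A" by (simp add: complex_eq_iff)
    qed
    have sumQ: "(\<Sum>m\<in>{1..N}. (norm (Q m v))\<^sup>2) = (norm v)\<^sup>2" if "v \<in> fin_space (idx N)" for v
    proof -
      have "v = (\<Sum>m\<in>{1..N}. Q m v)" using PQ[OF N, of v] that by (simp add: restrict_fin_space)
      moreover have "(norm (\<Sum>m\<in>{1..N}. Q m v))\<^sup>2 = (\<Sum>m\<in>{1..N}. (norm (Q m v))\<^sup>2)"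
        by (rule norm_sum_disjoint[where W = diff_idx]) (auto simp: Q_def intro!: diff_idx_disjoint)
      ultimately show ?thesis by simp
    qed
    define P where "P = Sigma {1..N} (\<lambda>k. {1..k})"
    have P: "finite P" by (simp add: P_def)
    have eig: "eigval (gram (trunc \<beta> N)) u powr q \<le> C1 powr q * C1 powr (q - 1) * (\<Sum>k\<in>{1..N}. \<Sum>m\<in>{1..k}. (2 * y) ^ (k - m) * F k (Q m u))"
      if u: "u \<in> U" for u
    proof -
      have uV: "u \<in> fin_space (idx N)" and nu: "norm u = 1" using is_onbD[OF onb] u by auto
      define w where "w = (\<lambda>(k, m). x ^ (k - m) * (norm (Q m u))\<^sup>2)"
      define z where "z = (\<lambda>(k, m). (1 / (x ^ (k - m))\<^sup>2) * (diag_form (W k) (l k) (Q m u) / (norm (Q m u))\<^sup>2))"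
      have df: "(norm (blinfun_apply (dop \<beta> k) (Q m u)))\<^sup>2 = diag_form (W k) (l k) (Q m u)" if "m \<in> {1..k}" for k m
      proof -
        have "1 \<le> k" using that by auto
        then show ?thesis unfolding l_def
          by (rule trans[OF gram_form[OF dop_clinear, symmetric] operator_form[OF W QV[OF that]]])
      qed
      have "eigval (gram (trunc \<beta> N)) u = (\<Sum>k\<in>{1..N}. (norm (blinfun_apply (dop \<beta> k) (restrict_L2 (idx k) u)))\<^sup>2)"
        unfolding gram_form[OF trunc_clinear] by (rule trunc_norm)
      also have "\<dots> \<le> (\<Sum>k\<in>{1..N}. C1 * (\<Sum>m\<in>{1..k}. (norm (blinfun_apply (dop \<beta> k) (Q m u)))\<^sup>2 / x ^ (k - m)))"
      proof (rule sum_mono)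
        fix k assume k: "k \<in> {1..N}"
        then have "blinfun_apply (dop \<beta> k) (restrict_L2 (idx k) u) = (\<Sum>m\<in>{1..k}. blinfun_apply (dop \<beta> k) (Q m u))"
          by (simp add: PQ blinfun.sum_right)
        then have "(norm (blinfun_apply (dop \<beta> k) (restrict_L2 (idx k) u)))\<^sup>2 \<le> (\<Sum>m\<in>{1..k}. norm (blinfun_apply (dop \<beta> k) (Q m u)))\<^sup>2"
          by (simp add: norm_sum power_mono)
        also have "\<dots> \<le> C1 * (\<Sum>m\<in>{1..k}. (norm (blinfun_apply (dop \<beta> k) (Q m u)))\<^sup>2 / x ^ (k - m))"
          unfolding C1_def by (rule weighted_square_sum[OF x]) simp
        finally show "(norm (blinfun_apply (dop \<beta> k) (restrict_L2 (idx k) u)))\<^sup>2 \<le> C1 * (\<Sum>m\<in>{1..k}. (norm (blinfun_apply (dop \<beta> k) (Q m u)))\<^sup>2 / x ^ (k - m))" .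
      qed
      also have "\<dots> = C1 * (\<Sum>k\<in>{1..N}. \<Sum>m\<in>{1..k}. w (k, m) * z (k, m))"
        unfolding sum_distrib_left[symmetric]
      proof (intro arg_cong2[where f = "(*)"] sum.cong refl)
        fix k m assume km: "k \<in> {1..N}" "m \<in> {1..k}"
        have "diag_form (W k) (l k) (Q m u) = 0" if "Q m u = 0" using that by (simp add: diag_form_def)
        then show "(norm (blinfun_apply (dop \<beta> k) (Q m u)))\<^sup>2 / x ^ (k - m) = w (k, m) * z (k, m)"
          using x unfolding df[OF km(2)] w_def z_def by (auto simp: field_simps power2_eq_square)
      qed
      also have "\<dots> = C1 * (\<Sum>i\<in>P. w i * z i)" unfolding P_def by (subst sum.Sigma) auto
      finally have "eigval (gram (trunc \<beta> N)) u powr q \<le> (C1 * (\<Sum>i\<in>P. w i * z i)) powr q"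
        using q eigval_gram[OF trunc_clinear] by (intro powr_mono2) auto
      also have "\<dots> = C1 powr q * (\<Sum>i\<in>P. w i * z i) powr q" by (rule powr_mult)
      also have "\<dots> \<le> C1 powr q * ((\<Sum>i\<in>P. w i) powr (q - 1) * (\<Sum>i\<in>P. w i * z i powr q))"
        using x q l by (intro mult_left_mono weighted_power_mean) (auto simp: w_def z_def diag_form_def intro!: sum_nonneg divide_nonneg_nonneg mult_nonneg_nonneg)
      also have "\<dots> \<le> C1 powr q * (C1 powr (q - 1) * (\<Sum>i\<in>P. w i * z i powr q))"
      proof (intro mult_left_mono mult_right_mono powr_mono2)
        have "(\<Sum>i\<in>P. w i) = (\<Sum>k\<in>{1..N}. \<Sum>m\<in>{1..k}. w (k, m))" unfolding P_def by (subst sum.Sigma) auto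
        also have "\<dots> = (\<Sum>m\<in>{1..N}. \<Sum>k\<in>{m..N}. w (k, m))"
          unfolding sum.Sigma[OF finite_atLeastAtMost ballI[OF finite_atLeastAtMost]]
          by (rule sum.reindex_bij_witness[of _ "\<lambda>(m, k). (k, m)" "\<lambda>(k, m). (m, k)"]) auto
        also have "\<dots> = (\<Sum>m\<in>{1..N}. (\<Sum>k\<in>{m..N}. x ^ (k - m)) * (norm (Q m u))\<^sup>2)"
          by (simp add: w_def sum_distrib_right)
        also have "\<dots> \<le> (\<Sum>m\<in>{1..N}. C1 * (norm (Q m u))\<^sup>2)"
          unfolding C1_def by (intro sum_mono mult_right_mono geometric_head_sum x) simp
        also have "\<dots> = C1" using sumQ[OF uV] nu by (simp add: sum_distrib_left[symmetric])
        finally show "(\<Sum>i\<in>P. w i) \<le> C1" .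
        show "0 \<le> (\<Sum>i\<in>P. w i)" "0 \<le> (\<Sum>i\<in>P. w i * z i powr q)"
          using x by (auto simp: w_def intro!: sum_nonneg)
      qed (use q in auto)
      also have "(\<Sum>i\<in>P. w i * z i powr q) = (\<Sum>k\<in>{1..N}. \<Sum>m\<in>{1..k}. w (k, m) * z (k, m) powr q)"
        unfolding P_def by (subst sum.Sigma) auto
      also have "\<dots> \<le> (\<Sum>k\<in>{1..N}. \<Sum>m\<in>{1..k}. (2 * y) ^ (k - m) * F k (Q m u))"
      proof (intro sum_mono)
        fix k m assume km: "k \<in> {1..N}" "m \<in> {1..k}"
        then have k1: "1 \<le> k" by simp
        define n g where "n = (norm (Q m u))\<^sup>2" and "g = diag_form (W k) (l k) (Q m u)"
        have g: "0 \<le> g" "0 \<le> n" using l by (auto simp: g_def n_def diag_form_def intro!: sum_nonneg)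
        have xn: "0 \<le> x ^ (k - m)" "x ^ (k - m) \<le> 1" using x by (auto intro: power_le_one)
        have j: "n * (g / n) powr q \<le> F k (Q m u)"
          unfolding n_def g_def F_def by (rule diag_form_powr_jensen_scaled[OF onbW[OF k1] l QV[OF km(2)] q])
        have "z (k, m) powr q = (1 / (x ^ (k - m))\<^sup>2) powr q * (g / n) powr q"
          unfolding z_def n_def g_def prod.case by (rule powr_mult)
        then have "z (k, m) powr q = (2 * y) ^ (k - m) * (g / n) powr q" by (simp only: x2q)
        then have "w (k, m) * z (k, m) powr q = x ^ (k - m) * ((2 * y) ^ (k - m) * (n * (g / n) powr q))"
          by (simp add: w_def n_def)
        also have "\<dots> \<le> 1 * ((2 * y) ^ (k - m) * (n * (g / n) powr q))"
          using xn y g by (intro mult_right_mono) auto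
        also have "\<dots> \<le> (2 * y) ^ (k - m) * F k (Q m u)" using j y by (simp add: mult_left_mono)
        finally show "w (k, m) * z (k, m) powr q \<le> (2 * y) ^ (k - m) * F k (Q m u)" .
      qed
      finally show ?thesis using C1 by (simp add: mult.assoc mult_left_mono)
    qed
    have level: "(\<Sum>u\<in>U. F k (Q m u)) \<le> 2 * 2 ^ m * moment p (dop \<beta> k)" if k: "k \<in> {1..N}" and m: "m \<in> {1..k}" for k m
    proof -
      have k1: "1 \<le> k" and m1: "1 \<le> m" using k m by auto
      have sub: "diff_idx m \<subseteq> idx k" using diff_idx_facts(2)[of m] idx_mono[of m k] m by auto
      have "(\<Sum>u\<in>U. F k (Q m u)) = (\<Sum>w\<in>W k. l k w powr q * (\<Sum>u\<in>U. (inner (Q m w) u)\<^sup>2))"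
      proof -
        have "inner (Q m u) w = inner (Q m w) u" for u w
          unfolding Q_def inner_restrict[of _ u] by (rule inner_commute)
        then show ?thesis unfolding F_def diag_form_def sum_distrib_left by (subst sum.swap) simp
      qed
      also have "\<dots> = (\<Sum>w\<in>W k. l k w powr q * (\<Sum>b\<in>real_basis (diff_idx m). (inner b w)\<^sup>2))"
      proof (rule sum.cong)
        fix w
        have "m \<in> {1..N}" using k m by auto
        then have "(\<Sum>u\<in>U. (inner (Q m w) u)\<^sup>2) = (norm (Q m w))\<^sup>2" by (intro parseval[OF onb] QV)
        also have "\<dots> = (\<Sum>b\<in>real_basis (diff_idx m). (inner (Q m w) b)\<^sup>2)"
          by (rule parseval[OF onb_real_basis[OF diff_idx_facts(1,3)], symmetric]) (simp add: Q_def)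
        also have "\<dots> = (\<Sum>b\<in>real_basis (diff_idx m). (inner b w)\<^sup>2)"
        proof (rule sum.cong)
          fix b assume "b \<in> real_basis (diff_idx m)"
          then have "b \<in> fin_space (diff_idx m)" by (rule is_onbD(3)[OF onb_real_basis[OF diff_idx_facts(1,3)]])
          then have "inner (Q m w) b = inner b w" unfolding Q_def by (simp only: inner_restrict_fixed inner_commute[of w b])
          then show "(inner (Q m w) b)\<^sup>2 = (inner b w)\<^sup>2" by simp
        qed simp
        finally show "l k w powr q * (\<Sum>u\<in>U. (inner (Q m w) u)\<^sup>2) = l k w powr q * (\<Sum>b\<in>real_basis (diff_idx m). (inner b w)\<^sup>2)"
          by simp
      qed simp
      also have "\<dots> = (\<Sum>b\<in>real_basis (diff_idx m). diag_form (W k) (\<lambda>u. l k u powr q) b)"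
        unfolding diag_form_def sum_distrib_left by (rule sum.swap)
      also have "\<dots> = (\<Sum>b\<in>real_basis (diff_idx m). moment p (dop \<beta> k))"
        unfolding l_def q_def using sub
        by (intro sum.cong refl moment_form[OF p0 dop_right_inv finite_idx idx_car_index W[OF k1]]) (auto simp: real_basis_def)
      also have "\<dots> = 2 * real (card (diff_idx m)) * moment p (dop \<beta> k)"
        by (subst sum_real_basis[OF diff_idx_facts(1,3)]) simp
      also have "\<dots> \<le> 2 * 2 ^ m * moment p (dop \<beta> k)"
        using card_diff_idx(2)[OF m1] moment_dop_nonneg[OF p0 k1] by (intro mult_right_mono) auto
      finally show ?thesis .
    qed
    have "2 * trunc_trace p \<beta> N = (\<Sum>u\<in>U. eigval (gram (trunc \<beta> N)) u powr q)"
      unfolding q_def by (rule trunc_trace_eigenvalues[OF p0 U, symmetric])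
    also have "\<dots> \<le> (\<Sum>u\<in>U. C1 powr q * C1 powr (q - 1) * (\<Sum>k\<in>{1..N}. \<Sum>m\<in>{1..k}. (2 * y) ^ (k - m) * F k (Q m u)))"
      by (rule sum_mono[OF eig])
    also have "\<dots> = C1 powr q * C1 powr (q - 1) * (\<Sum>k\<in>{1..N}. \<Sum>m\<in>{1..k}. (2 * y) ^ (k - m) * (\<Sum>u\<in>U. F k (Q m u)))"
      by (simp only: sum_distrib_left sum.swap[of _ U])
    also have "\<dots> \<le> C1 powr q * C1 powr (q - 1) * (\<Sum>k\<in>{1..N}. \<Sum>m\<in>{1..k}. (2 * y) ^ (k - m) * (2 * 2 ^ m * moment p (dop \<beta> k)))"
      using y by (intro mult_left_mono sum_mono level) auto
    also have "(\<Sum>k\<in>{1..N}. \<Sum>m\<in>{1..k}. (2 * y) ^ (k - m) * (2 * 2 ^ m * moment p (dop \<beta> k)))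
        \<le> (\<Sum>k\<in>{1..N}. 1 / (1 - y) * (2 * 2 ^ k * moment p (dop \<beta> k)))"
    proof (rule sum_mono)
      fix k assume k: "k \<in> {1..N}"
      have "(\<Sum>m\<in>{1..k}. (2 * y) ^ (k - m) * (2 * 2 ^ m * moment p (dop \<beta> k))) = (\<Sum>m\<in>{1..k}. y ^ (k - m)) * (2 * 2 ^ k * moment p (dop \<beta> k))"
        unfolding sum_distrib_right
      proof (rule sum.cong)
        fix m assume "m \<in> {1..k}"
        then have "(2::real) ^ (k - m) * 2 ^ m = 2 ^ k" by (simp add: power_add[symmetric])
        then show "(2 * y) ^ (k - m) * (2 * 2 ^ m * moment p (dop \<beta> k)) = y ^ (k - m) * (2 * 2 ^ k * moment p (dop \<beta> k))"
          by (simp add: power_mult_distrib)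
      qed simp
      also have "\<dots> \<le> 1 / (1 - y) * (2 * 2 ^ k * moment p (dop \<beta> k))"
        using k moment_dop_nonneg[OF p0, of k] by (intro mult_right_mono geometric_tail_sum y) auto
      finally show "(\<Sum>m\<in>{1..k}. (2 * y) ^ (k - m) * (2 * 2 ^ m * moment p (dop \<beta> k))) \<le> 1 / (1 - y) * (2 * 2 ^ k * moment p (dop \<beta> k))" .
    qed
    also have "\<dots> = 2 * (1 / (1 - y) * (\<Sum>k\<in>{1..N}. 2 ^ k * moment p (dop \<beta> k)))"
      by (simp add: sum_distrib_left mult.assoc)
    finally have "2 * trunc_trace p \<beta> N \<le> C1 powr q * C1 powr (q - 1) * (2 * (1 / (1 - y) * (\<Sum>k\<in>{1..N}. 2 ^ k * moment p (dop \<beta> k))))"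
      using C1 by (simp add: mult_left_mono)
    also have "\<dots> = 2 * (C * (\<Sum>k\<in>{1..N}. 2 ^ k * moment p (dop \<beta> k)))" by (simp add: C_def)
    finally show ?thesis by simp
  qed
  then show ?thesis using that C by blast
qed

lemma trunc_trace_equivalent:
  assumes p: "0 < p"
  obtains c C where "0 < c" "0 < C"
    "\<forall>\<beta>. \<forall>N\<ge>1. c * (\<Sum>k\<in>{1..N}. 2 ^ k * moment p (dop \<beta> k)) \<le> trunc_trace p \<beta> N \<and>
       trunc_trace p \<beta> N \<le> C * (\<Sum>k\<in>{1..N}. 2 ^ k * moment p (dop \<beta> k))"
proof (cases "2 \<le> p")
  case True
  obtain C where C: "0 < C" "\<And>\<beta> N. 1 \<le> N \<Longrightarrow> trunc_trace p \<beta> N \<le> C * (\<Sum>k\<in>{1..N}. 2 ^ k * moment p (dop \<beta> k))"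
    using trunc_trace_upper[OF True] by metis
  show ?thesis by (rule that[of 1 C]) (use C trunc_trace_decomposition(1)[OF p True] in auto)
next
  case False
  then have p2: "p \<le> 2" by simp
  obtain c where c: "0 < c" "\<And>\<beta> N. 1 \<le> N \<Longrightarrow> c * (\<Sum>k\<in>{1..N}. 2 ^ k * moment p (dop \<beta> k)) \<le> trunc_trace p \<beta> N"
    using trunc_trace_lower[OF p p2] by metis
  show ?thesis by (rule that[of c 1]) (use c trunc_trace_decomposition(2)[OF p p2] in auto)
qed

section \<open>Passage to the limit\<close>

lemma paraproduct_terms_eq:
  assumes "has_coeffs b \<beta>"
  shows "paraproduct_terms b f k = (if k = 0 then 0 else blinfun_apply (dop \<beta> k) (restrict_L2 (idx k) f))"
  using assms by (simp add: paraproduct_terms_def martingale_L2_def cond_exp_L2_eq mdiff_eq_combo dop_def)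

lemma paraproduct_partial_sum:
  assumes "has_coeffs b \<beta>"
  shows "(\<Sum>k<Suc N. paraproduct_terms b f k) = blinfun_apply (trunc \<beta> N) f"
proof -
  have "{..<Suc N} = insert 0 {1..N}" by auto
  then have "(\<Sum>k<Suc N. paraproduct_terms b f k) = (\<Sum>k\<in>{1..N}. paraproduct_terms b f k)"
    by (simp add: paraproduct_terms_eq[OF assms])
  then show ?thesis unfolding trunc_apply by (simp add: paraproduct_terms_eq[OF assms])
qed

text \<open>
  The terms with \<open>k > N\<close> have their range outside \<open>L\<^sub>2(C\<^sub>N\<^sub>+\<^sub>1)\<close>, so truncating the paraproduct amounts to
  projecting its values.
\<close>

lemma paraproduct_restrict:
  assumes b: "has_coeffs b \<beta>" and sm: "summable (paraproduct_terms b f)"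
  shows "restrict_L2 (idx (Suc N)) (paraproduct b f) = blinfun_apply (trunc \<beta> N) f"
proof -
  have range: "paraproduct_terms b f k \<in> fin_space (diff_idx (Suc k))" if "k \<noteq> 0" for k
    using that by (simp add: paraproduct_terms_eq[OF b] dop_range)
  have "restrict_L2 (idx (Suc N)) (paraproduct b f) = (\<Sum>k. restrict_L2 (idx (Suc N)) (paraproduct_terms b f k))"
    unfolding paraproduct_def by (rule bounded_linear.suminf[OF bounded_linear_restrict sm])
  also have "\<dots> = (\<Sum>k\<in>{1..N}. restrict_L2 (idx (Suc N)) (paraproduct_terms b f k))"
  proof (rule suminf_finite)
    fix k assume k: "k \<notin> {1..N}"
    show "restrict_L2 (idx (Suc N)) (paraproduct_terms b f k) = 0"
    proof (cases "k = 0")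
      case True
      then show ?thesis by (simp add: paraproduct_terms_eq[OF b])
    next
      case False
      then have "Suc N \<le> k" using k by auto
      then have disj: "A \<notin> diff_idx (Suc k)" if "A \<in> idx (Suc N)" for A
        using that idx_mono[of "Suc N" k] False by (auto simp: diff_idx_def)
      show ?thesis
        by (rule car_L2_eqI) (use range[OF False] disj in \<open>auto simp: fin_space_def\<close>)
    qed
  qed simp
  also have "\<dots> = (\<Sum>k\<in>{1..N}. paraproduct_terms b f k)"
  proof (rule sum.cong)
    fix k assume k: "k \<in> {1..N}"
    have "diff_idx (Suc k) \<subseteq> idx (Suc N)" using diff_idx_facts(2)[of "Suc k"] idx_mono[of "Suc k" "Suc N"] k by auto
    then have "paraproduct_terms b f k \<in> fin_space (idx (Suc N))" using range[of k] k by (auto simp: fin_space_def)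
    then show "restrict_L2 (idx (Suc N)) (paraproduct_terms b f k) = paraproduct_terms b f k" by (simp add: restrict_fin_space)
  qed simp
  also have "\<dots> = blinfun_apply (trunc \<beta> N) f" by (simp add: trunc_apply paraproduct_terms_eq[OF b])
  finally show ?thesis .
qed

text \<open>
  An orthogonal series with bounded partial sums converges.
\<close>

lemma paraproduct_summable:
  assumes b: "has_coeffs b \<beta>" and M: "\<And>N. norm (blinfun_apply (trunc \<beta> N) f) \<le> M"
  shows "summable (paraproduct_terms b f)"
proof -
  define a where "a k = (norm (paraproduct_terms b f k))\<^sup>2" for k
  have range: "paraproduct_terms b f k \<in> fin_space (if k = 0 then {} else diff_idx (Suc k))" for k
    by (simp add: paraproduct_terms_eq[OF b] dop_range) (simp add: fin_space_def)
  have orth: "(norm (\<Sum>k\<in>K. paraproduct_terms b f k))\<^sup>2 = (\<Sum>k\<in>K. a k)" if "finite K" for K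
    unfolding a_def using that range
  proof (rule norm_sum_disjoint)
    fix j k :: nat assume "j < k"
    then show "(if j = 0 then {} else diff_idx (Suc j)) \<inter> (if k = 0 then {} else diff_idx (Suc k)) = {}"
      using diff_idx_disjoint[of "Suc j" "Suc k"] by simp
  qed
  have "summable a"
  proof (rule summableI_nonneg_bounded)
    show "0 \<le> a k" for k by (simp add: a_def)
    fix n
    have "(\<Sum>k<n. a k) \<le> (\<Sum>k<Suc n. a k)" by (simp add: a_def)
    also have "\<dots> = (norm (blinfun_apply (trunc \<beta> n) f))\<^sup>2"
      unfolding paraproduct_partial_sum[OF b, symmetric] by (rule orth[symmetric]) simp
    also have "\<dots> \<le> M\<^sup>2" by (intro power_mono M) simp
    finally show "(\<Sum>k<n. a k) \<le> M\<^sup>2" .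
  qed
  show ?thesis unfolding summable_Cauchy
  proof (intro allI impI)
    fix e :: real assume e: "0 < e"
    then obtain N where N: "\<And>m n. m \<ge> N \<Longrightarrow> norm (\<Sum>k\<in>{m..<n}. a k) < e\<^sup>2"
      using \<open>summable a\<close> unfolding summable_Cauchy by (metis zero_less_power)
    have "norm (\<Sum>k\<in>{m..<n}. paraproduct_terms b f k) < e" if "m \<ge> N" for m n
    proof (rule power2_less_imp_less)
      have "(norm (\<Sum>k\<in>{m..<n}. paraproduct_terms b f k))\<^sup>2 = (\<Sum>k\<in>{m..<n}. a k)" by (rule orth) simp
      also have "\<dots> < e\<^sup>2" using N[OF that, of n] by simp
      finally show "(norm (\<Sum>k\<in>{m..<n}. paraproduct_terms b f k))\<^sup>2 < e\<^sup>2" .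
    qed (use e in simp)
    then show "\<exists>N. \<forall>m\<ge>N. \<forall>n. norm (\<Sum>k\<in>{m..<n}. paraproduct_terms b f k) < e" by blast
  qed
qed

lemma paraproduct_bounded:
  assumes b: "has_coeffs b \<beta>" and M: "\<And>N f. norm (blinfun_apply (trunc \<beta> N) f) \<le> M * norm f"
  shows "bounded_linear (paraproduct b)" and "Blinfun (paraproduct b) \<in> clinear_ops"
proof -
  have sm: "summable (paraproduct_terms b f)" for f by (rule paraproduct_summable[OF b M])
  have "paraproduct_terms b (f + g) k = paraproduct_terms b f k + paraproduct_terms b g k" for f g k
    by (simp add: paraproduct_terms_eq[OF b] blinfun.add_right)
  then have add: "paraproduct b (f + g) = paraproduct b f + paraproduct b g" for f g
    unfolding paraproduct_def suminf_add[OF sm sm] by (intro suminf_cong)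
  have "paraproduct_terms b (cscale c f) k = cscale c (paraproduct_terms b f k)" for c f k
    by (simp add: paraproduct_terms_eq[OF b] clinear_cscale[OF dop_clinear])
  then have sc: "paraproduct b (cscale c f) = cscale c (paraproduct b f)" for c f
    unfolding paraproduct_def bounded_linear.suminf[OF bounded_linear_cscale sm] by (intro suminf_cong)
  have bd: "norm (paraproduct b f) \<le> norm f * M" for f
  proof (rule LIMSEQ_le_const2)
    have "(\<lambda>n. \<Sum>k<Suc n. paraproduct_terms b f k) \<longlonglongrightarrow> paraproduct b f"
      unfolding paraproduct_def by (rule LIMSEQ_Suc[OF summable_LIMSEQ[OF sm]])
    then show "(\<lambda>n. norm (blinfun_apply (trunc \<beta> n) f)) \<longlonglongrightarrow> norm (paraproduct b f)"
      unfolding paraproduct_partial_sum[OF b] by (rule tendsto_norm)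
    show "\<exists>N. \<forall>n\<ge>N. norm (blinfun_apply (trunc \<beta> n) f) \<le> norm f * M" using M by (simp add: mult.commute)
  qed
  show bl: "bounded_linear (paraproduct b)"
    by (rule bounded_linear_intro[OF add _ bd]) (simp add: scaleR_eq_cscale sc)
  show "Blinfun (paraproduct b) \<in> clinear_ops"
    by (simp add: clinear_ops_def bounded_linear_Blinfun_apply[OF bl] sc)
qed

lemma norm_adj_le:
  assumes "T \<in> clinear_ops"
  shows "norm (blinfun_apply (adj T) y) \<le> norm T * norm y"
proof -
  have "(norm (blinfun_apply (adj T) y))\<^sup>2 = inner (blinfun_apply T (blinfun_apply (adj T) y)) y"
    by (simp add: adj_props(3)[OF assms] power2_norm_eq_inner)
  also have "\<dots> \<le> norm (blinfun_apply T (blinfun_apply (adj T) y)) * norm y" by (rule norm_cauchy_schwarz)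
  also have "\<dots> \<le> norm T * norm (blinfun_apply (adj T) y) * norm y" by (intro mult_right_mono norm_blinfun) simp
  finally have "norm (blinfun_apply (adj T) y) * norm (blinfun_apply (adj T) y) \<le> norm (blinfun_apply (adj T) y) * (norm T * norm y)"
    by (simp add: power2_eq_square mult_ac)
  then show ?thesis by (cases "norm (blinfun_apply (adj T) y) = 0") auto
qed

lemma norm_sq_le_gram:
  assumes "T \<in> clinear_ops"
  shows "(norm T)\<^sup>2 \<le> norm (gram T)"
proof -
  have "norm T \<le> sqrt (norm (gram T))"
  proof (rule norm_blinfun_bound)
    fix x
    have "(norm (blinfun_apply T x))\<^sup>2 = inner (blinfun_apply (gram T) x) x" by (rule gram_form[OF assms, symmetric])
    also have "\<dots> \<le> norm (blinfun_apply (gram T) x) * norm x" by (rule norm_cauchy_schwarz)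
    also have "\<dots> \<le> norm (gram T) * norm x * norm x" by (intro mult_right_mono norm_blinfun) simp
    also have "\<dots> = (sqrt (norm (gram T)) * norm x)\<^sup>2" by (simp add: power_mult_distrib power2_eq_square[of "norm x"])
    finally show "norm (blinfun_apply T x) \<le> sqrt (norm (gram T)) * norm x" by (rule power2_le_imp_le) simp
  qed simp
  then have "(norm T)\<^sup>2 \<le> (sqrt (norm (gram T)))\<^sup>2" by (intro power_mono) auto
  then show ?thesis by simp
qed

text \<open>
  The traces of the truncations increase, even if the trace of the later one is taken only over the
  smaller space; this prevents a loss of trace in the limit.
\<close>

lemma trunc_trace_mono:
  assumes p: "0 < p" and MN: "N \<le> M"
  shows "trunc_trace p \<beta> N \<le> (\<Sum>A\<in>idx N. inner (blinfun_apply (fun_calc (\<lambda>t. t powr (p / 2)) (gram (trunc \<beta> M))) (basis_L2 A)) (basis_L2 A))"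
proof -
  obtain U where U: "spectral_basis (gram (trunc \<beta> M)) (fin_space (idx M)) U" using trunc_spectral_basis .
  obtain W where W: "spectral_basis (gram (trunc \<beta> N)) (fin_space (idx N)) W" using trunc_spectral_basis .
  note onb = spectral_basisD(1)[OF U] and onbW = spectral_basisD(1)[OF W]
  have "(\<Sum>w\<in>W. eigval (gram (trunc \<beta> N)) w powr (p / 2)) \<le>
     (\<Sum>b\<in>real_basis (idx N). diag_form U (\<lambda>u. eigval (gram (trunc \<beta> M)) u powr (p / 2)) b)"
  proof (rule trace_powr_mono[OF onb _ onbW _ _ _ _ onb_real_basis[OF finite_idx idx_car_index]])
    show "fin_space (idx N) \<subseteq> fin_space (idx M)" using idx_mono[OF MN] by (auto simp: fin_space_def)
    fix v assume v: "v \<in> fin_space (idx M)"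
    have "diag_form W (eigval (gram (trunc \<beta> N))) v = diag_form W (eigval (gram (trunc \<beta> N))) (restrict_L2 (idx N) v)"
      by (rule diag_form_restrict[OF onbW, symmetric])
    also have "\<dots> = (norm (blinfun_apply (trunc \<beta> N) v))\<^sup>2"
      by (simp only: trunc_form[OF W restrict_in_fin_space] trunc_restrict)
    also have "\<dots> \<le> (norm (blinfun_apply (trunc \<beta> M) v))\<^sup>2" by (intro power_mono trunc_norm_mono MN) simp
    also have "\<dots> = diag_form U (eigval (gram (trunc \<beta> M))) v"
      by (rule trunc_form[OF U v, symmetric])
    finally show "diag_form W (eigval (gram (trunc \<beta> N))) v \<le> diag_form U (eigval (gram (trunc \<beta> M))) v" .
  qed (use p in \<open>auto intro: eigval_gram trunc_clinear\<close>)
  then show ?thesis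
    unfolding trunc_trace_eigenvalues[OF p W] real_basis_sum_trunc[OF p U idx_mono[OF MN]] by simp
qed

definition schatten_entry :: "real \<Rightarrow> car_martingale \<Rightarrow> nat set \<Rightarrow> real" where
  "schatten_entry p b A = Re (cinner (blinfun_apply (abs_powr (Blinfun (paraproduct b)) p) (basis_L2 A)) (basis_L2 A))"

text \<open>
  \<open>\<pi>\<^sub>N = P \<pi>\<close> with the projection \<open>P\<close> onto \<open>L\<^sub>2(C\<^sub>N\<^sub>+\<^sub>1)\<close>, so \<open>\<pi>\<^sub>N\<^sup>* \<pi>\<^sub>N = \<pi>\<^sup>* P \<pi>\<close> converges strongly to \<open>\<pi>\<^sup>* \<pi>\<close> and
  is bounded by \<open>\<parallel>\<pi>\<^sup>* \<pi>\<parallel> = \<parallel>\<pi>\<parallel>\<^sup>2\<close>, as the strong continuity of the functional calculus requires.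
\<close>

lemma schatten_entry_limit:
  assumes p: "0 < p" and b: "has_coeffs b \<beta>" and sm: "\<And>f. summable (paraproduct_terms b f)"
    and bl: "bounded_linear (paraproduct b)" and cl: "Blinfun (paraproduct b) \<in> clinear_ops"
  shows "(\<lambda>N. inner (blinfun_apply (fun_calc (\<lambda>t. t powr (p / 2)) (gram (trunc \<beta> N))) (basis_L2 A)) (basis_L2 A))
     \<longlonglongrightarrow> schatten_entry p b A"
proof -
  define T where "T = Blinfun (paraproduct b)"
  have T: "blinfun_apply T = paraproduct b" unfolding T_def by (rule bounded_linear_Blinfun_apply[OF bl])
  have Tc: "T \<in> clinear_ops" using cl by (simp add: T_def)
  have tr: "trunc \<beta> N = Pop (Suc N) o\<^sub>L T" for N
    by (rule blinfun_eqI) (simp add: T paraproduct_restrict[OF b sm])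
  have adjtr: "adj (trunc \<beta> N) = adj T o\<^sub>L Pop (Suc N)" for N
    by (rule adj_unique[OF trunc_clinear])
       (simp add: tr cinner_restrict adj_props(2)[OF Tc])
  have gr: "blinfun_apply (gram (trunc \<beta> N)) x = blinfun_apply (adj T) (restrict_L2 (idx (Suc N)) (blinfun_apply T x))" for N x
    unfolding gram_def adjtr unfolding tr by simp
  have "(\<lambda>N. blinfun_apply (fun_calc (\<lambda>t. t powr (p / 2)) (gram (trunc \<beta> N))) (basis_L2 A))
     \<longlonglongrightarrow> blinfun_apply (fun_calc (\<lambda>t. t powr (p / 2)) (gram T)) (basis_L2 A)"
  proof (rule fun_calc_strong_tendsto[OF gram_psd[OF Tc] gram_psd[OF trunc_clinear] _ powr_cont[OF p]])
    fix N
    have "norm (gram (trunc \<beta> N)) \<le> (norm T)\<^sup>2"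
    proof (rule norm_blinfun_bound)
      fix x
      have "norm (blinfun_apply (gram (trunc \<beta> N)) x) \<le> norm T * norm (restrict_L2 (idx (Suc N)) (blinfun_apply T x))"
        unfolding gr by (rule norm_adj_le[OF Tc])
      also have "\<dots> \<le> norm T * (norm T * norm x)"
        by (intro mult_left_mono order_trans[OF norm_restrict_le] norm_blinfun) simp
      finally show "norm (blinfun_apply (gram (trunc \<beta> N)) x) \<le> (norm T)\<^sup>2 * norm x" by (simp add: power2_eq_square mult.assoc)
    qed simp
    then show "norm (gram (trunc \<beta> N)) \<le> norm (gram T)" using norm_sq_le_gram[OF Tc] by simp
  next
    fix x
    have "(\<lambda>N. restrict_L2 (idx (Suc N)) (blinfun_apply T x)) \<longlonglongrightarrow> blinfun_apply T x"
      by (rule LIMSEQ_Suc[OF restrict_idx_tendsto])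
    then have "(\<lambda>N. blinfun_apply (adj T) (restrict_L2 (idx (Suc N)) (blinfun_apply T x))) \<longlonglongrightarrow> blinfun_apply (adj T) (blinfun_apply T x)"
      by (intro blinfun.tendsto tendsto_const)
    then show "(\<lambda>N. blinfun_apply (gram (trunc \<beta> N)) x) \<longlonglongrightarrow> blinfun_apply (gram T) x"
      unfolding gr by (simp add: gram_def)
  qed
  then have "(\<lambda>N. inner (blinfun_apply (fun_calc (\<lambda>t. t powr (p / 2)) (gram (trunc \<beta> N))) (basis_L2 A)) (basis_L2 A))
     \<longlonglongrightarrow> inner (blinfun_apply (fun_calc (\<lambda>t. t powr (p / 2)) (gram T)) (basis_L2 A)) (basis_L2 A)"
    by (rule tendsto_inner[OF _ tendsto_const])
  then show ?thesis by (simp add: schatten_entry_def abs_powr_def gram_def T_def inner_eq_Re)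
qed

lemma schatten_entry_bounds:
  assumes p: "0 < p" and b: "has_coeffs b \<beta>" and sm: "\<And>f. summable (paraproduct_terms b f)"
    and bl: "bounded_linear (paraproduct b)" and cl: "Blinfun (paraproduct b) \<in> clinear_ops"
  shows "A \<in> car_index \<Longrightarrow> 0 \<le> schatten_entry p b A"
    and "finite F \<Longrightarrow> F \<subseteq> car_index \<Longrightarrow> (\<And>N. 1 \<le> N \<Longrightarrow> trunc_trace p \<beta> N \<le> M) \<Longrightarrow> (\<Sum>A\<in>F. schatten_entry p b A) \<le> M"
    and "trunc_trace p \<beta> N \<le> (\<Sum>A\<in>idx N. schatten_entry p b A)"
proof -
  define g where "g N A = inner (blinfun_apply (fun_calc (\<lambda>t. t powr (p / 2)) (gram (trunc \<beta> N))) (basis_L2 A)) (basis_L2 A)" for N A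
  have lim: "(\<lambda>N. g N A) \<longlonglongrightarrow> schatten_entry p b A" for A
    unfolding g_def by (rule schatten_entry_limit[OF assms])
  have g0: "0 \<le> g N A" if "A \<in> idx N" for N A
  proof -
    obtain U where U: "spectral_basis (gram (trunc \<beta> N)) (fin_space (idx N)) U" using trunc_spectral_basis .
    show ?thesis unfolding g_def trunc_fun_calc_form[OF p U basis_in_fin_space[OF that]]
      by (auto simp: diag_form_def intro!: sum_nonneg)
  qed
  show "0 \<le> schatten_entry p b A" if Ai: "A \<in> car_index"
  proof (rule LIMSEQ_le_const[OF lim])
    obtain N0 where "{A} \<subseteq> idx N0" by (rule finite_subset_idx[of "{A}"]) (use Ai in auto)
    then have "A \<in> idx N" if "N \<ge> N0" for N using idx_mono[OF that] by auto
    then show "\<exists>N. \<forall>n\<ge>N. 0 \<le> g n A" using g0 by blast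
  qed
  show "(\<Sum>A\<in>F. schatten_entry p b A) \<le> M"
    if F: "finite F" "F \<subseteq> car_index" and M: "\<And>N. 1 \<le> N \<Longrightarrow> trunc_trace p \<beta> N \<le> M"
  proof (rule LIMSEQ_le_const2)
    show "(\<lambda>N. \<Sum>A\<in>F. g N A) \<longlonglongrightarrow> (\<Sum>A\<in>F. schatten_entry p b A)" by (intro tendsto_sum lim)
    obtain N0 where N0: "F \<subseteq> idx N0" using finite_subset_idx[OF F] .
    have "(\<Sum>A\<in>F. g N A) \<le> M" if N: "N \<ge> max N0 1" for N
    proof -
      have "F \<subseteq> idx N" using N0 idx_mono[of N0 N] N by auto
      then have "(\<Sum>A\<in>F. g N A) \<le> (\<Sum>A\<in>idx N. g N A)" using g0 by (intro sum_mono2) auto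
      also have "\<dots> = trunc_trace p \<beta> N" by (simp add: trunc_trace_def g_def)
      also have "\<dots> \<le> M" using M N by simp
      finally show ?thesis .
    qed
    then show "\<exists>N. \<forall>n\<ge>N. (\<Sum>A\<in>F. g n A) \<le> M" by blast
  qed
  show "trunc_trace p \<beta> N \<le> (\<Sum>A\<in>idx N. schatten_entry p b A)"
  proof (rule LIMSEQ_le_const)
    show "(\<lambda>M. \<Sum>A\<in>idx N. g M A) \<longlonglongrightarrow> (\<Sum>A\<in>idx N. schatten_entry p b A)" by (intro tendsto_sum lim)
    show "\<exists>K. \<forall>M\<ge>K. trunc_trace p \<beta> N \<le> (\<Sum>A\<in>idx N. g M A)"
      unfolding g_def using trunc_trace_mono[OF p] by blast
  qed
qed

text \<open>
  Every eigenvalue is dominated by the trace, so bounded traces give uniformly bounded truncations.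
\<close>

lemma trunc_norm_bound:
  assumes p: "0 < p" and M: "\<And>N. 1 \<le> N \<Longrightarrow> trunc_trace p \<beta> N \<le> M"
  shows "norm (blinfun_apply (trunc \<beta> N) f) \<le> sqrt ((2 * M) powr (2 / p)) * norm f"
proof -
  define K where "K = (2 * M) powr (2 / p)"
  define n where "n = max N 1"
  obtain U where U: "spectral_basis (gram (trunc \<beta> n)) (fin_space (idx n)) U" using trunc_spectral_basis .
  note onb = spectral_basisD(1)[OF U]
  have eig: "eigval (gram (trunc \<beta> n)) u \<le> K" if u: "u \<in> U" for u
  proof -
    define e where "e = eigval (gram (trunc \<beta> n)) u"
    have e0: "0 \<le> e" unfolding e_def by (rule eigval_gram[OF trunc_clinear])
    have "e powr (p / 2) \<le> (\<Sum>u\<in>U. eigval (gram (trunc \<beta> n)) u powr (p / 2))"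
      unfolding e_def using u is_onbD(2)[OF onb] by (intro member_le_sum) auto
    also have "\<dots> \<le> 2 * M" unfolding trunc_trace_eigenvalues[OF p U] using M[of n] by (simp add: n_def)
    finally have "(e powr (p / 2)) powr (2 / p) \<le> K" unfolding K_def using p by (intro powr_mono2) auto
    then show ?thesis using e0 p by (simp add: powr_powr e_def)
  qed
  have "(norm (blinfun_apply (trunc \<beta> N) f))\<^sup>2 \<le> (norm (blinfun_apply (trunc \<beta> n) f))\<^sup>2"
    by (intro power_mono trunc_norm_mono) (auto simp: n_def)
  also have "\<dots> = diag_form U (eigval (gram (trunc \<beta> n))) (restrict_L2 (idx n) f)"
    by (simp only: trunc_form[OF U restrict_in_fin_space] trunc_restrict)
  also have "\<dots> \<le> (\<Sum>u\<in>U. K * (inner (restrict_L2 (idx n) f) u)\<^sup>2)"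
    unfolding diag_form_def by (intro sum_mono mult_right_mono eig) auto
  also have "\<dots> = K * (norm (restrict_L2 (idx n) f))\<^sup>2"
    using parseval[OF onb restrict_in_fin_space] by (simp add: sum_distrib_left[symmetric])
  also have "\<dots> \<le> K * (norm f)\<^sup>2" by (intro mult_left_mono power_mono norm_restrict_le) (auto simp: K_def)
  also have "\<dots> = (sqrt K * norm f)\<^sup>2" by (simp add: power_mult_distrib K_def)
  finally show ?thesis unfolding K_def[symmetric] by (rule power2_le_imp_le) (simp add: K_def)
qed

lemma schatten_iff:
  "paraproduct_in_schatten p b \<longleftrightarrow> (\<forall>f. summable (paraproduct_terms b f)) \<and> bounded_linear (paraproduct b) \<and>
     Blinfun (paraproduct b) \<in> clinear_ops \<and> schatten_entry p b summable_on car_index"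
  by (simp add: paraproduct_in_schatten_def schatten_def schatten_entry_def[abs_def])

lemma schatten_norm_eq: "schatten_norm p (paraproduct b) = (\<Sum>\<^sub>\<infinity>A\<in>car_index. schatten_entry p b A) powr (1 / p)"
  by (simp add: schatten_norm_def schatten_entry_def[abs_def])

lemma schatten_of_bounded_traces:
  assumes p: "0 < p" and b: "has_coeffs b \<beta>" and M: "\<And>N. 1 \<le> N \<Longrightarrow> trunc_trace p \<beta> N \<le> M"
  shows "paraproduct_in_schatten p b" and "(\<Sum>\<^sub>\<infinity>A\<in>car_index. schatten_entry p b A) \<le> M"
proof -
  have nb: "norm (blinfun_apply (trunc \<beta> N) f) \<le> sqrt ((2 * M) powr (2 / p)) * norm f" for N f
    by (rule trunc_norm_bound[OF p M])
  have sm: "summable (paraproduct_terms b f)" for f by (rule paraproduct_summable[OF b nb])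
  note bl = paraproduct_bounded[OF b nb]
  note bounds = schatten_entry_bounds[OF p b sm bl]
  have fin: "(\<Sum>A\<in>F. schatten_entry p b A) \<le> M" if "finite F" "F \<subseteq> car_index" for F
    by (rule bounds(2)[OF that M])
  have "schatten_entry p b summable_on car_index"
    by (rule nonneg_bdd_above_summable_on) (auto intro!: bdd_aboveI[of _ M] bounds(1) fin)
  then show "paraproduct_in_schatten p b" unfolding schatten_iff using sm bl by blast
  then show "(\<Sum>\<^sub>\<infinity>A\<in>car_index. schatten_entry p b A) \<le> M"
    using fin unfolding schatten_iff by (intro infsum_le_finite_sums) auto
qed

lemma bounded_traces_of_schatten:
  assumes p: "0 < p" and b: "has_coeffs b \<beta>" and sch: "paraproduct_in_schatten p b"
  shows "trunc_trace p \<beta> N \<le> (\<Sum>\<^sub>\<infinity>A\<in>car_index. schatten_entry p b A)"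
proof -
  have h: "\<And>f. summable (paraproduct_terms b f)" "bounded_linear (paraproduct b)" "Blinfun (paraproduct b) \<in> clinear_ops"
    "schatten_entry p b summable_on car_index" using sch unfolding schatten_iff by auto
  note bounds = schatten_entry_bounds[OF p b h(1-3)]
  have "trunc_trace p \<beta> N \<le> (\<Sum>A\<in>idx N. schatten_entry p b A)" by (rule bounds(3))
  also have "\<dots> \<le> (\<Sum>\<^sub>\<infinity>A\<in>car_index. schatten_entry p b A)"
    by (intro finite_sum_le_infsum h(4) finite_idx idx_car_index) (use bounds(1) in auto)
  finally show ?thesis .
qed

section \<open>The Besov norm in terms of moments\<close>

definition besov_term :: "real \<Rightarrow> (nat set \<Rightarrow> complex) \<Rightarrow> nat \<Rightarrow> real" where
  "besov_term p \<beta> k = 2 ^ k * moment p (combo (diff_idx k) \<beta>)"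

lemma moment_diff_nonneg:
  assumes "0 < p"
  shows "0 \<le> moment p (combo (diff_idx k) \<beta>)"
proof (rule moment_nonneg[OF assms combo_right_inv[OF diff_idx_facts(3)] finite_idx idx_car_index])
  show "idx k \<noteq> {}" using empty_idx by blast
  fix x assume x: "x \<in> fin_space (idx k)"
  show "blinfun_apply (gram (combo (diff_idx k) \<beta>)) x \<in> fin_space (idx k)"
  proof (rule gram_invariant[OF diff_idx_facts(3) _ idx_car_index idx_car_index x])
    fix A B assume "A \<in> diff_idx k"
    then have "A \<in> idx k" using diff_idx_facts(2) by blast
    then show "sdiff A B \<in> idx k \<longleftrightarrow> B \<in> idx k" unfolding sdiff_def mem_idx by blast
  qed
qed

lemma besov_term_nonneg: "0 < p \<Longrightarrow> 0 \<le> besov_term p \<beta> k"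
  by (simp add: besov_term_def moment_diff_nonneg)

lemma besov_summand:
  assumes p: "0 < p" and b: "has_coeffs b \<beta>" and k: "1 \<le> k"
  shows "2 ^ k * Lp_norm p (mdiff b k) powr p = besov_term p \<beta> k"
  by (simp add: mdiff_eq_combo[OF b k] Lp_norm_powr[OF p moment_diff_nonneg[OF p]] besov_term_def)

lemma besov_finite_iff:
  assumes "0 < p" "has_coeffs b \<beta>"
  shows "besov_finite p b \<longleftrightarrow> besov_term p \<beta> summable_on {1..}"
  unfolding besov_finite_def by (rule summable_on_cong) (use besov_summand[OF assms] in auto)

lemma besov_norm_eq:
  assumes "0 < p" "has_coeffs b \<beta>"
  shows "besov_norm p b = (\<Sum>\<^sub>\<infinity>k\<in>{1..}. besov_term p \<beta> k) powr (1 / p)"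
  unfolding besov_norm_def by (intro arg_cong2[where f = "(powr)"] infsum_cong refl) (use besov_summand[OF assms] in auto)

lemma sum_besov_term:
  "(\<Sum>k\<in>{1..Suc N}. besov_term p \<beta> k) = besov_term p \<beta> 1 + 2 * (\<Sum>k\<in>{1..N}. 2 ^ k * moment p (dop \<beta> k))"
proof -
  have "(\<Sum>k\<in>{1..Suc N}. besov_term p \<beta> k) = besov_term p \<beta> 1 + (\<Sum>k\<in>{Suc 1..Suc N}. besov_term p \<beta> k)"
    by (rule sum.atLeast_Suc_atMost) simp
  also have "(\<Sum>k\<in>{Suc 1..Suc N}. besov_term p \<beta> k) = (\<Sum>k\<in>{1..N}. besov_term p \<beta> (Suc k))"
    by (rule sum.shift_bounds_cl_Suc_ivl)
  also have "\<dots> = 2 * (\<Sum>k\<in>{1..N}. 2 ^ k * moment p (dop \<beta> k))"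
    by (simp add: besov_term_def dop_def sum_distrib_left mult.assoc)
  finally show ?thesis .
qed

lemma combo_cong: "(\<And>A. A \<in> S \<Longrightarrow> \<beta> A = \<gamma> A) \<Longrightarrow> combo S \<beta> = combo S \<gamma>"
  unfolding combo_def by (intro sum.cong) auto

lemma combo_zero: "combo S (\<lambda>_. 0) = 0"
  by (rule blinfun_eqI) (simp add: combo_apply)

text \<open>
  One approximating element at finite distance suffices, by the quasi-triangle inequality.
\<close>

lemma besov_imp_summable:
  assumes p: "0 < p" and b: "has_coeffs b \<beta>" and B: "b \<in> besov p"
  shows "besov_term p \<beta> summable_on {1..}"
proof -
  obtain y where y: "y \<in> CAR" "besov_finite p (martingale_of y)" "besov_finite p (\<lambda>n z. b n z - martingale_of y n z)"
    using B unfolding besov_def by blast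
  define \<gamma> where "\<gamma> = coeff_L2 (blinfun_apply y vacuum)"
  have c: "has_coeffs (martingale_of y) \<gamma>" unfolding \<gamma>_def by (rule has_coeffs_martingale_of[OF y(1)])
  have s1: "besov_term p \<gamma> summable_on {1..}" using y(2) besov_finite_iff[OF p c] by simp
  have s2: "besov_term p (\<lambda>A. \<beta> A - \<gamma> A) summable_on {1..}"
    using y(3) besov_finite_iff[OF p has_coeffs_diff[OF b c]] by simp
  show ?thesis
  proof (rule summable_on_comparison_test)
    show "(\<lambda>k. 16 powr p * (besov_term p \<gamma> k + besov_term p (\<lambda>A. \<beta> A - \<gamma> A) k)) summable_on {1..}"
      by (intro summable_on_cmult_right summable_on_add s1 s2)
    fix k :: nat
    have "combo (diff_idx k) \<beta> = combo (diff_idx k) (\<lambda>A. \<gamma> A + (\<beta> A - \<gamma> A))" by (rule combo_cong) simp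
    then have "moment p (combo (diff_idx k) \<beta>) \<le> 16 powr p * (moment p (combo (diff_idx k) \<gamma>) + moment p (combo (diff_idx k) (\<lambda>A. \<beta> A - \<gamma> A)))"
      using moment_combo_add[OF p diff_idx_facts(2), of k \<gamma> "\<lambda>A. \<beta> A - \<gamma> A"] by simp
    then have "2 ^ k * moment p (combo (diff_idx k) \<beta>) \<le> 2 ^ k * (16 powr p * (moment p (combo (diff_idx k) \<gamma>) + moment p (combo (diff_idx k) (\<lambda>A. \<beta> A - \<gamma> A))))"
      by (intro mult_left_mono) auto
    then show "besov_term p \<beta> k \<le> 16 powr p * (besov_term p \<gamma> k + besov_term p (\<lambda>A. \<beta> A - \<gamma> A) k)"
      by (simp add: besov_term_def algebra_simps)
    show "0 \<le> besov_term p \<beta> k" by (rule besov_term_nonneg[OF p])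
  qed
qed

text \<open>
  The approximating elements are the \<open>b\<^sub>m\<close>, for which the Besov norm of the difference is a tail of the
  series. They are taken from \<open>m = 1\<close> on, since \<open>C\<^sub>0\<close> does not belong to the filtration.
\<close>

lemma summable_imp_besov:
  assumes p: "0 < p" and m: "martingale b" and b: "has_coeffs b \<beta>" and s: "besov_term p \<beta> summable_on {1..}"
  shows "b \<in> besov p"
proof -
  define y where "y m = combo (idx m) \<beta>" for m
  have yC: "y m \<in> CAR" for m unfolding y_def by (rule combo_CAR[OF idx_car_index])
  define \<gamma> where "\<gamma> m A = (if A \<in> idx m then \<beta> A else 0)" for m A
  have c: "has_coeffs (martingale_of (y m)) (\<gamma> m)" for m
  proof -
    have "coeff_L2 (blinfun_apply (y m) vacuum) = \<gamma> m"
      by (rule ext) (simp add: y_def \<gamma>_def combo_vacuum[OF finite_idx idx_car_index])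
    then show ?thesis using has_coeffs_martingale_of[OF yC, of m] by simp
  qed
  have sub: "A \<in> idx m" if "k \<le> m" "A \<in> diff_idx k" for A k m
    using that diff_idx_facts(2)[of k] idx_mono[of k m] by blast
  have disj: "A \<notin> idx m" if "1 \<le> k" "m < k" "1 \<le> m" "A \<in> diff_idx k" for A k m
  proof -
    have "m \<le> k - 1" using that by simp
    then show ?thesis using that idx_mono[of m "k - 1"] by (auto simp: diff_idx_def)
  qed
  have t1: "besov_term p (\<gamma> m) k = (if k \<le> m then besov_term p \<beta> k else 0)" if "1 \<le> k" "1 \<le> m" for k m
  proof (cases "k \<le> m")
    case True
    then have "combo (diff_idx k) (\<gamma> m) = combo (diff_idx k) \<beta>" using sub by (intro combo_cong) (simp add: \<gamma>_def)
    then show ?thesis using True by (simp add: besov_term_def)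
  next
    case False
    then have "combo (diff_idx k) (\<gamma> m) = combo (diff_idx k) (\<lambda>_. 0)" using disj[of k m] that by (intro combo_cong) (auto simp: \<gamma>_def)
    then show ?thesis using False by (simp add: besov_term_def combo_zero moment_zero[OF p])
  qed
  have t2: "besov_term p (\<lambda>A. \<beta> A - \<gamma> m A) k = (if k \<le> m then 0 else besov_term p \<beta> k)" if "1 \<le> k" "1 \<le> m" for k m
  proof (cases "k \<le> m")
    case True
    then have "combo (diff_idx k) (\<lambda>A. \<beta> A - \<gamma> m A) = combo (diff_idx k) (\<lambda>_. 0)" using sub by (intro combo_cong) (simp add: \<gamma>_def)
    then show ?thesis using True by (simp add: besov_term_def combo_zero moment_zero[OF p])
  next
    case False
    then have "combo (diff_idx k) (\<lambda>A. \<beta> A - \<gamma> m A) = combo (diff_idx k) \<beta>" using disj[of k m] that by (intro combo_cong) (auto simp: \<gamma>_def)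
    then show ?thesis using False by (simp add: besov_term_def)
  qed
  have f1: "besov_finite p (martingale_of (y m))" if "1 \<le> m" for m
    unfolding besov_finite_iff[OF p c]
    by (rule summable_on_comparison_test[OF s]) (use t1 that besov_term_nonneg[OF p] in auto)
  have f2: "besov_finite p (\<lambda>n z. b n z - martingale_of (y m) n z)" if "1 \<le> m" for m
    unfolding besov_finite_iff[OF p has_coeffs_diff[OF b c]]
    by (rule summable_on_comparison_test[OF s]) (use t2 that besov_term_nonneg[OF p] in auto)
  define R where "R m = (\<Sum>\<^sub>\<infinity>k\<in>{1..}. besov_term p (\<lambda>A. \<beta> A - \<gamma> m A) k)" for m
  have R: "R m = (\<Sum>\<^sub>\<infinity>k\<in>{1..}. besov_term p \<beta> k) - (\<Sum>k\<in>{1..m}. besov_term p \<beta> k)" if "1 \<le> m" for m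
  proof -
    have "R m = (\<Sum>\<^sub>\<infinity>k\<in>{1..} - {1..m}. besov_term p \<beta> k)"
      unfolding R_def by (rule infsum_cong_neutral) (use t2 that in auto)
    also have "\<dots> = (\<Sum>\<^sub>\<infinity>k\<in>{1..}. besov_term p \<beta> k) - (\<Sum>\<^sub>\<infinity>k\<in>{1..m}. besov_term p \<beta> k)"
      by (rule infsum_Diff[OF s]) auto
    finally show ?thesis by simp
  qed
  have R0: "0 \<le> R m" for m unfolding R_def by (intro infsum_nonneg besov_term_nonneg[OF p])
  have "(\<lambda>m. R (Suc m)) \<longlonglongrightarrow> 0"
  proof (rule LIMSEQ_I)
    fix r :: real assume r: "0 < r"
    obtain K where K: "finite K" "K \<subseteq> {1..}" "dist (\<Sum>k\<in>K. besov_term p \<beta> k) (\<Sum>\<^sub>\<infinity>k\<in>{1..}. besov_term p \<beta> k) \<le> r / 2"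
      using infsum_finite_approximation[OF s, of "r / 2"] r by auto
    obtain n where n: "\<And>k. k \<in> K \<Longrightarrow> k \<le> n" using K(1) by (meson finite_nat_set_iff_bounded_le)
    have "norm (R (Suc m) - 0) < r" if "m \<ge> n" for m
    proof -
      have "(\<Sum>k\<in>K. besov_term p \<beta> k) \<le> (\<Sum>k\<in>{1..Suc m}. besov_term p \<beta> k)"
      proof (rule sum_mono2)
        show "K \<subseteq> {1..Suc m}"
        proof
          fix k assume k: "k \<in> K"
          then show "k \<in> {1..Suc m}" using K(2) n[OF k] that by auto
        qed
      qed (use besov_term_nonneg[OF p] in auto)
      moreover have "(\<Sum>\<^sub>\<infinity>k\<in>{1..}. besov_term p \<beta> k) - (\<Sum>k\<in>K. besov_term p \<beta> k) \<le> r / 2"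
        using K(3) unfolding dist_real_def by linarith
      moreover have "R (Suc m) = (\<Sum>\<^sub>\<infinity>k\<in>{1..}. besov_term p \<beta> k) - (\<Sum>k\<in>{1..Suc m}. besov_term p \<beta> k)"
        by (rule R) simp
      ultimately have "R (Suc m) \<le> r / 2" by linarith
      then show ?thesis using R0[of "Suc m"] r by simp
    qed
    then show "\<exists>n. \<forall>m\<ge>n. norm (R (Suc m) - 0) < r" by blast
  qed
  then have "(\<lambda>m. R (Suc m) powr (1 / p)) \<longlonglongrightarrow> 0"
    using p R0 by (intro tendsto_zero_powrI[OF _ tendsto_const]) (auto intro: always_eventually)
  moreover have "besov_norm p (\<lambda>n z. b n z - martingale_of (y (Suc m)) n z) = R (Suc m) powr (1 / p)" for m
    unfolding besov_norm_eq[OF p has_coeffs_diff[OF b c]] R_def ..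
  ultimately have lim: "(\<lambda>m. besov_norm p (\<lambda>n z. b n z - martingale_of (y (Suc m)) n z)) \<longlonglongrightarrow> 0" by simp
  show ?thesis unfolding besov_def
    using m lim yC f1 f2 by (intro CollectI conjI exI[of _ "\<lambda>m. y (Suc m)"]) auto
qed

section \<open>Schatten class paraproducts\<close>

lemma powr_inverse_mono:
  fixes a b c p :: real
  assumes "0 < p" "0 \<le> a" "a \<le> c * b" "0 < c" "0 \<le> b"
  shows "a powr (1 / p) \<le> c powr (1 / p) * b powr (1 / p)"
proof -
  have "a powr (1 / p) \<le> (c * b) powr (1 / p)" using assms by (intro powr_mono2) auto
  then show ?thesis by (simp add: powr_mult)
qed

theorem theorem1p3:
  fixes p :: real
  assumes "0 < p"
  shows "(\<forall>b. martingale b \<longrightarrow> (paraproduct_in_schatten p b \<longleftrightarrow> b \<in> besov p)) \<and>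
    (\<exists>C>0. \<exists>C'>0. \<forall>b. martingale b \<longrightarrow> b \<in> besov p \<longrightarrow>
       schatten_norm p (paraproduct b) \<le> C * besov_norm p b \<and>
       (mdiff b 1 = 0 \<longrightarrow> besov_norm p b \<le> C' * schatten_norm p (paraproduct b)))"
proof -
  note p = assms
  obtain c C where c: "0 < c" "0 < C"
    and bounds: "\<forall>\<beta>. \<forall>N\<ge>1. c * (\<Sum>k\<in>{1..N}. 2 ^ k * moment p (dop \<beta> k)) \<le> trunc_trace p \<beta> N \<and>
      trunc_trace p \<beta> N \<le> C * (\<Sum>k\<in>{1..N}. 2 ^ k * moment p (dop \<beta> k))"
    using trunc_trace_equivalent[OF p] by blast
  have lower: "c * (\<Sum>k\<in>{1..N}. 2 ^ k * moment p (dop \<beta> k)) \<le> trunc_trace p \<beta> N"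
    and upper: "trunc_trace p \<beta> N \<le> C * (\<Sum>k\<in>{1..N}. 2 ^ k * moment p (dop \<beta> k))" if "1 \<le> N" for \<beta> N
    using bounds that by blast+
  define s where "s b = (\<Sum>\<^sub>\<infinity>A\<in>car_index. schatten_entry p b A)" for b
  define B where "B \<beta> = (\<Sum>\<^sub>\<infinity>k\<in>{1..}. besov_term p \<beta> k)" for \<beta>
  have B0: "0 \<le> B \<beta>" for \<beta> unfolding B_def by (intro infsum_nonneg besov_term_nonneg[OF p])
  have up: "paraproduct_in_schatten p b \<and> s b \<le> C / 2 * B \<beta>"
    if b: "has_coeffs b \<beta>" and fin: "besov_term p \<beta> summable_on {1..}" for b \<beta>
  proof -
    have "trunc_trace p \<beta> N \<le> C / 2 * B \<beta>" if N: "1 \<le> N" for N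
    proof -
      have "(\<Sum>k\<in>{1..Suc N}. besov_term p \<beta> k) \<le> B \<beta>"
        unfolding B_def by (intro finite_sum_le_infsum fin) (use besov_term_nonneg[OF p] in auto)
      then have "2 * (\<Sum>k\<in>{1..N}. 2 ^ k * moment p (dop \<beta> k)) \<le> B \<beta>"
        unfolding sum_besov_term using besov_term_nonneg[OF p, of \<beta> 1] by simp
      then have "C / 2 * (2 * (\<Sum>k\<in>{1..N}. 2 ^ k * moment p (dop \<beta> k))) \<le> C / 2 * B \<beta>"
        using c by (intro mult_left_mono) auto
      then show ?thesis using upper[OF N, of \<beta>] by simp
    qed
    then show ?thesis using schatten_of_bounded_traces[OF p b] unfolding s_def by blast
  qed
  have down: "(\<Sum>k\<in>{1..Suc N}. besov_term p \<beta> k) \<le> besov_term p \<beta> 1 + 2 / c * s b"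
    if b: "has_coeffs b \<beta>" and sch: "paraproduct_in_schatten p b" and N: "1 \<le> N" for b \<beta> N
  proof -
    have "c * (\<Sum>k\<in>{1..N}. 2 ^ k * moment p (dop \<beta> k)) \<le> s b"
      using lower[OF N, of \<beta>] bounded_traces_of_schatten[OF p b sch, of N] unfolding s_def by simp
    then have "(\<Sum>k\<in>{1..N}. 2 ^ k * moment p (dop \<beta> k)) \<le> s b / c" using c by (simp add: field_simps)
    then show ?thesis unfolding sum_besov_term by simp
  qed
  have fin_le: "(\<Sum>k\<in>K. besov_term p \<beta> k) \<le> besov_term p \<beta> 1 + 2 / c * s b"
    if b: "has_coeffs b \<beta>" and sch: "paraproduct_in_schatten p b" and K: "finite K" "K \<subseteq> {1..}" for b \<beta> K
  proof -
    obtain n where n: "\<And>k. k \<in> K \<Longrightarrow> k \<le> n" using K(1) by (meson finite_nat_set_iff_bounded_le)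
    have "K \<subseteq> {1..Suc (Suc n)}"
    proof
      fix k assume k: "k \<in> K"
      then show "k \<in> {1..Suc (Suc n)}" using K(2) n[OF k] by auto
    qed
    then have "(\<Sum>k\<in>K. besov_term p \<beta> k) \<le> (\<Sum>k\<in>{1..Suc (Suc n)}. besov_term p \<beta> k)"
      using besov_term_nonneg[OF p] by (intro sum_mono2) auto
    also have "\<dots> \<le> besov_term p \<beta> 1 + 2 / c * s b" by (rule down[OF b sch]) simp
    finally show ?thesis .
  qed
  have conv: "besov_term p \<beta> summable_on {1..}" if "has_coeffs b \<beta>" "paraproduct_in_schatten p b" for b \<beta>
    by (rule nonneg_bdd_above_summable_on)
       (auto intro!: bdd_aboveI[of _ "besov_term p \<beta> 1 + 2 / c * s b"] besov_term_nonneg[OF p] fin_le[OF that])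
  have s0: "0 \<le> s b" if b: "has_coeffs b \<beta>" and sch: "paraproduct_in_schatten p b" for b \<beta>
    unfolding s_def using trunc_trace_nonneg[OF p, of \<beta> 1] bounded_traces_of_schatten[OF p b sch, of 1] by linarith
  show ?thesis
  proof (intro conjI allI impI)
    fix b assume m: "martingale b"
    obtain \<beta> where b: "has_coeffs b \<beta>" using martingale_coeffs[OF m] .
    show "paraproduct_in_schatten p b \<longleftrightarrow> b \<in> besov p"
      using up[OF b] conv[OF b] besov_imp_summable[OF p b] summable_imp_besov[OF p m b] by blast
  next
    show "\<exists>C>0. \<exists>C'>0. \<forall>b. martingale b \<longrightarrow> b \<in> besov p \<longrightarrow>
       schatten_norm p (paraproduct b) \<le> C * besov_norm p b \<and>
       (mdiff b 1 = 0 \<longrightarrow> besov_norm p b \<le> C' * schatten_norm p (paraproduct b))"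
    proof (intro exI conjI allI impI)
      show "0 < (C / 2) powr (1 / p)" "0 < (2 / c) powr (1 / p)" using c by auto
      fix b assume m: "martingale b" and bes: "b \<in> besov p"
      obtain \<beta> where b: "has_coeffs b \<beta>" using martingale_coeffs[OF m] .
      have fin: "besov_term p \<beta> summable_on {1..}" by (rule besov_imp_summable[OF p b bes])
      have sch: "paraproduct_in_schatten p b" and sB: "s b \<le> C / 2 * B \<beta>" using up[OF b fin] by auto
      show "schatten_norm p (paraproduct b) \<le> (C / 2) powr (1 / p) * besov_norm p b"
        unfolding schatten_norm_eq besov_norm_eq[OF p b] s_def[symmetric] B_def[symmetric]
        by (rule powr_inverse_mono[OF p s0[OF b sch] sB _ B0]) (use c in simp)
      assume "mdiff b 1 = 0"
      then have "besov_term p \<beta> 1 = 0"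
        using mdiff_eq_combo[OF b order_refl] by (simp add: besov_term_def moment_zero[OF p])
      then have "B \<beta> \<le> 2 / c * s b"
        unfolding B_def using fin_le[OF b sch] by (intro infsum_le_finite_sums fin) auto
      then show "besov_norm p b \<le> (2 / c) powr (1 / p) * schatten_norm p (paraproduct b)"
        unfolding schatten_norm_eq besov_norm_eq[OF p b] s_def[symmetric] B_def[symmetric]
        by (rule powr_inverse_mono[OF p B0 _ _ s0[OF b sch]]) (use c in simp)
    qed
  qed
qed

end
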